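(* Let $K$ be a primitive triangulation of a smooth $(n+1)$-dimensional lattice polytope $P$. For all integers $p,q\ge0$ with $p+q=n$, the subspace of $H_{p,q}(X;\mathbb F_2)$ spanned by the classes $[f_{\sigma^p}]$, for $\sigma^p$ ranging over the interior $p$-simplices of $K$, is the kernel of the morphism $$i_{p,q}:H_{p,q}(X;\mathbb F_2)\to H_{p,q}(Y;\mathbb F_2)$$ induced by the inclusion $X\le Y$.
   Context: Polytope and triangulation. $M,N$ are dual lattices of rank $n+1$, $n\ge1$, with pairing $\langle-,-\rangle$; $M_2=M\otimes\mathbb F_2$, $N_2=N\otimes\mathbb F_2$. A full-dimensional lattice polytope $P\subset M\otimes\mathbb R$ is smooth if it is simple and at each vertex the primitive edge directions form a basis of $M$. A primitive triangulation $K$ of $P$ is a triangulation into lattice simplices whose maximal simplices have volume $1/(n+1)!$ (unit volume = parallelepiped on a basis of $M$). $\sigma^p$ denotes a $p$-simplex; a simplex is interior if it is not contained in $\partial P$. $T\sigma,TQ$ are linear tangent spaces. Complexes. For $\sigma\le\tau$ in $K$, $[\sigma,\tau]$ is the union of the simplices of the barycentric subdivision given by flags between $\sigma$ and $\tau$; for $\sigma$ contained in a face $Q$ of $P$, $[\sigma,Q]=\bigcup_{\sigma\le\tau\subset Q}[\sigma,\tau]$ is a ball of dimension $\dim Q-\dim\sigma$. These are the closed cells of a regular CW structure $Y$ on $P$, with $[\sigma',Q']\le[\sigma,Q]$ iff $\sigma'\ge\sigma$, $Q'\subset Q$. $X\le Y$ is the subcomplex of cells with $\dim\sigma\ge1$.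 Put $\sigma^*=[\sigma,P]$. Tropical homology. A cellular cosheaf $\mathcal F$ of $\mathbb F_2$-vector spaces has functorial maps $\mathcal F(e)\to\mathcal F(e')$ for $e'\le e$, and $H_q(-;\mathcal F)$ is its cellular homology (chains $\bigoplus_{e^q}\mathcal F(e^q)$, boundary = sum over codimension-one faces). Put $\mathrm{Sed}(Q)=(TQ^\perp\cap N)\otimes\mathbb F_2$. On $Y$, $\mathcal F^Y_p(\sigma,Q)=\bigwedge^p(N_2/\mathrm{Sed}(Q))$; on $X$, $\mathcal F^X_p(\sigma,Q)=\sum_{\sigma^1\le\sigma}\bigwedge^p\big(((T\sigma^1)^\perp\cap N)\otimes\mathbb F_2/\mathrm{Sed}(Q)\big)\subset\mathcal F^Y_p(\sigma,Q)$, the sum being over the edges of $\sigma$. Transition maps are induced by projections. $H_{p,q}(Z;\mathbb F_2)=H_q(Z;\mathcal F^Z_p)$ for $Z\in\{X,Y\}$. Face cycles. $\omega(\sigma^p)\in\bigwedge^pM_2$ is the unique non-zero element of $\bigwedge^p\big((T\sigma^p\cap M)\otimes\mathbb F_2\big)$. Choose a decomposable $\omega^*(\sigma^p)=u_1\wedge\dots\wedge u_p\in\bigwedge^pN_2$ with $\langle\omega(\sigma^p),\omega^*(\sigma^p)\rangle=1$. For an interior $p$-simplex $\sigma^p$, $0\le p\le n$, $f_{\sigma^p}=\omega^*(\sigma^p)\otimes\partial(\sigma^p)^*=\sum_{\sigma^{p+1}\ge\sigma^p}\omega^*(\sigma^p)\otimes(\sigma^{p+1})^*\in C_{n-p}(X;\mathcal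 F^X_p)$; it is a cycle whose class $[f_{\sigma^p}]\in H_{p,n-p}(X;\mathbb F_2)$ does not depend on the choice of $\omega^*(\sigma^p)$. *)

theory Defs
  imports
    "HOL-Analysis.Analysis"
    "HOL-Algebra.FiniteProduct"
    "HOL-Algebra.Product_Groups"
    "HOL-Library.Z2"
    "HOL-Library.Poly_Mapping"
    "HOL-Combinatorics.Permutations"
begin

section \<open>Smooth lattice polytopes and primitive triangulations\<close>

text \<open>
  A basis of \<open>M\<close> and the dual basis of \<open>N\<close> identify both lattices with the integral points of
  \<open>real^'d\<close>, where \<open>CARD('d)\<close> is the rank \<open>n + 1\<close>; the pairing becomes the standard inner product,
  and \<open>M\<^sub>2\<close> and \<open>N\<^sub>2\<close> become \<open>bit^'d\<close>.
\<close>

definition lattice :: "(real^'d) set" where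
  "lattice = {x. \<forall>i. x $ i \<in> \<int>}"

definition lattice_basis :: "(real^'d) set \<Rightarrow> bool" where
  "lattice_basis B \<longleftrightarrow> finite B \<and> independent B \<and>
     {(\<Sum>b\<in>B. of_int (c b) *\<^sub>R b) |c :: real^'d \<Rightarrow> int. True} = lattice"

definition lattice_polytope :: "(real^'d) set \<Rightarrow> bool" where
  "lattice_polytope P \<longleftrightarrow> (\<exists>V. finite V \<and> V \<subseteq> lattice \<and> P = convex hull V)"

definition primitive_direction :: "real^'d \<Rightarrow> (real^'d) set \<Rightarrow> real^'d \<Rightarrow> bool" where
  "primitive_direction v E u \<longleftrightarrow>
     u \<in> lattice \<and> (\<exists>t>0. E = closed_segment v (v + t *\<^sub>R u)) \<and>
     (\<forall>s. 0 < s \<and> s < 1 \<longrightarrow> s *\<^sub>R u \<notin> lattice)"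

definition simple_polytope :: "(real^'d) set \<Rightarrow> bool" where
  "simple_polytope P \<longleftrightarrow>
     polytope P \<and> (\<forall>v. v extreme_point_of P \<longrightarrow> int (card {E. E edge_of P \<and> v \<in> E}) = aff_dim P)"

definition smooth_polytope :: "(real^'d) set \<Rightarrow> bool" where
  "smooth_polytope P \<longleftrightarrow>
     lattice_polytope P \<and> aff_dim P = int CARD('d) \<and> simple_polytope P \<and>
     (\<forall>v. v extreme_point_of P \<longrightarrow>
        lattice_basis {u. \<exists>E. E edge_of P \<and> v \<in> E \<and> primitive_direction v E u})"

text \<open>Note that a \<^const>\<open>simplicial_complex\<close> contains the empty simplex.\<close>

definition primitive_triangulation :: "(real^'d) set \<Rightarrow> (real^'d) set set \<Rightarrow> bool" where
  "primitive_triangulation P K \<longleftrightarrow>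
     simplicial_complex K \<and> \<Union>K = P \<and>
     (\<forall>\<sigma>\<in>K. {v. v extreme_point_of \<sigma>} \<subseteq> lattice) \<and>
     (\<forall>\<sigma>\<in>K. (\<forall>\<tau>\<in>K. \<sigma> \<subseteq> \<tau> \<longrightarrow> \<tau> = \<sigma>) \<longrightarrow> measure lebesgue \<sigma> = 1 / fact CARD('d))"

definition interior_simplices ::
    "(real^'d) set \<Rightarrow> (real^'d) set set \<Rightarrow> nat \<Rightarrow> (real^'d) set set" where
  "interior_simplices P K p = {\<sigma> \<in> K. int p simplex \<sigma> \<and> \<not> \<sigma> \<subseteq> frontier P}"

definition tangent :: "(real^'d) set \<Rightarrow> (real^'d) set" where
  "tangent S = span {x - y |x y. x \<in> S \<and> y \<in> S}"


section \<open>The cell structure\<close>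

text \<open>
  The cell \<open>[\<sigma>, Q]\<close> is represented by the pair \<open>(\<sigma>, Q)\<close>; the set of its points is \<open>cell_points\<close>.
\<close>

type_synonym 'd cell = "(real^'d) set \<times> (real^'d) set"

definition barycenter :: "(real^'d) set \<Rightarrow> real^'d" where
  "barycenter \<sigma> =
     (1 / real (card {v. v extreme_point_of \<sigma>})) *\<^sub>R (\<Sum>v | v extreme_point_of \<sigma>. v)"

definition interval_points ::
    "(real^'d) set set \<Rightarrow> (real^'d) set \<Rightarrow> (real^'d) set \<Rightarrow> (real^'d) set" where
  "interval_points K \<sigma> \<tau> =
     \<Union>{convex hull (barycenter ` C) |C.
         C \<subseteq> {\<rho> \<in> K. \<sigma> face_of \<rho> \<and> \<rho> face_of \<tau>} \<and> (\<forall>\<rho>\<in>C. \<forall>\<rho>'\<in>C. \<rho> \<subseteq> \<rho>' \<or> \<rho>' \<subseteq> \<rho>)}"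

definition cell_points :: "(real^'d) set set \<Rightarrow> 'd::finite cell \<Rightarrow> (real^'d) set" where
  "cell_points K = (\<lambda>(\<sigma>, Q). \<Union>{interval_points K \<sigma> \<tau> |\<tau>. \<tau> \<in> K \<and> \<sigma> face_of \<tau> \<and> \<tau> \<subseteq> Q})"

definition cells_Y :: "(real^'d) set \<Rightarrow> (real^'d) set set \<Rightarrow> 'd::finite cell set" where
  "cells_Y P K = {(\<sigma>, Q). \<sigma> \<in> K \<and> \<sigma> \<noteq> {} \<and> Q face_of P \<and> \<sigma> \<subseteq> Q}"

definition cells_X :: "(real^'d) set \<Rightarrow> (real^'d) set set \<Rightarrow> 'd::finite cell set" where
  "cells_X P K = {(\<sigma>, Q) \<in> cells_Y P K. 1 \<le> aff_dim \<sigma>}"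

definition cell_dim :: "'d::finite cell \<Rightarrow> int" where
  "cell_dim = (\<lambda>(\<sigma>, Q). aff_dim Q - aff_dim \<sigma>)"

definition cell_face :: "(real^'d) set set \<Rightarrow> 'd::finite cell \<Rightarrow> 'd cell \<Rightarrow> bool" where
  "cell_face K e' e \<longleftrightarrow> cell_points K e' \<subseteq> cell_points K e"

lemma simplex_vertices:
  fixes \<sigma> :: "(real^'d) set"
  assumes "n simplex \<sigma>" "\<sigma> \<noteq> {}"
  shows "finite {v. v extreme_point_of \<sigma>}" "{v. v extreme_point_of \<sigma>} \<noteq> {}"
    "barycenter \<sigma> \<in> rel_interior \<sigma>"
proof -
  obtain C where C: "\<not> affine_dependent C" "\<sigma> = convex hull C"
    using assms(1) unfolding simplex_def by blast
  have ext: "{v. v extreme_point_of \<sigma>} = C"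
    using C by (simp add: extreme_point_of_convex_hull_affine_independent)
  have fin: "finite C" using C(1) aff_independent_finite by blast
  have ne: "C \<noteq> {}" using assms(2) C(2) by auto
  show "finite {v. v extreme_point_of \<sigma>}" "{v. v extreme_point_of \<sigma>} \<noteq> {}"
    using ext fin ne by auto
  have "0 < card C" using fin ne by (simp add: card_gt_0_iff)
  moreover have "barycenter \<sigma> = (\<Sum>x\<in>C. (1 / real (card C)) *\<^sub>R x)"
    unfolding barycenter_def ext by (rule scaleR_sum_right)
  ultimately have "barycenter \<sigma> \<in> rel_interior (convex hull C)"
    unfolding rel_interior_convex_hull_explicit[OF C(1)]
    by (intro CollectI exI[of _ "\<lambda>_. 1 / real (card C)"]) simp
  then show "barycenter \<sigma> \<in> rel_interior \<sigma>" by (simp only: C(2))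
qed

lemma simplicial_complexD:
  assumes "simplicial_complex K" "\<sigma> \<in> K"
  shows "\<exists>n. n simplex \<sigma>" "\<tau> \<in> K \<Longrightarrow> \<sigma> \<inter> \<tau> face_of \<sigma>"
    "\<tau> face_of \<sigma> \<Longrightarrow> \<tau> \<in> K"
  using assms unfolding simplicial_complex_def by blast+

lemma simplicial_complex_subset_face:
  assumes "simplicial_complex K" "\<sigma> \<in> K" "\<tau> \<in> K" "\<sigma> \<subseteq> \<tau>"
  shows "\<sigma> face_of \<tau>"
  using simplicial_complexD(2)[OF assms(1,3,2)] assms(4) by (simp add: Int_absorb1)

lemma barycenter_in_cell_points:
  assumes "\<tau> \<in> K" "\<sigma> face_of \<tau>" "\<tau> \<subseteq> Q" "simplicial_complex K"
  shows "barycenter \<tau> \<in> cell_points K (\<sigma>, Q)"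
proof -
  have "\<tau> face_of \<tau>"
    using simplicial_complexD(1)[OF assms(4,1)] convex_simplex face_of_refl by blast
  then have "{\<tau>} \<subseteq> {\<rho> \<in> K. \<sigma> face_of \<rho> \<and> \<rho> face_of \<tau>}"
    using assms(1,2) by auto
  then have "convex hull (barycenter ` {\<tau>}) \<subseteq> interval_points K \<sigma> \<tau>"
    unfolding interval_points_def by (intro Union_upper CollectI exI[of _ "{\<tau>}"]) simp
  moreover have "barycenter \<tau> \<in> convex hull (barycenter ` {\<tau>})"
    by simp
  ultimately show ?thesis
    unfolding cell_points_def prod.case using assms(1-3) by (intro UnionI CollectI) auto
qed

lemma cell_points_subset:
  assumes K: "simplicial_complex K" and ne: "\<sigma> \<noteq> {}"
  shows "cell_points K (\<sigma>, Q) \<subseteq> Q"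
proof -
  have "convex hull (barycenter ` C) \<subseteq> \<tau>"
    if \<tau>: "\<tau> \<in> K" and C: "C \<subseteq> {\<rho> \<in> K. \<sigma> face_of \<rho> \<and> \<rho> face_of \<tau>}" for C \<tau>
  proof (rule hull_minimal)
    show "convex \<tau>"
      using simplicial_complexD(1)[OF K \<tau>] convex_simplex by blast
    show "barycenter ` C \<subseteq> \<tau>"
    proof
      fix x assume "x \<in> barycenter ` C"
      then obtain \<rho> where \<rho>: "\<rho> \<in> K" "\<sigma> face_of \<rho>" "\<rho> face_of \<tau>" "x = barycenter \<rho>"
        using C by blast
      have "\<rho> \<noteq> {}" using ne \<rho>(2) face_of_imp_subset by blast
      then have "x \<in> rel_interior \<rho>"
        using simplex_vertices(3) simplicial_complexD(1)[OF K \<rho>(1)] \<rho>(4) by blast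
      then show "x \<in> \<tau>"
        using \<rho>(3) face_of_imp_subset rel_interior_subset by blast
    qed
  qed
  note hull = this
  show ?thesis
  proof
    fix x assume "x \<in> cell_points K (\<sigma>, Q)"
    then obtain \<tau> C where "\<tau> \<in> K" "\<tau> \<subseteq> Q"
      "C \<subseteq> {\<rho> \<in> K. \<sigma> face_of \<rho> \<and> \<rho> face_of \<tau>}" "x \<in> convex hull (barycenter ` C)"
      unfolding cell_points_def interval_points_def by auto
    then show "x \<in> Q" using hull[of \<tau> C] by (meson subsetD)
  qed
qed

lemma cell_face_iff:
  fixes K :: "(real^'d) set set"
  assumes K: "simplicial_complex K" and P: "\<Union>K = P" "convex P"
    and e: "(\<sigma>, Q) \<in> cells_Y P K" and e': "(\<sigma>', Q') \<in> cells_Y P K"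
  shows "cell_face K (\<sigma>', Q') (\<sigma>, Q) \<longleftrightarrow> \<sigma> face_of \<sigma>' \<and> Q' \<subseteq> Q"
proof
  have s: "\<sigma> \<in> K" "\<sigma> \<noteq> {}" "Q face_of P" "\<sigma> \<subseteq> Q"
    and s': "\<sigma>' \<in> K" "\<sigma>' \<noteq> {}" "Q' face_of P" "\<sigma>' \<subseteq> Q'"
    using e e' by (auto simp: cells_Y_def)
  have bary: "barycenter \<rho> \<in> rel_interior \<rho>" if "\<rho> \<in> K" "\<rho> \<noteq> {}" for \<rho>
    using simplex_vertices(3) simplicial_complexD(1)[OF K that(1)] that(2) by blast
  {
    assume "\<sigma> face_of \<sigma>' \<and> Q' \<subseteq> Q"
    then have f: "\<sigma> face_of \<sigma>'" and QQ: "Q' \<subseteq> Q" by auto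
    have int: "interval_points K \<sigma>' \<tau> \<subseteq> interval_points K \<sigma> \<tau>" for \<tau>
    proof
      fix x assume "x \<in> interval_points K \<sigma>' \<tau>"
      then obtain C where C: "C \<subseteq> {\<rho> \<in> K. \<sigma>' face_of \<rho> \<and> \<rho> face_of \<tau>}"
        "\<forall>\<rho>\<in>C. \<forall>\<rho>'\<in>C. \<rho> \<subseteq> \<rho>' \<or> \<rho>' \<subseteq> \<rho>" "x \<in> convex hull (barycenter ` C)"
        unfolding interval_points_def by auto
      have "C \<subseteq> {\<rho> \<in> K. \<sigma> face_of \<rho> \<and> \<rho> face_of \<tau>}"
        using C(1) face_of_trans[OF f] by auto
      then show "x \<in> interval_points K \<sigma> \<tau>"
        unfolding interval_points_def using C(2,3) by auto
    qed
    show "cell_face K (\<sigma>', Q') (\<sigma>, Q)"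
      unfolding cell_face_def
    proof
      fix x assume "x \<in> cell_points K (\<sigma>', Q')"
      then obtain \<tau> where \<tau>: "\<tau> \<in> K" "\<sigma>' face_of \<tau>" "\<tau> \<subseteq> Q'" "x \<in> interval_points K \<sigma>' \<tau>"
        unfolding cell_points_def by auto
      have "\<sigma> face_of \<tau>" "\<tau> \<subseteq> Q" "x \<in> interval_points K \<sigma> \<tau>"
        using face_of_trans[OF f \<tau>(2)] \<tau>(3) QQ int \<tau>(4) by blast+
      then show "x \<in> cell_points K (\<sigma>, Q)"
        unfolding cell_points_def using \<tau>(1) by auto
    qed
  }
  assume "cell_face K (\<sigma>', Q') (\<sigma>, Q)"
  then have sub: "cell_points K (\<sigma>', Q') \<subseteq> cell_points K (\<sigma>, Q)"
    by (simp add: cell_face_def)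
  have "convex \<sigma>'" using simplicial_complexD(1)[OF K s'(1)] convex_simplex by blast
  define b where "b = barycenter \<sigma>'"
  have b: "b \<in> rel_interior \<sigma>'" using bary s' b_def by auto
  have "b \<in> cell_points K (\<sigma>, Q)"
    using barycenter_in_cell_points[OF s'(1) _ s'(4) K, of \<sigma>'] face_of_refl[OF \<open>convex \<sigma>'\<close>]
      sub b_def by blast
  then obtain \<tau> C where tau: "\<tau> \<in> K" "\<tau> \<subseteq> Q"
    and C: "C \<subseteq> {\<rho> \<in> K. \<sigma> face_of \<rho> \<and> \<rho> face_of \<tau>}" and bC: "b \<in> convex hull (barycenter ` C)"
    unfolding cell_points_def interval_points_def by auto
  have Cne: "\<rho> \<noteq> {}" if "\<rho> \<in> C" for \<rho>
    using that C s(2) face_of_imp_subset by blast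
  have subtau: "barycenter ` C \<subseteq> \<tau>"
  proof
    fix x assume "x \<in> barycenter ` C"
    then obtain \<rho> where \<rho>: "\<rho> \<in> C" "x = barycenter \<rho>" by blast
    have "\<rho> \<in> K" "\<rho> \<subseteq> \<tau>" using C \<rho>(1) face_of_imp_subset by blast+
    then show "x \<in> \<tau>" using bary[OF _ Cne[OF \<rho>(1)]] rel_interior_subset \<rho>(2) by blast
  qed
  have face: "\<tau> \<inter> \<sigma>' face_of \<tau>" using simplicial_complexD(2)[OF K tau(1) s'(1)] .
  have "convex \<tau>" using simplicial_complexD(1)[OF K tau(1)] convex_simplex by blast
  have cd: "convex (\<tau> - \<tau> \<inter> \<sigma>')"
    unfolding convex_contains_segment
  proof (intro ballI subsetI)
    fix u v x
    assume uv: "u \<in> \<tau> - \<tau> \<inter> \<sigma>'" "v \<in> \<tau> - \<tau> \<inter> \<sigma>'" "x \<in> closed_segment u v"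
    then have "x \<in> \<tau>"
      using \<open>convex \<tau>\<close> by (auto simp: convex_contains_segment)
    moreover have "x \<notin> \<tau> \<inter> \<sigma>'"
    proof
      assume x: "x \<in> \<tau> \<inter> \<sigma>'"
      then have "x \<in> open_segment u v"
        using uv by (auto simp: open_segment_def)
      then show False
        using face x uv unfolding face_of_def by blast
    qed
    ultimately show "x \<in> \<tau> - \<tau> \<inter> \<sigma>'" by blast
  qed
  have "\<not> barycenter ` C \<subseteq> \<tau> - \<tau> \<inter> \<sigma>'"
  proof
    assume "barycenter ` C \<subseteq> \<tau> - \<tau> \<inter> \<sigma>'"
    then have "convex hull (barycenter ` C) \<subseteq> \<tau> - \<tau> \<inter> \<sigma>'" using cd by (rule hull_minimal)
    then show False using bC b rel_interior_subset by blast
  qed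
  then obtain \<rho> where rho: "\<rho> \<in> C" "barycenter \<rho> \<in> \<sigma>'" using subtau by blast
  have rhoK: "\<rho> \<in> K" "\<sigma> face_of \<rho>" using rho(1) C by auto
  have "\<rho> \<subseteq> \<rho> \<inter> \<sigma>'"
    using subset_of_face_of[OF simplicial_complexD(2)[OF K rhoK(1) s'(1)], of \<rho>]
      bary[OF rhoK(1) Cne[OF rho(1)]] rho(2) rel_interior_subset by blast
  then have "\<sigma> \<subseteq> \<sigma>'" using rhoK(2) face_of_imp_subset by blast
  then have 1: "\<sigma> face_of \<sigma>'"
    using simplicial_complex_subset_face[OF K s(1) s'(1)] by blast

  have cQ': "convex Q'" using s'(3) face_of_imp_convex by blast
  have bQ': "b \<in> Q'" using b rel_interior_subset s'(4) by blast
  define D where "D = {\<tau>\<in>K. \<tau> \<subseteq> Q' \<and> b \<notin> \<tau>}"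
  have finK: "finite K" using K unfolding simplicial_complex_def by blast
  have cl: "closed (\<Union>D)"
    using finK simplicial_complexD(1)[OF K] closed_simplex unfolding D_def
    by (intro closed_Union) auto
  have "b \<in> - \<Union>D" by (auto simp: D_def)
  have "b \<in> closure (rel_interior Q')"
    using bQ' closure_subset convex_closure_rel_interior[OF cQ'] by blast
  then have "rel_interior Q' \<inter> (- \<Union>D) \<noteq> {}"
    using \<open>b \<in> - \<Union>D\<close> cl open_Int_closure_eq_empty[of "- \<Union>D" "rel_interior Q'"]
    by (metis IntI empty_iff inf_commute open_Compl)
  then obtain y where y: "y \<in> rel_interior Q'" "y \<notin> \<Union>D" by blast
  have "y \<in> P" using subsetD[OF rel_interior_subset y(1)] face_of_imp_subset[OF s'(3)] by auto
  then obtain \<mu>0 where mu0: "\<mu>0 \<in> K" "y \<in> \<mu>0" using P by blast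
  have "\<exists>\<mu>\<in>K. y \<in> \<mu> \<and> \<mu> \<subseteq> Q'"
  proof -
    have "convex \<mu>0" using simplicial_complexD(1)[OF K mu0(1)] convex_simplex by blast
    moreover have "P \<inter> \<mu>0 = \<mu>0" using mu0 P by blast
    ultimately have "\<mu>0 \<inter> Q' face_of \<mu>0"
      using face_of_slice[OF s'(3), of \<mu>0] by (simp add: inf_commute)
    then have "\<mu>0 \<inter> Q' \<in> K" using simplicial_complexD(3)[OF K mu0(1)] by simp
    moreover have "y \<in> \<mu>0 \<inter> Q'" using mu0 subsetD[OF rel_interior_subset y(1)] by simp
    ultimately show ?thesis by (intro bexI[of _ "\<mu>0 \<inter> Q'"]) auto
  qed
  then obtain \<mu> where mu: "\<mu> \<in> K" "y \<in> \<mu>" "\<mu> \<subseteq> Q'" by blast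
  have "b \<in> \<mu>" using mu y(2) by (auto simp: D_def)
  have "b \<in> \<sigma>' \<inter> \<mu> \<inter> rel_interior \<sigma>'"
    using \<open>b \<in> \<mu>\<close> b subsetD[OF rel_interior_subset b] by simp
  then have "\<sigma>' \<subseteq> \<sigma>' \<inter> \<mu>"
    by (intro subset_of_face_of[OF simplicial_complexD(2)[OF K s'(1) mu(1)]]) auto
  then have "\<sigma>' face_of \<mu>"
    using simplicial_complex_subset_face[OF K s'(1) mu(1)] by simp
  then have "barycenter \<mu> \<in> Q"
    using barycenter_in_cell_points[OF mu(1) _ mu(3) K] subsetD[OF sub]
      subsetD[OF cell_points_subset[OF K s(2)]] by simp
  moreover have "barycenter \<mu> \<in> rel_interior \<mu>" using bary[OF mu(1)] mu(2) by auto
  moreover have "\<mu> \<subseteq> P" using mu(1) P(1) by auto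
  ultimately have "\<mu> \<subseteq> Q"
    by (intro subset_of_face_of[OF s(3)]) auto
  then have "Q \<inter> rel_interior Q' \<noteq> {}" using y(1) mu(2) by auto
  then have "Q' \<subseteq> Q"
    by (rule subset_of_face_of[OF s(3) face_of_imp_subset[OF s'(3)]])
  with 1 show "\<sigma> face_of \<sigma>' \<and> Q' \<subseteq> Q" by simp
qed


section \<open>Vector spaces over the field with two elements\<close>

text \<open>
  These are treated as commutative groups of exponent 2: the linear maps are the homomorphisms,
  the subspaces are the subgroups, and the span of a set is the subgroup it generates. The
  operations are written multiplicatively, following HOL-Algebra.
\<close>

definition additive_group :: "'a::ab_group_add set \<Rightarrow> 'a monoid" where
  "additive_group A = \<lparr>carrier = A, mult = (+), one = 0\<rparr>"

text \<open>
  The map \<open>G Mod N \<rightarrow> G' Mod N'\<close> induced by a homomorphism \<open>f : G \<rightarrow> G'\<close> with \<open>f ` N \<subseteq> N'\<close>, on cosets: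
  it sends \<open>N x\<close> to \<open>N' (f x)\<close>.
\<close>

definition coset_map ::
    "('b, 'm) monoid_scheme \<Rightarrow> 'b set \<Rightarrow> ('a \<Rightarrow> 'b) \<Rightarrow> 'a set \<Rightarrow> 'b set" where
  "coset_map G' N' f C = N' <#>\<^bsub>G'\<^esub> (f ` C)"

text \<open>
  The \<open>p\<close>-th exterior power of \<open>V\<close>: the free vector space on the \<open>p\<close>-tuples of elements of \<open>V\<close>, modulo
  the multilinear and the alternating relations. Compatibility with the scalars 0 and 1 follows
  from additivity.
\<close>

definition free_space :: "nat \<Rightarrow> 'a monoid \<Rightarrow> ('a list \<Rightarrow>\<^sub>0 bit) monoid" where
  "free_space p V =
     additive_group {c. \<forall>l \<in> Poly_Mapping.keys c. length l = p \<and> set l \<subseteq> carrier V}"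

definition exterior_relations :: "nat \<Rightarrow> 'a monoid \<Rightarrow> ('a list \<Rightarrow>\<^sub>0 bit) set" where
  "exterior_relations p V = generate (free_space p V)
     ({Poly_Mapping.single (xs @ (x \<otimes>\<^bsub>V\<^esub> y) # ys) 1
         - Poly_Mapping.single (xs @ x # ys) 1 - Poly_Mapping.single (xs @ y # ys) 1 |xs x y ys.
         length (xs @ x # ys) = p \<and> set xs \<union> {x, y} \<union> set ys \<subseteq> carrier V} \<union>
      {Poly_Mapping.single l 1 |l. length l = p \<and> set l \<subseteq> carrier V \<and> \<not> distinct l})"

definition exterior_power :: "nat \<Rightarrow> 'a monoid \<Rightarrow> ('a list \<Rightarrow>\<^sub>0 bit) set monoid" where
  "exterior_power p V = free_space p V Mod exterior_relations p V"

definition wedge :: "nat \<Rightarrow> 'a monoid \<Rightarrow> 'a list \<Rightarrow> ('a list \<Rightarrow>\<^sub>0 bit) set" where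
  "wedge p V l = exterior_relations p V #>\<^bsub>free_space p V\<^esub> Poly_Mapping.single l 1"

definition push_words :: "('a \<Rightarrow> 'b) \<Rightarrow> ('a list \<Rightarrow>\<^sub>0 bit) \<Rightarrow> ('b list \<Rightarrow>\<^sub>0 bit)" where
  "push_words h c =
     (\<Sum>l \<in> Poly_Mapping.keys c. Poly_Mapping.single (map h l) (Poly_Mapping.lookup c l))"

text \<open>The map \<open>exterior_power p V \<rightarrow> exterior_power p W\<close> induced by a linear map \<open>h : V \<rightarrow> W\<close>.\<close>

definition exterior_map ::
    "nat \<Rightarrow> 'b monoid \<Rightarrow> ('a \<Rightarrow> 'b) \<Rightarrow> ('a list \<Rightarrow>\<^sub>0 bit) set \<Rightarrow> ('b list \<Rightarrow>\<^sub>0 bit) set" where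
  "exterior_map p W h = coset_map (free_space p W) (exterior_relations p W) (push_words h)"

abbreviation F2_space :: "(bit^'d) monoid" where
  "F2_space \<equiv> additive_group UNIV"

text \<open>
  The pairing of the \<open>p\<close>-th exterior powers of \<open>M\<^sub>2\<close> and \<open>N\<^sub>2\<close>: on decomposable elements it is the
  determinant of the pairings of the factors. The value does not depend on the representatives.
\<close>

definition gram_det :: "nat \<Rightarrow> (bit^'d) list \<Rightarrow> (bit^'d) list \<Rightarrow> bit" where
  "gram_det p l m =
     (\<Sum>\<pi> | \<pi> permutes {..<p}. of_int (sign \<pi>) * (\<Prod>i<p. \<Sum>k\<in>UNIV. (l ! i) $ k * (m ! \<pi> i) $ k))"

definition exterior_pairing ::
    "nat \<Rightarrow> ((bit^'d) list \<Rightarrow>\<^sub>0 bit) set \<Rightarrow> ((bit^'d) list \<Rightarrow>\<^sub>0 bit) set \<Rightarrow> bit" where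
  "exterior_pairing p C D = (THE b. \<exists>c\<in>C. \<exists>d\<in>D.
     b = (\<Sum>l \<in> Poly_Mapping.keys c. \<Sum>m \<in> Poly_Mapping.keys d.
            Poly_Mapping.lookup c l * Poly_Mapping.lookup d m * gram_det p l m))"


section \<open>Cellular homology of cosheaves\<close>

record ('e, 'a) cosheaf =
  cells :: "'e set"
  celldim :: "'e \<Rightarrow> int"
  face :: "'e \<Rightarrow> 'e \<Rightarrow> bool"
  stalk :: "'e \<Rightarrow> 'a monoid"
  transition :: "'e \<Rightarrow> 'e \<Rightarrow> 'a \<Rightarrow> 'a"

text \<open>\<open>face F e' e\<close> means \<open>e' \<le> e\<close>, and \<open>transition F e e'\<close> is then the map from \<open>stalk F e\<close> to \<open>stalk F e'\<close>.\<close>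

definition cells_of_dim :: "('e, 'a) cosheaf \<Rightarrow> int \<Rightarrow> 'e set" where
  "cells_of_dim F q = {e \<in> cells F. celldim F e = q}"

definition chain_group :: "('e, 'a) cosheaf \<Rightarrow> int \<Rightarrow> ('e \<Rightarrow> 'a) monoid" where
  "chain_group F q = sum_group (cells_of_dim F q) (stalk F)"

definition elementary_chain :: "('e, 'a) cosheaf \<Rightarrow> int \<Rightarrow> 'a \<Rightarrow> 'e \<Rightarrow> ('e \<Rightarrow> 'a)" where
  "elementary_chain F q a e =
     (\<lambda>e' \<in> cells_of_dim F q. if e' = e then a else \<one>\<^bsub>stalk F e'\<^esub>)"

definition boundary :: "('e, 'a) cosheaf \<Rightarrow> int \<Rightarrow> ('e \<Rightarrow> 'a) \<Rightarrow> ('e \<Rightarrow> 'a)" where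
  "boundary F q c = (\<lambda>e' \<in> cells_of_dim F (q - 1).
     finprod (stalk F e') (\<lambda>e. transition F e e' (c e)) {e \<in> cells_of_dim F q. face F e' e})"

definition cycles :: "('e, 'a) cosheaf \<Rightarrow> int \<Rightarrow> ('e \<Rightarrow> 'a) set" where
  "cycles F q = kernel (chain_group F q) (chain_group F (q - 1)) (boundary F q)"

definition boundaries :: "('e, 'a) cosheaf \<Rightarrow> int \<Rightarrow> ('e \<Rightarrow> 'a) set" where
  "boundaries F q = boundary F (q + 1) ` carrier (chain_group F (q + 1))"

definition homology_group :: "('e, 'a) cosheaf \<Rightarrow> int \<Rightarrow> ('e \<Rightarrow> 'a) set monoid" where
  "homology_group F q = subgroup_generated (chain_group F q) (cycles F q) Mod boundaries F q"

definition homology_class :: "('e, 'a) cosheaf \<Rightarrow> int \<Rightarrow> ('e \<Rightarrow> 'a) \<Rightarrow> ('e \<Rightarrow> 'a) set" where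
  "homology_class F q z = boundaries F q #>\<^bsub>chain_group F q\<^esub> z"

text \<open>
  For a subcomplex, given by a cosheaf \<open>F\<close> whose stalks are subgroups of those of \<open>G\<close>: extension of
  chains by zero, and the map it induces in homology.
\<close>

definition chain_inclusion ::
    "('e, 'a) cosheaf \<Rightarrow> ('e, 'a) cosheaf \<Rightarrow> int \<Rightarrow> ('e \<Rightarrow> 'a) \<Rightarrow> ('e \<Rightarrow> 'a)" where
  "chain_inclusion F G q c =
     (\<lambda>e \<in> cells_of_dim G q. if e \<in> cells F then c e else \<one>\<^bsub>stalk G e\<^esub>)"

definition homology_inclusion ::
    "('e, 'a) cosheaf \<Rightarrow> ('e, 'a) cosheaf \<Rightarrow> int \<Rightarrow> ('e \<Rightarrow> 'a) set \<Rightarrow> ('e \<Rightarrow> 'a) set" where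
  "homology_inclusion F G q = coset_map (chain_group G q) (boundaries G q) (chain_inclusion F G q)"


section \<open>The tropical cosheaves\<close>

text \<open>
  For a linear subspace \<open>W\<close> the sublattice \<open>W \<inter> lattice\<close> is saturated, so its tensor product with
  the field with two elements embeds into \<open>bit^'d\<close>; \<open>mod2_space W\<close> is the image.
\<close>

definition mod2 :: "real^'d \<Rightarrow> bit^'d" where
  "mod2 x = (\<chi> i. of_int \<lfloor>x $ i\<rfloor>)"

definition mod2_space :: "(real^'d) set \<Rightarrow> (bit^'d) set" where
  "mod2_space W = mod2 ` (W \<inter> lattice)"

definition Sed :: "(real^'d) set \<Rightarrow> (bit^'d) set" where
  "Sed Q = mod2_space (orthogonal_comp (tangent Q))"

definition N_mod_Sed :: "(real^'d) set \<Rightarrow> (bit^'d) set monoid" where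
  "N_mod_Sed Q = F2_space Mod Sed Q"

text \<open>The image in the exterior power of \<open>N\<^sub>2 / Sed Q\<close> of the exterior power of the subspace attached to an edge \<open>\<epsilon>\<close>.\<close>

definition edge_part ::
    "nat \<Rightarrow> (real^'d) set \<Rightarrow> (real^'d) set \<Rightarrow> ((bit^'d) set list \<Rightarrow>\<^sub>0 bit) set set" where
  "edge_part p Q \<epsilon> = exterior_map p (N_mod_Sed Q) id `
     carrier (exterior_power p (additive_group (mod2_space (orthogonal_comp (tangent \<epsilon>))) Mod Sed Q))"

definition cosheaf_Y :: "(real^'d) set \<Rightarrow> (real^'d) set set \<Rightarrow> nat \<Rightarrow>
    ('d::finite cell, ((bit^'d) set list \<Rightarrow>\<^sub>0 bit) set) cosheaf" where
  "cosheaf_Y P K p =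
     \<lparr>cells = cells_Y P K,
      celldim = cell_dim,
      face = cell_face K,
      stalk = (\<lambda>(\<sigma>, Q). exterior_power p (N_mod_Sed Q)),
      transition = (\<lambda>(\<sigma>, Q) (\<sigma>', Q').
        exterior_map p (N_mod_Sed Q') (coset_map F2_space (Sed Q') id))\<rparr>"

definition cosheaf_X :: "(real^'d) set \<Rightarrow> (real^'d) set set \<Rightarrow> nat \<Rightarrow>
    ('d::finite cell, ((bit^'d) set list \<Rightarrow>\<^sub>0 bit) set) cosheaf" where
  "cosheaf_X P K p = (cosheaf_Y P K p)
     \<lparr>cells := cells_X P K,
      stalk := (\<lambda>(\<sigma>, Q). subgroup_generated (exterior_power p (N_mod_Sed Q))
                            (\<Union>\<epsilon>\<in>{\<epsilon>. \<epsilon> edge_of \<sigma>}. edge_part p Q \<epsilon>))\<rparr>"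


section \<open>Face cycles\<close>

definition omega :: "nat \<Rightarrow> (real^'d) set \<Rightarrow> ((bit^'d) list \<Rightarrow>\<^sub>0 bit) set" where
  "omega p \<sigma> = (THE x.
     x \<in> exterior_map p F2_space id `
           carrier (exterior_power p (additive_group (mod2_space (tangent \<sigma>)))) \<and>
     x \<noteq> \<one>\<^bsub>exterior_power p F2_space\<^esub>)"

text \<open>A decomposable \<open>\<omega>\<^sup>*(\<sigma>)\<close> is given by the list of its factors.\<close>

definition dual_omega :: "nat \<Rightarrow> (real^'d) set \<Rightarrow> (bit^'d) list \<Rightarrow> bool" where
  "dual_omega p \<sigma> us \<longleftrightarrow>
     length us = p \<and> exterior_pairing p (omega p \<sigma>) (wedge p F2_space us) = 1"

text \<open>As \<open>\<tau>\<^sup>* = [\<tau>, P]\<close>, the coefficients are taken in the exterior power of \<open>N\<^sub>2 / Sed P\<close>, where \<open>Sed P = {0}\<close>.\<close>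

definition face_cycle :: "(real^'d) set \<Rightarrow> (real^'d) set set \<Rightarrow> nat \<Rightarrow> nat \<Rightarrow>
    (bit^'d) list \<Rightarrow> (real^'d) set \<Rightarrow> ('d::finite cell \<Rightarrow> ((bit^'d) set list \<Rightarrow>\<^sub>0 bit) set)" where
  "face_cycle P K p q us \<sigma> =
     finprod (chain_group (cosheaf_X P K p) (int q))
       (\<lambda>\<tau>. elementary_chain (cosheaf_X P K p) (int q)
              (wedge p (N_mod_Sed P) (map (\<lambda>u. Sed P #>\<^bsub>F2_space\<^esub> u) us)) (\<tau>, P))
       {\<tau> \<in> K. (int p + 1) simplex \<tau> \<and> \<sigma> face_of \<tau>}"

end

theory Submission
  imports Defs "HOL-Library.Function_Algebras"
begin

text \<open>
  Let \<open>i\<close> be the morphism \<open>H\<^sub>p\<^sub>,\<^sub>q(X) \<rightarrow> H\<^sub>p\<^sub>,\<^sub>q(Y)\<close>. A cycle of \<open>X\<close> whose class lies in the kernel of \<open>i\<close> is the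
  boundary of a chain \<open>b\<close> of \<open>Y\<close>, and \<open>b\<close> is then a cycle of the quotient complex of \<open>Y\<close> by \<open>X\<close>. The face
  cycle of \<open>\<sigma>\<close> is the boundary of the chain \<open>\<omega>\<^sup>*(\<sigma>) \<otimes> \<sigma>\<^sup>*\<close> of \<open>Y\<close>, so it lies in the kernel, and the
  theorem amounts to the following: every cycle of degree \<open>q + 1\<close> of the quotient complex is, up to
  a boundary, a sum of chains \<open>\<omega>\<^sup>*(\<sigma>) \<otimes> \<sigma>\<^sup>*\<close> with \<open>\<sigma>\<close> an interior \<open>p\<close>-simplex
  (\<open>cycles_generated_by_interior_simplices\<close>).

  The stalks of the quotient complex are explicit. Fix \<open>\<sigma>\<close>. Near a vertex the smooth polytope is a
  coordinate orthant, so the faces containing \<open>\<sigma>\<close> are indexed by the subsets \<open>I\<close> of a set \<open>T\<close> of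
  coordinates; the edges of the primitive simplex \<open>\<sigma>\<close> issuing from a vertex are independent modulo
  two. Combining both, \<open>cell_chart_exists\<close> finds a basis \<open>x\<close> of \<open>N\<^sub>2\<close>, with dual basis \<open>\<xi>\<close>, and a set \<open>A\<close>
  disjoint from \<open>T\<close> with \<open>dim \<sigma>\<close> elements such that \<open>Sed(Q\<^sub>I)\<close> is spanned by the \<open>x\<^sub>i\<close> with \<open>i \<in> I\<close>, and the
  edges of \<open>\<sigma>\<close> reduce to the vectors \<open>\<xi>\<^sub>a\<close> and \<open>\<xi>\<^sub>a + \<xi>\<^sub>b\<close> with \<open>a, b \<in> A\<close>. A sum of monomials \<open>x\<^sub>J\<close> then
  belongs to the stalk of \<open>X\<close> at \<open>(\<sigma>, Q\<^sub>I)\<close> if and only if it contains no \<open>x\<^sub>J\<close> with \<open>A \<subseteq> J\<close> and \<open>J \<inter> I = {}\<close>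
  (\<open>monomial_description\<close>). These \<open>x\<^sub>J\<close> are a basis of the quotient stalk.

  For fixed \<open>\<sigma>\<close> and \<open>J\<close> the faces \<open>Q\<^sub>I\<close> with \<open>I \<subseteq> T - J\<close> contribute the augmented cochain complex of a full
  simplex, which is exact at every \<open>I \<noteq> {}\<close> (\<open>vertical_exactness\<close>). In degree \<open>q + 1\<close> a cell \<open>(\<sigma>, Q\<^sub>I)\<close> has
  \<open>card I = p - dim \<sigma>\<close>. By induction on \<open>dim \<sigma>\<close>, a cycle can therefore be changed by boundaries until
  it vanishes on all cells with \<open>dim \<sigma> < p\<close> (\<open>clear_below\<close>). What remains lives on the cells \<open>(\<sigma>, P)\<close>
  with \<open>dim \<sigma> = p\<close>, where the quotient stalk is the line spanned by \<open>x\<^sub>A\<close>, that is, by the image of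
  \<open>\<omega>\<^sup>*(\<sigma>)\<close> (\<open>dual_omega_coord\<close>). If \<open>\<sigma>\<close> lies on a facet of \<open>P\<close>, the cycle condition at that facet says that
  the coefficient is zero; so only interior simplices are left.

  All stalks are subquotients of the vector space of formal sums of words of length \<open>p\<close> in \<open>N\<^sub>2\<close>, and
  the transition maps are induced by the identity of words. Chains are therefore represented by
  functions with values in formal sums, with one boundary operator \<open>D\<close> for all cosheaves, and the
  cosheaves enter through the subgroups in which these values lie (\<open>presents_homology\<close>).
\<close>

section \<open>Groups of exponent two and their presentations\<close>

class char2 = ab_group_add +
  assumes add_self [simp]: "x + x = 0"
begin

lemma uminus_char2 [simp]: "- x = x"
  using add_self[of x] by (simp only: minus_unique)

lemma minus_char2 [simp]: "x - y = x + y"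
  by (simp add: diff_conv_add_uminus)

lemma add_eq_0_char2: "x + y = 0 \<longleftrightarrow> x = y"
  using eq_neg_iff_add_eq_0[of x y] by simp

lemma add_self_left [simp]: "x + (x + y) = y"
  using add_assoc[of x x y] by simp

end

instance bit :: char2
proof
  fix x :: bit show "x + x = 0" by (cases x) simp_all
qed

instance vec :: (char2, finite) char2
  by standard (simp add: vec_eq_iff)

instance poly_mapping :: (type, char2) char2
  by standard (rule poly_mapping_eqI, simp add: lookup_add)

instance "fun" :: (type, char2) char2
  by standard (simp add: fun_eq_iff)

lemma sum_apply: "(\<Sum>i\<in>A. f i) x = (\<Sum>i\<in>A. f i x)"
  by (induction A rule: infinite_finite_induct) auto

text \<open>
  In exponent two, where \<open>- x = x\<close>, these are the subgroups; \<open>gen2\<close> below is the subgroup generated by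
  a set.
\<close>

definition addsub :: "'a::char2 set \<Rightarrow> bool" where
  "addsub A \<longleftrightarrow> 0 \<in> A \<and> (\<forall>x\<in>A. \<forall>y\<in>A. x + y \<in> A)"

lemma addsub_0: "addsub A \<Longrightarrow> 0 \<in> A"
  and addsub_add: "addsub A \<Longrightarrow> x \<in> A \<Longrightarrow> y \<in> A \<Longrightarrow> x + y \<in> A"
  by (auto simp: addsub_def)

lemma addsub_cancel: "addsub A \<Longrightarrow> x \<in> A \<Longrightarrow> x + y \<in> A \<longleftrightarrow> y \<in> A"
  using addsub_add[of A x y] addsub_add[of A x "x + y"] by auto

lemma addsub_sum: "addsub A \<Longrightarrow> (\<And>i. i \<in> I \<Longrightarrow> f i \<in> A) \<Longrightarrow> (\<Sum>i\<in>I. f i) \<in> A"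
  by (induction I rule: infinite_finite_induct) (auto simp: addsub_def)

lemma addsub_UNIV [simp]: "addsub UNIV"
  by (simp add: addsub_def)

inductive_set gen2 :: "'a::char2 set \<Rightarrow> 'a set" for H where
  gen2_0: "0 \<in> gen2 H"
| gen2_step: "x \<in> H \<Longrightarrow> y \<in> gen2 H \<Longrightarrow> x + y \<in> gen2 H"

lemma gen2_add: "x \<in> gen2 H \<Longrightarrow> y \<in> gen2 H \<Longrightarrow> x + y \<in> gen2 H"
  by (induction rule: gen2.induct) (auto simp: add.assoc intro: gen2.intros)

lemma addsub_gen2: "addsub (gen2 H)"
  by (auto simp: addsub_def intro: gen2_0 gen2_add)

lemma gen2_incl: "x \<in> H \<Longrightarrow> x \<in> gen2 H"
  using gen2_step[OF _ gen2_0] by force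

lemma gen2_minimal: "addsub A \<Longrightarrow> H \<subseteq> A \<Longrightarrow> gen2 H \<subseteq> A"
proof
  fix x assume "addsub A" "H \<subseteq> A" "x \<in> gen2 H"
  from this(3,1,2) show "x \<in> A" by (induction rule: gen2.induct) (auto simp: addsub_def)
qed

lemma gen2_mono: "A \<subseteq> B \<Longrightarrow> gen2 A \<subseteq> gen2 B"
  using gen2_minimal[OF addsub_gen2, of A B] gen2_incl by blast

lemma gen2_Un_split:
  assumes "x \<in> gen2 (A \<union> B)"
  obtains a b where "a \<in> gen2 A" "b \<in> gen2 B" "x = a + b"
proof -
  have "\<exists>a\<in>gen2 A. \<exists>b\<in>gen2 B. x = a + b"
    using assms
  proof (induction rule: gen2.induct)
    case gen2_0
    then show ?case using gen2.gen2_0 by force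
  next
    case (gen2_step x y)
    then obtain a b where ab: "a \<in> gen2 A" "b \<in> gen2 B" "y = a + b" by blast
    from gen2_step(1) show ?case
    proof
      assume "x \<in> A"
      then have "x + a \<in> gen2 A" using ab(1) by (rule gen2.gen2_step)
      moreover have "x + y = (x + a) + b" using ab(3) by (simp add: add.assoc)
      ultimately show ?thesis using ab(2) by blast
    next
      assume "x \<in> B"
      then have "x + b \<in> gen2 B" using ab(2) by (rule gen2.gen2_step)
      moreover have "x + y = a + (x + b)" using ab(3) by (simp add: algebra_simps)
      ultimately show ?thesis using ab(1) by blast
    qed
  qed
  then show thesis using that by blast
qed

lemma gen2_addsub_id: "addsub A \<Longrightarrow> gen2 A = A"
  using gen2_minimal[of A A] gen2_incl by blast

text \<open>
  A presentation of \<open>G\<close> as the quotient of \<open>A\<close> by \<open>S \<inter> A\<close>. Outside \<open>A\<close> neither \<open>h\<close> nor \<open>S\<close> is constrained, so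
  that one map \<open>h\<close> and one set \<open>S\<close> can present a group and all its subgroups. Subgroups, quotients and
  products of presented groups are presented again, which replaces computations with nested cosets
  by computations in \<open>A\<close>.
\<close>

definition presents ::
    "('v::char2 \<Rightarrow> 'b) \<Rightarrow> 'v set \<Rightarrow> 'v set \<Rightarrow> ('b, 'm) monoid_scheme \<Rightarrow> bool" where
  "presents h A S G \<longleftrightarrow> addsub A \<and> comm_group G \<and> h ` A = carrier G \<and>
     (\<forall>x\<in>A. \<forall>y\<in>A. h (x + y) = h x \<otimes>\<^bsub>G\<^esub> h y) \<and> (\<forall>x\<in>A. h x = \<one>\<^bsub>G\<^esub> \<longleftrightarrow> x \<in> S)"

lemma presentsD:
  assumes "presents h A S G"
  shows "addsub A" "comm_group G" "group G" "h ` A = carrier G"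
    "x \<in> A \<Longrightarrow> h x \<in> carrier G"
    "x \<in> A \<Longrightarrow> y \<in> A \<Longrightarrow> h (x + y) = h x \<otimes>\<^bsub>G\<^esub> h y"
    "x \<in> A \<Longrightarrow> h x = \<one>\<^bsub>G\<^esub> \<longleftrightarrow> x \<in> S"
  using assms comm_group.axioms(2) unfolding presents_def by auto

lemma presents_0:
  assumes "presents h A S G"
  shows "h 0 = \<one>\<^bsub>G\<^esub>"
proof -
  interpret group G using presentsD(3)[OF assms] .
  have 0: "0 \<in> A" using addsub_0 presentsD(1)[OF assms] .
  have "h 0 \<otimes>\<^bsub>G\<^esub> h 0 = h 0" using presentsD(6)[OF assms 0 0] by simp
  then show ?thesis using presentsD(5)[OF assms 0] by (simp add: l_cancel_one)
qed

lemma presents_eq: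
  assumes "presents h A S G" "x \<in> A" "y \<in> A"
  shows "h x = h y \<longleftrightarrow> x + y \<in> S"
proof -
  interpret group G using presentsD(3)[OF assms(1)] .
  have yy: "h y \<otimes>\<^bsub>G\<^esub> h y = \<one>\<^bsub>G\<^esub>"
    using presentsD(6)[OF assms(1,3,3)] presents_0[OF assms(1)] by simp
  have c: "h x \<in> carrier G" "h y \<in> carrier G" using presentsD(5)[OF assms(1)] assms by auto
  have "x + y \<in> A" using addsub_add presentsD(1) assms by metis
  then have "x + y \<in> S \<longleftrightarrow> h x \<otimes>\<^bsub>G\<^esub> h y = \<one>\<^bsub>G\<^esub>"
    using presentsD(6,7)[OF assms(1)] assms(2,3) by metis
  also have "\<dots> \<longleftrightarrow> h x \<otimes>\<^bsub>G\<^esub> h y = h y \<otimes>\<^bsub>G\<^esub> h y" using yy by simp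
  also have "\<dots> \<longleftrightarrow> h x = h y" using c by simp
  finally show ?thesis by blast
qed

lemma presents_addsub_kernel:
  assumes "presents h A S G"
  shows "addsub (S \<inter> A)"
  unfolding addsub_def
proof (intro conjI ballI)
  interpret group G using presentsD(3)[OF assms] .
  have 0: "0 \<in> A" using addsub_0 presentsD(1)[OF assms] .
  show "0 \<in> S \<inter> A" using 0 presents_0[OF assms] presentsD(7)[OF assms 0] by simp
  fix x y assume x: "x \<in> S \<inter> A" and y: "y \<in> S \<inter> A"
  then have A: "x + y \<in> A" using addsub_add presentsD(1)[OF assms] by auto
  have "h (x + y) = \<one>\<^bsub>G\<^esub>"
    using presentsD(6)[OF assms, of x y] presentsD(7)[OF assms, of x] presentsD(7)[OF assms, of y] x y
    by simp
  then show "x + y \<in> S \<inter> A" using A presentsD(7)[OF assms A] by simp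
qed

lemma presents_finprod:
  assumes "presents h A S G" "\<And>i. i \<in> I \<Longrightarrow> f i \<in> A"
  shows "finprod G (\<lambda>i. h (f i)) I = h (\<Sum>i\<in>I. f i)"
proof -
  interpret comm_group G using presentsD(2)[OF assms(1)] .
  show ?thesis using assms(2)
  proof (induction I rule: infinite_finite_induct)
    case (insert i I)
    have "(\<Sum>i\<in>I. f i) \<in> A" using addsub_sum presentsD(1)[OF assms(1)] insert by blast
    then show ?case
      using insert presentsD(5,6)[OF assms(1)] by (subst finprod_insert) (auto simp: Pi_iff)
  qed (auto simp: presents_0[OF assms(1)])
qed

lemma presents_generate:
  assumes "presents h A S G" "B \<subseteq> A"
  shows "generate G (h ` B) = h ` gen2 B"
proof -
  interpret group G using presentsD(3)[OF assms(1)] .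
  have sub: "gen2 B \<subseteq> A" using gen2_minimal presentsD(1)[OF assms(1)] assms(2) by blast
  have hB: "h ` B \<subseteq> carrier G" using presentsD(5)[OF assms(1)] assms(2) by blast
  have inv: "inv\<^bsub>G\<^esub> (h x) = h x" if "x \<in> A" for x
    using presentsD(5)[OF assms(1) that] presentsD(6)[OF assms(1) that that] presents_0[OF assms(1)]
    by (intro inv_equality) auto
  show ?thesis
  proof
    show "generate G (h ` B) \<subseteq> h ` gen2 B"
    proof
      fix x assume "x \<in> generate G (h ` B)"
      then show "x \<in> h ` gen2 B"
      proof (induction rule: generate.induct)
        case one
        then show ?case using presents_0[OF assms(1)] gen2_0 by (metis imageI)
      next
        case (incl x)
        then show ?case using gen2_incl by blast
      next
        case (inv x)
        then show ?case using \<open>\<And>x. x \<in> A \<Longrightarrow> inv\<^bsub>G\<^esub> (h x) = h x\<close> assms(2) gen2_incl by fastforce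
      next
        case (eng x y)
        then obtain a b where "a \<in> gen2 B" "b \<in> gen2 B" "x = h a" "y = h b" by blast
        then show ?case using presentsD(6)[OF assms(1), of a b] sub gen2_add[of a B b] by (metis imageI subsetD)
      qed
    qed
    show "h ` gen2 B \<subseteq> generate G (h ` B)"
    proof
      fix x assume "x \<in> h ` gen2 B"
      then obtain a where "a \<in> gen2 B" "x = h a" by blast
      from this(1) have "h a \<in> generate G (h ` B)"
      proof (induction rule: gen2.induct)
        case gen2_0
        then show ?case using presents_0[OF assms(1)] generate.one by metis
      next
        case (gen2_step x y)
        have "h (x + y) = h x \<otimes>\<^bsub>G\<^esub> h y" using presentsD(6)[OF assms(1), of x y] assms(2) sub gen2_step(1,2) by blast
        moreover have "h x \<in> generate G (h ` B)" using gen2_step(1) by (intro generate.incl) simp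
        ultimately show ?case using gen2_step(3) by (simp add: generate.eng)
      qed
      then show "x \<in> generate G (h ` B)" using \<open>x = h a\<close> by simp
    qed
  qed
qed

lemma presents_subgroup_generated:
  assumes "presents h A S G" "B \<subseteq> A"
  shows "presents h (gen2 B) S (subgroup_generated G (h ` B))"
proof -
  interpret comm_group G using presentsD(2)[OF assms(1)] .
  have sub: "gen2 B \<subseteq> A" using gen2_minimal presentsD(1)[OF assms(1)] assms(2) by blast
  have "carrier (subgroup_generated G (h ` B)) = h ` gen2 B"
  proof -
    have "h ` B \<subseteq> carrier G" using presentsD(5)[OF assms(1)] assms(2) by blast
    then show ?thesis using presents_generate[OF assms] by (simp add: carrier_subgroup_generated Int_absorb1)
  qed
  then show ?thesis
    unfolding presents_def
    using presentsD(6,7)[OF assms(1)] sub abelian_subgroup_generated[OF comm_group_axioms]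
    by (auto simp: addsub_gen2 subset_iff)
qed

text \<open>
  Enlarging \<open>A\<close> by elements of the kernel does not change the group. This turns a presentation by
  chosen generators into one whose \<open>A\<close> contains the whole kernel, so that membership in the group
  can be tested on an arbitrary representative.
\<close>

lemma presents_enlarge:
  assumes "presents h B S G" "addsub A" "B \<subseteq> A" "presents h A S G'"
    "\<And>x. x \<in> A \<Longrightarrow> \<exists>y\<in>B. x + y \<in> S"
    "mult G = mult G'" "one G = one G'"
  shows "presents h A S G"
proof -
  have "h ` A = h ` B"
  proof
    show "h ` A \<subseteq> h ` B"
    proof
      fix z assume "z \<in> h ` A"
      then obtain x where x: "x \<in> A" "z = h x" by blast
      obtain y where "y \<in> B" "x + y \<in> S" using assms(5)[OF x(1)] by blast
      then have "h x = h y" using presents_eq[OF assms(4), of x y] x assms(3) by blast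
      then show "z \<in> h ` B" using x(2) \<open>y \<in> B\<close> by simp
    qed
  qed (use assms(3) in blast)
  then show ?thesis using assms(1,2,4,6,7) unfolding presents_def by auto
qed

lemma presents_Mod:
  assumes "presents h A S G" "addsub T" "S \<inter> A \<subseteq> T" "T \<subseteq> A"
  shows "presents (\<lambda>x. h ` T #>\<^bsub>G\<^esub> h x) A T (G Mod (h ` T))"
proof -
  interpret comm_group G using presentsD(2)[OF assms(1)] .
  have gen: "h ` T = generate G (h ` T)"
    using presents_generate[OF assms(1,4)] gen2_addsub_id[OF assms(2)] by simp
  have sg: "subgroup (h ` T) G"
    by (subst gen, rule generate_is_subgroup) (use presentsD(5)[OF assms(1)] assms(4) in blast)
  interpret N: normal "h ` T" G using subgroup_imp_normal[OF sg] .
  have car: "(\<lambda>x. h ` T #>\<^bsub>G\<^esub> h x) ` A = carrier (G Mod (h ` T))"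
    unfolding FactGroup_def RCOSETS_def presentsD(4)[OF assms(1), symmetric] by auto
  have mul: "h ` T #>\<^bsub>G\<^esub> h (x + y) = (h ` T #>\<^bsub>G\<^esub> h x) \<otimes>\<^bsub>G Mod h ` T\<^esub> (h ` T #>\<^bsub>G\<^esub> h y)"
    if "x \<in> A" "y \<in> A" for x y
    using presentsD(5,6)[OF assms(1)] that by (simp add: FactGroup_def N.rcos_sum)
  have ker: "h ` T #>\<^bsub>G\<^esub> h x = \<one>\<^bsub>G Mod h ` T\<^esub> \<longleftrightarrow> x \<in> T" if x: "x \<in> A" for x
  proof -
    have "h ` T #>\<^bsub>G\<^esub> h x = h ` T \<longleftrightarrow> h x \<in> h ` T"
      using coset_join1[of "h ` T" "h x"] coset_join2[of "h x" "h ` T"] sg presentsD(5)[OF assms(1) x]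
        subgroup.subset[OF sg] by blast
    also have "\<dots> \<longleftrightarrow> x \<in> T"
    proof
      assume "h x \<in> h ` T"
      then obtain t where t: "t \<in> T" "h x = h t" by blast
      then have "x + t \<in> S" using presents_eq[OF assms(1) x, of t] assms(4) by blast
      moreover have "x + t \<in> A" using addsub_add[OF presentsD(1)[OF assms(1)] x, of t] t assms(4) by blast
      ultimately have "x + t \<in> T" using assms(3) by blast
      then show "x \<in> T" using addsub_cancel[OF assms(2) t(1), of x] by (simp add: add.commute)
    qed simp
    finally show ?thesis by (simp add: FactGroup_def)
  qed
  show ?thesis
    unfolding presents_def using presentsD(1)[OF assms(1)] abelian_FactGroup[OF sg] car mul ker by blast
qed

lemma presents_additive_group:
  assumes "addsub A"
  shows "presents id A {0} (additive_group A)"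
proof -
  have "comm_group (additive_group A)"
    by (rule comm_groupI)
      (use assms in \<open>auto simp: additive_group_def addsub_def algebra_simps add_eq_0_char2\<close>)
  then show ?thesis
    using assms by (auto simp: presents_def additive_group_def)
qed

lemma r_coset_additive: "S #>\<^bsub>additive_group A\<^esub> x = (\<lambda>s. s + x) ` S"
  by (auto simp: r_coset_def additive_group_def)

lemma presents_additive_Mod:
  assumes "addsub A" "addsub S" "S \<subseteq> A"
  shows "presents (\<lambda>x. S #>\<^bsub>additive_group A\<^esub> x) A S (additive_group A Mod S)"
proof -
  have "{0} \<inter> A \<subseteq> S" using addsub_0[OF assms(2)] by blast
  from presents_Mod[OF presents_additive_group[OF assms(1)] assms(2) this assms(3)]
  show ?thesis by simp
qed

lemma generate_additive:
  assumes "addsub A" "H \<subseteq> A"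
  shows "generate (additive_group A) H = gen2 H"
  using presents_generate[OF presents_additive_group[OF assms(1)] assms(2)] by simp

lemma presents_sum_group:
  assumes fin: "finite I" and p: "\<And>i. i \<in> I \<Longrightarrow> presents (h i) (A i) (S i) (G i)"
  shows "presents (\<lambda>b. \<lambda>i\<in>I. h i (b i)) {b. \<forall>i\<in>I. b i \<in> A i} {b. \<forall>i\<in>I. b i \<in> S i} (sum_group I G)"
  unfolding presents_def
proof (intro conjI ballI)
  have gr: "group (G i)" and cgr: "comm_group (G i)" if "i \<in> I" for i
    using presentsD(2,3)[OF p[OF that]] by auto
  show "addsub {b. \<forall>i\<in>I. b i \<in> A i}"
    using presentsD(1)[OF p] by (auto simp: addsub_def)
  have car: "carrier (sum_group I G) = (\<Pi>\<^sub>E i\<in>I. carrier (G i))"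
    using fin gr by (simp add: carrier_sum_group)
  show "comm_group (sum_group I G)"
  proof (rule group.group_comm_groupI)
    show "group (sum_group I G)" using gr by simp
    fix x y assume "x \<in> carrier (sum_group I G)" "y \<in> carrier (sum_group I G)"
    then show "x \<otimes>\<^bsub>sum_group I G\<^esub> y = y \<otimes>\<^bsub>sum_group I G\<^esub> x"
      unfolding car using comm_groupE(4)[OF cgr] by (auto simp: PiE_iff intro!: restrict_ext)
  qed
  show "(\<lambda>b. \<lambda>i\<in>I. h i (b i)) ` {b. \<forall>i\<in>I. b i \<in> A i} = carrier (sum_group I G)"
    unfolding car
  proof (intro equalityI subsetI)
    fix x assume x: "x \<in> (\<Pi>\<^sub>E i\<in>I. carrier (G i))"
    then have "\<forall>i\<in>I. \<exists>a\<in>A i. x i = h i a"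
      using presentsD(4)[OF p] by (metis PiE_mem image_iff)
    then obtain b where "\<forall>i\<in>I. b i \<in> A i \<and> x i = h i (b i)" by metis
    then show "x \<in> (\<lambda>b. \<lambda>i\<in>I. h i (b i)) ` {b. \<forall>i\<in>I. b i \<in> A i}"
      using x by (intro image_eqI[of _ _ b]) (auto simp: PiE_iff extensional_def fun_eq_iff)
  qed (use presentsD(5)[OF p] in auto)
  show "(\<lambda>i\<in>I. h i ((x + y) i)) = (\<lambda>i\<in>I. h i (x i)) \<otimes>\<^bsub>sum_group I G\<^esub> (\<lambda>i\<in>I. h i (y i))"
    if "x \<in> {b. \<forall>i\<in>I. b i \<in> A i}" "y \<in> {b. \<forall>i\<in>I. b i \<in> A i}" for x y
    using that presentsD(6)[OF p] by (auto intro!: restrict_ext)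
  show "((\<lambda>i\<in>I. h i (x i)) = \<one>\<^bsub>sum_group I G\<^esub>) = (x \<in> {b. \<forall>i\<in>I. b i \<in> S i})"
    if "x \<in> {b. \<forall>i\<in>I. b i \<in> A i}" for x
    using that presentsD(7)[OF p] by (auto simp: restrict_def fun_eq_iff)
qed

text \<open>
  The next two simplification rules replace the arithmetic of \<open>bit\<close> by Boolean operations and would
  block the ring identities used below.
\<close>

declare add_bit_eq_xor [simp del] mult_bit_eq_and [simp del]

section \<open>Exterior powers over the field with two elements\<close>

abbreviation word :: "'a list \<Rightarrow> 'a list \<Rightarrow>\<^sub>0 bit" where
  "word l \<equiv> Poly_Mapping.single l 1"

definition words :: "nat \<Rightarrow> 'a set \<Rightarrow> ('a list \<Rightarrow>\<^sub>0 bit) set" where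
  "words p A = {c. \<forall>l\<in>Poly_Mapping.keys c. length l = p \<and> set l \<subseteq> A}"

lemma keys_add_bit:
  fixes c d :: "'a \<Rightarrow>\<^sub>0 bit"
  shows "Poly_Mapping.keys (c + d) =
    (Poly_Mapping.keys c - Poly_Mapping.keys d) \<union> (Poly_Mapping.keys d - Poly_Mapping.keys c)"
  by (auto simp: in_keys_iff lookup_add)

lemma addsub_words [simp]: "addsub (words p A)"
  by (auto simp: addsub_def words_def keys_add_bit)

lemma free_space_words: "free_space p V = additive_group (words p (carrier V))"
  by (simp add: free_space_def words_def)

lemma word_in_words [simp]: "word l \<in> words p A \<longleftrightarrow> length l = p \<and> set l \<subseteq> A"
  by (simp add: words_def)

lemma words_mono: "A \<subseteq> B \<Longrightarrow> words p A \<subseteq> words p B"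
  by (auto simp: words_def)

text \<open>
  The linear extension of a map on a basis: over the field with two elements a formal sum is
  determined by its support.
\<close>

definition linext :: "('a \<Rightarrow> 'b::char2) \<Rightarrow> ('a \<Rightarrow>\<^sub>0 bit) \<Rightarrow> 'b" where
  "linext f c = (\<Sum>l\<in>Poly_Mapping.keys c. f l)"

lemma sum_sym_diff_char2:
  fixes f :: "'a \<Rightarrow> 'b::char2"
  assumes "finite A" "finite B"
  shows "sum f ((A - B) \<union> (B - A)) = sum f A + sum f B"
proof -
  have "sum f A = sum f (A - B) + sum f (A \<inter> B)"
    using assms by (subst sum.union_disjoint[symmetric]) (auto intro: arg_cong[where f = "sum f"])
  moreover have "sum f B = sum f (B - A) + sum f (A \<inter> B)"
    using assms by (subst sum.union_disjoint[symmetric]) (auto intro: arg_cong[where f = "sum f"])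
  moreover have "sum f ((A - B) \<union> (B - A)) = sum f (A - B) + sum f (B - A)"
    using assms by (intro sum.union_disjoint) auto
  ultimately show ?thesis by (simp add: algebra_simps)
qed

lemma linext_add: "linext f (c + d) = linext f c + linext f d"
  unfolding linext_def keys_add_bit by (rule sum_sym_diff_char2) simp_all

lemma linext_0 [simp]: "linext f 0 = 0"
  by (simp add: linext_def)

lemma linext_single [simp]: "linext f (Poly_Mapping.single l 1) = f l"
  by (simp add: linext_def)

lemma linext_sum: "linext f (\<Sum>i\<in>I. g i) = (\<Sum>i\<in>I. linext f (g i))"
  by (induction I rule: infinite_finite_induct) (auto simp: linext_add)

lemma lookup_keys_bit: "l \<in> Poly_Mapping.keys (c :: 'a \<Rightarrow>\<^sub>0 bit) \<Longrightarrow> Poly_Mapping.lookup c l = 1"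
  by (simp add: in_keys_iff)

lemma sum_words: "(\<Sum>l\<in>Poly_Mapping.keys c. Poly_Mapping.single l (1::bit)) = c"
  by (rule poly_mapping_eqI)
    (auto simp: lookup_sum lookup_single when_def in_keys_iff sum.delta' intro: bit_not_zero_iff[THEN iffD1])

lemma additive_gen2:
  fixes \<phi> :: "'a::char2 \<Rightarrow> 'b::char2"
  assumes "\<And>x y. \<phi> (x + y) = \<phi> x + \<phi> y" "addsub S" "\<And>x. x \<in> H \<Longrightarrow> \<phi> x \<in> S" "c \<in> gen2 H"
  shows "\<phi> c \<in> S"
  using assms(4)
proof (induction rule: gen2.induct)
  case gen2_0
  have "\<phi> 0 = 0" using assms(1)[of 0 0] by simp
  then show ?case using addsub_0[OF assms(2)] by simp
next
  case (gen2_step x y)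
  then show ?case using assms(1,3) addsub_add[OF assms(2)] by simp
qed

lemma words_eq_gen2: "words p A = gen2 {word l |l. length l = p \<and> set l \<subseteq> A}"
proof
  show "words p A \<subseteq> gen2 {word l |l. length l = p \<and> set l \<subseteq> A}"
  proof
    fix c assume "c \<in> words p A"
    then have "(\<Sum>l\<in>Poly_Mapping.keys c. Poly_Mapping.single l (1::bit))
        \<in> gen2 {word l |l. length l = p \<and> set l \<subseteq> A}"
      by (intro addsub_sum[OF addsub_gen2] gen2_incl) (auto simp: words_def)
    then show "c \<in> gen2 {word l |l. length l = p \<and> set l \<subseteq> A}" by (simp add: sum_words)
  qed
qed (rule gen2_minimal, auto)

lemma words_subset:
  assumes "addsub S" "\<And>l. length l = p \<Longrightarrow> set l \<subseteq> A \<Longrightarrow> word l \<in> S"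
  shows "words p A \<subseteq> S"
  unfolding words_eq_gen2 by (rule gen2_minimal) (use assms in auto)

lemma push_words_linext: "push_words h = linext (\<lambda>l. word (map h l))"
  by (auto simp: push_words_def linext_def lookup_keys_bit fun_eq_iff intro!: sum.cong)

lemma push_words_add: "push_words h (c + d) = push_words h c + push_words h d"
  by (simp add: push_words_linext linext_add)

lemma push_words_word [simp]: "push_words h (word l) = word (map h l)"
  by (simp add: push_words_linext)

lemma linext_eq_on:
  assumes "\<And>l. l \<in> Poly_Mapping.keys c \<Longrightarrow> f l = g l"
  shows "linext f c = linext g c"
  using assms by (simp add: linext_def)

lemma linext_push_words: "linext f (push_words h c) = linext (\<lambda>l. f (map h l)) c"
proof -
  have "linext f (linext g c) = linext (\<lambda>l. linext f (g l)) c" for g :: "'c list \<Rightarrow> 'b list \<Rightarrow>\<^sub>0 bit" and c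
    unfolding linext_def[of g] by (subst linext_sum) (simp add: linext_def)
  then show ?thesis by (simp add: push_words_linext)
qed

lemma push_words_comp: "push_words g (push_words h c) = push_words (\<lambda>u. g (h u)) c"
  by (subst (1 3) push_words_linext) (simp add: linext_push_words comp_def)

lemma push_words_id [simp]: "push_words id c = c"
  unfolding push_words_linext using sum_words[of c] by (simp add: linext_def)

text \<open>
  Surjectivity holds because letters can be lifted one by one; hence the words over a quotient of
  \<open>N\<^sub>2\<close> are images of words over \<open>N\<^sub>2\<close>.
\<close>

lemma push_words_image: "push_words h ` words p A = words p (h ` A)"
proof
  show "push_words h ` words p A \<subseteq> words p (h ` A)"
  proof
    fix d assume "d \<in> push_words h ` words p A"
    then obtain c where c: "c \<in> words p A" "d = push_words h c" by blast
    have "push_words h c \<in> words p (h ` A)"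
      by (rule additive_gen2[OF push_words_add addsub_words, where H = "{word l |l. length l = p \<and> set l \<subseteq> A}"])
        (use c words_eq_gen2[of p A] in \<open>fastforce+\<close>)
    then show "d \<in> words p (h ` A)" using c by simp
  qed
  show "words p (h ` A) \<subseteq> push_words h ` words p A"
  proof (rule words_subset)
    show "addsub (push_words h ` words p A)"
      unfolding addsub_def
    proof (intro conjI ballI)
      have "push_words h 0 = 0" by (simp add: push_words_linext)
      then show "0 \<in> push_words h ` words p A" using addsub_0[OF addsub_words] by (metis imageI)
      fix x y assume "x \<in> push_words h ` words p A" "y \<in> push_words h ` words p A"
      then show "x + y \<in> push_words h ` words p A"
        using addsub_add[OF addsub_words] by (auto simp: push_words_add[symmetric] intro!: imageI)
    qed
    fix l assume l: "length l = p" "set l \<subseteq> h ` A"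
    define k where "k = map (\<lambda>u. SOME v. v \<in> A \<and> h v = u) l"
    have s: "(SOME v. v \<in> A \<and> h v = u) \<in> A \<and> h (SOME v. v \<in> A \<and> h v = u) = u" if "u \<in> set l" for u
      by (rule someI_ex) (use that l in blast)
    have "map h k = l" using s by (auto simp: k_def o_def intro: map_idI)
    moreover have "word k \<in> words p A" using l s by (auto simp: k_def)
    ultimately show "word l \<in> push_words h ` words p A" by (metis push_words_word imageI)
  qed
qed

text \<open>
  The generators of the relations defining the exterior power, with signs removed.
\<close>

definition relators :: "nat \<Rightarrow> 'a monoid \<Rightarrow> ('a list \<Rightarrow>\<^sub>0 bit) set" where
  "relators p V =
     {word (xs @ (x \<otimes>\<^bsub>V\<^esub> y) # ys) + word (xs @ x # ys) + word (xs @ y # ys) |xs x y ys.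
         length (xs @ x # ys) = p \<and> set xs \<union> {x, y} \<union> set ys \<subseteq> carrier V} \<union>
      {word l |l. length l = p \<and> set l \<subseteq> carrier V \<and> \<not> distinct l}"

lemma relators_subset:
  assumes "monoid V"
  shows "relators p V \<subseteq> words p (carrier V)"
  using monoid.m_closed[OF assms] by (auto simp: relators_def intro!: addsub_add[OF addsub_words])

lemma exterior_relations_gen2:
  assumes "monoid V"
  shows "exterior_relations p V = gen2 (relators p V)"
  unfolding exterior_relations_def free_space_words
  using generate_additive[OF addsub_words relators_subset[OF assms]] by (simp add: relators_def)

lemma relators_multilinear:
  assumes "length (xs @ x # ys) = p" "set xs \<subseteq> carrier V" "x \<in> carrier V" "y \<in> carrier V" "set ys \<subseteq> carrier V"
  shows "word (xs @ (x \<otimes>\<^bsub>V\<^esub> y) # ys) + word (xs @ x # ys) + word (xs @ y # ys) \<in> relators p V"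
  unfolding relators_def using assms by (intro UnI1 CollectI exI[of _ xs] exI[of _ x] exI[of _ y] exI[of _ ys]) auto

lemma relators_alternating:
  "length l = p \<Longrightarrow> set l \<subseteq> carrier V \<Longrightarrow> \<not> distinct l \<Longrightarrow> word l \<in> relators p V"
  unfolding relators_def by blast

lemma relators_cases:
  assumes "c \<in> relators p V"
  obtains xs x y ys where "c = word (xs @ (x \<otimes>\<^bsub>V\<^esub> y) # ys) + word (xs @ x # ys) + word (xs @ y # ys)"
    "length (xs @ x # ys) = p" "set xs \<subseteq> carrier V" "x \<in> carrier V" "y \<in> carrier V" "set ys \<subseteq> carrier V"
  | l where "c = word l" "length l = p" "set l \<subseteq> carrier V" "\<not> distinct l"
  using assms unfolding relators_def by fastforce

lemma presents_exterior_power: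
  assumes "monoid V"
  shows "presents (\<lambda>c. exterior_relations p V #>\<^bsub>free_space p V\<^esub> c) (words p (carrier V))
     (exterior_relations p V) (exterior_power p V)"
  unfolding exterior_power_def free_space_words
    exterior_relations_gen2[OF assms]
  by (rule presents_additive_Mod[OF addsub_words addsub_gen2
        gen2_minimal[OF addsub_words relators_subset[OF assms]]])

lemma push_words_relations:
  assumes "monoid V" "monoid W" "\<And>x. x \<in> carrier V \<Longrightarrow> h x \<in> carrier W"
    "\<And>x y. x \<in> carrier V \<Longrightarrow> y \<in> carrier V \<Longrightarrow> h (x \<otimes>\<^bsub>V\<^esub> y) = h x \<otimes>\<^bsub>W\<^esub> h y"
    "c \<in> exterior_relations p V"
  shows "push_words h c \<in> exterior_relations p W"
proof -
  have c: "c \<in> gen2 (relators p V)" using assms(5) by (simp add: exterior_relations_gen2[OF assms(1)])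
  show ?thesis
    unfolding exterior_relations_gen2[OF assms(2)]
  proof (rule additive_gen2[OF push_words_add addsub_gen2 _ c])
    fix x assume "x \<in> relators p V"
    then show "push_words h x \<in> gen2 (relators p W)"
    proof (cases rule: relators_cases)
      case (1 xs x y ys)
      have "word (map h xs @ (h x \<otimes>\<^bsub>W\<^esub> h y) # map h ys) + word (map h xs @ h x # map h ys)
          + word (map h xs @ h y # map h ys) \<in> relators p W"
        by (rule relators_multilinear) (use 1 assms(3) in auto)
      then show ?thesis using 1 assms(4) by (auto simp: push_words_add intro: gen2_incl)
    next
      case (2 l)
      have "word (map h l) \<in> relators p W"
        by (rule relators_alternating) (use 2 assms(3) in \<open>auto simp: distinct_map\<close>)
      then show ?thesis using 2 by (auto intro: gen2_incl)
    qed
  qed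
qed

lemma presents_comp:
  assumes "presents g A S G" "addsub B" "\<And>x y. x \<in> B \<Longrightarrow> y \<in> B \<Longrightarrow> \<phi> (x + y) = \<phi> x + \<phi> y" "\<phi> ` B = A"
  shows "presents (\<lambda>x. g (\<phi> x)) B {x \<in> B. \<phi> x \<in> S} G"
  unfolding presents_def
proof (intro conjI ballI)
  show "(\<lambda>x. g (\<phi> x)) ` B = carrier G"
    using presentsD(4)[OF assms(1)] unfolding assms(4)[symmetric] by (simp add: image_image)
qed (use presentsD[OF assms(1)] assms in auto)

subsection \<open>Determinants\<close>

definition bdot :: "bit^'d \<Rightarrow> bit^'d \<Rightarrow> bit" where
  "bdot u v = (\<Sum>k\<in>UNIV. u $ k * v $ k)"

lemma bdot_add_right: "bdot u (v + w) = bdot u v + bdot u w"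
  and bdot_add_left: "bdot (v + w) u = bdot v u + bdot w u"
  by (simp_all add: bdot_def algebra_simps sum.distrib)

lemma bdot_commute: "bdot u v = bdot v u"
  by (simp add: bdot_def mult.commute)

lemma bdot_0 [simp]: "bdot u 0 = 0" "bdot 0 u = 0"
  by (simp_all add: bdot_def)

lemma bdot_sum_right: "bdot u (\<Sum>i\<in>I. f i) = (\<Sum>i\<in>I. bdot u (f i))"
  by (induction I rule: infinite_finite_induct) (auto simp: bdot_add_right)

text \<open>
  The determinant of the matrix of values of \<open>p\<close> functionals on \<open>p\<close> letters. In characteristic two all
  signs are 1, so that it coincides with the permanent.
\<close>

definition gdet :: "nat \<Rightarrow> (nat \<Rightarrow> 'a \<Rightarrow> bit) \<Rightarrow> 'a list \<Rightarrow> bit" where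
  "gdet p \<kappa> l = (\<Sum>\<pi> | \<pi> permutes {..<p}. \<Prod>i<p. \<kappa> i (l ! \<pi> i))"

lemma of_int_sign_bit: "(of_int (sign \<pi>) :: bit) = 1"
  by (simp add: sign_def)

lemma gram_det_gdet: "gram_det p l m = gdet p (\<lambda>i. bdot (l ! i)) m"
  by (simp add: gram_det_def gdet_def of_int_sign_bit bdot_def)

lemma gram_det_commute: "gram_det p l m = gram_det p m l"
proof -
  have "gram_det p l m = (\<Sum>\<pi> | \<pi> permutes {..<p}. \<Prod>i<p. bdot (l ! i) (m ! \<pi> i))"
    by (simp add: gram_det_gdet gdet_def)
  also have "\<dots> = (\<Sum>\<pi> | \<pi> permutes {..<p}. \<Prod>i<p. bdot (l ! i) (m ! (inv_into UNIV \<pi>) i))"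
    by (rule sum.reindex_bij_witness[of _ "inv_into UNIV" "inv_into UNIV"]) (auto simp: permutes_inv permutes_inv_inv)
  also have "\<dots> = (\<Sum>\<pi> | \<pi> permutes {..<p}. \<Prod>i<p. bdot (m ! i) (l ! \<pi> i))"
  proof (rule sum.cong[OF refl])
    fix \<pi> assume "\<pi> \<in> {\<pi>. \<pi> permutes {..<p}}"
    then have \<pi>: "\<pi> permutes {..<p}" by simp
    have "(\<Prod>i<p. bdot (l ! i) (m ! (inv_into UNIV \<pi>) i)) = (\<Prod>i<p. bdot (l ! \<pi> i) (m ! inv_into UNIV \<pi> (\<pi> i)))"
      using prod.permute[OF \<pi>, of "\<lambda>i. bdot (l ! i) (m ! (inv_into UNIV \<pi>) i)"] by (simp add: o_def)
    also have "\<dots> = (\<Prod>i<p. bdot (m ! i) (l ! \<pi> i))"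
      using permutes_inverses(2)[OF \<pi>] by (simp add: bdot_commute)
    finally show "(\<Prod>i<p. bdot (l ! i) (m ! (inv_into UNIV \<pi>) i)) = (\<Prod>i<p. bdot (m ! i) (l ! \<pi> i))" .
  qed
  also have "\<dots> = gram_det p m l" by (simp add: gram_det_gdet gdet_def)
  finally show ?thesis .
qed

text \<open>
  The orbits of a fixed point free involution are pairs of equal summands. This is how
  cancellation works in characteristic two, without signs.
\<close>

lemma sum_involution_char2:
  fixes f :: "'a \<Rightarrow> 'b::char2"
  assumes "finite S" "\<And>x. x \<in> S \<Longrightarrow> t x \<in> S" "\<And>x. x \<in> S \<Longrightarrow> t (t x) = x"
    "\<And>x. x \<in> S \<Longrightarrow> t x \<noteq> x" "\<And>x. x \<in> S \<Longrightarrow> f (t x) = f x"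
  shows "sum f S = 0"
  using assms
proof (induction "card S" arbitrary: S rule: less_induct)
  case less
  show ?case
  proof (cases "S = {}")
    case False
    then obtain x where x: "x \<in> S" by blast
    let ?S = "S - {x, t x}"
    have "sum f ?S = 0"
    proof (rule less.hyps)
      show "card ?S < card S" using less.prems(1) x by (intro psubset_card_mono) auto
      show "t y \<in> ?S" if "y \<in> ?S" for y
        using that less.prems(2,3) x by (metis Diff_iff insert_iff empty_iff)
    qed (use less.prems in auto)
    moreover have "sum f S = f x + sum f (S - {x})" using less.prems(1) x by (rule sum.remove)
    moreover have "t x \<in> S - {x}" using less.prems(2,4) x by simp
    then have "sum f (S - {x}) = f (t x) + sum f (S - {x} - {t x})"
      using less.prems(1) by (intro sum.remove) auto
    moreover have "S - {x} - {t x} = ?S" by auto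
    ultimately show ?thesis using less.prems(5) x by simp
  qed simp
qed

lemma gdet_additive:
  assumes "m < p" "\<And>i. i < p \<Longrightarrow> \<kappa> i (l ! m) = \<kappa> i (l' ! m) + \<kappa> i (l'' ! m)"
    "\<And>j. j < p \<Longrightarrow> j \<noteq> m \<Longrightarrow> l ! j = l' ! j \<and> l ! j = l'' ! j"
  shows "gdet p \<kappa> l = gdet p \<kappa> l' + gdet p \<kappa> l''"
  unfolding gdet_def sum.distrib[symmetric]
proof (rule sum.cong[OF refl])
  fix \<pi> assume "\<pi> \<in> {\<pi>. \<pi> permutes {..<p}}"
  then have \<pi>: "\<pi> permutes {..<p}" by simp
  define k where "k = inv_into UNIV \<pi> m"
  have k: "k < p" "\<pi> k = m"
    using permutes_inverses(1)[OF \<pi>] permutes_in_image[OF permutes_inv[OF \<pi>], of m] assms(1) by (auto simp: k_def)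
  have other: "\<pi> i < p \<and> \<pi> i \<noteq> m" if "i < p" "i \<noteq> k" for i
    using that k permutes_in_image[OF \<pi>, of i] permutes_inj[OF \<pi>] by (auto dest: injD)
  have split: "(\<Prod>i<p. \<kappa> i (a ! \<pi> i)) = \<kappa> k (a ! m) * (\<Prod>i\<in>{..<p} - {k}. \<kappa> i (a ! \<pi> i))" for a
    using prod.remove[of "{..<p}" k "\<lambda>i. \<kappa> i (a ! \<pi> i)"] k by simp
  have "(\<Prod>i\<in>{..<p} - {k}. \<kappa> i (l ! \<pi> i)) = (\<Prod>i\<in>{..<p} - {k}. \<kappa> i (l' ! \<pi> i))"
    "(\<Prod>i\<in>{..<p} - {k}. \<kappa> i (l ! \<pi> i)) = (\<Prod>i\<in>{..<p} - {k}. \<kappa> i (l'' ! \<pi> i))"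
    using other assms(3) by (auto intro!: prod.cong simp del: bit_not_zero_iff) metis+
  then show "(\<Prod>i<p. \<kappa> i (l ! \<pi> i)) = (\<Prod>i<p. \<kappa> i (l' ! \<pi> i)) + (\<Prod>i<p. \<kappa> i (l'' ! \<pi> i))"
    unfolding split assms(2)[OF k(1)] by (simp add: distrib_right)
qed

lemma transpose_comp_permutes:
  assumes "a < p" "b < p" "\<pi> permutes {..<p::nat}"
  shows "Transposition.transpose a b \<circ> \<pi> permutes {..<p}" "\<pi> \<circ> Transposition.transpose a b permutes {..<p}"
  using assms permutes_compose permutes_swap_id[of a "{..<p}" b] by auto

text \<open>
  Composing a permutation with the transposition of the two positions of the letter pairs off
  equal terms.
\<close>

lemma gdet_repeated_letter:
  assumes "a < p" "b < p" "a \<noteq> b" "l ! a = l ! b"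
  shows "gdet p \<kappa> l = 0"
  unfolding gdet_def
proof (rule sum_involution_char2[where t = "\<lambda>\<pi>. Transposition.transpose a b \<circ> \<pi>"])
  show "finite {\<pi>. \<pi> permutes {..<p}}" by (simp add: finite_permutations)
  fix \<pi> assume "\<pi> \<in> {\<pi>. \<pi> permutes {..<p}}"
  then have \<pi>: "\<pi> permutes {..<p}" by simp
  show "Transposition.transpose a b \<circ> \<pi> \<in> {\<pi>. \<pi> permutes {..<p}}" using transpose_comp_permutes[OF assms(1,2) \<pi>] by simp
  show "Transposition.transpose a b \<circ> (Transposition.transpose a b \<circ> \<pi>) = \<pi>" by (simp add: fun_eq_iff)
  show "Transposition.transpose a b \<circ> \<pi> \<noteq> \<pi>"
  proof
    assume "Transposition.transpose a b \<circ> \<pi> = \<pi>"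
    then have "Transposition.transpose a b (\<pi> (inv_into UNIV \<pi> a)) = \<pi> (inv_into UNIV \<pi> a)" by (metis comp_apply)
    then show False using assms(3) permutes_inverses(1)[OF \<pi>] by simp
  qed
  show "(\<Prod>i<p. \<kappa> i (l ! (Transposition.transpose a b \<circ> \<pi>) i)) = (\<Prod>i<p. \<kappa> i (l ! \<pi> i))"
    using assms(4) by (intro prod.cong) (auto simp: Transposition.transpose_def)
qed

text \<open>
  Two rows of the matrix agree, as the functionals agree on the letters of the word. For the functionals
  \<open>\<xi>\<^sub>a\<close> and \<open>\<xi>\<^sub>b\<close> this happens when all letters are in the kernel of \<open>\<xi>\<^sub>a + \<xi>\<^sub>b\<close>.
\<close>

lemma gdet_repeated_functional:
  assumes "a < p" "b < p" "a \<noteq> b" "length l = p" "\<And>u. u \<in> set l \<Longrightarrow> \<kappa> a u = \<kappa> b u"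
  shows "gdet p \<kappa> l = 0"
  unfolding gdet_def
proof (rule sum_involution_char2[where t = "\<lambda>\<pi>. \<pi> \<circ> Transposition.transpose a b"])
  show "finite {\<pi>. \<pi> permutes {..<p}}" by (simp add: finite_permutations)
  fix \<pi> assume "\<pi> \<in> {\<pi>. \<pi> permutes {..<p}}"
  then have \<pi>: "\<pi> permutes {..<p}" by simp
  show "\<pi> \<circ> Transposition.transpose a b \<in> {\<pi>. \<pi> permutes {..<p}}" using transpose_comp_permutes[OF assms(1,2) \<pi>] by simp
  show "(\<pi> \<circ> Transposition.transpose a b) \<circ> Transposition.transpose a b = \<pi>" by (simp add: fun_eq_iff)
  show "\<pi> \<circ> Transposition.transpose a b \<noteq> \<pi>"
  proof
    assume "\<pi> \<circ> Transposition.transpose a b = \<pi>"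
    then have "\<pi> (Transposition.transpose a b a) = \<pi> a" by (metis comp_apply)
    then show False using assms(3) permutes_inj[OF \<pi>] by (auto dest: injD)
  qed
  have tr: "Transposition.transpose a b permutes {..<p}" using assms(1,2) by (simp add: permutes_swap_id)
  have "(\<Prod>i<p. \<kappa> i (l ! \<pi> i)) = (\<Prod>i<p. \<kappa> (Transposition.transpose a b i) (l ! \<pi> (Transposition.transpose a b i)))"
    using prod.permute[OF tr, of "\<lambda>i. \<kappa> i (l ! \<pi> i)"] by (simp add: o_def)
  also have "\<dots> = (\<Prod>i<p. \<kappa> i (l ! \<pi> (Transposition.transpose a b i)))"
  proof (rule prod.cong[OF refl])
    fix i assume "i \<in> {..<p}"
    then have "l ! \<pi> (Transposition.transpose a b i) \<in> set l"
      using permutes_in_image[OF \<pi>] permutes_in_image[OF tr] assms(4) by (auto intro!: nth_mem)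
    then show "\<kappa> (Transposition.transpose a b i) (l ! \<pi> (Transposition.transpose a b i)) = \<kappa> i (l ! \<pi> (Transposition.transpose a b i))"
      using assms(5)[of "l ! \<pi> (Transposition.transpose a b i)"] by (auto simp: Transposition.transpose_def)
  qed
  finally show "(\<Prod>i<p. \<kappa> i (l ! (\<pi> \<circ> Transposition.transpose a b) i)) = (\<Prod>i<p. \<kappa> i (l ! \<pi> i))" by simp
qed

lemma gdet_zero_functional:
  assumes "a < p" "length l = p" "\<And>u. u \<in> set l \<Longrightarrow> \<kappa> a u = 0"
  shows "gdet p \<kappa> l = 0"
  unfolding gdet_def
proof (rule sum.neutral, intro ballI)
  fix \<pi> assume "\<pi> \<in> {\<pi>. \<pi> permutes {..<p}}"
  then have "\<pi> a < p" using permutes_in_image[of \<pi> "{..<p}" a] assms(1) by auto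
  then have "\<kappa> a (l ! \<pi> a) = 0" using assms(2,3) by simp
  then show "(\<Prod>i<p. \<kappa> i (l ! \<pi> i)) = 0" using assms(1) by (intro prod_zero bexI[of _ a]) auto
qed

lemma gdet_relations:
  assumes "monoid V" "\<And>i x y. i < p \<Longrightarrow> x \<in> carrier V \<Longrightarrow> y \<in> carrier V \<Longrightarrow> \<kappa> i (x \<otimes>\<^bsub>V\<^esub> y) = \<kappa> i x + \<kappa> i y"
    "c \<in> exterior_relations p V"
  shows "linext (gdet p \<kappa>) c = 0"
proof -
  have c: "c \<in> gen2 (relators p V)" using assms(3) by (simp add: exterior_relations_gen2[OF assms(1)])
  have "linext (gdet p \<kappa>) c \<in> {0}"
  proof (rule additive_gen2[OF linext_add _ _ c])
    show "addsub {0 :: bit}" by (simp add: addsub_def)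
    fix x assume "x \<in> relators p V"
    then show "linext (gdet p \<kappa>) x \<in> {0}"
    proof (cases rule: relators_cases)
      case (1 xs x y ys)
      have "gdet p \<kappa> (xs @ (x \<otimes>\<^bsub>V\<^esub> y) # ys) = gdet p \<kappa> (xs @ x # ys) + gdet p \<kappa> (xs @ y # ys)"
        by (rule gdet_additive[where m = "length xs"]) (use 1 assms(2) in \<open>auto simp: nth_append nth_Cons'\<close>)
      then show ?thesis using 1 by (simp add: linext_add)
    next
      case (2 l)
      then obtain a b where "a < length l" "b < length l" "a \<noteq> b" "l ! a = l ! b"
        by (auto simp: distinct_conv_nth)
      then show ?thesis using 2 gdet_repeated_letter[of a p b l \<kappa>] by simp
    qed
  qed
  then show ?thesis by simp
qed

subsection \<open>Words modulo the exterior relations\<close>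

lemma carrier_additive [simp]: "carrier (additive_group A) = A"
  and mult_additive [simp]: "x \<otimes>\<^bsub>additive_group A\<^esub> y = x + y"
  and one_additive [simp]: "\<one>\<^bsub>additive_group A\<^esub> = 0"
  by (simp_all add: additive_group_def)

lemma monoid_additive: "addsub A \<Longrightarrow> monoid (additive_group A)"
  using presentsD(3)[OF presents_additive_group] group.is_monoid by blast

lemma F2_multilinear:
  fixes x y :: "bit^'d"
  assumes "relators p F2_space \<subseteq> R" "length (xs @ x # ys) = p"
  shows "word (xs @ (x + y) # ys) + word (xs @ x # ys) + word (xs @ y # ys) \<in> R"
  using relators_multilinear[of xs x ys p F2_space y] assms by auto

lemma F2_alternating:
  fixes l :: "(bit^'d) list"
  assumes "relators p F2_space \<subseteq> R" "length l = p" "\<not> distinct l"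
  shows "word l \<in> R"
  using relators_alternating[of l p F2_space] assms by auto

text \<open>
  Bilinear expansion of \<open>(a + b) \<and> (a + b) = 0\<close>, together with \<open>a \<and> a = b \<and> b = 0\<close>. Here and below \<open>R\<close>
  is any subgroup containing the relators, so that the same computation serves modulo larger
  subgroups.
\<close>

lemma swap_adjacent_letters:
  fixes a b :: "bit^'d"
  assumes R: "addsub R" "relators p F2_space \<subseteq> R" and len: "length (xs @ a # b # ys) = p"
  shows "word (xs @ a # b # ys) + word (xs @ b # a # ys) \<in> R"
proof -
  let ?w = "\<lambda>u v. word (xs @ u # v # ys)"
  have 1: "?w (a + b) (a + b) + ?w a (a + b) + ?w b (a + b) \<in> R"
    by (rule F2_multilinear[OF R(2)]) (use len in auto)
  have 2: "?w u (a + b) + ?w u a + ?w u b \<in> R" for u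
    using F2_multilinear[OF R(2), of "xs @ [u]" a ys b] len by auto
  have 3: "?w u u \<in> R" for u
    by (rule F2_alternating[OF R(2)]) (use len in auto)
  have "?w a b + ?w b a = (?w (a + b) (a + b) + ?w a (a + b) + ?w b (a + b)) + (?w (a + b) (a + b)
      + ((?w a (a + b) + ?w a a + ?w a b) + ((?w b (a + b) + ?w b a + ?w b b) + (?w a a + ?w b b))))"
    by (simp add: ac_simps)
  also have "\<dots> \<in> R"
  proof -
    note add = addsub_add[OF R(1)]
    show ?thesis by (rule add[OF 1 add[OF 3 add[OF 2 add[OF 2 add[OF 3 3]]]]])
  qed
  finally show ?thesis .
qed

lemma move_letter_to_front:
  fixes y :: "bit^'d"
  assumes R: "addsub R" "relators p F2_space \<subseteq> R" and len: "length (pre @ as @ y # bs) = p"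
  shows "word (pre @ as @ y # bs) + word (pre @ y # as @ bs) \<in> R"
  using len
proof (induction as arbitrary: pre)
  case Nil
  then show ?case using addsub_0[OF R(1)] by simp
next
  case (Cons a as)
  have "word ((pre @ [a]) @ as @ y # bs) + word ((pre @ [a]) @ y # as @ bs) \<in> R"
    by (rule Cons.IH) (use Cons.prems in simp)
  moreover have "word (pre @ a # y # as @ bs) + word (pre @ y # a # as @ bs) \<in> R"
    by (rule swap_adjacent_letters[OF R]) (use Cons.prems in simp)
  ultimately have "(word ((pre @ [a]) @ as @ y # bs) + word ((pre @ [a]) @ y # as @ bs))
      + (word (pre @ a # y # as @ bs) + word (pre @ y # a # as @ bs)) \<in> R"
    by (rule addsub_add[OF R(1)])
  then show ?case by (simp add: ac_simps)
qed

lemma permute_letters: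
  fixes xs :: "(bit^'d) list"
  assumes R: "addsub R" "relators p F2_space \<subseteq> R" and "mset xs = mset ys" "length (pre @ xs) = p"
  shows "word (pre @ xs) + word (pre @ ys) \<in> R"
  using assms(3,4)
proof (induction ys arbitrary: xs pre)
  case Nil
  then show ?case using addsub_0[OF R(1)] by simp
next
  case (Cons y ys)
  then have "y \<in> set xs" by (metis list.set_intros(1) mset_eq_setD)
  then obtain as bs where xs: "xs = as @ y # bs" by (meson split_list)
  have "word (pre @ as @ y # bs) + word (pre @ y # as @ bs) \<in> R"
    by (rule move_letter_to_front[OF R]) (use Cons.prems xs in simp)
  moreover have "word ((pre @ [y]) @ (as @ bs)) + word ((pre @ [y]) @ ys) \<in> R"
    by (rule Cons.IH) (use Cons.prems xs in auto)
  ultimately have "(word (pre @ as @ y # bs) + word (pre @ y # as @ bs))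
      + (word ((pre @ [y]) @ (as @ bs)) + word ((pre @ [y]) @ ys)) \<in> R"
    by (rule addsub_add[OF R(1)])
  then show ?case by (simp add: xs ac_simps)
qed

definition enum :: "'a set \<Rightarrow> 'a list" where
  "enum J = (SOME js. distinct js \<and> set js = J)"

lemma enum:
  assumes "finite J"
  shows "distinct (enum J)" "set (enum J) = J" "length (enum J) = card J"
proof -
  have "distinct (enum J) \<and> set (enum J) = J"
    unfolding enum_def by (rule someI_ex) (use finite_distinct_list[OF assms] in blast)
  then show "distinct (enum J)" "set (enum J) = J" "length (enum J) = card J"
    using distinct_card by force+
qed

lemma expand_letter:
  fixes x :: "'i \<Rightarrow> bit^'d"
  assumes R: "addsub R" "relators p F2_space \<subseteq> R" and "finite S" "length pre + length post + 1 = p"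
    and "\<And>i. i \<in> S \<Longrightarrow> word (pre @ x i # post) \<in> R"
  shows "word (pre @ (\<Sum>i\<in>S. x i) # post) \<in> R"
  using assms(3,5)
proof (induction S rule: finite_induct)
  case empty
  have "word (pre @ (0 + 0) # post) + word (pre @ 0 # post) + word (pre @ 0 # post) \<in> R"
    by (rule F2_multilinear[OF R(2)]) (use assms(4) in simp)
  then show ?case by simp
next
  case (insert i S)
  let ?s = "\<Sum>i\<in>S. x i"
  have 1: "word (pre @ (x i + ?s) # post) + word (pre @ x i # post) + word (pre @ ?s # post) \<in> R"
    by (rule F2_multilinear[OF R(2)]) (use assms(4) in simp)
  have "word (pre @ x i # post) \<in> R" "word (pre @ ?s # post) \<in> R"
    using insert by auto
  from addsub_add[OF R(1) 1 addsub_add[OF R(1) this]] show ?case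
    using insert(1,2) by (simp add: ac_simps)
qed

text \<open>
  Words are expanded letter by letter into words of basis vectors; these vanish if a letter is
  repeated and can otherwise be sorted into the chosen enumeration of their set of indices.
\<close>

lemma words_span:
  fixes x :: "'i \<Rightarrow> bit^'d"
  assumes R: "addsub R" "relators p F2_space \<subseteq> R" and I: "finite I"
    and mon: "\<And>J. J \<subseteq> I \<Longrightarrow> card J = p \<Longrightarrow> word (map x (enum J)) \<in> R"
  shows "words p {\<Sum>i\<in>S. x i |S. S \<subseteq> I} \<subseteq> R"
proof (rule words_subset[OF R(1)])
  have basis: "word (map x js) \<in> R" if "length js = p" "set js \<subseteq> I" for js
  proof (cases "distinct js")
    case False
    then show ?thesis by (intro F2_alternating[OF R(2)]) (use that in \<open>auto simp: distinct_map\<close>)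
  next
    case True
    have fin: "finite (set js)" by simp
    have "mset js = mset (enum (set js))"
      using True enum[OF fin] by (intro set_eq_iff_mset_eq_distinct[THEN iffD1]) auto
    then have "mset (map x js) = mset (map x (enum (set js)))" by simp
    then have "word ([] @ map x js) + word ([] @ map x (enum (set js))) \<in> R"
      by (rule permute_letters[OF R]) (use that in simp)
    moreover have "word (map x (enum (set js))) \<in> R"
      using mon[of "set js"] that True distinct_card[of js] by simp
    ultimately show ?thesis using addsub_cancel[OF R(1)] by (metis add.commute append_Nil)
  qed
  have main: "word (map x js @ l) \<in> R"
    if "length js + length l = p" "set js \<subseteq> I" "set l \<subseteq> {\<Sum>i\<in>S. x i |S. S \<subseteq> I}" for js l
    using that
  proof (induction l arbitrary: js)
    case Nil
    then show ?case using basis by simp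
  next
    case (Cons u l)
    then obtain S where S: "u = (\<Sum>i\<in>S. x i)" "S \<subseteq> I" by auto
    show ?case
      unfolding S(1)
    proof (rule expand_letter[OF R])
      show "finite S" using S(2) I finite_subset by blast
      fix i assume "i \<in> S"
      have "word (map x (js @ [i]) @ l) \<in> R"
        by (rule Cons.IH) (use Cons.prems \<open>i \<in> S\<close> S(2) in auto)
      then show "word (map x js @ x i # l) \<in> R" by simp
    qed (use Cons.prems in simp)
  qed
  show "word l \<in> R" if "length l = p" "set l \<subseteq> {\<Sum>i\<in>S. x i |S. S \<subseteq> I}" for l
    using main[of "[]" l] that by simp
qed

subsection \<open>Coordinates of exterior powers and of their quotients\<close>

text \<open>
  The second clause expands \<open>u\<close> in the basis \<open>x\<close>: the coordinate \<open>\<xi> i\<close> of \<open>u\<close> is 0 or 1.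
\<close>

definition dual_bases :: "('d \<Rightarrow> bit^'d) \<Rightarrow> ('d \<Rightarrow> bit^'d) \<Rightarrow> bool" where
  "dual_bases x \<xi> \<longleftrightarrow> (\<forall>i j. bdot (\<xi> i) (x j) = (if i = j then 1 else 0)) \<and>
     (\<forall>u. u = (\<Sum>i | bdot (\<xi> i) u = 1. x i))"

text \<open>
  The coefficient of the monomial \<open>x\<^sub>J\<close>, as the pairing with the monomial \<open>\<xi>\<^sub>J\<close> of the dual basis.
\<close>

definition coord :: "nat \<Rightarrow> ('d \<Rightarrow> bit^'d) \<Rightarrow> 'd set \<Rightarrow> ((bit^'d) list \<Rightarrow>\<^sub>0 bit) \<Rightarrow> bit" where
  "coord p \<xi> J = linext (gram_det p (map \<xi> (enum J)))"

definition monom_word :: "('d \<Rightarrow> bit^'d) \<Rightarrow> 'd set \<Rightarrow> (bit^'d) list \<Rightarrow>\<^sub>0 bit" where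
  "monom_word x J = word (map x (enum J))"

lemma coord_add: "coord p \<xi> J (c + d) = coord p \<xi> J c + coord p \<xi> J d"
  by (simp add: coord_def linext_add)

lemma coord_sum: "coord p \<xi> J (\<Sum>i\<in>I. f i) = (\<Sum>i\<in>I. coord p \<xi> J (f i))"
  by (simp add: coord_def linext_sum)

lemma coord_0 [simp]: "coord p \<xi> J 0 = 0"
  by (simp add: coord_def)

lemma gram_det_dual_lists:
  assumes "\<And>i j. bdot (\<xi> i) (x j) = (if i = j then 1 else 0)"
    "distinct js" "length js = p" "distinct js'" "length js' = p" "set js \<noteq> set js' \<or> js = js'"
  shows "gram_det p (map \<xi> js) (map x js') = (if set js = set js' then 1 else 0)"
proof (cases "js = js'")
  case False
  then obtain j where j: "j \<in> set js" "j \<notin> set js'"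
    using assms by (metis card_subset_eq distinct_card finite_set subsetI)
  then obtain a where a: "a < p" "js ! a = j" using assms(3) by (auto simp: in_set_conv_nth)
  have "gdet p (\<lambda>i. bdot (map \<xi> js ! i)) (map x js') = 0"
  proof (rule gdet_zero_functional[OF a(1)])
    fix u assume "u \<in> set (map x js')"
    then obtain i where "i \<in> set js'" "u = x i" by auto
    moreover have "map \<xi> js ! a = \<xi> j" using a assms(3) by simp
    ultimately show "bdot (map \<xi> js ! a) u = 0" using j(2) assms(1)[of j i] by auto
  qed (use assms(5) in simp)
  then show ?thesis using False assms(6) by (simp add: gram_det_gdet)
next
  case True
  have "gram_det p (map \<xi> js) (map x js) = (\<Sum>\<pi> | \<pi> permutes {..<p}. \<Prod>i<p. bdot (map \<xi> js ! i) (map x js ! \<pi> i))"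
    by (simp add: gram_det_gdet gdet_def)
  also have "\<dots> = (\<Sum>\<pi> | \<pi> permutes {..<p}. if \<pi> = id then 1 else 0)"
  proof (rule sum.cong[OF refl])
    fix \<pi> assume "\<pi> \<in> {\<pi>. \<pi> permutes {..<p}}"
    then have \<pi>: "\<pi> permutes {..<p}" by simp
    have eq: "bdot (map \<xi> js ! i) (map x js ! \<pi> i) = (if \<pi> i = i then 1 else 0)" if "i < p" for i
      using that assms(1,2,3) permutes_in_image[OF \<pi>, of i] by (auto simp: nth_eq_iff_index_eq)
    show "(\<Prod>i<p. bdot (map \<xi> js ! i) (map x js ! \<pi> i)) = (if \<pi> = id then 1 else 0)"
    proof (cases "\<pi> = id")
      case False
      then obtain i where "i < p" "\<pi> i \<noteq> i" using \<pi> by (metis permutes_def eq_id_iff lessThan_iff)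
      then show ?thesis using False eq by (auto intro!: prod_zero)
    next
      case True
      then have "bdot (map \<xi> js ! i) (map x js ! \<pi> i) = 1" if "i < p" for i using eq[OF that] by simp
      then show ?thesis using True by (simp add: prod.neutral)
    qed
  qed
  also have "\<dots> = 1" by (simp add: finite_permutations permutes_id sum.delta)
  finally show ?thesis using True by simp
qed

lemma coord_monom:
  assumes "dual_bases x \<xi>" "card J = p" "card J' = p"
  shows "coord p \<xi> J (monom_word x J') = (if J = J' then 1 else 0)"
proof -
  have fin: "finite J" "finite J'" by simp_all
  have "gram_det p (map \<xi> (enum J)) (map x (enum J')) = (if set (enum J) = set (enum J') then 1 else 0)"
    by (rule gram_det_dual_lists) (use assms enum[OF fin(1)] enum[OF fin(2)] in \<open>auto simp: dual_bases_def\<close>)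
  then show ?thesis using enum(2)[OF fin(1)] enum(2)[OF fin(2)] by (simp add: coord_def monom_word_def)
qed

lemma dual_bases_span: "dual_bases x \<xi> \<Longrightarrow> {\<Sum>i\<in>S. x i |S. S \<subseteq> UNIV} = UNIV"
  unfolding dual_bases_def by blast

lemma monom_word_in_words [simp]: "card J = p \<Longrightarrow> monom_word x J \<in> words p UNIV"
  using enum[of J] by (simp add: monom_word_def)

lemma exists_coords:
  assumes "dual_bases x \<xi>"
  shows "\<exists>c\<in>words p UNIV. \<forall>J. card J = p \<longrightarrow> coord p \<xi> J c = g J"
proof (intro bexI allI impI)
  let ?G = "{J. card J = p \<and> g J = 1}"
  show "(\<Sum>J\<in>?G. monom_word x J) \<in> words p UNIV"
    by (rule addsub_sum) auto
  fix J :: "'a set" assume J: "card J = p"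
  have "coord p \<xi> J (\<Sum>J\<in>?G. monom_word x J) = (\<Sum>J'\<in>?G. if J = J' then 1 else 0)"
    unfolding coord_sum by (rule sum.cong) (use coord_monom[OF assms J] in auto)
  also have "\<dots> = g J" using J by (simp add: sum.delta)
  finally show "coord p \<xi> J (\<Sum>J\<in>?G. monom_word x J) = g J" .
qed

text \<open>
  The kernel of the surjection from words over \<open>N\<^sub>2\<close> to the exterior power of \<open>N\<^sub>2 / S\<close>.
\<close>

definition quotient_kernel :: "nat \<Rightarrow> (bit^'d) set \<Rightarrow> ((bit^'d) list \<Rightarrow>\<^sub>0 bit) set" where
  "quotient_kernel p S = {c \<in> words p UNIV.
     push_words (\<lambda>u. S #>\<^bsub>F2_space\<^esub> u) c \<in> exterior_relations p (F2_space Mod S)}"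

lemma presents_F2_Mod:
  "addsub S \<Longrightarrow> presents (\<lambda>u. S #>\<^bsub>F2_space\<^esub> u) UNIV S (F2_space Mod S)"
  by (rule presents_additive_Mod) simp_all

lemma monoid_F2_Mod: "addsub S \<Longrightarrow> monoid (F2_space Mod S)"
  using presentsD(3)[OF presents_F2_Mod] group.is_monoid by blast

lemma presents_quotient_power:
  assumes "addsub S"
  shows "presents (\<lambda>c. exterior_relations p (F2_space Mod S) #>\<^bsub>free_space p (F2_space Mod S)\<^esub>
       push_words (\<lambda>u. S #>\<^bsub>F2_space\<^esub> u) c) (words p UNIV) (quotient_kernel p S)
     (exterior_power p (F2_space Mod S))"
  unfolding quotient_kernel_def
  by (rule presents_comp[OF presents_exterior_power[OF monoid_F2_Mod[OF assms]]])
    (use presentsD(4)[OF presents_F2_Mod[OF assms]] in \<open>auto simp: push_words_add push_words_image\<close>)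

lemma addsub_quotient_kernel: "addsub S \<Longrightarrow> addsub (quotient_kernel p S)"
proof -
  assume "addsub S"
  have "quotient_kernel p S \<inter> words p UNIV = quotient_kernel p S"
    by (auto simp: quotient_kernel_def)
  then show ?thesis
    using presents_addsub_kernel[OF presents_quotient_power[OF \<open>addsub S\<close>, of p]] by simp
qed

lemma relators_quotient_kernel:
  fixes S :: "(bit^'a) set"
  assumes "addsub S"
  shows "relators p F2_space \<subseteq> quotient_kernel p S"
proof
  fix c :: "(bit^'a) list \<Rightarrow>\<^sub>0 bit"
  assume c: "c \<in> relators p F2_space"
  have "c \<in> exterior_relations p F2_space"
    using c gen2_incl by (simp add: exterior_relations_gen2 monoid_additive) 
  then have "push_words (\<lambda>u. S #>\<^bsub>F2_space\<^esub> u) c \<in> exterior_relations p (F2_space Mod S)"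
    by (rule push_words_relations[rotated -1])
      (use presentsD(5,6)[OF presents_F2_Mod[OF assms]] monoid_F2_Mod[OF assms] monoid_additive[of UNIV] in auto)
  moreover have "c \<in> words p UNIV" using c relators_subset[OF monoid_additive[of UNIV], of p] by auto
  ultimately show "c \<in> quotient_kernel p S" by (simp add: quotient_kernel_def)
qed

lemma word_quotient_kernel:
  assumes "addsub S" "length l = p" "u \<in> set l" "u \<in> S"
  shows "word l \<in> quotient_kernel p S"
proof -
  let ?k = "\<lambda>u. S #>\<^bsub>F2_space\<^esub> u" and ?V = "F2_space Mod S"
  obtain xs ys where l: "l = xs @ u # ys" using split_list[OF assms(3)] by blast
  have u: "?k u = \<one>\<^bsub>?V\<^esub>" using presentsD(7)[OF presents_F2_Mod[OF assms(1)], of u] assms(4) by simp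
  interpret V: monoid ?V using monoid_F2_Mod[OF assms(1)] .
  have c: "?k v \<in> carrier ?V" for v using presentsD(5)[OF presents_F2_Mod[OF assms(1)], of v] by simp
  have "word (map ?k xs @ (\<one>\<^bsub>?V\<^esub> \<otimes>\<^bsub>?V\<^esub> \<one>\<^bsub>?V\<^esub>) # map ?k ys) + word (map ?k xs @ \<one>\<^bsub>?V\<^esub> # map ?k ys)
      + word (map ?k xs @ \<one>\<^bsub>?V\<^esub> # map ?k ys) \<in> relators p ?V"
    by (rule relators_multilinear) (use assms(2) l c V.one_closed in \<open>auto simp del: one_FactGroup\<close>)
  then have "word (map ?k l) \<in> exterior_relations p ?V"
    unfolding exterior_relations_gen2[OF V.monoid_axioms] V.l_one[OF V.one_closed] add_self
    by (intro gen2_incl) (simp add: l u del: one_FactGroup)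
  then show ?thesis using assms(2) by (simp add: quotient_kernel_def)
qed

text \<open>
  The functionals \<open>\<xi>\<^sub>j\<close> with \<open>j \<in> J\<close> vanish on \<open>S\<close>, so that they descend to the quotient by \<open>S\<close>, and with
  them the determinant they define.
\<close>

lemma coord_quotient_kernel:
  assumes "addsub S" "\<And>j u. j \<in> J \<Longrightarrow> u \<in> S \<Longrightarrow> bdot (\<xi> j) u = 0" "card J = p" "c \<in> quotient_kernel p S"
  shows "coord p \<xi> J c = 0"
proof -
  let ?k = "\<lambda>u. S #>\<^bsub>F2_space\<^esub> u" and ?V = "F2_space Mod S"
  define rep where "rep C = (SOME u. u \<in> C)" for C :: "(bit^'a) set"
  note P = presents_F2_Mod[OF assms(1)]
  have rep: "bdot (\<xi> j) (rep (?k u)) = bdot (\<xi> j) u" if "j \<in> J" for j u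
  proof -
    have "0 + u \<in> ?k u" unfolding r_coset_additive using addsub_0[OF assms(1)] by blast
    then have "rep (?k u) \<in> ?k u" unfolding rep_def by (rule someI)
    then obtain s where "s \<in> S" "rep (?k u) = s + u" unfolding r_coset_additive by blast
    then show ?thesis using assms(2)[OF that] by (simp add: bdot_add_right)
  qed
  have J: "enum J ! i \<in> J" if "i < p" for i using enum[of J] that assms(3) by (metis finite nth_mem)
  \<comment> \<open>the functional on the quotient induced by the \<open>i\<close>-th element of \<open>J\<close>\<close>
  define \<kappa> where "\<kappa> i C = bdot (\<xi> (enum J ! i)) (rep C)" for i C
  have "linext (gdet p \<kappa>) (push_words ?k c) = 0"
  proof (rule gdet_relations[OF monoid_F2_Mod[OF assms(1)]])
    fix i x y assume i: "i < p" and xy: "x \<in> carrier ?V" "y \<in> carrier ?V"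
    obtain u v where uv: "x = ?k u" "y = ?k v"
      using xy unfolding presentsD(4)[OF P, symmetric] by blast
    then have "x \<otimes>\<^bsub>?V\<^esub> y = ?k (u + v)" using presentsD(6)[OF P, of u v] by simp
    then show "\<kappa> i (x \<otimes>\<^bsub>?V\<^esub> y) = \<kappa> i x + \<kappa> i y"
      unfolding \<kappa>_def uv using rep[OF J[OF i]] by (simp add: bdot_add_right)
  qed (use assms(4) in \<open>simp add: quotient_kernel_def\<close>)
  also have "linext (gdet p \<kappa>) (push_words ?k c) = coord p \<xi> J c"
    unfolding linext_push_words coord_def
  proof (rule linext_eq_on)
    fix l assume "l \<in> Poly_Mapping.keys c"
    then have l: "length l = p" using assms(4) by (auto simp: quotient_kernel_def words_def)
    show "gdet p \<kappa> (map ?k l) = gram_det p (map \<xi> (enum J)) l"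
      unfolding gram_det_gdet gdet_def
    proof (intro sum.cong[OF refl] prod.cong[OF refl])
      fix \<pi> i assume "\<pi> \<in> {\<pi>. \<pi> permutes {..<p}}" "i \<in> {..<p}"
      then have i: "i < p" "\<pi> i < p" using permutes_in_image[of \<pi> "{..<p}" i] by auto
      then show "\<kappa> i (map ?k l ! \<pi> i) = bdot (map \<xi> (enum J) ! i) (l ! \<pi> i)"
        using l rep[OF J[OF i(1)]] enum[of J] assms(3) by (simp add: \<kappa>_def)
    qed
  qed
  finally show ?thesis .
qed

text \<open>
  If \<open>M\<close> consists of the edges of \<open>\<sigma>\<close> modulo two, these words generate the stalk of \<open>X\<close>.
\<close>

definition edge_words :: "nat \<Rightarrow> (bit^'d) set \<Rightarrow> ((bit^'d) list \<Rightarrow>\<^sub>0 bit) set" where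
  "edge_words p M = (\<Union>m\<in>M. words p {u. bdot m u = 0})"

text \<open>
  The set \<open>M\<close> stands for the edges of \<open>\<sigma>\<close> and \<open>S\<close> for \<open>Sed(Q)\<close>. A coordinate \<open>J \<supseteq> A\<close> vanishes on the words
  orthogonal to an edge: for the edge \<open>\<xi>\<^sub>a\<close> the determinant has a zero row, and for the edge \<open>\<xi>\<^sub>a + \<xi>\<^sub>b\<close>
  it has two equal rows. Conversely, a monomial \<open>x\<^sub>J\<close> with \<open>a \<in> A - J\<close> is a word orthogonal to \<open>\<xi>\<^sub>a\<close>, and
  a monomial with \<open>i \<in> J \<inter> I\<close> has the letter \<open>x\<^sub>i\<close> of \<open>S\<close>. The remaining monomials are independent, since
  their coordinates are.
\<close>

proposition monomial_description:
  fixes x \<xi> :: "'d \<Rightarrow> bit^'d"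
  assumes dual: "dual_bases x \<xi>"
    and M1: "\<And>a. a \<in> A \<Longrightarrow> \<xi> a \<in> M"
    and M2: "\<And>m. m \<in> M \<Longrightarrow> (\<exists>a\<in>A. m = \<xi> a) \<or> (\<exists>a\<in>A. \<exists>b\<in>A. a \<noteq> b \<and> m = \<xi> a + \<xi> b)"
    and S: "addsub S" "S = {u. \<forall>i. i \<notin> I \<longrightarrow> bdot (\<xi> i) u = 0}"
  shows "gen2 (edge_words p M \<union> quotient_kernel p S) =
    {c \<in> words p UNIV. \<forall>J. card J = p \<longrightarrow> A \<subseteq> J \<longrightarrow> J \<inter> I = {} \<longrightarrow> coord p \<xi> J c = 0}"
    (is "?R = ?Z")
proof
  have addZ: "addsub ?Z"
    by (auto simp: addsub_def coord_add intro: addsub_0[OF addsub_words] addsub_add[OF addsub_words])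
  have RZ: "edge_words p M \<union> quotient_kernel p S \<subseteq> ?Z"
  proof
    fix c assume "c \<in> edge_words p M \<union> quotient_kernel p S"
    then show "c \<in> ?Z"
    proof
      assume "c \<in> quotient_kernel p S"
      then show ?thesis
        using coord_quotient_kernel[OF S(1), of _ \<xi> p c] unfolding S(2) by (auto simp: quotient_kernel_def)
    next
      assume "c \<in> edge_words p M"
      then obtain m where m: "m \<in> M" "c \<in> words p {u. bdot m u = 0}" by (auto simp: edge_words_def)
      have "words p {u. bdot m u = 0} \<subseteq> ?Z"
      proof (rule words_subset[OF addZ])
        fix l :: "(bit^'d) list" assume l: "length l = p" "set l \<subseteq> {u. bdot m u = 0}"
        have "gdet p (\<lambda>i. bdot (map \<xi> (enum J) ! i)) l = 0" if J: "card J = p" "A \<subseteq> J" for J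
        proof -
          have ex: "\<exists>i<p. map \<xi> (enum J) ! i = \<xi> a \<and> enum J ! i = a" if "a \<in> A" for a
          proof -
            have "a \<in> set (enum J)" using that J(2) enum(2)[of J] by auto
            then show ?thesis using enum(3)[of J] J(1) by (auto simp: in_set_conv_nth)
          qed
          from M2[OF m(1)] show ?thesis
          proof
            assume "\<exists>a\<in>A. m = \<xi> a"
            then obtain i where "i < p" "map \<xi> (enum J) ! i = m" using ex by blast
            then show ?thesis using l by (intro gdet_zero_functional[of i]) auto
          next
            assume "\<exists>a\<in>A. \<exists>b\<in>A. a \<noteq> b \<and> m = \<xi> a + \<xi> b"
            then obtain a b where ab: "a \<in> A" "b \<in> A" "a \<noteq> b" "m = \<xi> a + \<xi> b" by blast
            obtain i j where ij: "i < p" "map \<xi> (enum J) ! i = \<xi> a" "enum J ! i = a"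
              "j < p" "map \<xi> (enum J) ! j = \<xi> b" "enum J ! j = b" using ex ab(1,2) by metis
            have "bdot (\<xi> a) u = bdot (\<xi> b) u" if "u \<in> set l" for u
              using l(2) that ab(4) by (auto simp: bdot_add_left add_eq_0_char2)
            then show ?thesis
              using ij ab(3) l(1) by (intro gdet_repeated_functional[of i _ j]) auto
          qed
        qed
        then show "word l \<in> ?Z" using l by (auto simp: coord_def gram_det_gdet)
      qed
      then show ?thesis using m(2) by blast
    qed
  qed
  show "?R \<subseteq> ?Z" using gen2_minimal[OF addZ RZ] .
  \<comment> \<open>the monomials that represent a basis of the quotient by the left-hand side\<close>
  define G where "G = {monom_word x J |J. card J = p \<and> A \<subseteq> J \<and> J \<inter> I = {}}"
  let ?R' = "gen2 ((edge_words p M \<union> quotient_kernel p S) \<union> G)"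
  have inR': "c \<in> ?R'" if "c \<in> edge_words p M \<or> c \<in> quotient_kernel p S \<or> c \<in> G" for c
    using that by (intro gen2_incl) auto
  have "words p {\<Sum>i\<in>T. x i |T. T \<subseteq> UNIV} \<subseteq> ?R'"
  proof (rule words_span)
    show "addsub ?R'" by (rule addsub_gen2)
    show "relators p F2_space \<subseteq> ?R'" using relators_quotient_kernel[OF S(1)] inR' by blast
    fix J :: "'d set" assume J: "card J = p"
    note e = enum[OF finite[of J]]
    consider "A \<subseteq> J" "J \<inter> I = {}" | a where "a \<in> A" "a \<notin> J" | i where "i \<in> J" "i \<in> I" by blast
    then have "monom_word x J \<in> ?R'"
    proof cases
      case 1
      then show ?thesis using J by (intro inR') (auto simp: G_def)
    next
      case (2 a)
      have "bdot (\<xi> a) (x j) = 0" if "j \<in> J" for j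
        using dual 2(2) that by (auto simp: dual_bases_def)
      then have "monom_word x J \<in> words p {u. bdot (\<xi> a) u = 0}"
        using e J by (auto simp: monom_word_def)
      then show ?thesis using M1[OF 2(1)] by (intro inR') (auto simp: edge_words_def)
    next
      case (3 i)
      have "x i \<in> S" unfolding S(2) using dual 3(2) by (auto simp: dual_bases_def)
      then have "monom_word x J \<in> quotient_kernel p S"
        unfolding monom_word_def using e J 3(1) by (intro word_quotient_kernel[OF S(1), of _ _ "x i"]) auto
      then show ?thesis by (intro inR') auto
    qed
    then show "word (map x (enum J)) \<in> ?R'" by (simp add: monom_word_def)
  qed simp
  then have all: "words p UNIV \<subseteq> ?R'" unfolding dual_bases_span[OF dual] .
  show "?Z \<subseteq> ?R"
  proof
    fix c assume c: "c \<in> ?Z"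
    then have "c \<in> ?R'" using all by blast
    then obtain r g where rg: "r \<in> ?R" "g \<in> gen2 G" "c = r + g" by (rule gen2_Un_split)
    let ?good = "{J. card J = p \<and> A \<subseteq> J \<and> J \<inter> I = {}}"
    \<comment> \<open>the additive map \<open>?\<phi>\<close> compares \<open>g\<close> with its expansion in the monomials of \<open>G\<close>; it vanishes on \<open>G\<close>\<close>
    let ?\<phi> = "\<lambda>g. g + (\<Sum>J\<in>?good. if coord p \<xi> J g = 1 then monom_word x J else 0)"
    have sum_if: "(\<Sum>J\<in>?good. if coord p \<xi> J (g + h) = 1 then monom_word x J else 0) =
      (\<Sum>J\<in>?good. if coord p \<xi> J g = 1 then monom_word x J else 0) +
      (\<Sum>J\<in>?good. if coord p \<xi> J h = 1 then monom_word x J else 0)" for g h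
      unfolding sum.distrib[symmetric] coord_add
    proof (rule sum.cong[OF refl])
      fix J
      show "(if coord p \<xi> J g + coord p \<xi> J h = 1 then monom_word x J else 0) =
        (if coord p \<xi> J g = 1 then monom_word x J else 0) + (if coord p \<xi> J h = 1 then monom_word x J else 0)"
        by (cases "coord p \<xi> J g"; cases "coord p \<xi> J h") simp_all
    qed
    have "?\<phi> g \<in> {0}"
    proof (rule additive_gen2[OF _ _ _ rg(2)])
      show "addsub {0 :: (bit^'d) list \<Rightarrow>\<^sub>0 bit}" by (simp add: addsub_def)
      show "?\<phi> (g + h) = ?\<phi> g + ?\<phi> h" for g h
        unfolding sum_if by (simp add: ac_simps)
      fix h assume "h \<in> G"
      then obtain J where J: "h = monom_word x J" "J \<in> ?good" by (auto simp: G_def)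
      have "(\<Sum>J'\<in>?good. if coord p \<xi> J' h = 1 then monom_word x J' else 0) =
        (\<Sum>J'\<in>?good. if J' = J then monom_word x J' else 0)"
        using J coord_monom[OF dual, of _ p J] by (intro sum.cong) auto
      also have "\<dots> = h" using J by (simp add: sum.delta)
      finally show "?\<phi> h \<in> {0}" by simp
    qed
    moreover have "coord p \<xi> J g = 0" if "J \<in> ?good" for J
    proof -
      have "coord p \<xi> J c = 0" "coord p \<xi> J r = 0"
        using that c rg(1) \<open>?R \<subseteq> ?Z\<close> by auto
      then show ?thesis using rg(3) by (simp add: coord_add)
    qed
    ultimately have "g = 0" by simp
    then show "c \<in> ?R" using rg by simp
  qed
qed

section \<open>Unimodular bases and reduction modulo two\<close>

lemma lattice_0 [simp]: "0 \<in> lattice"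
  and lattice_add: "x \<in> lattice \<Longrightarrow> y \<in> lattice \<Longrightarrow> x + y \<in> lattice"
  and lattice_diff: "x \<in> lattice \<Longrightarrow> y \<in> lattice \<Longrightarrow> x - y \<in> lattice"
  and lattice_scale: "x \<in> lattice \<Longrightarrow> a \<in> \<int> \<Longrightarrow> a *\<^sub>R x \<in> lattice"
  and lattice_axis: "axis k 1 \<in> lattice"
  by (auto simp: lattice_def axis_def)

lemma lattice_sum: "(\<And>i. i \<in> I \<Longrightarrow> f i \<in> lattice) \<Longrightarrow> (\<Sum>i\<in>I. f i) \<in> lattice"
  by (induction I rule: infinite_finite_induct) (auto intro: lattice_add)

lemma lattice_inner: "x \<in> lattice \<Longrightarrow> y \<in> lattice \<Longrightarrow> x \<bullet> y \<in> \<int>"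
  by (auto simp: lattice_def inner_vec_def intro!: Ints_sum Ints_mult)

lemma of_int_bit_eq: "(of_int a :: bit) = (if even a then 0 else 1)"
  by (metis (full_types) bit_not_one_iff even_of_int_iff even_zero odd_one)

lemma floor_Ints: "a \<in> \<int> \<Longrightarrow> real_of_int \<lfloor>a\<rfloor> = a"
  by (auto simp: Ints_def)

lemma mod2_add: "x \<in> lattice \<Longrightarrow> y \<in> lattice \<Longrightarrow> mod2 (x + y) = mod2 x + mod2 y"
  unfolding vec_eq_iff mod2_def by (auto simp: lattice_def elim!: Ints_cases allE)

lemma mod2_0 [simp]: "mod2 0 = 0"
  by (simp add: mod2_def vec_eq_iff)

lemma mod2_uminus: "x \<in> lattice \<Longrightarrow> mod2 (- x) = mod2 x"
  using mod2_add[of x "- x"] lattice_diff[of 0 x] add_eq_0_char2 by (metis add.right_inverse diff_0 lattice_0 mod2_0)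

lemma mod2_diff: "x \<in> lattice \<Longrightarrow> y \<in> lattice \<Longrightarrow> mod2 (x - y) = mod2 x + mod2 y"
  using mod2_add[of x "- y"] mod2_uminus[of y] lattice_diff[of 0 y] by simp

lemma mod2_sum: "(\<And>i. i \<in> I \<Longrightarrow> f i \<in> lattice) \<Longrightarrow> mod2 (\<Sum>i\<in>I. f i) = (\<Sum>i\<in>I. mod2 (f i))"
  by (induction I rule: infinite_finite_induct) (auto simp: mod2_add lattice_sum)

lemma mod2_scale: "x \<in> lattice \<Longrightarrow> mod2 (real_of_int a *\<^sub>R x) = (if even a then 0 else mod2 x)"
proof -
  assume "x \<in> lattice"
  have "(of_int \<lfloor>real_of_int a * x $ i\<rfloor> :: bit) = of_int a * of_int \<lfloor>x $ i\<rfloor>" for i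
  proof -
    have "real_of_int a * x $ i = of_int (a * \<lfloor>x $ i\<rfloor>)"
      using \<open>x \<in> lattice\<close> floor_Ints[of "x $ i"] by (simp add: lattice_def)
    then have "\<lfloor>real_of_int a * x $ i\<rfloor> = a * \<lfloor>x $ i\<rfloor>" by (simp only: floor_of_int)
    then show ?thesis by simp
  qed
  then show ?thesis by (simp add: mod2_def vec_eq_iff of_int_bit_eq)
qed

lemma mod2_surj: "\<exists>x\<in>lattice. mod2 x = y"
proof
  show "mod2 (\<chi> i. if y $ i = 1 then 1 else 0) = y"
    by (simp add: mod2_def vec_eq_iff)
qed (simp add: lattice_def)

lemma bdot_mod2:
  assumes "x \<in> lattice" "y \<in> lattice"
  shows "bdot (mod2 x) (mod2 y) = of_int \<lfloor>x \<bullet> y\<rfloor>"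
proof -
  have "x \<bullet> y = (\<Sum>k\<in>UNIV. of_int \<lfloor>x $ k\<rfloor> * of_int \<lfloor>y $ k\<rfloor>)"
    using assms by (simp add: inner_vec_def lattice_def floor_Ints)
  also have "\<dots> = of_int (\<Sum>k\<in>UNIV. \<lfloor>x $ k\<rfloor> * \<lfloor>y $ k\<rfloor>)" by simp
  finally have "\<lfloor>x \<bullet> y\<rfloor> = (\<Sum>k\<in>UNIV. \<lfloor>x $ k\<rfloor> * \<lfloor>y $ k\<rfloor>)" by (simp only: floor_of_int)
  then show ?thesis by (simp add: bdot_def mod2_def)
qed

text \<open>
  As both families are integral, \<open>u\<close> is a basis of the lattice and \<open>\<xi>\<close> is its dual basis.
\<close>

definition unimodular :: "('d \<Rightarrow> real^'d) \<Rightarrow> ('d \<Rightarrow> real^'d) \<Rightarrow> bool" where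
  "unimodular u \<xi> \<longleftrightarrow> (\<forall>i. u i \<in> lattice) \<and> (\<forall>i. \<xi> i \<in> lattice) \<and>
     (\<forall>i j. \<xi> i \<bullet> u j = (if i = j then 1 else 0))"

lemma unimodular_expand:
  assumes "unimodular u \<xi>"
  shows "(\<Sum>i\<in>UNIV. (\<xi> i \<bullet> x) *\<^sub>R u i) = x"
proof -
  define A where "A = (\<chi> i. \<xi> i)"
  define B where "B = (\<chi> k i. u i $ k)"
  have "A ** B = mat 1"
    using assms by (simp add: A_def B_def matrix_matrix_mult_def mat_def vec_eq_iff unimodular_def inner_vec_def)
  then have "B ** A = mat 1" by (simp add: matrix_left_right_inverse)
  then have "B *v (A *v x) = x" by (simp add: matrix_vector_mul_assoc)
  then show ?thesis
    by (simp add: vec_eq_iff A_def B_def matrix_vector_mult_def inner_vec_def mult.commute)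
qed

lemma unimodular_commute: "unimodular u \<xi> \<Longrightarrow> unimodular \<xi> u"
  unfolding unimodular_def by (simp add: inner_commute eq_commute)

text \<open>
  Integral vectors that generate the standard basis over the integers form a basis of the lattice;
  the coefficients of the generation are the dual basis, because one-sided inverses of square
  matrices are two-sided.
\<close>

lemma unimodularI:
  assumes "\<And>j. u j \<in> lattice" "\<And>k. axis k 1 = (\<Sum>j\<in>UNIV. real_of_int (c k j) *\<^sub>R u j)"
  shows "unimodular u (\<lambda>i. \<chi> k. real_of_int (c k i))"
proof -
  define A where "A = (\<chi> k j. real_of_int (c k j))"
  define B where "B = (\<chi> j. u j)"
  have "A ** B = mat 1"
  proof -
    have "axis k 1 $ l = (\<Sum>j\<in>UNIV. real_of_int (c k j) * u j $ l)" for k l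
      using arg_cong[OF assms(2)[of k], of "\<lambda>v. v $ l"] by simp
    then show ?thesis
      by (simp add: A_def B_def matrix_matrix_mult_def mat_def vec_eq_iff axis_def eq_commute)
  qed
  then have BA: "B ** A = mat 1" by (simp add: matrix_left_right_inverse)
  have "(\<Sum>k\<in>UNIV. real_of_int (c k i) * u j $ k) = (if i = j then 1 else 0)" for i j
    using arg_cong[OF BA, of "\<lambda>M. M $ j $ i"]
    by (simp add: A_def B_def matrix_matrix_mult_def mat_def mult.commute eq_commute)
  then show ?thesis
    unfolding unimodular_def using assms(1) by (auto simp: lattice_def inner_vec_def)
qed

lemma unimodular_lattice_coeff:
  "unimodular u \<xi> \<Longrightarrow> x \<in> lattice \<Longrightarrow> \<xi> i \<bullet> x \<in> \<int>"
  by (simp add: unimodular_def lattice_inner)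

lemma mod2_unimodular:
  assumes "unimodular u \<xi>"
  shows "bdot (mod2 (\<xi> i)) (mod2 (u j)) = (if i = j then 1 else 0)"
  using assms bdot_mod2[of "\<xi> i" "u j"] by (auto simp: unimodular_def)

lemma mod2_expand:
  assumes "unimodular u \<xi>" "x \<in> lattice"
  shows "mod2 x = (\<Sum>i | bdot (mod2 (\<xi> i)) (mod2 x) = 1. mod2 (u i))"
proof -
  have lat: "u i \<in> lattice" "\<xi> i \<in> lattice" for i using assms(1) by (auto simp: unimodular_def)
  have int: "\<xi> i \<bullet> x = of_int \<lfloor>\<xi> i \<bullet> x\<rfloor>" for i
    using unimodular_lattice_coeff[OF assms] floor_Ints by metis
  have "mod2 x = mod2 (\<Sum>i\<in>UNIV. (of_int \<lfloor>\<xi> i \<bullet> x\<rfloor>) *\<^sub>R u i)"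
    using unimodular_expand[OF assms(1), of x] int by simp
  also have "\<dots> = (\<Sum>i\<in>UNIV. if even \<lfloor>\<xi> i \<bullet> x\<rfloor> then 0 else mod2 (u i))"
    by (subst mod2_sum) (auto simp: lat mod2_scale intro!: lattice_scale)
  also have "\<dots> = (\<Sum>i\<in>UNIV. if bdot (mod2 (\<xi> i)) (mod2 x) = 1 then mod2 (u i) else 0)"
    by (intro sum.cong) (auto simp: bdot_mod2 lat assms(2) of_int_bit_eq)
  finally show ?thesis by (simp add: sum.If_cases)
qed

lemma lattice_basis_unimodular:
  fixes B :: "(real^'d) set"
  assumes "lattice_basis B"
  obtains u \<xi> where "unimodular u \<xi>" "bij_betw u (UNIV::'d set) B"
proof -
  have fin: "finite B" and ind: "independent B"
    and gen: "{(\<Sum>b\<in>B. of_int (c b) *\<^sub>R b) |c :: real^'d \<Rightarrow> int. True} = lattice"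
    using assms by (auto simp: lattice_basis_def)
  have ax: "\<exists>c :: real^'d \<Rightarrow> int. axis k 1 = (\<Sum>b\<in>B. of_int (c b) *\<^sub>R b)" for k :: 'd
    using lattice_axis[of k] unfolding gen[symmetric] by blast
  have "Basis \<subseteq> span B"
  proof
    fix e :: "real^'d" assume "e \<in> Basis"
    then obtain k where "e = axis k 1" by (auto simp: Basis_vec_def)
    then obtain c :: "real^'d \<Rightarrow> int" where "e = (\<Sum>b\<in>B. of_int (c b) *\<^sub>R b)" using ax by blast
    moreover have "(\<Sum>b\<in>B. of_int (c b) *\<^sub>R b) \<in> span B"
      by (intro span_sum span_scale span_base)
    ultimately show "e \<in> span B" by simp
  qed
  then have "span B = UNIV" using span_mono[of Basis "span B"] by (auto simp: span_span)
  then have "card B = CARD('d)" using ind by (metis dim_UNIV dim_eq_card_independent dim_span DIM_cart DIM_real mult.right_neutral)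
  then obtain u where u: "bij_betw u (UNIV::'d set) B" using fin by (metis finite_same_card_bij finite_class.finite_UNIV)
  obtain c where c: "axis k 1 = (\<Sum>b\<in>B. real_of_int (c k b) *\<^sub>R b)" for k :: 'd using ax by metis
  have "axis k 1 = (\<Sum>j\<in>UNIV. real_of_int (c k (u j)) *\<^sub>R u j)" for k
    unfolding c[of k] by (rule sum.reindex_bij_betw[OF u, symmetric])
  moreover have "u j \<in> lattice" for j
  proof -
    have "u j \<in> B" using u by (auto simp: bij_betw_def)
    have "(\<Sum>b\<in>B. real_of_int ((\<lambda>b. if b = u j then 1 else 0) b) *\<^sub>R b) = (\<Sum>b\<in>B. if b = u j then b else 0)"
      by (rule sum.cong) auto
    also have "\<dots> = u j" using fin \<open>u j \<in> B\<close> by (simp add: sum.delta')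
    finally have "u j = (\<Sum>b\<in>B. real_of_int ((\<lambda>b. if b = u j then 1 else 0) b) *\<^sub>R b)" by simp
    then show ?thesis
      unfolding gen[symmetric] by (intro CollectI exI[of _ "\<lambda>b. if b = u j then 1 else 0"] conjI TrueI) simp
  qed
  ultimately have "unimodular u (\<lambda>i. \<chi> k. real_of_int (c k (u i)))" by (intro unimodularI)
  then show thesis using u that by blast
qed

section \<open>Primitive simplices\<close>

text \<open>
  The determinant formula for the volume of a simplex presupposes an ordering of the coordinates.
  The copy \<open>wo\<close> of a finite index type carries a well-ordering, and relabelling the coordinates
  preserves volumes and the lattice.
\<close>

typedef 'a wo = "UNIV :: 'a set" morphisms un_wo mk_wo ..

instance wo :: (finite) finite
proof
  have "(UNIV :: 'a wo set) = range mk_wo" by (metis mk_wo_cases UNIV_eq_I rangeI)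
  then show "finite (UNIV :: 'a wo set)" by (metis finite finite_imageI)
qed

instantiation wo :: (finite) wellorder
begin

definition wo_rank :: "'a wo \<Rightarrow> nat" where
  "wo_rank = (SOME f. inj f)"

definition "x \<le> y \<longleftrightarrow> wo_rank x \<le> wo_rank y"
definition "x < y \<longleftrightarrow> wo_rank x < wo_rank y"

lemma inj_wo_rank: "inj (wo_rank :: 'a wo \<Rightarrow> nat)"
proof -
  have "\<exists>f :: 'a wo \<Rightarrow> nat. inj f" using finite_imp_inj_to_nat_seg[of "UNIV :: 'a wo set"] by auto
  then show ?thesis unfolding wo_rank_def by (rule someI_ex)
qed

instance
proof
  fix x y z a :: "'a wo" and P :: "'a wo \<Rightarrow> bool"
  show "x < y \<longleftrightarrow> x \<le> y \<and> \<not> y \<le> x" "x \<le> x" "x \<le> y \<or> y \<le> x"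
    by (auto simp: less_eq_wo_def less_wo_def)
  show "x \<le> y \<Longrightarrow> y \<le> z \<Longrightarrow> x \<le> z" by (simp add: less_eq_wo_def)
  show "x \<le> y \<Longrightarrow> y \<le> x \<Longrightarrow> x = y" using inj_wo_rank by (auto simp: less_eq_wo_def dest: injD)
  assume step: "\<And>x. (\<And>y. y < x \<Longrightarrow> P y) \<Longrightarrow> P x"
  show "P a"
    by (induction "wo_rank a" arbitrary: a rule: less_induct) (use step in \<open>auto simp: less_wo_def\<close>)
qed

end

definition relabel :: "real^'d \<Rightarrow> real^('d wo)" where
  "relabel x = (\<chi> i. x $ un_wo i)"

definition unlabel :: "real^('d wo) \<Rightarrow> real^'d" where
  "unlabel x = (\<chi> i. x $ mk_wo i)"

lemma relabel_inverse [simp]: "unlabel (relabel x) = x" "relabel (unlabel y) = y"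
  by (simp_all add: relabel_def unlabel_def mk_wo_inverse un_wo_inverse)

lemma linear_relabel: "linear relabel" "linear unlabel"
  by (auto intro!: linearI simp: relabel_def unlabel_def vec_eq_iff)

lemma lborel_unlabel: "lborel = distr lborel borel (unlabel :: real^('d wo) \<Rightarrow> real^'d)"
proof (rule lborel_eqI)
  have cont: "continuous_on UNIV (unlabel :: real^('d wo) \<Rightarrow> real^'d)"
    by (rule linear_continuous_on) (use linear_relabel(2) linear_conv_bounded_linear in blast)
  then have m: "(unlabel :: real^('d wo) \<Rightarrow> real^'d) \<in> borel_measurable lborel"
    using borel_measurable_continuous_onI by auto
  fix l u :: "real^'d" assume le: "\<And>b. b \<in> Basis \<Longrightarrow> l \<bullet> b \<le> u \<bullet> b"
  have le': "l $ i \<le> u $ i" for i using le[of "axis i 1"] by (simp add: inner_axis)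
  have pre: "unlabel -` box l u = box (relabel l) (relabel u)"
  proof -
    have "(\<forall>i::'d. l $ i < x $ mk_wo i \<and> x $ mk_wo i < u $ i) \<longleftrightarrow>
      (\<forall>j. l $ un_wo j < x $ j \<and> x $ j < u $ un_wo j)" for x :: "real^('d wo)"
      by (metis un_wo_inverse mk_wo_inverse UNIV_I)
    then show ?thesis by (auto simp: mem_box_cart unlabel_def relabel_def)
  qed
  have "emeasure (distr lborel borel unlabel) (box l u) = emeasure lborel (box (relabel l) (relabel u))"
    using m by (simp add: emeasure_distr pre)
  also have "\<dots> = (\<Prod>b\<in>Basis. (relabel u - relabel l) \<bullet> b)"
    using le' by (intro emeasure_lborel_box) (auto simp: Basis_vec_def inner_axis relabel_def)
  also have "(\<Prod>b\<in>Basis. (relabel u - relabel l) \<bullet> b) = (\<Prod>j\<in>UNIV. (u - l) $ un_wo j)"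
    by (simp add: Basis_vec_def UNION_singleton_eq_range prod.reindex inj_on_def axis_eq_axis inner_axis relabel_def)
  also have "\<dots> = (\<Prod>i\<in>UNIV. (u - l) $ i)"
    by (rule prod.reindex_bij_witness[of _ mk_wo un_wo]) (auto simp: mk_wo_inverse un_wo_inverse)
  also have "\<dots> = (\<Prod>b\<in>Basis. (u - l) \<bullet> b)"
    by (simp add: Basis_vec_def UNION_singleton_eq_range prod.reindex inj_on_def axis_eq_axis inner_axis)
  finally show "emeasure (distr lborel borel unlabel) (box l u) = ennreal (\<Prod>b\<in>Basis. (u - l) \<bullet> b)"
    by simp
qed simp

lemma measure_relabel:
  fixes S :: "(real^'d) set"
  assumes "compact S"
  shows "measure lebesgue S = measure lborel (relabel ` S)"
proof -
  have cont: "continuous_on UNIV (unlabel :: real^('d wo) \<Rightarrow> real^'d)"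
    by (rule linear_continuous_on) (use linear_relabel(2) linear_conv_bounded_linear in blast)
  have pre: "unlabel -` S = relabel ` S"
    by (auto simp: image_iff) (metis relabel_inverse)+
  have "S \<in> sets borel" using assms by (simp add: compact_imp_closed)
  then have "measure lebesgue S = measure lborel S" by (simp add: measure_completion)
  also have "\<dots> = measure (distr lborel borel unlabel) S" by (subst lborel_unlabel) simp
  also have "\<dots> = measure lborel (unlabel -` S)"
    using \<open>S \<in> sets borel\<close> borel_measurable_continuous_onI[OF cont] by (simp add: measure_distr)
  finally show ?thesis by (simp add: pre)
qed

lemma det_Ints:
  fixes A :: "real^'n^'n"
  assumes "\<And>i j. A $ i $ j \<in> \<int>"
  shows "det A \<in> \<int>"
  unfolding det_def by (intro Ints_sum Ints_mult Ints_prod assms) auto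

text \<open>
  The volume is \<open>|det A| / (n + 1)!\<close> for the matrix \<open>A\<close> of edge vectors at \<open>x0\<close>, hence \<open>det A\<close> is 1 or -1.
  By Cramer's rule the standard basis is an integral combination of the edge vectors.
\<close>

lemma primitive_simplex_unimodular_wo:
  fixes X :: "(real ^ 'n :: {finite, wellorder}) set" and f :: "'n :: _ \<Rightarrow> real ^ ('n :: _)"
  assumes "finite X" "x0 \<in> X" "X \<subseteq> lattice" and f: "bij_betw f UNIV (X - {x0})"
    and vol: "measure lborel (convex hull X) = 1 / fact CARD('n)"
  shows "\<exists>\<xi>. unimodular (\<lambda>j. f j - x0) \<xi>"
proof -
  define A where "A = (\<chi> i j. f j $ i - x0 $ i)"
  have cX: "card X = Suc CARD('n)"
    using bij_betw_same_card[OF f] card_Suc_Diff1[OF assms(1,2)] by simp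
  have lat: "f j - x0 \<in> lattice" for j
    using assms(2,3) f by (intro lattice_diff) (auto simp: bij_betw_def)
  have int: "A $ i $ j \<in> \<int>" for i j using lat[of j] by (simp add: A_def lattice_def)
  have "measure lborel (convex hull X) = \<bar>det A\<bar> / fact CARD('n)"
    using content_simplex[OF assms(1) cX assms(2) f] by (simp add: A_def)
  then have det: "\<bar>det A\<bar> = 1" using vol by simp
  have "\<exists>c :: 'n \<Rightarrow> int. axis k 1 = (\<Sum>j\<in>UNIV. real_of_int (c j) *\<^sub>R (f j - x0))" for k :: 'n
  proof -
    define v where "v = (\<chi> l. det (\<chi> i j. if j = l then axis k 1 $ i else A $ i $ j) / det A)"
    have Av: "A *v v = axis k 1"
      using cramer[of A v "axis k 1"] det by (auto simp: v_def)
    have "v $ l \<in> \<int>" for l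
    proof -
      have "det (\<chi> i j. if j = l then axis k 1 $ i else A $ i $ j) \<in> \<int>"
        by (rule det_Ints) (use int in \<open>auto simp: axis_def\<close>)
      moreover have "det A = 1 \<or> det A = -1" using det by linarith
      ultimately show ?thesis by (auto simp: v_def)
    qed
    then have v: "v $ l = of_int \<lfloor>v $ l\<rfloor>" for l by (simp add: floor_Ints)
    have "axis k 1 = (\<Sum>j\<in>UNIV. v $ j *\<^sub>R (f j - x0))"
      unfolding Av[symmetric] by (simp add: vec_eq_iff matrix_vector_mult_def A_def mult.commute)
    then show ?thesis using v by (intro exI[of _ "\<lambda>j. \<lfloor>v $ j\<rfloor>"]) simp
  qed
  then obtain c where c: "\<And>k. axis k 1 = (\<Sum>j\<in>UNIV. real_of_int (c k j) *\<^sub>R (f j - x0))"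
    by metis
  show ?thesis using unimodularI[of "\<lambda>j. f j - x0", OF lat c] by blast
qed

lemma primitive_simplex_unimodular:
  fixes X :: "(real^'d) set" and f :: "'d \<Rightarrow> real^'d"
  assumes "finite X" "x0 \<in> X" "X \<subseteq> lattice" and f: "bij_betw f UNIV (X - {x0})"
    and vol: "measure lebesgue (convex hull X) = 1 / fact CARD('d)"
  shows "\<exists>\<xi>. unimodular (\<lambda>j. f j - x0) \<xi>"
proof -
  have inj: "inj (relabel :: real^'d \<Rightarrow> real^('d wo))" by (metis injI relabel_inverse(1))
  have bu: "bij_betw un_wo (UNIV :: 'd wo set) UNIV"
    by (rule bij_betw_byWitness[of _ mk_wo]) (auto simp: mk_wo_inverse un_wo_inverse)
  define g where "g = (\<lambda>j. relabel (f (un_wo j)))"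
  have card_wo: "CARD('d wo) = CARD('d)" using bij_betw_same_card[OF bu] by simp
  have bg: "bij_betw g (UNIV :: 'd wo set) (relabel ` X - {relabel x0})"
  proof -
    have "bij_betw (f \<circ> un_wo) (UNIV :: 'd wo set) (X - {x0})" using bu f by (rule bij_betw_trans)
    moreover have "bij_betw relabel (X - {x0}) (relabel ` (X - {x0}))"
      using inj_on_subset[OF inj] by (simp add: bij_betw_def)
    ultimately have "bij_betw (relabel \<circ> (f \<circ> un_wo)) UNIV (relabel ` (X - {x0}))" by (rule bij_betw_trans)
    moreover have "relabel ` (X - {x0}) = relabel ` X - {relabel x0}" using inj by (auto dest: injD)
    ultimately show ?thesis by (simp add: g_def comp_def)
  qed
  have "relabel ` (convex hull X) = convex hull (relabel ` X)"
    by (rule convex_hull_linear_image[OF linear_relabel(1)])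
  then have "measure lborel (convex hull (relabel ` X)) = 1 / fact CARD('d wo)"
    using vol measure_relabel[OF finite_imp_compact_convex_hull[OF assms(1)]] card_wo by simp
  then obtain \<xi> where \<xi>: "unimodular (\<lambda>j. g j - relabel x0) \<xi>"
    using primitive_simplex_unimodular_wo[OF _ _ _ bg] assms(1,2,3)
    by (force simp: relabel_def lattice_def)
  have inner: "unlabel a \<bullet> unlabel b = a \<bullet> b" for a b :: "real^('d wo)"
    unfolding inner_vec_def unlabel_def
    by (rule sum.reindex_bij_witness[of _ un_wo mk_wo]) (auto simp: mk_wo_inverse un_wo_inverse)
  have u: "f j - x0 = unlabel (g (mk_wo j) - relabel x0)" for j
    by (simp add: g_def mk_wo_inverse linear_diff[OF linear_relabel(2)])
  have latu: "a \<in> lattice \<Longrightarrow> unlabel a \<in> lattice" for a :: "real^('d wo)"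
    by (simp add: lattice_def unlabel_def)
  have "unimodular (\<lambda>j. f j - x0) (\<lambda>j. unlabel (\<xi> (mk_wo j)))"
    unfolding u using \<xi> by (simp add: unimodular_def inner latu mk_wo_inject)
  then show ?thesis by blast
qed

section \<open>Simplices of a primitive triangulation\<close>

abbreviation verts :: "(real^'d) set \<Rightarrow> (real^'d) set" where
  "verts \<sigma> \<equiv> {v. v extreme_point_of \<sigma>}"

lemma simplex_verts:
  assumes "n simplex \<sigma>"
  shows "\<sigma> = convex hull (verts \<sigma>)" "\<not> affine_dependent (verts \<sigma>)" "finite (verts \<sigma>)"
    "int (card (verts \<sigma>)) = n + 1" "aff_dim \<sigma> = n"
proof -
  obtain C where C: "\<not> affine_dependent C" "int (card C) = n + 1" "\<sigma> = convex hull C"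
    using assms unfolding simplex_def by blast
  have "verts \<sigma> = C"
    using C by (simp add: extreme_point_of_convex_hull_affine_independent)
  then show "\<sigma> = convex hull (verts \<sigma>)" "\<not> affine_dependent (verts \<sigma>)" "finite (verts \<sigma>)"
    "int (card (verts \<sigma>)) = n + 1" using C aff_independent_finite by auto
  show "aff_dim \<sigma> = n" using assms by (rule aff_dim_simplex)
qed

text \<open>
  A simplex is a face of a maximal one, which is full-dimensional because its volume is positive;
  its edge vectors at \<open>v0\<close> form a basis of the lattice.
\<close>

lemma primitive_triangulation_verts:
  fixes K :: "(real^'d) set set"
  assumes "primitive_triangulation P K" "\<sigma> \<in> K" "v0 \<in> verts \<sigma>"
  shows "\<exists>u \<xi>. unimodular u \<xi> \<and> (\<forall>w\<in>verts \<sigma> - {v0}. \<exists>j. w - v0 = u (j :: 'd))"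
proof -
  have K: "simplicial_complex K" and lat: "\<And>\<sigma>. \<sigma> \<in> K \<Longrightarrow> verts \<sigma> \<subseteq> lattice"
    and vol: "\<And>\<sigma>. \<sigma> \<in> K \<Longrightarrow> (\<forall>\<tau>\<in>K. \<sigma> \<subseteq> \<tau> \<longrightarrow> \<tau> = \<sigma>) \<Longrightarrow> measure lebesgue \<sigma> = 1 / fact CARD('d)"
    using assms(1) by (auto simp: primitive_triangulation_def)
  have "finite K" using K by (simp add: simplicial_complex_def)
  then obtain \<tau> where \<tau>: "\<tau> \<in> K" "\<sigma> \<subseteq> \<tau>" "\<forall>\<rho>\<in>K. \<tau> \<subseteq> \<rho> \<longrightarrow> \<rho> = \<tau>"
    using finite_has_maximal2[OF _ assms(2)] by metis
  have face: "\<sigma> face_of \<tau>" using simplicial_complex_subset_face[OF K assms(2) \<tau>(1,2)] .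
  obtain m where m: "m simplex \<tau>" using simplicial_complexD(1)[OF K \<tau>(1)] by blast
  note V = simplex_verts[OF m]
  have vt: "measure lebesgue \<tau> = 1 / fact CARD('d)" using vol[OF \<tau>(1,3)] .
  have "m = int CARD('d)"
  proof (rule ccontr)
    assume "m \<noteq> int CARD('d)"
    then have "interior \<tau> = {}" using low_dim_interior[of \<tau>] V(5) by simp
    then have "negligible \<tau>" using negligible_convex_interior convex_simplex[OF m] by blast
    then have "measure lebesgue \<tau> = 0" by (simp add: negligible_imp_measure0)
    then show False using vt by simp
  qed
  have sub: "verts \<sigma> \<subseteq> verts \<tau>" using extreme_point_of_face[OF face] by blast
  then have v0: "v0 \<in> verts \<tau>" using assms(3) by blast
  have "card (verts \<tau> - {v0}) = CARD('d)"
    using V(3,4) v0 \<open>m = int CARD('d)\<close> by simp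
  then obtain f where f: "bij_betw f (UNIV :: 'd set) (verts \<tau> - {v0})"
    using V(3) by (metis finite_Diff finite_same_card_bij finite)
  have "measure lebesgue (convex hull (verts \<tau>)) = 1 / fact CARD('d)" using vt V(1) by simp
  then obtain \<xi> where \<xi>: "unimodular (\<lambda>j. f j - v0) \<xi>"
    using primitive_simplex_unimodular[OF V(3) v0 lat[OF \<tau>(1)] f] by blast
  have "\<exists>j. w - v0 = f j - v0" if w: "w \<in> verts \<sigma> - {v0}" for w
  proof -
    have "w \<in> verts \<tau> - {v0}" using w sub by blast
    then obtain j where "w = f j" using f by (auto simp: bij_betw_def)
    then show ?thesis by blast
  qed
  then show ?thesis using \<xi> by blast
qed

section \<open>The corners of a smooth polytope\<close>

lemma polytope_minimal_face:
  fixes P :: "'a::euclidean_space set"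
  assumes "polytope P" "convex S" "S \<noteq> {}" "S \<subseteq> P"
  obtains F where "F face_of P" "S \<subseteq> F" "\<And>Q. Q face_of P \<Longrightarrow> S \<subseteq> Q \<Longrightarrow> F \<subseteq> Q"
proof -
  let ?F = "{Q. Q face_of P \<and> S \<subseteq> Q}"
  have "P \<in> ?F" using assms polytope_imp_convex face_of_refl by blast
  then have "\<Inter>?F face_of P" by (intro face_of_Inter) auto
  then show thesis by (rule that) auto
qed

lemma polytope_face_rel_interior:
  fixes P :: "'a::euclidean_space set"
  assumes "polytope P" "z \<in> P"
  obtains F where "F face_of P" "z \<in> rel_interior F"
proof -
  obtain F where F: "F face_of P" "{z} \<subseteq> F" "\<And>Q. Q face_of P \<Longrightarrow> {z} \<subseteq> Q \<Longrightarrow> F \<subseteq> Q"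
    using polytope_minimal_face[OF assms(1), of "{z}"] assms(2) by auto
  have poly: "polytope F" using face_of_polytope_polytope assms(1) F(1) by blast
  have "z \<in> rel_interior F"
  proof (rule ccontr)
    assume "z \<notin> rel_interior F"
    then have "z \<in> rel_frontier F"
      using F(2) closure_subset by (auto simp: rel_frontier_def)
    then obtain G where G: "z \<in> G" "G facet_of F"
      using rel_frontier_of_polyhedron[OF polytope_imp_polyhedron[OF poly]] by blast
    then have "G face_of P" using F(1) face_of_trans facet_of_imp_face_of by blast
    then have "F \<subseteq> G" using F(3) G(1) by blast
    then have "G = F" using G(2) facet_of_imp_subset by blast
    then show False using G(2) by simp
  qed
  then show thesis using that F(1) by blast
qed

text \<open>
  The face of \<open>P\<close> containing \<open>z\<close> in its relative interior has dimension at most 1: in a face of higher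
  dimension there is a direction \<open>d\<close> parallel to both the face and the hyperplane, and \<open>z\<close> would be
  the midpoint of a segment of the slice. The face is not a vertex of \<open>P\<close>, since the hyperplane
  avoids the vertices, so it is an edge.
\<close>

lemma slice_vertex_on_edge:
  fixes P :: "'a::euclidean_space set"
  assumes P: "polytope P" and z: "z extreme_point_of (P \<inter> {y. a \<bullet> y = \<beta>})"
    and nv: "\<And>w. w extreme_point_of P \<Longrightarrow> a \<bullet> w \<noteq> \<beta>"
  obtains p q where "closed_segment p q edge_of P" "z \<in> closed_segment p q"
proof -
  have zP: "z \<in> P" "a \<bullet> z = \<beta>" using z by (auto simp: extreme_point_of_def)
  obtain F where F: "F face_of P" "z \<in> rel_interior F" using polytope_face_rel_interior[OF P zP(1)] .
  have zF: "z \<in> F" using F(2) rel_interior_subset by blast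
  have "aff_dim F \<le> 1"
  proof (rule ccontr)
    assume "\<not> aff_dim F \<le> 1"
    let ?T = "span ((\<lambda>x. x - z) ` F)"
    have "aff_dim F = int (dim ((\<lambda>x. x - z) ` F))"
      by (rule aff_dim_eq_dim_subtract) (simp add: hull_inc zF)
    then have "\<not> dim ?T \<le> 1" using \<open>\<not> aff_dim F \<le> 1\<close> by simp
    have "\<exists>d\<in>?T. d \<noteq> 0 \<and> a \<bullet> d = 0"
    proof (rule ccontr)
      assume no: "\<not> (\<exists>d\<in>?T. d \<noteq> 0 \<and> a \<bullet> d = 0)"
      have "\<exists>e\<in>?T. e \<noteq> 0"
        using \<open>\<not> dim ?T \<le> 1\<close> by (metis dim_eq_0 not_less_eq_eq le0 subset_iff singletonI One_nat_def le_SucI)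
      then obtain e where e: "e \<in> ?T" "e \<noteq> 0" "a \<bullet> e \<noteq> 0" using no by blast
      have "?T \<subseteq> span {e}"
      proof
        fix d assume d: "d \<in> ?T"
        have "d - ((a \<bullet> d) / (a \<bullet> e)) *\<^sub>R e \<in> ?T"
          using d e(1) by (intro span_diff span_scale)
        moreover have "a \<bullet> (d - ((a \<bullet> d) / (a \<bullet> e)) *\<^sub>R e) = 0"
          using e(3) by (simp add: inner_diff_right)
        ultimately have "d = ((a \<bullet> d) / (a \<bullet> e)) *\<^sub>R e" using no by fastforce
        then show "d \<in> span {e}" by (metis span_base span_scale singletonI)
      qed
      then have "dim ?T \<le> dim {e}" by (metis dim_span dim_subset)
      also have "\<dots> \<le> 1" by (simp add: dim_singleton)
      finally show False using \<open>\<not> dim ?T \<le> 1\<close> by blast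
    qed
    then obtain d where d: "d \<in> ?T" "d \<noteq> 0" "a \<bullet> d = 0" by blast
    obtain e where e: "e > 0" "cball z e \<inter> affine hull F \<subseteq> F"
      using F(2) by (auto simp: mem_rel_interior_cball)
    define s where "s = e / norm d"
    have s: "s > 0" using e(1) d(2) by (simp add: s_def)
    have aff: "z + c *\<^sub>R d \<in> affine hull F" for c
    proof -
      have "affine hull F = (\<lambda>x. z + x) ` span ((\<lambda>x. - z + x) ` F)"
        by (rule affine_hull_span_gen) (simp add: hull_inc zF)
      then show ?thesis using d(1) span_scale by fastforce
    qed
    have "z + s *\<^sub>R d \<in> F" "z - s *\<^sub>R d \<in> F"
      using e(2) aff[of s] aff[of "- s"] s e(1) d(2) by (auto simp: s_def dist_norm)
    then have "z + s *\<^sub>R d \<in> P \<inter> {y. a \<bullet> y = \<beta>}" "z - s *\<^sub>R d \<in> P \<inter> {y. a \<bullet> y = \<beta>}"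
      using face_of_imp_subset[OF F(1)] d(3) zP(2) by (auto simp: inner_add_right inner_diff_right)
    moreover have "z \<in> open_segment (z + s *\<^sub>R d) (z - s *\<^sub>R d)"
    proof -
      have "z + s *\<^sub>R d \<noteq> z - s *\<^sub>R d"
      proof
        assume "z + s *\<^sub>R d = z - s *\<^sub>R d"
        then have "(2 * s) *\<^sub>R d = 0" by (simp add: algebra_simps scaleR_2[symmetric] add_eq_0_iff2 flip: scaleR_add_left) 
        then show False using s d(2) by simp
      qed
      moreover have "z = midpoint (z + s *\<^sub>R d) (z - s *\<^sub>R d)" by (simp add: midpoint_def scaleR_2[symmetric])
      ultimately show ?thesis by (metis midpoint_in_open_segment)
    qed
    ultimately show False using z by (auto simp: extreme_point_of_def)
  qed
  have cc: "compact F" "convex F"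
    using P F(1) face_of_imp_compact polytope_imp_compact polytope_imp_convex face_of_imp_convex by blast+
  then obtain p q where pq: "F = closed_segment p q"
    using compact_convex_collinear_segment[of F] \<open>aff_dim F \<le> 1\<close> zF by (metis collinear_aff_dim empty_iff)
  have "p \<noteq> q"
  proof
    assume "p = q"
    then have "z = p" using zF pq by simp
    then have "z extreme_point_of P" using segment_face_of[of p q P] F(1) pq by simp
    then show False using nv zP(2) by blast
  qed
  then have "aff_dim F = 1" unfolding pq segment_convex_hull by (simp add: aff_dim_convex_hull aff_dim_2)
  then show thesis using that[of p q] F(1) zF pq by (simp add: edge_of_def)
qed

text \<open>
  A hyperplane that separates \<open>v\<close> from all other vertices cuts \<open>P\<close> in a polytope whose vertices lie on
  edges of \<open>P\<close>; these edges cross the hyperplane, hence they start at \<open>v\<close>. So the slice is contained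
  in the cone \<open>Cn\<close> generated by the edges at \<open>v\<close>, and every other vertex of \<open>P\<close> lies on a ray from \<open>v\<close>
  through the slice.
\<close>

proposition polytope_subset_vertex_cone:
  fixes P :: "'a::euclidean_space set"
  assumes P: "polytope P" and v: "v extreme_point_of P" and x: "x \<in> P"
  defines "W \<equiv> {w. closed_segment v w edge_of P}"
  shows "\<exists>c. (\<forall>w. 0 \<le> c w) \<and> x = v + (\<Sum>w\<in>W. c w *\<^sub>R (w - v))"
proof -
  define Cn where "Cn = {v + (\<Sum>w\<in>W. c w *\<^sub>R (w - v)) |c. \<forall>w. 0 \<le> c w}"
  have CnE: "\<exists>c. (\<forall>w. 0 \<le> c w) \<and> y = v + (\<Sum>w\<in>W. c w *\<^sub>R (w - v))" if "y \<in> Cn" for y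
    using that unfolding Cn_def by (elim CollectE exE conjE) (intro exI conjI)
  have ext: "w extreme_point_of P" if "w \<in> W" for w
    using that segment_face_of[of v w P] by (auto simp: W_def edge_of_def)
  have finV: "finite {w. w extreme_point_of P}"
    using finite_polyhedron_extreme_points polytope_imp_polyhedron P by blast
  have finW: "finite W" using ext finV by (rule_tac finite_subset[of _ "{w. w extreme_point_of P}"]) auto
  have cone: "v + t *\<^sub>R (y - v) \<in> Cn" if yC: "y \<in> Cn" and t0: "0 \<le> t" for y t
  proof -
    obtain c where "\<forall>w. 0 \<le> c w" "y = v + (\<Sum>w\<in>W. c w *\<^sub>R (w - v))" using CnE[OF yC] by metis
    then have "v + t *\<^sub>R (y - v) = v + (\<Sum>w\<in>W. (t * c w) *\<^sub>R (w - v))" "\<forall>w. 0 \<le> t * c w"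
      using t0 by (auto simp: scaleR_sum_right)
    then show ?thesis unfolding Cn_def by (intro CollectI exI[of _ "\<lambda>w. t * c w"]) auto
  qed
  have vCn: "v \<in> Cn" unfolding Cn_def by (intro CollectI exI[of _ "\<lambda>w. 0"]) auto
  have conv: "convex Cn"
    unfolding convex_def
  proof (intro ballI allI impI)
    fix y y' :: 'a and s t :: real
    assume y: "y \<in> Cn" "y' \<in> Cn" and st: "0 \<le> s" "0 \<le> t" "s + t = 1"
    obtain c where c: "\<forall>w. 0 \<le> c w" "y = v + (\<Sum>w\<in>W. c w *\<^sub>R (w - v))" using CnE[OF y(1)] by metis
    obtain d where d: "\<forall>w. 0 \<le> d w" "y' = v + (\<Sum>w\<in>W. d w *\<^sub>R (w - v))" using CnE[OF y(2)] by metis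
    have "s *\<^sub>R y + t *\<^sub>R y' = (s + t) *\<^sub>R v + (\<Sum>w\<in>W. (s * c w + t * d w) *\<^sub>R (w - v))"
      unfolding c(2) d(2) by (simp add: scaleR_sum_right algebra_simps sum.distrib sum_subtractf)
    then have "s *\<^sub>R y + t *\<^sub>R y' = v + (\<Sum>w\<in>W. (s * c w + t * d w) *\<^sub>R (w - v))" using st(3) by simp
    then show "s *\<^sub>R y + t *\<^sub>R y' \<in> Cn"
      unfolding Cn_def using c(1) d(1) st by (intro CollectI exI[of _ "\<lambda>w. s * c w + t * d w"]) auto
  qed
  have vert: "w \<in> Cn" if w: "w extreme_point_of P" for w
  proof (cases "w = v")
    case False
    have "{v} exposed_face_of P"
      using v exposed_face_of_polyhedron[OF polytope_imp_polyhedron[OF P]] by (simp add: face_of_singleton)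
    then obtain a b where ab: "P \<subseteq> {x. a \<bullet> x \<le> b}" "{v} = P \<inter> {x. a \<bullet> x = b}"
      unfolding exposed_face_of_def by blast
    define V where "V = {w. w extreme_point_of P} - {v}"
    have V: "finite V" "w \<in> V" using finV w False by (auto simp: V_def)
    define m where "m = Max ((\<bullet>) a ` V)"
    have less: "a \<bullet> y < b" if "y \<in> V" for y
    proof -
      have "y \<in> P" "y \<noteq> v" using that by (auto simp: V_def extreme_point_of_def)
      then show ?thesis using ab by force
    qed
    have m: "a \<bullet> y \<le> m" if "y \<in> V" for y unfolding m_def using V that by (intro Max_ge) auto
    have "m \<in> (\<bullet>) a ` V" unfolding m_def using V by (intro Max_in) auto
    then have "m < b" using less by auto
    \<comment> \<open>the level \<open>\<beta>\<close> separates \<open>v\<close>, at level \<open>b\<close>, from the other vertices, at levels at most \<open>m\<close>\<close>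
    define \<beta> where "\<beta> = (m + b) / 2"
    have \<beta>: "m < \<beta>" "\<beta> < b" using \<open>m < b\<close> by (auto simp: \<beta>_def)
    have av: "a \<bullet> v = b" using ab(2) by auto
    have nv: "a \<bullet> y \<noteq> \<beta>" if "y extreme_point_of P" for y
      using m[of y] that \<beta> av by (cases "y = v") (auto simp: V_def)
    let ?S = "P \<inter> {y. a \<bullet> y = \<beta>}"
    have S: "?S = convex hull {z. z extreme_point_of ?S}"
      using polytope_imp_compact[OF P] polytope_imp_convex[OF P]
      by (intro Krein_Milman_Minkowski compact_Int_closed convex_Int convex_hyperplane closed_hyperplane)
    have "{z. z extreme_point_of ?S} \<subseteq> Cn"
    proof
      fix z assume "z \<in> {z. z extreme_point_of ?S}"
      then have z: "z extreme_point_of ?S" by simp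
      then have za: "a \<bullet> z = \<beta>" by (auto simp: extreme_point_of_def)
      obtain p q where pq: "closed_segment p q edge_of P" "z \<in> closed_segment p q"
        using slice_vertex_on_edge[OF P z nv] .
      have epq: "p extreme_point_of P" "q extreme_point_of P"
        using segment_face_of[of p q P] pq(1) by (auto simp: edge_of_def)
      have "p = v \<or> q = v"
      proof (rule ccontr)
        assume "\<not> (p = v \<or> q = v)"
        then have "a \<bullet> p < \<beta>" "a \<bullet> q < \<beta>" using m[of p] m[of q] epq \<beta>(1) by (auto simp: V_def)
        then have "closed_segment p q \<subseteq> {y. a \<bullet> y < \<beta>}"
          by (intro closed_segment_subset) (auto simp: convex_halfspace_lt)
        then show False using pq(2) za by auto
      qed
      then obtain w' where w': "closed_segment v w' edge_of P" "z \<in> closed_segment v w'"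
        using pq by (metis closed_segment_commute)
      then obtain s where s: "0 \<le> s" "z = (1 - s) *\<^sub>R v + s *\<^sub>R w'" by (auto simp: closed_segment_def)
      have W: "w' \<in> W" using w' by (simp add: W_def)
      have "(\<Sum>y\<in>W. (if y = w' then s else 0) *\<^sub>R (y - v)) = (\<Sum>y\<in>W. if y = w' then s *\<^sub>R (w' - v) else 0)"
        by (rule sum.cong) auto
      also have "\<dots> = s *\<^sub>R (w' - v)" using W finW by simp
      finally have eq: "(\<Sum>y\<in>W. (if y = w' then s else 0) *\<^sub>R (y - v)) = s *\<^sub>R (w' - v)" .
      have "z = v + (\<Sum>y\<in>W. (if y = w' then s else 0) *\<^sub>R (y - v))"
        unfolding eq using s(2) by (simp add: algebra_simps)
      then show "z \<in> Cn"
        unfolding Cn_def using s(1) by (intro CollectI exI[of _ "\<lambda>y. if y = w' then s else 0"]) auto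
    qed
    then have SC: "?S \<subseteq> Cn" using S conv by (metis hull_minimal)
    \<comment> \<open>the segment from \<open>v\<close> to \<open>w\<close> meets the slice at the parameter \<open>t\<close>\<close>
    define t where "t = (b - \<beta>) / (b - a \<bullet> w)"
    have aw: "a \<bullet> w < \<beta>" using m[OF V(2)] \<beta>(1) by simp
    have t: "0 < t" "t \<le> 1" using \<beta> aw by (auto simp: t_def)
    define y where "y = v + t *\<^sub>R (w - v)"
    have "y \<in> closed_segment v w" unfolding y_def closed_segment_def using t by (auto simp: algebra_simps intro!: exI[of _ t])
    moreover have "closed_segment v w \<subseteq> P"
      using v w polytope_imp_convex[OF P] by (intro closed_segment_subset) (auto simp: extreme_point_of_def)
    moreover have "a \<bullet> y = \<beta>"
    proof -
      have "t * (b - a \<bullet> w) = b - \<beta>" using aw \<beta>(2) by (simp add: t_def)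
      then show ?thesis using av by (simp add: y_def inner_add_right inner_diff_right algebra_simps)
    qed
    ultimately have "y \<in> Cn" using SC by blast
    then have "v + (1 / t) *\<^sub>R (y - v) \<in> Cn" using t by (intro cone) auto
    then show ?thesis using t by (simp add: y_def)
  qed (simp add: vCn)
  have "P = convex hull {w. w extreme_point_of P}"
    using P Krein_Milman_Minkowski polytope_imp_compact polytope_imp_convex by blast
  also have "\<dots> \<subseteq> Cn" using vert conv by (intro hull_minimal) auto
  finally show ?thesis using x CnE by blast
qed

text \<open>
  Among the positive multiples of \<open>x\<close> in the lattice, take the one for which the modulus of a fixed
  non-zero coordinate, a positive integer, is least.
\<close>

lemma primitive_multiple:
  fixes x :: "real^'d"
  assumes "x \<in> lattice" "x \<noteq> 0"
  obtains t u where "t > 0" "u \<in> lattice" "x = t *\<^sub>R u" "\<And>s. 0 < s \<Longrightarrow> s < 1 \<Longrightarrow> s *\<^sub>R u \<notin> lattice"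
proof -
  obtain i where i: "x $ i \<noteq> 0" using assms(2) by (auto simp: vec_eq_iff)
  define P where "P k \<longleftrightarrow> (\<exists>r>0. r *\<^sub>R x \<in> lattice \<and> \<bar>r * x $ i\<bar> = real k)" for k :: nat
  have nat: "\<exists>k::nat. \<bar>y\<bar> = real k" if "y \<in> \<int>" for y :: real
  proof -
    from that obtain z where "y = of_int z" by (auto simp: Ints_def)
    then show ?thesis by (intro exI[of _ "nat \<bar>z\<bar>"]) simp
  qed
  have "x $ i \<in> \<int>" using assms(1) by (simp add: lattice_def)
  then obtain k0 where "\<bar>x $ i\<bar> = real k0" using nat by blast
  then have "P k0" unfolding P_def using assms(1) by (intro exI[of _ 1]) auto
  then have "P (LEAST k. P k)" by (rule LeastI)
  then obtain r where r: "r > 0" "r *\<^sub>R x \<in> lattice" "\<bar>r * x $ i\<bar> = real (LEAST k. P k)"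
    unfolding P_def by blast
  show thesis
  proof
    show "1 / r > 0" "r *\<^sub>R x \<in> lattice" "x = (1 / r) *\<^sub>R (r *\<^sub>R x)" using r by auto
    fix s :: real assume s: "0 < s" "s < 1"
    show "s *\<^sub>R (r *\<^sub>R x) \<notin> lattice"
    proof
      assume lat: "s *\<^sub>R (r *\<^sub>R x) \<in> lattice"
      then have "(s *\<^sub>R (r *\<^sub>R x)) $ i \<in> \<int>" unfolding lattice_def by blast
      then have "(s * r) * x $ i \<in> \<int>" by (simp add: mult.assoc)
      then obtain k where k: "\<bar>(s * r) * x $ i\<bar> = real k" using nat by blast
      then have "P k" unfolding P_def using lat s r by (intro exI[of _ "s * r"]) auto
      then have "(LEAST k. P k) \<le> k" by (rule Least_le)
      moreover have "\<bar>(s * r) * x $ i\<bar> = s * \<bar>r * x $ i\<bar>" using s by (simp add: abs_mult)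
      ultimately have "\<bar>r * x $ i\<bar> \<le> s * \<bar>r * x $ i\<bar>" using r(3) k by linarith
      moreover have "\<bar>r * x $ i\<bar> > 0" using i r(1) by simp
      ultimately show False using s(2) by (simp add: mult_le_cancel_right1)
    qed
  qed
qed

text \<open>
  Near \<open>v\<close> the set \<open>P\<close> is the orthant spanned by \<open>u\<close>: it contains an initial segment of each of the rays
  and lies in the region where the coordinates \<open>\<xi>\<close> are non-negative.
\<close>

definition corner :: "(real^'d) set \<Rightarrow> real^'d \<Rightarrow> ('d \<Rightarrow> real^'d) \<Rightarrow> ('d \<Rightarrow> real^'d) \<Rightarrow> bool" where
  "corner P v u \<xi> \<longleftrightarrow> convex P \<and> v \<in> P \<and> v \<in> lattice \<and> unimodular u \<xi> \<and>
     (\<forall>x\<in>P. \<forall>i. 0 \<le> \<xi> i \<bullet> (x - v)) \<and> (\<forall>i. \<exists>t>0. v + t *\<^sub>R u i \<in> P)"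

text \<open>
  By smoothness the primitive edge directions at \<open>v\<close> form a basis \<open>u\<close> of the lattice, and \<open>P\<close> lies in
  the cone that they generate.
\<close>

proposition smooth_polytope_corner:
  fixes P :: "(real^'d) set"
  assumes P: "smooth_polytope P" and v: "v extreme_point_of P"
  shows "\<exists>u \<xi>. corner P v u \<xi>"
proof -
  have poly: "polytope P" using P by (auto simp: smooth_polytope_def simple_polytope_def)
  obtain V where V: "V \<subseteq> lattice" "P = convex hull V"
    using P by (auto simp: smooth_polytope_def lattice_polytope_def)
  have lat: "w \<in> lattice" if "w extreme_point_of P" for w
    using extreme_point_of_convex_hull[of w V] that V by blast
  let ?B = "{u. \<exists>E. E edge_of P \<and> v \<in> E \<and> primitive_direction v E u}"
  have "lattice_basis ?B" using P v by (simp add: smooth_polytope_def)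
  then obtain u \<xi> where u: "unimodular u \<xi>" "bij_betw u (UNIV :: 'd set) ?B"
    by (rule lattice_basis_unimodular)
  have vP: "v \<in> P" using v by (simp add: extreme_point_of_def)
  have edge: "\<exists>i t. 0 < t \<and> w - v = t *\<^sub>R u i" if "closed_segment v w edge_of P" for w
  proof -
    have "w extreme_point_of P" using segment_face_of[of v w P] that by (auto simp: edge_of_def)
    then have "w - v \<in> lattice" using lat v by (intro lattice_diff) auto
    moreover have "w - v \<noteq> 0" using that by (auto simp: edge_of_def)
    ultimately obtain t b where tb: "t > 0" "b \<in> lattice" "w - v = t *\<^sub>R b"
      "\<And>s. 0 < s \<Longrightarrow> s < 1 \<Longrightarrow> s *\<^sub>R b \<notin> lattice" using primitive_multiple by metis
    have "w = v + t *\<^sub>R b" using tb(3) by (simp add: algebra_simps)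
    then have "primitive_direction v (closed_segment v w) b"
      unfolding primitive_direction_def using tb by blast
    then have "b \<in> ?B" using that by auto
    then obtain i where "b = u i" using u(2) by (auto simp: bij_betw_def)
    then show ?thesis using tb by blast
  qed
  have nonneg: "0 \<le> \<xi> i \<bullet> (x - v)" if x: "x \<in> P" for x i
  proof -
    let ?W = "{w. closed_segment v w edge_of P}"
    obtain c where c: "\<forall>w. 0 \<le> c w" "x = v + (\<Sum>w\<in>?W. c w *\<^sub>R (w - v))"
      using polytope_subset_vertex_cone[OF poly v x] by blast
    have "0 \<le> \<xi> i \<bullet> (w - v)" if w: "w \<in> ?W" for w
    proof -
      obtain j t where "0 < t" "w - v = t *\<^sub>R u j" using edge w by blast
      then show ?thesis using u(1) by (simp add: unimodular_def)
    qed
    then have "0 \<le> (\<Sum>w\<in>?W. c w * (\<xi> i \<bullet> (w - v)))" using c(1) by (intro sum_nonneg) auto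
    then show ?thesis by (simp add: c(2) inner_sum_right)
  qed
  have "\<exists>t>0. v + t *\<^sub>R u i \<in> P" for i
  proof -
    have "u i \<in> ?B" using u(2) by (auto simp: bij_betw_def)
    then obtain E where E: "E edge_of P" "primitive_direction v E (u i)" by blast
    then obtain t where "t > 0" "E = closed_segment v (v + t *\<^sub>R u i)"
      by (auto simp: primitive_direction_def)
    then show ?thesis using edge_of_imp_subset[OF E(1)] by auto
  qed
  then show ?thesis
    unfolding corner_def using polytope_imp_convex[OF poly] vP lat[OF v] u(1) nonneg by blast
qed

definition cface :: "(real^'d) set \<Rightarrow> real^'d \<Rightarrow> ('d \<Rightarrow> real^'d) \<Rightarrow> 'd set \<Rightarrow> (real^'d) set" where
  "cface P v \<xi> I = {x \<in> P. \<forall>i\<in>I. \<xi> i \<bullet> (x - v) = 0}"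

context
  fixes P :: "(real^'d) set" and v u \<xi>
  assumes corner: "corner P v u \<xi>"
begin

lemma cornerD:
  "convex P" "v \<in> P" "v \<in> lattice" "unimodular u \<xi>"
  "x \<in> P \<Longrightarrow> 0 \<le> \<xi> i \<bullet> (x - v)"
  using corner by (auto simp: corner_def)

lemma corner_dual: "\<xi> i \<bullet> u j = (if i = j then 1 else 0)"
  using cornerD(4) by (simp add: unimodular_def)

text \<open>
  On \<open>P\<close> the sum of the coordinates in \<open>I\<close> is non-negative and vanishes exactly on this set.
\<close>

lemma cface_face: "cface P v \<xi> I face_of P"
proof -
  let ?a = "\<Sum>i\<in>I. \<xi> i"
  have ge: "?a \<bullet> v \<le> ?a \<bullet> x" if "x \<in> P" for x
    unfolding inner_sum_left using cornerD(5)[OF that] by (intro sum_mono) (simp add: inner_diff_right)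
  have "cface P v \<xi> I = P \<inter> {x. ?a \<bullet> x = ?a \<bullet> v}"
  proof -
    have "?a \<bullet> x = ?a \<bullet> v \<longleftrightarrow> (\<forall>i\<in>I. \<xi> i \<bullet> (x - v) = 0)" if "x \<in> P" for x
    proof -
      have "?a \<bullet> x = ?a \<bullet> v \<longleftrightarrow> (\<Sum>i\<in>I. \<xi> i \<bullet> (x - v)) = 0"
        by (simp add: inner_sum_left inner_diff_right sum_subtractf)
      also have "\<dots> \<longleftrightarrow> (\<forall>i\<in>I. \<xi> i \<bullet> (x - v) = 0)"
        using cornerD(5)[OF that] by (intro sum_nonneg_eq_0_iff) auto
      finally show ?thesis .
    qed
    then show ?thesis by (auto simp: cface_def)
  qed
  then show ?thesis using face_of_Int_supporting_hyperplane_ge[OF cornerD(1) ge] by simp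
qed

lemma v_cface: "v \<in> cface P v \<xi> I"
  using cornerD(2) by (simp add: cface_def)

lemma corner_simplex:
  obtains t where "t > 0" "\<And>c. (\<And>i. 0 \<le> c i) \<Longrightarrow> sum c UNIV \<le> t \<Longrightarrow> v + (\<Sum>i\<in>UNIV. c i *\<^sub>R u i) \<in> P"
proof -
  obtain T where T: "\<And>i. T i > 0" "\<And>i. v + T i *\<^sub>R u i \<in> P"
    using corner unfolding corner_def by metis
  define t where "t = Min (range T)"
  have t: "t > 0" "t \<le> T i" for i using T(1) by (auto simp: t_def)
  have pt: "v + t *\<^sub>R u i \<in> P" for i
  proof -
    have "v + t *\<^sub>R u i = (1 - t / T i) *\<^sub>R v + (t / T i) *\<^sub>R (v + T i *\<^sub>R u i)"
      using T(1)[of i] by (simp add: algebra_simps)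
    moreover have "0 \<le> t / T i" "t / T i \<le> 1" using t(1) t(2)[of i] T(1)[of i] by auto
    ultimately show ?thesis using convexD_alt[OF cornerD(1,2) T(2)[of i], of "t / T i"] by simp
  qed
  show thesis
  proof
    show "t > 0" by (rule t(1))
    fix c :: "'d \<Rightarrow> real" assume c: "\<And>i. 0 \<le> c i" "sum c UNIV \<le> t"
    define s where "s = sum c UNIV"
    show "v + (\<Sum>i\<in>UNIV. c i *\<^sub>R u i) \<in> P"
    proof (cases "s = 0")
      case True
      then have "c i = 0" for i using c(1) sum_nonneg_eq_0_iff[of UNIV c] by (auto simp: s_def)
      then show ?thesis using cornerD(2) by simp
    next
      case False
      have s: "s > 0" using False c(1) sum_nonneg[of UNIV c] by (auto simp: s_def order_less_le)
      have y: "(\<Sum>i\<in>UNIV. (c i / s) *\<^sub>R (v + t *\<^sub>R u i)) \<in> P"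
        using pt c(1) s cornerD(1)
        by (intro convex_sum) (auto simp: sum_divide_distrib[symmetric] s_def[symmetric])
      have eq: "(\<Sum>i\<in>UNIV. (c i / s) *\<^sub>R (v + t *\<^sub>R u i)) = v + (t / s) *\<^sub>R (\<Sum>i\<in>UNIV. c i *\<^sub>R u i)"
      proof -
        have "(\<Sum>i\<in>UNIV. (c i / s) *\<^sub>R v) = v"
          using s by (simp add: scaleR_sum_left[symmetric] sum_divide_distrib[symmetric] s_def[symmetric])
        then show ?thesis
          by (simp add: scaleR_add_right sum.distrib scaleR_sum_right mult.commute)
      qed
      have "v + (\<Sum>i\<in>UNIV. c i *\<^sub>R u i) = (1 - s / t) *\<^sub>R v + (s / t) *\<^sub>R (v + (t / s) *\<^sub>R (\<Sum>i\<in>UNIV. c i *\<^sub>R u i))"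
        using s t(1) by (simp add: algebra_simps)
      moreover have "0 \<le> s / t" "s / t \<le> 1" using s t(1) c(2) by (auto simp: s_def)
      ultimately show ?thesis using convexD_alt[OF cornerD(1,2) y, of "s / t"] unfolding eq by simp
    qed
  qed
qed

lemma corner_ray: "\<exists>t>0. \<forall>I. v + t *\<^sub>R u i \<in> cface P v \<xi> I \<longleftrightarrow> i \<notin> I"
proof -
  obtain t where t: "t > 0" "v + t *\<^sub>R u i \<in> P" using corner unfolding corner_def by metis
  then show ?thesis by (intro exI[of _ t]) (auto simp: cface_def corner_dual)
qed

lemma cface_subset_iff: "cface P v \<xi> I \<subseteq> cface P v \<xi> I' \<longleftrightarrow> I' \<subseteq> I"
proof
  assume sub: "cface P v \<xi> I \<subseteq> cface P v \<xi> I'"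
  show "I' \<subseteq> I"
  proof
    fix i assume "i \<in> I'"
    obtain t where "\<forall>I. v + t *\<^sub>R u i \<in> cface P v \<xi> I \<longleftrightarrow> i \<notin> I" using corner_ray[of i] by blast
    then show "i \<in> I" using sub \<open>i \<in> I'\<close> by blast
  qed
qed (auto simp: cface_def)

text \<open>
  Let \<open>y\<close> be a point of the coordinate face. Averaging points of \<open>Q\<close> and moving towards \<open>v\<close> gives a
  point \<open>m\<close> of \<open>Q\<close> close to \<open>v\<close> at which all coordinates outside \<open>?I\<close> are positive. Then the segment from
  \<open>y\<close> to \<open>m\<close> can be prolonged beyond \<open>m\<close> to a point \<open>z\<close> of \<open>P\<close>, and \<open>y \<in> Q\<close> because \<open>Q\<close> is a face.
\<close>

lemma face_eq_cface:
  assumes Q: "Q face_of P" "v \<in> Q"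
  shows "Q = cface P v \<xi> {i. \<forall>x\<in>Q. \<xi> i \<bullet> (x - v) = 0}"
proof
  let ?I = "{i. \<forall>x\<in>Q. \<xi> i \<bullet> (x - v) = 0}"
  show "Q \<subseteq> cface P v \<xi> ?I" using face_of_imp_subset[OF Q(1)] by (auto simp: cface_def)
  have QP: "Q \<subseteq> P" using face_of_imp_subset[OF Q(1)] .
  show "cface P v \<xi> ?I \<subseteq> Q"
  proof
    fix y assume "y \<in> cface P v \<xi> ?I"
    then have y: "y \<in> P" "\<And>i. i \<in> ?I \<Longrightarrow> \<xi> i \<bullet> (y - v) = 0" by (auto simp: cface_def)
    obtain X where X: "\<And>i. X i \<in> Q" "\<And>i. i \<notin> ?I \<Longrightarrow> \<xi> i \<bullet> (X i - v) \<noteq> 0"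
    proof -
      have "\<forall>i. \<exists>x. x \<in> Q \<and> (i \<notin> ?I \<longrightarrow> \<xi> i \<bullet> (x - v) \<noteq> 0)" using Q(2) by auto
      from choice[OF this] show thesis using that by blast
    qed
    define N where "N = real CARD('d)"
    have N: "N > 0" by (simp add: N_def)
    define q where "q = (\<Sum>i\<in>UNIV. (1 / N) *\<^sub>R X i)"
    have qQ: "q \<in> Q"
      unfolding q_def using X(1) face_of_imp_convex[OF Q(1)] N by (intro convex_sum) (auto simp: N_def)
    have qv: "q - v = (\<Sum>i\<in>UNIV. (1 / N) *\<^sub>R (X i - v))"
      using N by (simp add: q_def scaleR_diff_right sum_subtractf N_def sum_constant_scaleR del: sum_constant)
    have qpos: "0 < \<xi> i \<bullet> (q - v)" if "i \<notin> ?I" for i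
    proof -
      have "0 \<le> \<xi> i \<bullet> (X j - v)" for j using cornerD(5) X(1) QP by blast
      moreover from this[of i] have "0 < \<xi> i \<bullet> (X i - v)" using X(2)[OF that] by linarith
      ultimately have "0 < (\<Sum>j\<in>UNIV. (1 / N) * (\<xi> i \<bullet> (X j - v)))"
        using N by (intro sum_pos2[of _ i]) auto
      then show ?thesis by (simp add: qv inner_sum_right)
    qed
    obtain t where t: "t > 0" "\<And>c. (\<And>i. 0 \<le> c i) \<Longrightarrow> sum c UNIV \<le> t \<Longrightarrow> v + (\<Sum>i\<in>UNIV. c i *\<^sub>R u i) \<in> P"
      by (rule corner_simplex) blast
    define a where "a i = \<xi> i \<bullet> (q - v)" for i
    define b where "b i = \<xi> i \<bullet> (y - v)" for i
    have a: "0 \<le> a i" "i \<in> ?I \<Longrightarrow> a i = 0" "i \<notin> ?I \<Longrightarrow> 0 < a i" for i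
      using cornerD(5)[of q i] qQ QP qpos[of i] by (auto simp: a_def)
    have b: "0 \<le> b i" "i \<in> ?I \<Longrightarrow> b i = 0" for i using cornerD(5)[OF y(1)] y(2)[of i] by (auto simp: b_def)
    \<comment> \<open>The factor \<open>\<eta>\<close> moves \<open>q\<close> so close to \<open>v\<close> that the prolongation, whose coordinates
      at most double those of \<open>m\<close>, stays within the bound \<open>t\<close>.\<close>
    define \<eta> where "\<eta> = min 1 (t / (2 * (sum a UNIV + 1)))"
    have sa: "0 \<le> sum a UNIV" using a(1) by (simp add: sum_nonneg)
    have \<eta>: "0 < \<eta>" "\<eta> \<le> 1" "\<eta> * sum a UNIV \<le> t / 2"
    proof -
      show "0 < \<eta>" "\<eta> \<le> 1" using t(1) sa by (auto simp: \<eta>_def)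
      have "\<eta> * sum a UNIV \<le> t / (2 * (sum a UNIV + 1)) * sum a UNIV"
        using sa by (intro mult_right_mono) (auto simp: \<eta>_def)
      also have "\<dots> \<le> t / 2" using t(1) sa by (simp add: field_simps)
      finally show "\<eta> * sum a UNIV \<le> t / 2" .
    qed
    define m where "m = v + \<eta> *\<^sub>R (q - v)"
    have mQ: "m \<in> Q"
    proof -
      have "m = (1 - \<eta>) *\<^sub>R v + \<eta> *\<^sub>R q" by (simp add: m_def algebra_simps)
      then show ?thesis using convexD_alt[OF face_of_imp_convex[OF Q(1)] Q(2) qQ] \<eta> by simp
    qed
    \<comment> \<open>prolonging by the factor \<open>\<epsilon>\<close> keeps the coordinates non-negative\<close>
    have "\<exists>\<epsilon>>0. \<forall>i. i \<notin> ?I \<longrightarrow> \<epsilon> * b i \<le> \<eta> * a i"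
    proof -
      define \<epsilon> where "\<epsilon> = Min (insert 1 ((\<lambda>i. \<eta> * a i / (b i + 1)) ` (- ?I)))"
      have pos: "0 < \<eta> * a i / (b i + 1)" if "i \<notin> ?I" for i
        using a(3)[OF that] b(1)[of i] \<eta>(1) by (intro divide_pos_pos) auto
      have "\<epsilon> > 0" unfolding \<epsilon>_def using pos by (subst Min_gr_iff) auto
      moreover have "\<epsilon> * b i \<le> \<eta> * a i" if i: "i \<notin> ?I" for i
      proof -
        have "\<epsilon> \<le> \<eta> * a i / (b i + 1)" unfolding \<epsilon>_def using i by (intro Min_le) auto
        then have "\<epsilon> * (b i + 1) \<le> \<eta> * a i" using b(1)[of i] by (simp add: pos_le_divide_eq)
        then show ?thesis using \<open>\<epsilon> > 0\<close> by (simp add: algebra_simps)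
      qed
      ultimately show ?thesis by blast
    qed
    then obtain \<epsilon>0 where \<epsilon>0: "\<epsilon>0 > 0" "\<And>i. i \<notin> ?I \<Longrightarrow> \<epsilon>0 * b i \<le> \<eta> * a i" by blast
    define \<epsilon> where "\<epsilon> = min \<epsilon>0 (1 :: real)"
    have \<epsilon>: "0 < \<epsilon>" "\<epsilon> \<le> 1" using \<epsilon>0 by (auto simp: \<epsilon>_def)
    have \<epsilon>b: "\<epsilon> * b i \<le> \<eta> * a i" for i
    proof (cases "i \<in> ?I")
      case False
      have "\<epsilon> * b i \<le> \<epsilon>0 * b i" using b(1)[of i] by (intro mult_right_mono) (auto simp: \<epsilon>_def)
      then show ?thesis using \<epsilon>0(2)[OF False] by linarith
    qed (use a(2) b(2) in simp)
    \<comment> \<open>the coordinates of \<open>z = m + \<epsilon> (m - y)\<close>\<close>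
    define d where "d i = \<eta> * a i + \<epsilon> * (\<eta> * a i - b i)" for i
    define z where "z = v + (\<Sum>i\<in>UNIV. d i *\<^sub>R u i)"
    have "z \<in> P"
      unfolding z_def
    proof (rule t(2))
      fix i
      have "0 \<le> \<epsilon> * (\<eta> * a i)" using \<epsilon>(1) \<eta>(1) a(1)[of i] by simp
      then show "0 \<le> d i" using \<epsilon>b[of i] by (simp add: d_def algebra_simps)
    next
      have "d i \<le> 2 * (\<eta> * a i)" for i
      proof -
        have "\<epsilon> * (\<eta> * a i) \<le> 1 * (\<eta> * a i)" using \<epsilon> \<eta>(1) a(1)[of i] by (intro mult_right_mono) auto
        moreover have "0 \<le> \<epsilon> * b i" using \<epsilon>(1) b(1)[of i] by simp
        ultimately show ?thesis by (simp add: d_def algebra_simps)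
      qed
      then have "sum d UNIV \<le> (\<Sum>i\<in>UNIV. 2 * (\<eta> * a i))" by (intro sum_mono)
      also have "\<dots> = 2 * (\<eta> * sum a UNIV)" by (simp add: sum_distrib_left)
      also have "\<dots> \<le> t" using \<eta>(3) by simp
      finally show "sum d UNIV \<le> t" .
    qed
    have "q - v = (\<Sum>i\<in>UNIV. a i *\<^sub>R u i)" "y - v = (\<Sum>i\<in>UNIV. b i *\<^sub>R u i)"
      using unimodular_expand[OF cornerD(4), of "q - v"] unimodular_expand[OF cornerD(4), of "y - v"]
      by (simp_all add: a_def b_def)
    then have "z - v = \<eta> *\<^sub>R (q - v) + \<epsilon> *\<^sub>R (\<eta> *\<^sub>R (q - v) - (y - v))"
      by (simp add: z_def d_def scaleR_add_left scaleR_diff_left sum.distrib sum_subtractf scaleR_sum_right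
          scaleR_diff_right right_diff_distrib)
    then have zm: "z - m = \<epsilon> *\<^sub>R (m - y)" by (simp add: m_def algebra_simps)
    show "y \<in> Q"
    proof (cases "y = m")
      case False
      have "m \<in> open_segment y z"
      proof -
        have "z = m + \<epsilon> *\<^sub>R (m - y)" using zm by (simp add: algebra_simps)
        then have "m = (1 - 1 / (1 + \<epsilon>)) *\<^sub>R y + (1 / (1 + \<epsilon>)) *\<^sub>R z"
        proof -
          assume z: "z = m + \<epsilon> *\<^sub>R (m - y)"
          have "(1 + \<epsilon>) *\<^sub>R ((1 - 1 / (1 + \<epsilon>)) *\<^sub>R y + (1 / (1 + \<epsilon>)) *\<^sub>R z) = \<epsilon> *\<^sub>R y + z"
            using \<epsilon>(1) by (simp add: scaleR_add_right right_diff_distrib)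
          also have "\<dots> = (1 + \<epsilon>) *\<^sub>R m" by (simp add: z algebra_simps)
          finally show ?thesis using \<epsilon>(1) by (simp add: scaleR_cancel_left)
        qed
        moreover have "y \<noteq> z"
        proof
          assume "y = z"
          then have "(1 + \<epsilon>) *\<^sub>R (m - y) = 0" using zm by (simp add: algebra_simps)
          then show False using \<epsilon>(1) False by simp
        qed
        ultimately show ?thesis using \<epsilon>(1) by (auto simp: in_segment intro!: exI[of _ "1 / (1 + \<epsilon>)"])
      qed
      then show ?thesis using face_ofD[OF Q(1) _ y(1) \<open>z \<in> P\<close> mQ] by blast
    qed (use mQ in simp)
  qed
qed

end

lemma tangent_eq_span:
  assumes "v \<in> S"
  shows "tangent S = span ((\<lambda>x. x - v) ` S)"
proof
  show "tangent S \<subseteq> span ((\<lambda>x. x - v) ` S)"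
    unfolding tangent_def
  proof (rule span_minimal)
    show "{x - y |x y. x \<in> S \<and> y \<in> S} \<subseteq> span ((\<lambda>x. x - v) ` S)"
    proof
      fix d assume "d \<in> {x - y |x y. x \<in> S \<and> y \<in> S}"
      then obtain x y where xy: "x \<in> S" "y \<in> S" "d = x - y" by blast
      then have "(x - v) - (y - v) \<in> span ((\<lambda>x. x - v) ` S)" by (intro span_diff span_base imageI)
      then show "d \<in> span ((\<lambda>x. x - v) ` S)" using xy(3) by simp
    qed
  qed simp
  show "span ((\<lambda>x. x - v) ` S) \<subseteq> tangent S"
    unfolding tangent_def using assms by (intro span_mono) auto
qed

context
  fixes P :: "(real^'d) set" and v u \<xi>
  assumes corner: "corner P v u \<xi>"
begin

lemma tangent_cface: "tangent (cface P v \<xi> I) = span (u ` (- I))"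
proof -
  have T: "tangent (cface P v \<xi> I) = span ((\<lambda>x. x - v) ` cface P v \<xi> I)"
    by (rule tangent_eq_span[OF v_cface[OF corner]])
  show ?thesis
    unfolding T
  proof (intro equalityI span_minimal subspace_span)
    show "(\<lambda>x. x - v) ` cface P v \<xi> I \<subseteq> span (u ` (- I))"
    proof
      fix d assume "d \<in> (\<lambda>x. x - v) ` cface P v \<xi> I"
      then obtain x where x: "x \<in> cface P v \<xi> I" "d = x - v" by blast
      have "d = (\<Sum>i\<in>UNIV. (\<xi> i \<bullet> d) *\<^sub>R u i)"
        using unimodular_expand[OF cornerD(4)[OF corner], of d] by simp
      also have "\<dots> \<in> span (u ` (- I))"
      proof (rule span_sum)
        fix i :: 'd
        show "(\<xi> i \<bullet> d) *\<^sub>R u i \<in> span (u ` (- I))"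
        proof (cases "i \<in> I")
          case True
          then show ?thesis using x by (simp add: cface_def span_zero)
        next
          case False
          then show ?thesis by (intro span_scale span_base) simp
        qed
      qed
      finally show "d \<in> span (u ` (- I))" .
    qed
    show "u ` (- I) \<subseteq> span ((\<lambda>x. x - v) ` cface P v \<xi> I)"
    proof
      fix d assume "d \<in> u ` (- I)"
      then obtain i where i: "i \<notin> I" "d = u i" by blast
      obtain t where t: "t > 0" "v + t *\<^sub>R u i \<in> cface P v \<xi> I" using corner_ray[OF corner, of i] i by blast
      have "(v + t *\<^sub>R u i) - v \<in> (\<lambda>x. x - v) ` cface P v \<xi> I" using t(2) by blast
      then have "(1 / t) *\<^sub>R ((v + t *\<^sub>R u i) - v) \<in> span ((\<lambda>x. x - v) ` cface P v \<xi> I)"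
        by (intro span_scale span_base)
      then show "d \<in> span ((\<lambda>x. x - v) ` cface P v \<xi> I)" using t(1) i(2) by simp
    qed
  qed
qed

end

lemma unimodular_independent:
  assumes "unimodular u \<xi>"
  shows "independent (u ` J)" "inj u"
proof -
  have d: "\<xi> i \<bullet> u j = (if i = j then 1 else 0)" for i j using assms by (simp add: unimodular_def)
  show inj: "inj u" by (rule injI) (metis d zero_neq_one)
  show "independent (u ` J)"
    unfolding independent_explicit_finite_subsets
  proof (intro allI impI ballI)
    fix T c w assume T: "T \<subseteq> u ` J" "finite T" "(\<Sum>w\<in>T. c w *\<^sub>R w) = 0" "w \<in> T"
    obtain i where i: "w = u i" using T(1,4) by blast
    have "0 = \<xi> i \<bullet> (\<Sum>w\<in>T. c w *\<^sub>R w)" using T(3) by simp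
    also have "\<dots> = (\<Sum>w\<in>T. c w * (\<xi> i \<bullet> w))" by (simp add: inner_sum_right)
    also have "\<dots> = (\<Sum>w'\<in>T. if w' = w then c w else 0)"
    proof (rule sum.cong[OF refl])
      fix w' assume "w' \<in> T"
      then obtain j where "w' = u j" using T(1) by blast
      then show "c w' * (\<xi> i \<bullet> w') = (if w' = w then c w else 0)" using i d inj by (auto dest: injD)
    qed
    also have "\<dots> = c w" using T(2,4) by simp
    finally show "c w = 0" by simp
  qed
qed

lemma aff_dim_tangent:
  fixes S :: "(real^'d) set"
  assumes "v \<in> S"
  shows "aff_dim S = int (dim (tangent S))"
  unfolding tangent_eq_span[OF assms]
  using aff_dim_eq_dim_subtract[of v S] assms by (simp add: hull_inc)

lemma aff_dim_cface:
  fixes P :: "(real^'d) set"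
  assumes "corner P v u \<xi>"
  shows "aff_dim (cface P v \<xi> I) = int CARD('d) - int (card I)"
proof -
  note U = unimodular_independent[OF cornerD(4)[OF assms]]
  have "dim (tangent (cface P v \<xi> I)) = card (u ` (- I))"
    unfolding tangent_cface[OF assms] using U(1) by (simp add: dim_eq_card_independent)
  also have "\<dots> = card (- I)" using U(2) by (simp add: card_image inj_on_subset)
  also have "\<dots> = CARD('d) - card I" by (simp add: Compl_eq_Diff_UNIV card_Diff_subset)
  finally show ?thesis
    using aff_dim_tangent[OF v_cface[OF assms], of I] card_mono[of UNIV I] by (simp add: of_nat_diff)
qed

section \<open>Reduction modulo two of linear subspaces\<close>

text \<open>
  Since \<open>u\<close> is part of a pair of dual lattice bases, a solution of the equations modulo two lifts to
  an integral solution: take the sum of the dual basis vectors that occur in its expansion.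
\<close>

lemma mod2_space_perp_span:
  fixes u :: "'d \<Rightarrow> real^'d"
  assumes "unimodular u \<xi>"
  shows "mod2_space (orthogonal_comp (span (u ` J))) = {y. \<forall>i\<in>J. bdot (mod2 (u i)) y = 0}"
proof -
  have lat: "u i \<in> lattice" "\<xi> i \<in> lattice" for i using assms by (auto simp: unimodular_def)
  have perp: "x \<in> orthogonal_comp (span (u ` J)) \<longleftrightarrow> (\<forall>i\<in>J. u i \<bullet> x = 0)" for x
  proof
    assume "x \<in> orthogonal_comp (span (u ` J))"
    then show "\<forall>i\<in>J. u i \<bullet> x = 0"
      unfolding orthogonal_comp_def orthogonal_def using span_base[of _ "u ` J"] by blast
  next
    assume x: "\<forall>i\<in>J. u i \<bullet> x = 0"
    have "orthogonal x y" if "y \<in> span (u ` J)" for y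
      by (rule orthogonal_to_span[OF that]) (use x in \<open>auto simp: orthogonal_def inner_commute\<close>)
    then show "x \<in> orthogonal_comp (span (u ` J))" by (auto simp: orthogonal_comp_def orthogonal_commute)
  qed
  show ?thesis
  proof (intro equalityI subsetI)
    fix y assume "y \<in> mod2_space (orthogonal_comp (span (u ` J)))"
    then obtain x where "x \<in> lattice" "y = mod2 x" "\<forall>i\<in>J. u i \<bullet> x = 0"
      using perp by (auto simp: mod2_space_def)
    then show "y \<in> {y. \<forall>i\<in>J. bdot (mod2 (u i)) y = 0}" using lat by (simp add: bdot_mod2)
  next
    fix y assume y: "y \<in> {y. \<forall>i\<in>J. bdot (mod2 (u i)) y = 0}"
    obtain x0 where x0: "x0 \<in> lattice" "mod2 x0 = y" using mod2_surj by blast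
    let ?S = "{i. bdot (mod2 (u i)) y = 1}"
    define x where "x = (\<Sum>i\<in>?S. \<xi> i)"
    have xl: "x \<in> lattice" unfolding x_def using lat by (intro lattice_sum)
    have "mod2 x = (\<Sum>i\<in>?S. mod2 (\<xi> i))" unfolding x_def using lat by (intro mod2_sum)
    also have "\<dots> = y" using mod2_expand[OF unimodular_commute[OF assms] x0(1)] x0(2) by simp
    finally have "mod2 x = y" .
    moreover have "u i \<bullet> x = 0" if "i \<in> J" for i
      using that y assms by (auto simp: x_def inner_sum_right unimodular_def inner_commute intro!: sum.neutral)
    ultimately show "y \<in> mod2_space (orthogonal_comp (span (u ` J)))"
      using xl perp unfolding mod2_space_def by blast
  qed
qed

lemma mod2_space_span:
  fixes u :: "'d \<Rightarrow> real^'d"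
  assumes "unimodular u \<xi>"
  shows "mod2_space (span (u ` J)) = {\<Sum>i\<in>S. mod2 (u i) |S. S \<subseteq> J}"
proof -
  have lat: "u i \<in> lattice" "\<xi> i \<in> lattice" for i using assms by (auto simp: unimodular_def)
  show ?thesis
  proof (intro equalityI subsetI)
    fix y assume "y \<in> mod2_space (span (u ` J))"
    then obtain x where x: "x \<in> lattice" "x \<in> span (u ` J)" "y = mod2 x" by (auto simp: mod2_space_def)
    have "\<xi> i \<bullet> x = 0" if "i \<notin> J" for i
    proof -
      have "orthogonal (\<xi> i) x"
        by (rule orthogonal_to_span[OF x(2)]) (use assms that in \<open>auto simp: unimodular_def orthogonal_def\<close>)
      then show ?thesis by (simp add: orthogonal_def)
    qed
    then have "{i. bdot (mod2 (\<xi> i)) (mod2 x) = 1} \<subseteq> J" using lat x(1) by (force simp: bdot_mod2)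
    then show "y \<in> {\<Sum>i\<in>S. mod2 (u i) |S. S \<subseteq> J}"
      using mod2_expand[OF assms x(1)] x(3) by blast
  next
    fix y assume "y \<in> {\<Sum>i\<in>S. mod2 (u i) |S. S \<subseteq> J}"
    then obtain S where S: "S \<subseteq> J" "y = (\<Sum>i\<in>S. mod2 (u i))" by blast
    have "(\<Sum>i\<in>S. u i) \<in> lattice \<inter> span (u ` J)"
      using S(1) lat by (intro IntI lattice_sum span_sum span_base) auto
    moreover have "y = mod2 (\<Sum>i\<in>S. u i)" using S lat by (simp add: mod2_sum)
    ultimately show "y \<in> mod2_space (span (u ` J))" unfolding mod2_space_def by blast
  qed
qed

lemma Sed_cface:
  fixes P :: "(real^'d) set"
  assumes "corner P v u \<xi>"
  shows "Sed (cface P v \<xi> I) = {y. \<forall>i. i \<notin> I \<longrightarrow> bdot (mod2 (u i)) y = 0}"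
  unfolding Sed_def tangent_cface[OF assms] mod2_space_perp_span[OF cornerD(4)[OF assms]] by auto

lemma tangent_convex_hull:
  assumes "v \<in> C"
  shows "tangent (convex hull C) = span ((\<lambda>w. w - v) ` (C - {v}))"
proof -
  have v: "v \<in> convex hull C" using assms by (simp add: hull_inc)
  have "(\<lambda>x. x - v) ` (convex hull C) \<subseteq> span ((\<lambda>w. w - v) ` (C - {v}))"
  proof -
    have "(\<lambda>x. - v + x) ` (convex hull C) = convex hull ((\<lambda>x. - v + x) ` C)"
      by (rule convex_hull_translation[symmetric])
    also have "\<dots> \<subseteq> span ((\<lambda>w. w - v) ` (C - {v}))"
    proof (rule hull_minimal)
      show "(\<lambda>x. - v + x) ` C \<subseteq> span ((\<lambda>w. w - v) ` (C - {v}))"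
      proof
        fix d assume "d \<in> (\<lambda>x. - v + x) ` C"
        then obtain w where "w \<in> C" "d = w - v" by auto
        then show "d \<in> span ((\<lambda>w. w - v) ` (C - {v}))"
          by (cases "w = v") (auto intro: span_base span_zero)
      qed
    qed (simp add: subspace_imp_convex)
    finally show ?thesis by simp
  qed
  moreover have "(\<lambda>w. w - v) ` (C - {v}) \<subseteq> span ((\<lambda>x. x - v) ` (convex hull C))"
    using hull_subset[of C convex] by (auto intro!: span_base)
  ultimately show ?thesis
    unfolding tangent_eq_span[OF v] by (meson span_minimal subspace_span subset_antisym)
qed

section \<open>Bases adapted to a cell\<close>

instance bit :: finite
proof
  have "(UNIV :: bit set) \<subseteq> {0, 1}" using bit_not_one_iff by blast
  then show "finite (UNIV :: bit set)" by (rule finite_subset) simp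
qed

lemma bit_scale: "(c::bit) *s v = (if c = 1 then v else 0)"
  by (cases c) (simp_all add: vec_eq_iff)

lemma dual_basesI:
  fixes x \<xi> :: "'d \<Rightarrow> bit^'d"
  assumes "\<And>i j. bdot (\<xi> i) (x j) = (if i = j then 1 else 0)"
  shows "dual_bases x \<xi>"
  unfolding dual_bases_def
proof (intro conjI allI)
  fix u :: "bit^'d"
  define A where "A = (\<chi> i. \<xi> i)"
  define B where "B = (\<chi> k j. x j $ k)"
  have "A ** B = mat 1"
    using assms by (simp add: A_def B_def matrix_matrix_mult_def mat_def vec_eq_iff bdot_def)
  then have "B ** A = mat 1" by (simp add: matrix_left_right_inverse)
  then have "B *v (A *v u) = u" by (simp add: matrix_vector_mul_assoc)
  then have "u $ k = (\<Sum>j\<in>UNIV. x j $ k * bdot (\<xi> j) u)" for k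
    by (simp add: vec_eq_iff A_def B_def matrix_vector_mult_def bdot_def)
  then have "u = (\<Sum>j\<in>UNIV. if bdot (\<xi> j) u = 1 then x j else 0)"
    unfolding vec_eq_iff sum_component by (auto intro!: sum.cong simp: if_distrib cong: if_cong)
  then show "u = (\<Sum>i | bdot (\<xi> i) u = 1. x i)" by (simp add: sum.If_cases)
qed (use assms in auto)

lemma dual_bases_commute: "dual_bases x \<xi> \<Longrightarrow> dual_bases \<xi> x"
  by (rule dual_basesI) (auto simp: dual_bases_def bdot_commute)

lemma dual_basesD:
  assumes "dual_bases x \<xi>"
  shows "bdot (\<xi> i) (x j) = (if i = j then 1 else 0)" "(\<Sum>i | bdot (\<xi> i) u = 1. x i) = u"
  using assms by (auto simp: dual_bases_def)

lemma bdot_scale: "bdot u (c *s v) = c * bdot u v"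
  by (simp add: bdot_def sum_distrib_left mult_ac)

text \<open>
  Here \<open>e\<close> and \<open>w\<close> come from the corner of the polytope, \<open>T\<close> indexes the facets through the cell and \<open>M\<close>
  consists of its edge vectors at one vertex, which are tangent to these facets. The independent set \<open>M\<close> is
  extended to a basis of the common kernel \<open>V\<close> of the \<open>e\<^sub>i\<close> with \<open>i \<in> T\<close>; together with the \<open>w\<^sub>i\<close>, \<open>i \<in> T\<close>,
  this is a basis \<open>\<xi>\<close>. Its dual basis satisfies \<open>x\<^sub>i = e\<^sub>i\<close> for \<open>i \<in> T\<close>, so that the coordinate subspaces
  for \<open>I \<subseteq> T\<close>, which are spanned by the \<open>x\<^sub>i\<close> with \<open>i \<in> I\<close>, are the same in both bases.
\<close>

proposition adapted_bases:
  fixes e w :: "'d \<Rightarrow> bit^'d"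
  assumes ew: "dual_bases w e"
    and MT: "\<And>m i. m \<in> M \<Longrightarrow> i \<in> T \<Longrightarrow> bdot (e i) m = 0"
    and ind: "\<And>S. S \<subseteq> M \<Longrightarrow> \<Sum>S = 0 \<Longrightarrow> S = {}"
  obtains x \<xi> A where "dual_bases x \<xi>" "A \<inter> T = {}" "bij_betw \<xi> A M"
    "\<And>I. I \<subseteq> T \<Longrightarrow> {z. \<forall>i. i \<notin> I \<longrightarrow> bdot (\<xi> i) z = 0} = {z. \<forall>i. i \<notin> I \<longrightarrow> bdot (w i) z = 0}"
proof -
  define V where "V = {y. \<forall>i\<in>T. bdot (e i) y = 0}"
  note d = dual_basesD(1)[OF ew]
  have M: "vec.independent M"
    unfolding vec.independent_explicit_finite_subsets
  proof (intro allI impI ballI)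
    fix S :: "(bit^'d) set" and c m assume S: "S \<subseteq> M" "finite S" "(\<Sum>v\<in>S. c v *s v) = 0" "m \<in> S"
    have "(\<Sum>v\<in>S. c v *s v) = \<Sum>{v \<in> S. c v = 1}"
      using S(2) by (simp add: bit_scale sum.If_cases Int_def)
    then have "{v \<in> S. c v = 1} = {}" using S(1,3) by (intro ind) auto
    then show "c m = 0" using S(4) by auto
  qed
  have MV: "M \<subseteq> V" using MT by (auto simp: V_def)
  obtain B where B: "M \<subseteq> B" "B \<subseteq> V" "vec.independent B" "V \<subseteq> vec.span B"
    using vec.maximal_independent_subset_extend[OF MV M] by blast
  have inj: "inj w" by (rule injI) (metis d zero_neq_one)
  \<comment> \<open>\<open>V\<close> has the basis \<open>w\<^sub>i\<close> with \<open>i\<close> outside \<open>T\<close>, whose cardinality is needed to index \<open>B\<close>\<close>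
  have "card (w ` (- T)) = vec.dim V"
  proof (rule vec.basis_card_eq_dim)
    show "w ` (- T) \<subseteq> V" using d by (auto simp: V_def)
    show "V \<subseteq> vec.span (w ` (- T))"
    proof
      fix y assume "y \<in> V"
      then have "{i. bdot (e i) y = 1} \<subseteq> - T" by (auto simp: V_def)
      then have "(\<Sum>i | bdot (e i) y = 1. w i) \<in> vec.span (w ` (- T))"
        by (intro vec.span_sum vec.span_base) auto
      then show "y \<in> vec.span (w ` (- T))" using dual_basesD(2)[OF ew] by simp
    qed
    show "vec.independent (w ` (- T))"
      unfolding vec.independent_explicit_finite_subsets
    proof (intro allI impI ballI)
      fix S :: "(bit^'d) set" and c v assume S: "S \<subseteq> w ` (- T)" "finite S" "(\<Sum>v\<in>S. c v *s v) = 0" "v \<in> S"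
      obtain i where i: "v = w i" using S(1,4) by blast
      have "0 = bdot (e i) (\<Sum>v\<in>S. c v *s v)" using S(3) by simp
      also have "\<dots> = (\<Sum>v'\<in>S. if v' = v then c v else 0)"
        unfolding bdot_sum_right bdot_scale
      proof (rule sum.cong[OF refl])
        fix v' assume "v' \<in> S"
        then obtain j where "v' = w j" using S(1) by blast
        then show "c v' * bdot (e i) v' = (if v' = v then c v else 0)" using i d inj by (auto dest: injD)
      qed
      also have "\<dots> = c v" using S(2,4) by simp
      finally show "c v = 0" by simp
    qed
  qed
  moreover have "card B = vec.dim V" using vec.basis_card_eq_dim B by blast
  moreover have "finite B" by simp
  ultimately have "card (- T) = card B" using inj by (simp add: card_image inj_on_subset)
  then obtain \<beta> where \<beta>: "bij_betw \<beta> (- T) B" by (metis finite_same_card_bij finite)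
  define \<xi> where "\<xi> i = (if i \<in> T then w i else \<beta> i)" for i
  have \<beta>B: "\<beta> i \<in> B" if "i \<notin> T" for i using \<beta> that by (auto simp: bij_betw_def)
  have e\<xi>: "bdot (e j) (\<xi> i) = (if i = j then 1 else 0)" if "j \<in> T" for i j
    using that \<beta>B[of i] B(2) d by (auto simp: \<xi>_def V_def)
  \<comment> \<open>applying \<open>e\<^sub>j\<close> isolates the coefficients in \<open>T\<close>; the others vanish since \<open>B\<close> is independent\<close>
  have rows: "\<forall>i. c i = 0" if c: "(\<Sum>i\<in>UNIV. c i *s \<xi> i) = 0" for c
  proof -
    have T0: "c j = 0" if "j \<in> T" for j
    proof -
      have "0 = bdot (e j) (\<Sum>i\<in>UNIV. c i *s \<xi> i)" using c by simp
      also have "\<dots> = (\<Sum>i\<in>UNIV. if i = j then c i else 0)"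
        unfolding bdot_sum_right bdot_scale using e\<xi>[OF that] by (intro sum.cong) auto
      also have "\<dots> = c j" by simp
      finally show ?thesis by simp
    qed
    have "0 = (\<Sum>i\<in>UNIV. c i *s \<xi> i)" using c by simp
    also have "\<dots> = (\<Sum>i\<in>- T. c i *s \<beta> i)"
      using T0 by (intro sum.mono_neutral_cong_right) (auto simp: \<xi>_def bit_scale)
    also have "\<dots> = (\<Sum>b\<in>B. c (inv_into (- T) \<beta> b) *s b)"
      using \<beta> by (intro sum.reindex_bij_witness[of _ "inv_into (- T) \<beta>" \<beta>])
        (auto simp: bij_betw_def inv_into_into f_inv_into_f)
    finally have z: "(\<Sum>b\<in>B. c (inv_into (- T) \<beta> b) *s b) = 0" by simp
    have "c i = 0" if "i \<notin> T" for i
    proof -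
      have "c (inv_into (- T) \<beta> (\<beta> i)) = 0"
        by (rule vec.independentD[OF B(3) \<open>finite B\<close> subset_refl z \<beta>B[OF that]])
      then show ?thesis using \<beta> that by (simp add: bij_betw_def)
    qed
    then show ?thesis using T0 by blast
  qed
  define Y where "Y = (\<chi> i. \<xi> i)"
  have "\<exists>X. Y ** X = mat 1"
    unfolding matrix_right_invertible_independent_rows using rows by (simp add: Y_def row_def)
  then obtain X where X: "Y ** X = mat 1" by blast
  define x where "x j = (\<chi> k. X $ k $ j)" for j
  have "bdot (\<xi> i) (x j) = (if i = j then 1 else 0)" for i j
    using arg_cong[OF X, of "\<lambda>M. M $ i $ j"]
    by (simp add: bdot_def Y_def x_def matrix_matrix_mult_def mat_def)
  then have x\<xi>: "dual_bases x \<xi>" by (rule dual_basesI)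
  define A where "A = {i. i \<notin> T \<and> \<beta> i \<in> M}"
  show thesis
  proof
    show "dual_bases x \<xi>" by (rule x\<xi>)
    show "A \<inter> T = {}" by (auto simp: A_def)
    have "inj_on \<xi> A" using \<beta> by (auto simp: A_def \<xi>_def bij_betw_def inj_on_def)
    moreover have "\<xi> ` A = M"
    proof
      show "M \<subseteq> \<xi> ` A"
      proof
        fix m assume "m \<in> M"
        then obtain i where "i \<notin> T" "m = \<beta> i" using \<beta> B(1) unfolding bij_betw_def by (metis ComplD imageE subsetD)
        then show "m \<in> \<xi> ` A" using \<open>m \<in> M\<close> by (auto simp: A_def \<xi>_def image_iff)
      qed
    qed (auto simp: A_def \<xi>_def)
    ultimately show "bij_betw \<xi> A M" by (simp add: bij_betw_def)
    fix I assume I: "I \<subseteq> T"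
    have xe: "x j = e j" if "j \<in> T" for j
    proof -
      have "bdot (\<xi> i) (e j) = bdot (\<xi> i) (x j)" for i
        using e\<xi>[OF that, of i] dual_basesD(1)[OF x\<xi>, of i j] by (simp add: bdot_commute)
      then have "(\<Sum>i | bdot (\<xi> i) (e j) = 1. x i) = (\<Sum>i | bdot (\<xi> i) (x j) = 1. x i)" by (simp only:)
      then show ?thesis unfolding dual_basesD(2)[OF x\<xi>] by (rule sym)
    qed
    have exp: "bdot y z = 0" if "\<And>i. i \<notin> I \<Longrightarrow> bdot (f i) z = 0" "\<And>i. i \<in> I \<Longrightarrow> bdot (g i) y = 0" "dual_bases f g"
      for f g y z
    proof -
      have "bdot y z = bdot (\<Sum>i | bdot (g i) y = 1. f i) z" using dual_basesD(2)[OF that(3)] by simp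
      also have "\<dots> = (\<Sum>i | bdot (g i) y = 1. bdot (f i) z)" by (simp add: bdot_commute[of _ z] bdot_sum_right)
      also have "\<dots> = 0"
      proof (intro sum.neutral ballI)
        fix i assume "i \<in> {i. bdot (g i) y = 1}"
        then have "i \<notin> I" using that(2)[of i] by auto
        then show "bdot (f i) z = 0" by (rule that(1))
      qed
      finally show ?thesis .
    qed
    show "{z. \<forall>i. i \<notin> I \<longrightarrow> bdot (\<xi> i) z = 0} = {z. \<forall>i. i \<notin> I \<longrightarrow> bdot (w i) z = 0}"
    proof (intro equalityI subsetI CollectI allI impI)
      fix z i assume z: "z \<in> {z. \<forall>i. i \<notin> I \<longrightarrow> bdot (\<xi> i) z = 0}" and i: "i \<notin> I"
      show "bdot (w i) z = 0"
        by (rule exp[OF _ _ dual_bases_commute[OF x\<xi>]]) (use z i I xe d in auto)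
    next
      fix z i assume z: "z \<in> {z. \<forall>i. i \<notin> I \<longrightarrow> bdot (w i) z = 0}" and i: "i \<notin> I"
      show "bdot (\<xi> i) z = 0"
        by (rule exp[OF _ _ ew]) (use z i I e\<xi> in auto)
    qed
  qed
qed

section \<open>Local structure at a cell\<close>

text \<open>
  The edge vectors of \<open>\<sigma>\<close> modulo two, viewed as the normals of the hyperplanes of \<open>N\<^sub>2\<close> that define the
  stalk of \<open>X\<close>.
\<close>

definition edge_normals :: "(real^'d) set \<Rightarrow> (bit^'d) set" where
  "edge_normals \<sigma> = {mod2 (b - a) |a b. a \<in> verts \<sigma> \<and> b \<in> verts \<sigma> \<and> a \<noteq> b}"

locale smooth_triangulation =
  fixes P :: "(real^'d) set" and K :: "(real^'d) set set"
  assumes smooth: "smooth_polytope P" and prim: "primitive_triangulation P K"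
begin

lemma complex: "simplicial_complex K" and union: "\<Union>K = P"
  and verts_lattice: "\<sigma> \<in> K \<Longrightarrow> verts \<sigma> \<subseteq> lattice"
  using prim by (auto simp: primitive_triangulation_def)

lemma finite_K: "finite K"
  using complex by (simp add: simplicial_complex_def)

lemma polytope_P: "polytope P"
  using smooth by (auto simp: smooth_polytope_def simple_polytope_def)

lemma convex_P: "convex P"
  using polytope_P polytope_imp_convex by blast

lemma aff_dim_P: "aff_dim P = int CARD('d)"
  using smooth by (simp add: smooth_polytope_def)

lemma simplexK:
  assumes "\<sigma> \<in> K"
  shows "\<sigma> = convex hull (verts \<sigma>)" "\<not> affine_dependent (verts \<sigma>)" "finite (verts \<sigma>)"
    "int (card (verts \<sigma>)) = aff_dim \<sigma> + 1" "convex \<sigma>" "\<sigma> \<subseteq> P"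
proof -
  obtain n where n: "n simplex \<sigma>" using simplicial_complexD(1)[OF complex assms] by blast
  note V = simplex_verts[OF n]
  show "\<sigma> = convex hull (verts \<sigma>)" using V(1) .
  show "\<not> affine_dependent (verts \<sigma>)" "finite (verts \<sigma>)"
    "int (card (verts \<sigma>)) = aff_dim \<sigma> + 1" using V by auto
  show "convex \<sigma>" using n convex_simplex by blast
  show "\<sigma> \<subseteq> P" using assms union by blast
qed

lemma verts_nonempty: "\<sigma> \<in> K \<Longrightarrow> \<sigma> \<noteq> {} \<Longrightarrow> verts \<sigma> \<noteq> {}"
  using simplexK(1) by (metis convex_hull_empty)

text \<open>
  Take \<open>v\<close> to be a vertex of the smallest face containing \<open>\<sigma>\<close>.
\<close>

lemma cell_corner:
  assumes "\<sigma> \<in> K" "\<sigma> \<noteq> {}"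
  obtains v u \<xi> where "corner P v u \<xi>" "\<And>Q. Q face_of P \<Longrightarrow> \<sigma> \<subseteq> Q \<Longrightarrow> v \<in> Q"
proof -
  obtain F where F: "F face_of P" "\<sigma> \<subseteq> F" "\<And>Q. Q face_of P \<Longrightarrow> \<sigma> \<subseteq> Q \<Longrightarrow> F \<subseteq> Q"
    using polytope_minimal_face[OF polytope_P simplexK(5)[OF assms(1)] assms(2) simplexK(6)[OF assms(1)]] by metis
  have "polytope F" using face_of_polytope_polytope[OF polytope_P F(1)] .
  then obtain v where v: "v extreme_point_of F"
    using extreme_point_exists_convex[of F] F(2) assms(2) polytope_imp_compact polytope_imp_convex by blast
  then have "v extreme_point_of P" using extreme_point_of_face[OF F(1)] by blast
  then obtain u \<xi> where "corner P v u \<xi>" using smooth_polytope_corner[OF smooth] by blast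
  moreover have "v \<in> F" using v by (simp add: extreme_point_of_def)
  ultimately show thesis using that F(3) by blast
qed

text \<open>
  Primitivity makes the edge vectors at \<open>v0\<close> part of a lattice basis, and reduction modulo two is
  faithful on coordinate subspaces of a lattice basis.
\<close>

lemma vertex_differences:
  assumes "\<sigma> \<in> K" "v0 \<in> verts \<sigma>"
  defines "M \<equiv> (\<lambda>w. mod2 (w - v0)) ` (verts \<sigma> - {v0})"
  shows "inj_on (\<lambda>w. mod2 (w - v0)) (verts \<sigma> - {v0})"
    "\<And>S. S \<subseteq> M \<Longrightarrow> \<Sum>S = 0 \<Longrightarrow> S = {}"
    "mod2_space (tangent \<sigma>) = {\<Sum>i\<in>S. i |S. S \<subseteq> M}"
    "\<And>w. w \<in> verts \<sigma> - {v0} \<Longrightarrow>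
       mod2_space (orthogonal_comp (tangent (closed_segment v0 w))) = {y. bdot (mod2 (w - v0)) y = 0}"
proof -
  obtain u \<xi> where u: "unimodular u \<xi>" "\<forall>w\<in>verts \<sigma> - {v0}. \<exists>j. w - v0 = u (j :: 'd)"
    using primitive_triangulation_verts[OF prim assms(1,2)] by blast
  obtain j where j: "\<And>w. w \<in> verts \<sigma> - {v0} \<Longrightarrow> w - v0 = u (j w)" using u(2) by metis
  have injj: "inj_on j (verts \<sigma> - {v0})" by (rule inj_onI) (metis j diff_add_cancel)
  let ?J = "j ` (verts \<sigma> - {v0})"
  note d = mod2_unimodular[OF u(1)]
  have inju: "inj (\<lambda>i. mod2 (u i))" by (rule injI) (metis d zero_neq_one)
  have meq: "mod2 (w - v0) = mod2 (u (j w))" if "w \<in> verts \<sigma> - {v0}" for w using j[OF that] by simp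
  have M: "M = (\<lambda>i. mod2 (u i)) ` ?J" unfolding M_def image_image using meq by (intro image_cong) auto
  show "inj_on (\<lambda>w. mod2 (w - v0)) (verts \<sigma> - {v0})"
    by (rule inj_onI) (metis meq inju injj injD inj_onD)
  show "S = {}" if S: "S \<subseteq> M" "\<Sum>S = 0" for S
  proof (rule ccontr)
    assume "S \<noteq> {}"
    then obtain i where i: "mod2 (u i) \<in> S" using S(1) M by blast
    have "0 = bdot (mod2 (\<xi> i)) (\<Sum>S)" using S(2) by simp
    also have "\<dots> = (\<Sum>m\<in>S. if m = mod2 (u i) then 1 else 0)"
      unfolding bdot_sum_right
    proof (rule sum.cong[OF refl])
      fix m assume "m \<in> S"
      then obtain i' where "m = mod2 (u i')" using S(1) M by blast
      then show "bdot (mod2 (\<xi> i)) m = (if m = mod2 (u i) then 1 else 0)" using d inju by (auto dest: injD)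
    qed
    also have "\<dots> = 1" using i by simp
    finally show False by simp
  qed
  have tan: "tangent \<sigma> = span (u ` ?J)"
  proof -
    have "tangent \<sigma> = tangent (convex hull (verts \<sigma>))" using simplexK(1)[OF assms(1)] by simp
    also have "\<dots> = span ((\<lambda>w. w - v0) ` (verts \<sigma> - {v0}))" by (rule tangent_convex_hull[OF assms(2)])
    also have "(\<lambda>w. w - v0) ` (verts \<sigma> - {v0}) = u ` ?J"
      unfolding image_image using j by (intro image_cong) auto
    finally show ?thesis .
  qed
  show "mod2_space (tangent \<sigma>) = {\<Sum>i\<in>S. i |S. S \<subseteq> M}"
    unfolding tan mod2_space_span[OF u(1)]
  proof (intro equalityI subsetI)
    fix y assume "y \<in> {\<Sum>i\<in>S. mod2 (u i) |S. S \<subseteq> ?J}"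
    then obtain S where S: "S \<subseteq> ?J" "y = (\<Sum>i\<in>S. mod2 (u i))" by blast
    then have "y = \<Sum>((\<lambda>i. mod2 (u i)) ` S)" using inj_on_subset[OF inju] by (simp add: sum.reindex)
    moreover have "(\<lambda>i. mod2 (u i)) ` S \<subseteq> M" unfolding M using S(1) by blast
    ultimately show "y \<in> {\<Sum>i\<in>S. i |S. S \<subseteq> M}" by blast
  next
    fix y assume "y \<in> {\<Sum>i\<in>S. i |S. S \<subseteq> M}"
    then obtain S where "S \<subseteq> M" "y = \<Sum>S" by blast
    then obtain S' where S': "S' \<subseteq> ?J" "S = (\<lambda>i. mod2 (u i)) ` S'" unfolding M by (auto simp: subset_image_iff)
    then have "y = (\<Sum>i\<in>S'. mod2 (u i))"
      using \<open>y = \<Sum>S\<close> inj_on_subset[OF inju] by (simp add: sum.reindex)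
    then show "y \<in> {\<Sum>i\<in>S. mod2 (u i) |S. S \<subseteq> ?J}" using S'(1) by blast
  qed
  fix w assume w: "w \<in> verts \<sigma> - {v0}"
  have "tangent (closed_segment v0 w) = span ((\<lambda>w. w - v0) ` ({v0, w} - {v0}))"
    unfolding segment_convex_hull by (rule tangent_convex_hull) simp
  also have "(\<lambda>w. w - v0) ` ({v0, w} - {v0}) = u ` {j w}" using w j[OF w] by auto
  finally have "tangent (closed_segment v0 w) = span (u ` {j w})" .
  then show "mod2_space (orthogonal_comp (tangent (closed_segment v0 w))) = {y. bdot (mod2 (w - v0)) y = 0}"
    using mod2_space_perp_span[OF u(1), of "{j w}"] meq[OF w] by simp
qed

text \<open>
  Coordinates adapted to \<open>\<sigma>\<close>. The set \<open>T\<close> indexes the facets of \<open>P\<close> that contain \<open>\<sigma>\<close>, and \<open>Qf I\<close> is the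
  intersection of those in \<open>I\<close>; every face containing \<open>\<sigma>\<close> is of this form. The basis vectors \<open>\<xi> a\<close> with
  \<open>a \<in> A\<close> are the edges of \<open>\<sigma>\<close> at one of its vertices; every other edge is a difference of two of
  them.
\<close>

definition cell_chart :: "(real^'d) set \<Rightarrow> 'd set \<Rightarrow> 'd set \<Rightarrow> ('d \<Rightarrow> bit^'d) \<Rightarrow> ('d \<Rightarrow> bit^'d) \<Rightarrow>
    ('d set \<Rightarrow> (real^'d) set) \<Rightarrow> bool" where
  "cell_chart \<sigma> T A x \<xi> Qf \<longleftrightarrow> dual_bases x \<xi> \<and> A \<inter> T = {} \<and> int (card A) = aff_dim \<sigma> \<and>
     {Q. Q face_of P \<and> \<sigma> \<subseteq> Q} = Qf ` Pow T \<and> Qf {} = P \<and>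
     (\<forall>I\<subseteq>T. aff_dim (Qf I) = int CARD('d) - int (card I) \<and> addsub (Sed (Qf I)) \<and>
        Sed (Qf I) = {z. \<forall>i. i \<notin> I \<longrightarrow> bdot (\<xi> i) z = 0}) \<and>
     (\<forall>I\<subseteq>T. \<forall>I'\<subseteq>T. Qf I \<subseteq> Qf I' \<longleftrightarrow> I' \<subseteq> I) \<and>
     (\<forall>a\<in>A. \<xi> a \<in> edge_normals \<sigma>) \<and>
     (\<forall>m\<in>edge_normals \<sigma>. (\<exists>a\<in>A. m = \<xi> a) \<or> (\<exists>a\<in>A. \<exists>b\<in>A. a \<noteq> b \<and> m = \<xi> a + \<xi> b)) \<and>
     mod2_space (tangent \<sigma>) = {\<Sum>i\<in>S. \<xi> i |S. S \<subseteq> A}"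

proposition cell_chart_exists:
  assumes \<sigma>: "\<sigma> \<in> K" "\<sigma> \<noteq> {}"
  shows "\<exists>T A x \<xi> Qf. cell_chart \<sigma> T A x \<xi> Qf"
proof -
  obtain v u \<zeta> where c: "corner P v u \<zeta>" and vQ: "\<And>Q. Q face_of P \<Longrightarrow> \<sigma> \<subseteq> Q \<Longrightarrow> v \<in> Q"
    using cell_corner[OF \<sigma>] by metis
  note U = cornerD(4)[OF c]
  define T where "T = {i. \<forall>x\<in>\<sigma>. \<zeta> i \<bullet> (x - v) = 0}"
  obtain v0 where v0: "v0 \<in> verts \<sigma>" using verts_nonempty[OF \<sigma>] by blast
  define M where "M = (\<lambda>w. mod2 (w - v0)) ` (verts \<sigma> - {v0})"
  note D = vertex_differences[OF \<sigma>(1) v0, folded M_def]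
  have lat: "w \<in> lattice" "w \<in> \<sigma>" if "w \<in> verts \<sigma>" for w
    using that verts_lattice[OF \<sigma>(1)] by (auto simp: extreme_point_of_def)
  have latz: "\<zeta> i \<in> lattice" "u i \<in> lattice" for i using U by (auto simp: unimodular_def)
  have "dual_bases (\<lambda>i. mod2 (u i)) (\<lambda>i. mod2 (\<zeta> i))"
    by (rule dual_basesI) (rule mod2_unimodular[OF U])
  then obtain x \<xi> A where x: "dual_bases x \<xi>" "A \<inter> T = {}" "bij_betw \<xi> A M"
    "\<And>I. I \<subseteq> T \<Longrightarrow> {z. \<forall>i. i \<notin> I \<longrightarrow> bdot (\<xi> i) z = 0} = {z. \<forall>i. i \<notin> I \<longrightarrow> bdot (mod2 (u i)) z = 0}"
  proof (rule adapted_bases[of _ _ M T])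
    fix m i assume "m \<in> M" "i \<in> T"
    then obtain w where w: "w \<in> verts \<sigma>" "m = mod2 (w - v0)" by (auto simp: M_def)
    have "\<zeta> i \<bullet> (w - v0) = \<zeta> i \<bullet> (w - v) - \<zeta> i \<bullet> (v0 - v)" by (simp add: inner_diff_right)
    also have "\<dots> = 0" using \<open>i \<in> T\<close> lat(2) w(1) v0 by (auto simp: T_def)
    finally show "bdot (mod2 (\<zeta> i)) m = 0"
      using lat(1) w v0 latz by (simp add: bdot_mod2 lattice_diff)
  qed (use D(2) in blast)+
  let ?Qf = "cface P v \<zeta>"
  have "cell_chart \<sigma> T A x \<xi> ?Qf"
    unfolding cell_chart_def
  proof (intro conjI allI impI ballI)
    show "dual_bases x \<xi>" "A \<inter> T = {}" by fact+
    have "card A = card (verts \<sigma>) - 1"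
      using bij_betw_same_card[OF x(3)] D(1) v0 simplexK(3)[OF \<sigma>(1)] by (simp add: M_def card_image)
    moreover have "0 < card (verts \<sigma>)" using v0 simplexK(3)[OF \<sigma>(1)] card_gt_0_iff by blast
    ultimately show "int (card A) = aff_dim \<sigma>" using simplexK(4)[OF \<sigma>(1)] by linarith
    show "{Q. Q face_of P \<and> \<sigma> \<subseteq> Q} = ?Qf ` Pow T"
    proof (intro equalityI subsetI)
      fix Q assume "Q \<in> {Q. Q face_of P \<and> \<sigma> \<subseteq> Q}"
      then have Q: "Q face_of P" "\<sigma> \<subseteq> Q" by auto
      have "Q = ?Qf {i. \<forall>x\<in>Q. \<zeta> i \<bullet> (x - v) = 0}" by (rule face_eq_cface[OF c Q(1) vQ[OF Q]])
      moreover have "{i. \<forall>x\<in>Q. \<zeta> i \<bullet> (x - v) = 0} \<subseteq> T" using Q(2) by (auto simp: T_def)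
      ultimately show "Q \<in> ?Qf ` Pow T" by blast
    next
      fix Q assume "Q \<in> ?Qf ` Pow T"
      then obtain I where "I \<subseteq> T" "Q = ?Qf I" by blast
      then show "Q \<in> {Q. Q face_of P \<and> \<sigma> \<subseteq> Q}"
        using cface_face[OF c, of I] simplexK(6)[OF \<sigma>(1)] by (auto simp: T_def cface_def)
    qed
    show "?Qf {} = P" by (simp add: cface_def)
    fix I assume I: "I \<subseteq> T"
    show "aff_dim (?Qf I) = int CARD('d) - int (card I)" by (rule aff_dim_cface[OF c])
    show "Sed (?Qf I) = {z. \<forall>i. i \<notin> I \<longrightarrow> bdot (\<xi> i) z = 0}"
      using Sed_cface[OF c, of I] x(4)[OF I] by simp
    then show "addsub (Sed (?Qf I))" by (auto simp: addsub_def bdot_add_right)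
  next
    fix I I' assume "I \<subseteq> T" "I' \<subseteq> T"
    show "(?Qf I \<subseteq> ?Qf I') = (I' \<subseteq> I)" by (rule cface_subset_iff[OF c])
  next
    fix a assume "a \<in> A"
    then have "\<xi> a \<in> M" using x(3) by (auto simp: bij_betw_def)
    then show "\<xi> a \<in> edge_normals \<sigma>" using v0 by (auto simp: M_def edge_normals_def)
  next
    fix m assume "m \<in> edge_normals \<sigma>"
    then obtain a b where ab: "a \<in> verts \<sigma>" "b \<in> verts \<sigma>" "a \<noteq> b" "m = mod2 (b - a)"
      by (auto simp: edge_normals_def)
    have inM: "\<exists>i\<in>A. mod2 (w - v0) = \<xi> i" if "w \<in> verts \<sigma>" "w \<noteq> v0" for w
      using x(3) that by (auto simp: bij_betw_def M_def image_iff)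
    have m: "m = mod2 (b - v0) + mod2 (a - v0)"
    proof -
      have "m = mod2 ((b - v0) - (a - v0))" using ab(4) by simp
      also have "\<dots> = mod2 (b - v0) + mod2 (a - v0)"
        using ab lat(1) v0 by (intro mod2_diff lattice_diff) auto
      finally show ?thesis .
    qed
    show "(\<exists>a\<in>A. m = \<xi> a) \<or> (\<exists>a\<in>A. \<exists>b\<in>A. a \<noteq> b \<and> m = \<xi> a + \<xi> b)"
    proof (cases "a = v0 \<or> b = v0")
      case True
      then show ?thesis using m inM[OF ab(1)] inM[OF ab(2)] ab(3) by auto
    next
      case False
      obtain i j where ij: "i \<in> A" "j \<in> A" "mod2 (b - v0) = \<xi> i" "mod2 (a - v0) = \<xi> j"
        using inM ab False by metis
      moreover have "i \<noteq> j" using ij D(1) ab False by (auto simp: inj_on_def)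
      ultimately show ?thesis using m by auto
    qed
  next
    show "mod2_space (tangent \<sigma>) = {\<Sum>i\<in>S. \<xi> i |S. S \<subseteq> A}"
      unfolding D(3)
    proof (intro equalityI subsetI)
      fix y assume "y \<in> {\<Sum>i\<in>S. i |S. S \<subseteq> M}"
      then obtain S where "S \<subseteq> M" "y = \<Sum>S" by blast
      moreover obtain S' where S': "S' \<subseteq> A" "S = \<xi> ` S'"
        using \<open>S \<subseteq> M\<close> x(3) by (auto simp: subset_image_iff bij_betw_def)
      moreover have "inj_on \<xi> S'" using x(3) S'(1) by (auto simp: bij_betw_def intro: inj_on_subset)
      ultimately show "y \<in> {\<Sum>i\<in>S. \<xi> i |S. S \<subseteq> A}" by (auto simp: sum.reindex)
    next
      fix y assume "y \<in> {\<Sum>i\<in>S. \<xi> i |S. S \<subseteq> A}"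
      then obtain S where S: "S \<subseteq> A" "y = (\<Sum>i\<in>S. \<xi> i)" by blast
      have "inj_on \<xi> S" using x(3) S(1) by (auto simp: bij_betw_def intro: inj_on_subset)
      then have "y = \<Sum>(\<xi> ` S)" using S(2) by (simp add: sum.reindex)
      moreover have "\<xi> ` S \<subseteq> M" using S(1) x(3) by (auto simp: bij_betw_def)
      ultimately show "y \<in> {\<Sum>i\<in>S. i |S. S \<subseteq> M}" by blast
    qed
  qed
  then show ?thesis by blast
qed

end

section \<open>Homology of presented cosheaves\<close>

text \<open>
  All stalks are presented in one ambient group and the transition maps are induced by its
  identity (\<open>transitions\<close>). Hence the boundary can be computed in the ambient group, and the cosheaf
  enters only through \<open>R\<close> and \<open>N\<close>.
\<close>

locale presented_cosheaf =
  fixes F :: "('e, 'a) cosheaf" and h :: "'e \<Rightarrow> 'v::char2 \<Rightarrow> 'a" and R N :: "'e \<Rightarrow> 'v set"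
  assumes finite_cells: "finite (cells F)"
    and stalks: "\<And>e. e \<in> cells F \<Longrightarrow> presents (h e) (R e) (N e) (stalk F e)"
    and restrict_R: "\<And>e e'. e \<in> cells F \<Longrightarrow> e' \<in> cells F \<Longrightarrow> face F e' e \<Longrightarrow> R e \<subseteq> R e'"
    and restrict_N: "\<And>e e'. e \<in> cells F \<Longrightarrow> e' \<in> cells F \<Longrightarrow> face F e' e \<Longrightarrow> N e \<subseteq> N e'"
    and transitions: "\<And>e e' c. e \<in> cells F \<Longrightarrow> e' \<in> cells F \<Longrightarrow> face F e' e \<Longrightarrow> c \<in> R e \<Longrightarrow>
      transition F e e' (h e c) = h e' c"
begin

definition lifts :: "int \<Rightarrow> ('e \<Rightarrow> 'v) set" where
  "lifts q = {c. \<forall>e\<in>cells_of_dim F q. c e \<in> R e}"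

definition null :: "int \<Rightarrow> ('e \<Rightarrow> 'v) set" where
  "null q = {c. \<forall>e\<in>cells_of_dim F q. c e \<in> N e}"

definition chain :: "int \<Rightarrow> ('e \<Rightarrow> 'v) \<Rightarrow> ('e \<Rightarrow> 'a)" where
  "chain q c = (\<lambda>e\<in>cells_of_dim F q. h e (c e))"

definition bd :: "int \<Rightarrow> ('e \<Rightarrow> 'v) \<Rightarrow> ('e \<Rightarrow> 'v)" where
  "bd q c e' = (\<Sum>e | e \<in> cells_of_dim F q \<and> face F e' e. c e)"

lemma cells_of_dimD: "e \<in> cells_of_dim F q \<Longrightarrow> e \<in> cells F"
  by (simp add: cells_of_dim_def)

lemma finite_cells_of_dim: "finite (cells_of_dim F q)"
  using finite_cells by (simp add: cells_of_dim_def)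

lemma presents_chain: "presents (chain q) (lifts q) (null q) (chain_group F q)"
  unfolding chain_def lifts_def null_def chain_group_def
  using presents_sum_group[OF finite_cells_of_dim stalks[OF cells_of_dimD]] by simp

lemma bd_add: "bd q (c + d) = bd q c + bd q d"
  by (simp add: bd_def sum.distrib fun_eq_iff)

lemma bd_0 [simp]: "bd q 0 = 0"
  by (simp add: bd_def fun_eq_iff)

lemma addsub_lifts: "addsub (lifts q)" and addsub_null_lifts: "addsub (null q \<inter> lifts q)"
  using presentsD(1)[OF presents_chain] presents_addsub_kernel[OF presents_chain] by auto

lemma bd_lifts:
  assumes "c \<in> lifts q"
  shows "bd q c \<in> lifts (q - 1)"
  unfolding lifts_def
proof (intro CollectI ballI)
  fix e' assume e': "e' \<in> cells_of_dim F (q - 1)"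
  show "bd q c e' \<in> R e'"
    unfolding bd_def
  proof (rule addsub_sum)
    show "addsub (R e')" using presentsD(1)[OF stalks[OF cells_of_dimD[OF e']]] .
    fix e assume "e \<in> {e \<in> cells_of_dim F q. face F e' e}"
    then show "c e \<in> R e'" using assms restrict_R[of e e'] e' by (auto simp: lifts_def cells_of_dim_def)
  qed
qed

lemma boundary_chain:
  assumes "c \<in> lifts q"
  shows "boundary F q (chain q c) = chain (q - 1) (bd q c)"
proof -
  have "finprod (stalk F e') (\<lambda>e. transition F e e' (chain q c e)) {e \<in> cells_of_dim F q. face F e' e} = h e' (bd q c e')"
    if e': "e' \<in> cells_of_dim F (q - 1)" for e'
  proof -
    note P = stalks[OF cells_of_dimD[OF e']]
    interpret comm_group "stalk F e'" using presentsD(2)[OF P] .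
    have cR: "c e \<in> R e'" "transition F e e' (chain q c e) = h e' (c e)"
      if "e \<in> {e \<in> cells_of_dim F q. face F e' e}" for e
    proof -
      have e: "e \<in> cells F" "e \<in> cells_of_dim F q" "face F e' e" using that by (auto simp: cells_of_dim_def)
      have "c e \<in> R e" using assms e(2) by (auto simp: lifts_def)
      then show "c e \<in> R e'" "transition F e e' (chain q c e) = h e' (c e)"
        using restrict_R[OF e(1) cells_of_dimD[OF e'] e(3)] transitions[OF e(1) cells_of_dimD[OF e'] e(3)] e(2)
        by (auto simp: chain_def)
    qed
    have "finprod (stalk F e') (\<lambda>e. transition F e e' (chain q c e)) {e \<in> cells_of_dim F q. face F e' e} =
      finprod (stalk F e') (\<lambda>e. h e' (c e)) {e \<in> cells_of_dim F q. face F e' e}"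
      using cR presentsD(5)[OF P] by (intro finprod_cong) (auto simp: Pi_iff simp_implies_def)
    also have "\<dots> = h e' (bd q c e')"
      unfolding bd_def using cR(1) by (intro presents_finprod[OF P]) auto
    finally show ?thesis .
  qed
  then show ?thesis unfolding boundary_def chain_def[of "q - 1"] by (intro restrict_ext) auto
qed

definition cycle_lifts :: "int \<Rightarrow> ('e \<Rightarrow> 'v) set" where
  "cycle_lifts q = {c \<in> lifts q. bd q c \<in> null (q - 1)}"

definition boundary_lifts :: "int \<Rightarrow> ('e \<Rightarrow> 'v) set" where
  "boundary_lifts q = {c \<in> lifts q. \<exists>a\<in>lifts (q + 1). c + bd (q + 1) a \<in> null q}"

definition hclass :: "int \<Rightarrow> ('e \<Rightarrow> 'v) \<Rightarrow> ('e \<Rightarrow> 'a) set" where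
  "hclass q c = homology_class F q (chain q c)"

lemma bd_null:
  assumes "c \<in> null q" "c \<in> lifts q"
  shows "bd q c \<in> null (q - 1)"
  unfolding null_def
proof (intro CollectI ballI)
  fix e' assume e': "e' \<in> cells_of_dim F (q - 1)"
  note P = stalks[OF cells_of_dimD[OF e']]
  have "bd q c e' \<in> N e' \<inter> R e'"
    unfolding bd_def
  proof (rule addsub_sum[OF presents_addsub_kernel[OF P]])
    fix e assume "e \<in> {e \<in> cells_of_dim F q. face F e' e}"
    then show "c e \<in> N e' \<inter> R e'"
      using assms restrict_R[of e e'] restrict_N[of e e'] e' by (auto simp: lifts_def null_def cells_of_dim_def)
  qed
  then show "bd q c e' \<in> N e'" by simp
qed

lemma cycles_eq: "cycles F q = chain q ` cycle_lifts q"
proof -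
  have "boundary F q (chain q c) = \<one>\<^bsub>chain_group F (q - 1)\<^esub> \<longleftrightarrow> bd q c \<in> null (q - 1)" if "c \<in> lifts q" for c
    using presentsD(7)[OF presents_chain bd_lifts[OF that]] boundary_chain[OF that] by simp
  then show ?thesis
    unfolding cycles_def kernel_def presentsD(4)[OF presents_chain, symmetric] cycle_lifts_def by auto
qed

lemma boundaries_eq: "boundaries F q = chain q ` boundary_lifts q"
proof -
  have "boundaries F q = boundary F (q + 1) ` chain (q + 1) ` lifts (q + 1)"
    by (simp add: boundaries_def presentsD(4)[OF presents_chain])
  also have "\<dots> = chain q ` bd (q + 1) ` lifts (q + 1)"
    unfolding image_image using boundary_chain[of _ "q + 1"] by (intro image_cong) auto
  also have "\<dots> = chain q ` boundary_lifts q"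
  proof (intro equalityI image_subsetI)
    fix b assume "b \<in> bd (q + 1) ` lifts (q + 1)"
    then obtain a where a: "a \<in> lifts (q + 1)" "b = bd (q + 1) a" by blast
    have "b \<in> lifts q" using bd_lifts[OF a(1)] a(2) by simp
    moreover have "b + bd (q + 1) a \<in> null q"
      using a(2) addsub_0[OF addsub_null_lifts[of q]] by simp
    ultimately show "chain q b \<in> chain q ` boundary_lifts q"
      using a(1) by (auto simp: boundary_lifts_def)
  next
    fix c assume "c \<in> boundary_lifts q"
    then obtain a where a: "c \<in> lifts q" "a \<in> lifts (q + 1)" "c + bd (q + 1) a \<in> null q"
      by (auto simp: boundary_lifts_def)
    have "bd (q + 1) a \<in> lifts q" using bd_lifts[OF a(2)] by simp
    then have "chain q c = chain q (bd (q + 1) a)"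
      using presents_eq[OF presents_chain a(1)] a(3) by blast
    then show "chain q c \<in> chain q ` bd (q + 1) ` lifts (q + 1)" using a(2) by blast
  qed
  finally show ?thesis .
qed

text \<open>
  Lifted boundaries are determined only up to \<open>null\<close>, and the boundary operator preserves \<open>null\<close>.
\<close>

lemma boundary_cycle_lifts:
  assumes dd: "\<And>c. c \<in> lifts (q + 1) \<Longrightarrow> bd q (bd (q + 1) c) \<in> null (q - 1)"
  shows "boundary_lifts q \<subseteq> cycle_lifts q"
proof
  fix c assume "c \<in> boundary_lifts q"
  then obtain a where a: "c \<in> lifts q" "a \<in> lifts (q + 1)" "c + bd (q + 1) a \<in> null q"
    by (auto simp: boundary_lifts_def)
  have bl: "bd (q + 1) a \<in> lifts q" using bd_lifts[OF a(2)] by simp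
  have N0: "addsub (null (q - 1) \<inter> lifts (q - 1))" by (rule addsub_null_lifts)
  have "bd q (c + bd (q + 1) a) \<in> null (q - 1) \<inter> lifts (q - 1)"
    using bd_null[OF a(3)] addsub_add[OF addsub_lifts a(1) bl] bd_lifts by blast
  moreover have "bd q (bd (q + 1) a) \<in> null (q - 1) \<inter> lifts (q - 1)"
    using dd[OF a(2)] bd_lifts[OF bl] by blast
  ultimately have "bd q (c + bd (q + 1) a) + bd q (bd (q + 1) a) \<in> null (q - 1) \<inter> lifts (q - 1)"
    by (rule addsub_add[OF N0])
  then have "bd q c \<in> null (q - 1)" by (simp add: bd_add add.assoc)
  then show "c \<in> cycle_lifts q" using a(1) by (simp add: cycle_lifts_def)
qed

proposition presents_homology:
  assumes dd: "\<And>c. c \<in> lifts (q + 1) \<Longrightarrow> bd q (bd (q + 1) c) \<in> null (q - 1)"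
  shows "presents (hclass q) (cycle_lifts q) (boundary_lifts q) (homology_group F q)"
proof -
  note PC = presents_chain
  have addZ: "addsub (cycle_lifts q)"
    unfolding addsub_def cycle_lifts_def
  proof (intro conjI ballI CollectI)
    have N0: "addsub (null (q - 1) \<inter> lifts (q - 1))" by (rule addsub_null_lifts)
    show "0 \<in> lifts q" by (rule addsub_0[OF addsub_lifts])
    show "bd q 0 \<in> null (q - 1)" using addsub_0[OF N0] by simp
    fix x y assume "x \<in> {c \<in> lifts q. bd q c \<in> null (q - 1)}" "y \<in> {c \<in> lifts q. bd q c \<in> null (q - 1)}"
    then have xy: "x \<in> lifts q" "y \<in> lifts q" "bd q x \<in> null (q - 1)" "bd q y \<in> null (q - 1)" by auto
    show "x + y \<in> lifts q" using xy by (intro addsub_add[OF addsub_lifts])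
    have "bd q x + bd q y \<in> null (q - 1) \<inter> lifts (q - 1)"
      by (rule addsub_add[OF N0]) (use xy bd_lifts in auto)
    then show "bd q (x + y) \<in> null (q - 1)" by (simp add: bd_add)
  qed
  have addB: "addsub (boundary_lifts q)"
    unfolding addsub_def boundary_lifts_def
  proof (intro conjI ballI CollectI)
    have N0: "addsub (null q \<inter> lifts q)" by (rule addsub_null_lifts)
    show "0 \<in> lifts q" by (rule addsub_0[OF addsub_lifts])
    show "\<exists>a\<in>lifts (q + 1). 0 + bd (q + 1) a \<in> null q"
      using addsub_0[OF addsub_lifts[of "q + 1"]] addsub_0[OF N0] by (intro bexI[of _ 0]) auto
    fix x y assume x: "x \<in> {c \<in> lifts q. \<exists>a\<in>lifts (q + 1). c + bd (q + 1) a \<in> null q}"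
      and y: "y \<in> {c \<in> lifts q. \<exists>a\<in>lifts (q + 1). c + bd (q + 1) a \<in> null q}"
    obtain a where a: "a \<in> lifts (q + 1)" "x + bd (q + 1) a \<in> null q" using x by blast
    obtain b where b: "b \<in> lifts (q + 1)" "y + bd (q + 1) b \<in> null q" using y by blast
    show "x + y \<in> lifts q" using x y by (intro addsub_add[OF addsub_lifts]) auto
    have L: "x + bd (q + 1) a \<in> lifts q" "y + bd (q + 1) b \<in> lifts q"
      using x y bd_lifts[OF a(1)] bd_lifts[OF b(1)] by (auto intro!: addsub_add[OF addsub_lifts])
    have "(x + bd (q + 1) a) + (y + bd (q + 1) b) \<in> null q \<inter> lifts q"
      by (rule addsub_add[OF N0]) (use a b L in auto)
    then have "x + y + bd (q + 1) (a + b) \<in> null q" by (simp add: bd_add algebra_simps)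
    then show "\<exists>a\<in>lifts (q + 1). x + y + bd (q + 1) a \<in> null q"
      using addsub_add[OF addsub_lifts a(1) b(1)] by blast
  qed
  note BZ = boundary_cycle_lifts[OF dd]
  have "cycle_lifts q \<subseteq> lifts q" by (auto simp: cycle_lifts_def)
  from presents_subgroup_generated[OF PC this]
  have PZ: "presents (chain q) (cycle_lifts q) (null q) (subgroup_generated (chain_group F q) (cycles F q))"
    unfolding cycles_eq gen2_addsub_id[OF addZ] .
  have NB: "null q \<inter> cycle_lifts q \<subseteq> boundary_lifts q"
  proof
    fix c assume c: "c \<in> null q \<inter> cycle_lifts q"
    then have "c \<in> lifts q" "c + bd (q + 1) 0 \<in> null q" by (auto simp: cycle_lifts_def)
    then show "c \<in> boundary_lifts q"
      using addsub_0[OF addsub_lifts[of "q + 1"]] unfolding boundary_lifts_def by blast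
  qed
  have eq: "hclass q = (\<lambda>x. chain q ` boundary_lifts q #>\<^bsub>subgroup_generated (chain_group F q) (cycles F q)\<^esub> chain q x)"
    by (simp add: hclass_def homology_class_def boundaries_eq r_coset_def fun_eq_iff)
  show ?thesis
    unfolding homology_group_def boundaries_eq eq by (rule presents_Mod[OF PZ addB NB BZ])
qed

end

section \<open>The stalks of the tropical cosheaves\<close>

text \<open>
  The induced map is defined as a product of cosets; on a coset it may be computed with any
  representative.
\<close>

lemma exterior_map_coset:
  assumes "monoid V" "monoid W" "\<And>x. x \<in> carrier V \<Longrightarrow> k x \<in> carrier W"
    "\<And>x y. x \<in> carrier V \<Longrightarrow> y \<in> carrier V \<Longrightarrow> k (x \<otimes>\<^bsub>V\<^esub> y) = k x \<otimes>\<^bsub>W\<^esub> k y"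
  shows "exterior_map p W k (exterior_relations p V #>\<^bsub>free_space p V\<^esub> c)
    = exterior_relations p W #>\<^bsub>free_space p W\<^esub> push_words k c"
proof -
  have add: "addsub (exterior_relations p W)" "addsub (exterior_relations p V)"
    using assms(1,2) by (simp_all add: exterior_relations_gen2 addsub_gen2)
  have push: "push_words k s \<in> exterior_relations p W" if "s \<in> exterior_relations p V" for s
    using push_words_relations[OF assms that] .
  show ?thesis
    unfolding exterior_map_def coset_map_def free_space_words r_coset_additive
  proof (intro equalityI subsetI)
    fix z assume "z \<in> exterior_relations p W <#>\<^bsub>additive_group (words p (carrier W))\<^esub>
      push_words k ` (\<lambda>s. s + c) ` exterior_relations p V"
    then obtain r s where rs: "r \<in> exterior_relations p W" "s \<in> exterior_relations p V" "z = r + push_words k (s + c)"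
      by (auto simp: set_mult_def)
    then have "z = (r + push_words k s) + push_words k c" by (simp add: push_words_add add.assoc)
    moreover have "r + push_words k s \<in> exterior_relations p W" using rs push addsub_add[OF add(1)] by blast
    ultimately show "z \<in> (\<lambda>s. s + push_words k c) ` exterior_relations p W" by blast
  next
    fix z assume "z \<in> (\<lambda>s. s + push_words k c) ` exterior_relations p W"
    then obtain r where r: "r \<in> exterior_relations p W" "z = r + push_words k (0 + c)" by auto
    then show "z \<in> exterior_relations p W <#>\<^bsub>additive_group (words p (carrier W))\<^esub>
      push_words k ` (\<lambda>s. s + c) ` exterior_relations p V"
      unfolding set_mult_def
      by (intro UN_I[OF r(1)] UN_I[of "push_words k (0 + c)"] imageI addsub_0[OF add(2)]) simp
  qed
qed

definition quot :: "nat \<Rightarrow> (real^'d) set \<Rightarrow> ((bit^'d) list \<Rightarrow>\<^sub>0 bit) \<Rightarrow> ((bit^'d) set list \<Rightarrow>\<^sub>0 bit) set" where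
  "quot p Q c = exterior_relations p (N_mod_Sed Q) #>\<^bsub>free_space p (N_mod_Sed Q)\<^esub>
     push_words (\<lambda>u. Sed Q #>\<^bsub>F2_space\<^esub> u) c"

definition quotK :: "nat \<Rightarrow> (real^'d) set \<Rightarrow> ((bit^'d) list \<Rightarrow>\<^sub>0 bit) set" where
  "quotK p Q = quotient_kernel p (Sed Q)"

text \<open>
  The representatives of the stalk of \<open>X\<close> at \<open>(\<sigma>, Q)\<close>. The kernel is included, so that a word
  represents an element of the stalk of \<open>X\<close> if and only if it lies in \<open>edgeR\<close>.
\<close>

definition edgeR :: "nat \<Rightarrow> (real^'d) set \<Rightarrow> (real^'d) set \<Rightarrow> ((bit^'d) list \<Rightarrow>\<^sub>0 bit) set" where
  "edgeR p \<sigma> Q = gen2 (edge_words p (edge_normals \<sigma>) \<union> quotK p Q)"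

lemma presents_quot:
  "addsub (Sed Q) \<Longrightarrow> presents (quot p Q) (words p UNIV) (quotK p Q) (exterior_power p (N_mod_Sed Q))"
  using presents_quotient_power[of "Sed Q" p] unfolding quot_def quotK_def N_mod_Sed_def .

lemma coset_map_additive:
  assumes "addsub S'" "S \<subseteq> S'"
  shows "coset_map F2_space S' id (S #>\<^bsub>F2_space\<^esub> u) = (if S = {} then {} else S' #>\<^bsub>F2_space\<^esub> u)"
proof (cases "S = {}")
  case False
  show ?thesis
    unfolding coset_map_def r_coset_additive set_mult_def
  proof (intro equalityI subsetI)
    fix z assume "z \<in> (\<Union>h\<in>S'. \<Union>k\<in>id ` (\<lambda>s. s + u) ` S. {h \<otimes>\<^bsub>F2_space\<^esub> k})"
    then obtain r s where "r \<in> S'" "s \<in> S" "z = (r + s) + u" by (auto simp: add.assoc)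
    then show "z \<in> (if S = {} then {} else (\<lambda>s. s + u) ` S')"
      using assms addsub_add[OF assms(1), of r s] False by auto
  next
    fix z assume "z \<in> (if S = {} then {} else (\<lambda>s. s + u) ` S')"
    then obtain r where r: "r \<in> S'" "z = r + u" using False by auto
    obtain s where s: "s \<in> S" using False by blast
    have "z = (r + s) + (s + u)" using r(2) by (simp add: add.assoc)
    moreover have "r + s \<in> S'" using r s assms addsub_add by blast
    ultimately show "z \<in> (\<Union>h\<in>S'. \<Union>k\<in>id ` (\<lambda>s. s + u) ` S. {h \<otimes>\<^bsub>F2_space\<^esub> k})"
      using s by (intro UN_I[of "r + s"] UN_I[of "s + u"]) simp_all
  qed
qed (simp add: coset_map_def set_mult_def r_coset_def)

text \<open>
  Projection from \<open>N\<^sub>2 / Sed Q\<close> to \<open>N\<^sub>2 / Sed Q'\<close> is covered by the identity of \<open>N\<^sub>2\<close>.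
\<close>

lemma quot_transition:
  assumes "addsub (Sed Q)" "addsub (Sed Q')" "Sed Q \<subseteq> Sed Q'"
  shows "exterior_map p (N_mod_Sed Q') (coset_map F2_space (Sed Q') id) (quot p Q c) = quot p Q' c"
proof -
  let ?k = "coset_map F2_space (Sed Q') id"
  note P = presents_F2_Mod[OF assms(1), folded N_mod_Sed_def]
  note P' = presents_F2_Mod[OF assms(2), folded N_mod_Sed_def]
  have k: "?k (Sed Q #>\<^bsub>F2_space\<^esub> u) = Sed Q' #>\<^bsub>F2_space\<^esub> u" for u
    using coset_map_additive[OF assms(2,3)] addsub_0[OF assms(1)] by auto
  have "exterior_map p (N_mod_Sed Q') ?k (quot p Q c) = exterior_relations p (N_mod_Sed Q')
      #>\<^bsub>free_space p (N_mod_Sed Q')\<^esub> push_words ?k (push_words (\<lambda>u. Sed Q #>\<^bsub>F2_space\<^esub> u) c)"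
    unfolding quot_def
  proof (rule exterior_map_coset)
    show "monoid (N_mod_Sed Q)" "monoid (N_mod_Sed Q')"
      using monoid_F2_Mod assms by (auto simp: N_mod_Sed_def)
    show "?k x \<in> carrier (N_mod_Sed Q')" if "x \<in> carrier (N_mod_Sed Q)" for x
      using that presentsD(5)[OF P'] unfolding presentsD(4)[OF P, symmetric] by (auto simp: k)
    show "?k (x \<otimes>\<^bsub>N_mod_Sed Q\<^esub> y) = ?k x \<otimes>\<^bsub>N_mod_Sed Q'\<^esub> ?k y"
      if xy: "x \<in> carrier (N_mod_Sed Q)" "y \<in> carrier (N_mod_Sed Q)" for x y
    proof -
      obtain a b where ab: "x = Sed Q #>\<^bsub>F2_space\<^esub> a" "y = Sed Q #>\<^bsub>F2_space\<^esub> b"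
        using xy unfolding presentsD(4)[OF P, symmetric] by blast
      have "x \<otimes>\<^bsub>N_mod_Sed Q\<^esub> y = Sed Q #>\<^bsub>F2_space\<^esub> (a + b)" using presentsD(6)[OF P, of a b] ab by simp
      then show ?thesis using presentsD(6)[OF P', of a b] ab k by simp
    qed
  qed
  then show ?thesis by (simp add: push_words_comp k quot_def)
qed

text \<open>
  The exterior power of \<open>W / Sed Q\<close> is presented by the words with letters in \<open>W\<close>.
\<close>

lemma edge_part_eq:
  assumes "mod2_space (orthogonal_comp (tangent \<epsilon>)) = W" "addsub W" "addsub (Sed Q)" "Sed Q \<subseteq> W"
  shows "edge_part p Q \<epsilon> = quot p Q ` words p W"
proof -
  let ?V = "additive_group W Mod Sed Q" and ?\<kappa> = "\<lambda>u. Sed Q #>\<^bsub>F2_space\<^esub> u"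
  have eqk: "Sed Q #>\<^bsub>additive_group W\<^esub> u = ?\<kappa> u" for u by (simp add: r_coset_additive)
  note PV = presents_additive_Mod[OF assms(2,3,4), unfolded eqk]
  note PN = presents_F2_Mod[OF assms(3), folded N_mod_Sed_def]
  have mV: "monoid ?V" and mN: "monoid (N_mod_Sed Q)"
    using presentsD(3)[OF PV] presentsD(3)[OF PN] group.is_monoid by auto
  have "carrier (exterior_power p ?V) = (\<lambda>c. exterior_relations p ?V #>\<^bsub>free_space p ?V\<^esub> c) ` words p (carrier ?V)"
    using presentsD(4)[OF presents_exterior_power[OF mV]] by simp
  also have "words p (carrier ?V) = push_words ?\<kappa> ` words p W"
    unfolding push_words_image presentsD(4)[OF PV, symmetric] ..
  finally have "edge_part p Q \<epsilon> = (\<lambda>c. exterior_map p (N_mod_Sed Q) id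
      (exterior_relations p ?V #>\<^bsub>free_space p ?V\<^esub> push_words ?\<kappa> c)) ` words p W"
    by (simp add: edge_part_def assms(1) image_image)
  also have "\<dots> = quot p Q ` words p W"
  proof (rule image_cong[OF refl])
    fix c
    have "exterior_map p (N_mod_Sed Q) id (exterior_relations p ?V #>\<^bsub>free_space p ?V\<^esub> push_words ?\<kappa> c)
      = exterior_relations p (N_mod_Sed Q) #>\<^bsub>free_space p (N_mod_Sed Q)\<^esub> push_words id (push_words ?\<kappa> c)"
    proof (rule exterior_map_coset[OF mV mN])
      show "id x \<in> carrier (N_mod_Sed Q)" if "x \<in> carrier ?V" for x
        using that presentsD(5)[OF PN] unfolding presentsD(4)[OF PV, symmetric] by auto
      show "id (x \<otimes>\<^bsub>?V\<^esub> y) = id x \<otimes>\<^bsub>N_mod_Sed Q\<^esub> id y" for x y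
        by (simp add: N_mod_Sed_def FactGroup_def set_mult_def)
    qed
    then show "exterior_map p (N_mod_Sed Q) id (exterior_relations p ?V #>\<^bsub>free_space p ?V\<^esub> push_words ?\<kappa> c) = quot p Q c"
      by (simp add: quot_def)
  qed
  finally show ?thesis .
qed

lemma addsub_perp: "addsub {u. bdot m u = 0}"
  by (simp add: addsub_def bdot_add_right)

context smooth_triangulation
begin

lemma cell_chartE:
  assumes "\<sigma> \<in> K" "\<sigma> \<noteq> {}"
  obtains T A x \<xi> Qf where "cell_chart \<sigma> T A x \<xi> Qf"
  using cell_chart_exists[OF assms] by (elim exE)

lemma cell_chartD:
  assumes "cell_chart \<sigma> T A x \<xi> Qf"
  shows "dual_bases x \<xi>" "A \<inter> T = {}" "int (card A) = aff_dim \<sigma>" "Qf {} = P"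
    "I \<subseteq> T \<Longrightarrow> aff_dim (Qf I) = int CARD('d) - int (card I)"
    "I \<subseteq> T \<Longrightarrow> addsub (Sed (Qf I))"
    "I \<subseteq> T \<Longrightarrow> Sed (Qf I) = {z. \<forall>i. i \<notin> I \<longrightarrow> bdot (\<xi> i) z = 0}"
    "I \<subseteq> T \<Longrightarrow> I' \<subseteq> T \<Longrightarrow> Qf I \<subseteq> Qf I' \<longleftrightarrow> I' \<subseteq> I"
    "a \<in> A \<Longrightarrow> \<xi> a \<in> edge_normals \<sigma>"
    "m \<in> edge_normals \<sigma> \<Longrightarrow> (\<exists>a\<in>A. m = \<xi> a) \<or> (\<exists>a\<in>A. \<exists>b\<in>A. a \<noteq> b \<and> m = \<xi> a + \<xi> b)"
    "mod2_space (tangent \<sigma>) = {\<Sum>i\<in>S. \<xi> i |S. S \<subseteq> A}"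
    "Q face_of P \<Longrightarrow> \<sigma> \<subseteq> Q \<Longrightarrow> \<exists>I\<subseteq>T. Q = Qf I"
    "I \<subseteq> T \<Longrightarrow> Qf I face_of P" "I \<subseteq> T \<Longrightarrow> \<sigma> \<subseteq> Qf I"
proof -
  note c = assms[unfolded cell_chart_def]
  show "dual_bases x \<xi>" "A \<inter> T = {}" "int (card A) = aff_dim \<sigma>" "Qf {} = P"
    "mod2_space (tangent \<sigma>) = {\<Sum>i\<in>S. \<xi> i |S. S \<subseteq> A}"
    "a \<in> A \<Longrightarrow> \<xi> a \<in> edge_normals \<sigma>"
    "m \<in> edge_normals \<sigma> \<Longrightarrow> (\<exists>a\<in>A. m = \<xi> a) \<or> (\<exists>a\<in>A. \<exists>b\<in>A. a \<noteq> b \<and> m = \<xi> a + \<xi> b)"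
    using c by presburger+
  have c1: "\<forall>I\<subseteq>T. aff_dim (Qf I) = int CARD('d) - int (card I) \<and> addsub (Sed (Qf I)) \<and>
      Sed (Qf I) = {z. \<forall>i. i \<notin> I \<longrightarrow> bdot (\<xi> i) z = 0}" using c by (elim conjE)
  have c2: "\<forall>I\<subseteq>T. \<forall>I'\<subseteq>T. Qf I \<subseteq> Qf I' \<longleftrightarrow> I' \<subseteq> I" using c by (elim conjE)
  show "aff_dim (Qf I) = int CARD('d) - int (card I)" "addsub (Sed (Qf I))"
    "Sed (Qf I) = {z. \<forall>i. i \<notin> I \<longrightarrow> bdot (\<xi> i) z = 0}" if "I \<subseteq> T"
    using c1[rule_format, OF that] by blast+
  show "Qf I \<subseteq> Qf I' \<longleftrightarrow> I' \<subseteq> I" if "I \<subseteq> T" "I' \<subseteq> T"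
    by (rule c2[rule_format, OF that])
  have faces: "{Q. Q face_of P \<and> \<sigma> \<subseteq> Q} = Qf ` Pow T" using c by presburger
  show "\<exists>I\<subseteq>T. Q = Qf I" if "Q face_of P" "\<sigma> \<subseteq> Q"
  proof -
    have "Q \<in> Qf ` Pow T" unfolding faces[symmetric] using that by simp
    then show ?thesis by auto
  qed
  show "Qf I face_of P" "\<sigma> \<subseteq> Qf I" if "I \<subseteq> T"
  proof -
    have "Qf I \<in> {Q. Q face_of P \<and> \<sigma> \<subseteq> Q}" unfolding faces using that by simp
    then show "Qf I face_of P" "\<sigma> \<subseteq> Qf I" by simp_all
  qed
qed

lemma cells_YD:
  assumes "(\<sigma>, Q) \<in> cells_Y P K"
  shows "\<sigma> \<in> K" "\<sigma> \<noteq> {}" "Q face_of P" "\<sigma> \<subseteq> Q"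
  using assms by (auto simp: cells_Y_def)

text \<open>
  The edges of \<open>\<sigma>\<close> are tangent to the face \<open>Q\<close>, and \<open>Sed Q\<close> is orthogonal to it. In the chart this is
  the disjointness of \<open>A\<close> and \<open>T\<close>.
\<close>

lemma cell_Sed:
  assumes "(\<sigma>, Q) \<in> cells_Y P K"
  shows "addsub (Sed Q)" "\<And>m. m \<in> edge_normals \<sigma> \<Longrightarrow> Sed Q \<subseteq> {u. bdot m u = 0}"
proof -
  note \<sigma> = cells_YD[OF assms]
  obtain T A x \<xi> Qf where c: "cell_chart \<sigma> T A x \<xi> Qf" by (rule cell_chartE[OF \<sigma>(1,2)])
  note D = cell_chartD[OF c]
  obtain I where I: "I \<subseteq> T" "Q = Qf I" using D(12)[OF \<sigma>(3,4)] by blast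
  then show "addsub (Sed Q)" using D(6) by simp
  fix m assume "m \<in> edge_normals \<sigma>"
  note m = D(10)[OF this]
  have "a \<notin> I" if "a \<in> A" for a using that I(1) D(2) by blast
  then show "Sed Q \<subseteq> {u. bdot m u = 0}" unfolding I(2) D(7)[OF I(1)] using m by (auto simp: bdot_add_left)
qed

lemma cell_Sed_mono:
  assumes "(\<sigma>, Q) \<in> cells_Y P K" "(\<sigma>', Q') \<in> cells_Y P K" "\<sigma> \<subseteq> \<sigma>'" "Q' \<subseteq> Q"
  shows "Sed Q \<subseteq> Sed Q'"
proof -
  note \<sigma> = cells_YD[OF assms(1)] and \<sigma>' = cells_YD[OF assms(2)]
  obtain T A x \<xi> Qf where c: "cell_chart \<sigma>' T A x \<xi> Qf" by (rule cell_chartE[OF \<sigma>'(1,2)])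
  note D = cell_chartD[OF c]
  have "\<sigma>' \<subseteq> Q" using \<sigma>'(4) assms(4) by blast
  obtain I where I: "I \<subseteq> T" "Q = Qf I" using D(12)[OF \<sigma>(3) \<open>\<sigma>' \<subseteq> Q\<close>] by blast
  obtain I' where I': "I' \<subseteq> T" "Q' = Qf I'" using D(12)[OF \<sigma>'(3,4)] by blast
  have "I \<subseteq> I'" using D(8)[OF I'(1) I(1)] I(2) I'(2) assms(4) by simp
  then show ?thesis unfolding I(2) I'(2) D(7)[OF I(1)] D(7)[OF I'(1)] by blast
qed

lemma face_verts:
  assumes "\<sigma> \<in> K"
  shows "\<rho> face_of \<sigma> \<longleftrightarrow> (\<exists>C\<subseteq>verts \<sigma>. \<rho> = convex hull C)"
  using face_of_convex_hull_affine_independent[OF simplexK(2)[OF assms], of \<rho>] simplexK(1)[OF assms] by simp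

lemma verts_face:
  assumes "\<sigma> \<in> K" "C \<subseteq> verts \<sigma>"
  shows "verts (convex hull C) = C"
proof -
  have "\<not> affine_dependent C" using affine_independent_subset[OF simplexK(2)[OF assms(1)] assms(2)] .
  then show ?thesis by (simp add: extreme_point_of_convex_hull_affine_independent)
qed

lemma edges_of_simplex:
  assumes "\<sigma> \<in> K"
  shows "{\<epsilon>. \<epsilon> edge_of \<sigma>} = {closed_segment a b |a b. a \<in> verts \<sigma> \<and> b \<in> verts \<sigma> \<and> a \<noteq> b}"
proof (intro equalityI subsetI)
  fix \<epsilon> assume "\<epsilon> \<in> {\<epsilon>. \<epsilon> edge_of \<sigma>}"
  then have e: "\<epsilon> face_of \<sigma>" "aff_dim \<epsilon> = 1" by (auto simp: edge_of_def)
  obtain C where C: "C \<subseteq> verts \<sigma>" "\<epsilon> = convex hull C" using e(1) face_verts[OF assms] by blast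
  have "\<epsilon> \<in> K" using simplicial_complexD(3)[OF complex assms e(1)] .
  then have "int (card C) = 2" using simplexK(4)[of \<epsilon>] e(2) verts_face[OF assms C(1)] C(2) by simp
  then have "card C = 2" by simp
  then obtain a b where "C = {a, b}" "a \<noteq> b" by (meson card_2_iff)
  then show "\<epsilon> \<in> {closed_segment a b |a b. a \<in> verts \<sigma> \<and> b \<in> verts \<sigma> \<and> a \<noteq> b}"
    using C by (auto simp: segment_convex_hull)
next
  fix \<epsilon> assume "\<epsilon> \<in> {closed_segment a b |a b. a \<in> verts \<sigma> \<and> b \<in> verts \<sigma> \<and> a \<noteq> b}"
  then obtain a b where ab: "a \<in> verts \<sigma>" "b \<in> verts \<sigma>" "a \<noteq> b" "\<epsilon> = convex hull {a, b}"
    by (auto simp: segment_convex_hull)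
  have "\<epsilon> face_of \<sigma>" unfolding face_verts[OF assms] using ab by (intro exI[of _ "{a, b}"]) auto
  moreover have "aff_dim \<epsilon> = 1" using ab(3,4) by (simp add: aff_dim_convex_hull aff_dim_2)
  ultimately show "\<epsilon> \<in> {\<epsilon>. \<epsilon> edge_of \<sigma>}" by (simp add: edge_of_def)
qed

lemma presents_stalk_Y:
  assumes "(\<sigma>, Q) \<in> cells_Y P K"
  shows "presents (quot p Q) (words p UNIV) (quotK p Q) (stalk (cosheaf_Y P K p) (\<sigma>, Q))"
  using presents_quot[OF cell_Sed(1)[OF assms]] by (simp add: cosheaf_Y_def)

lemma edge_words_subset: "edge_words p M \<subseteq> words p UNIV"
  by (auto simp: edge_words_def words_def)

lemma edgeR_subset: "edgeR p \<sigma> Q \<subseteq> words p UNIV"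
  unfolding edgeR_def using edge_words_subset
  by (intro gen2_minimal) (auto simp: quotK_def quotient_kernel_def)

lemma addsub_edgeR: "addsub (edgeR p \<sigma> Q)"
  unfolding edgeR_def by (rule addsub_gen2)

lemma quotK_edgeR: "quotK p Q \<subseteq> edgeR p \<sigma> Q"
  unfolding edgeR_def by (auto intro: gen2_incl)

lemma addsub_quotK: "(\<sigma>, Q) \<in> cells_Y P K \<Longrightarrow> addsub (quotK p Q)"
  unfolding quotK_def by (rule addsub_quotient_kernel[OF cell_Sed(1)])

text \<open>
  The stalk is generated by the images of the edge words; the representatives are then enlarged by
  the kernel.
\<close>

lemma presents_stalk_X:
  assumes "(\<sigma>, Q) \<in> cells_Y P K"
  shows "presents (quot p Q) (edgeR p \<sigma> Q) (quotK p Q) (stalk (cosheaf_X P K p) (\<sigma>, Q))"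
proof -
  let ?G = "exterior_power p (N_mod_Sed Q)" and ?E = "edge_words p (edge_normals \<sigma>)"
  have \<sigma>: "\<sigma> \<in> K" using assms by (simp add: cells_Y_def)
  note PQ = presents_quot[OF cell_Sed(1)[OF assms], of p]
  have part: "edge_part p Q (closed_segment a b) = quot p Q ` words p {u. bdot (mod2 (b - a)) u = 0}"
    if ab: "a \<in> verts \<sigma>" "b \<in> verts \<sigma>" "a \<noteq> b" for a b
  proof (rule edge_part_eq)
    show "mod2_space (orthogonal_comp (tangent (closed_segment a b))) = {u. bdot (mod2 (b - a)) u = 0}"
      by (rule vertex_differences(4)[OF \<sigma> ab(1)]) (use ab in auto)
    show "Sed Q \<subseteq> {u. bdot (mod2 (b - a)) u = 0}"
      by (rule cell_Sed(2)[OF assms]) (use ab in \<open>auto simp: edge_normals_def\<close>)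
  qed (rule addsub_perp, rule cell_Sed(1)[OF assms])
  have "(\<Union>\<epsilon>\<in>{\<epsilon>. \<epsilon> edge_of \<sigma>}. edge_part p Q \<epsilon>) = quot p Q ` ?E"
    unfolding edges_of_simplex[OF \<sigma>] edge_words_def edge_normals_def image_UN
    using part by (auto 4 4)
  then have stalk: "stalk (cosheaf_X P K p) (\<sigma>, Q) = subgroup_generated ?G (quot p Q ` ?E)"
    by (simp add: cosheaf_X_def)
  have U: "?E \<union> quotK p Q \<subseteq> words p UNIV"
    using edge_words_subset by (auto simp: quotK_def quotient_kernel_def)
  note P1 = presents_subgroup_generated[OF PQ edge_words_subset[of p "edge_normals \<sigma>"]]
  note P2 = presents_subgroup_generated[OF PQ U]
  show ?thesis
    unfolding stalk edgeR_def
  proof (rule presents_enlarge[OF P1 addsub_gen2 _ P2])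
    show "gen2 ?E \<subseteq> gen2 (?E \<union> quotK p Q)" by (rule gen2_mono) blast
    fix x assume "x \<in> gen2 (?E \<union> quotK p Q)"
    then obtain a b where ab: "a \<in> gen2 ?E" "b \<in> gen2 (quotK p Q)" "x = a + b" by (rule gen2_Un_split)
    then have "x + a \<in> quotK p Q"
      using gen2_addsub_id[OF addsub_quotK[OF assms], of p] by (simp add: add.commute[of a b] add.assoc)
    then show "\<exists>y\<in>gen2 ?E. x + y \<in> quotK p Q" using ab(1) by blast
  qed simp_all
qed

end

section \<open>The canonical class of a simplex\<close>

lemma linext_gram_relations:
  fixes l :: "(bit^'d) list"
  assumes "d \<in> exterior_relations p F2_space"
  shows "linext (gram_det p l) d = 0"
proof -
  have "linext (gdet p (\<lambda>i. bdot (l ! i))) d = 0"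
    by (rule gdet_relations[OF monoid_additive[OF addsub_UNIV] _ assms]) (simp add: bdot_add_right)
  then show ?thesis by (simp add: gram_det_gdet cong: linext_eq_on)
qed

text \<open>
  The exterior power of the tangent space of \<open>\<sigma>\<close> is the line spanned by the product of the basis
  \<open>\<xi> a\<close>, \<open>a \<in> A\<close>, and this product is non-zero in the exterior power of \<open>M\<^sub>2\<close> because it pairs to 1 with
  the product of the \<open>x a\<close>.
\<close>

lemma omega_eq:
  fixes x \<xi> :: "'d \<Rightarrow> bit^'d"
  assumes dual: "dual_bases x \<xi>" and W: "mod2_space (tangent \<sigma>) = {\<Sum>i\<in>S. \<xi> i |S. S \<subseteq> A}" and A: "card A = p"
  shows "omega p \<sigma> = exterior_relations p F2_space #>\<^bsub>free_space p F2_space\<^esub> monom_word \<xi> A"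
proof -
  let ?rel = "exterior_relations p (F2_space :: (bit^'d) monoid)" and ?W = "mod2_space (tangent \<sigma>)"
  let ?c = "\<lambda>c. ?rel #>\<^bsub>free_space p F2_space\<^esub> c"
  have mF: "monoid (F2_space :: (bit^'d) monoid)" by (simp add: monoid_additive)
  have addW: "addsub ?W"
    unfolding addsub_def
  proof (intro conjI ballI)
    show "0 \<in> ?W" unfolding W by (intro CollectI exI[of _ "{}"]) simp
    fix y z assume "y \<in> ?W" "z \<in> ?W"
    then obtain S S' where S: "S \<subseteq> A" "S' \<subseteq> A" "y = (\<Sum>i\<in>S. \<xi> i)" "z = (\<Sum>i\<in>S'. \<xi> i)" unfolding W by blast
    then have "y + z = (\<Sum>i\<in>(S - S') \<union> (S' - S). \<xi> i)" using sum_sym_diff_char2[of S S' \<xi>] by simp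
    then show "y + z \<in> ?W" unfolding W using S(1,2) by blast
  qed
  have mW: "monoid (additive_group ?W)" using monoid_additive[OF addW] .
  have rel: "?rel = gen2 (relators p F2_space)" using exterior_relations_gen2[OF mF] .
  have addrel: "addsub ?rel" unfolding rel by (rule addsub_gen2)
  note PE = presents_exterior_power[OF mF, of p]
  have "carrier (exterior_power p (additive_group ?W)) =
      (\<lambda>c. exterior_relations p (additive_group ?W) #>\<^bsub>free_space p (additive_group ?W)\<^esub> c) ` words p ?W"
    using presentsD(4)[OF presents_exterior_power[OF mW, of p]] by simp
  then have im: "exterior_map p F2_space id ` carrier (exterior_power p (additive_group ?W)) = ?c ` words p ?W"
    using exterior_map_coset[OF mW mF, of id p] by (simp add: image_image)
  have fin: "finite A" by simp
  have mA: "monom_word \<xi> A \<in> words p ?W"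
  proof -
    have "\<xi> i \<in> ?W" if "i \<in> A" for i
      unfolding W using that by (intro CollectI exI[of _ "{i}"]) auto
    then show ?thesis using enum[OF fin] A by (auto simp: monom_word_def)
  qed
  have mA': "monom_word \<xi> A \<in> words p UNIV" using mA words_mono[of ?W UNIV p] by blast
  have notrel: "monom_word \<xi> A \<notin> ?rel"
  proof
    assume "monom_word \<xi> A \<in> ?rel"
    then have "coord p x A (monom_word \<xi> A) = 0" unfolding coord_def by (rule linext_gram_relations)
    then show False using coord_monom[OF dual_bases_commute[OF dual] A A] by simp
  qed
  have span: "c \<in> ?rel \<or> c + monom_word \<xi> A \<in> ?rel" if c: "c \<in> words p ?W" for c
  proof -
    have "words p ?W \<subseteq> gen2 (relators p F2_space \<union> {monom_word \<xi> A})"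
      unfolding W
    proof (rule words_span[OF addsub_gen2 _ fin])
      show "relators p F2_space \<subseteq> gen2 (relators p F2_space \<union> {monom_word \<xi> A})" by (auto intro: gen2_incl)
      fix J assume "J \<subseteq> A" "card J = p"
      then have "J = A" using A by (intro card_subset_eq) auto
      then show "word (map \<xi> (enum J)) \<in> gen2 (relators p F2_space \<union> {monom_word \<xi> A})"
        by (intro gen2_incl) (simp add: monom_word_def)
    qed
    then have "c \<in> gen2 (relators p F2_space \<union> {monom_word \<xi> A})" using c by blast
    then obtain r g where rg: "r \<in> ?rel" "g \<in> gen2 {monom_word \<xi> A}" "c = r + g"
      unfolding rel by (rule gen2_Un_split)
    have "gen2 {monom_word \<xi> A} \<subseteq> {0, monom_word \<xi> A}"
      by (rule gen2_minimal) (auto simp: addsub_def)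
    then have "g = 0 \<or> g = monom_word \<xi> A" using rg(2) by blast
    then show ?thesis using rg by (auto simp: add.assoc)
  qed
  show ?thesis
    unfolding omega_def im
  proof (rule the_equality)
    have "?c (monom_word \<xi> A) \<noteq> \<one>\<^bsub>exterior_power p F2_space\<^esub>"
      using presentsD(7)[OF PE, of "monom_word \<xi> A"] mA' notrel by simp
    then show "?c (monom_word \<xi> A) \<in> ?c ` words p ?W \<and> ?c (monom_word \<xi> A) \<noteq> \<one>\<^bsub>exterior_power p F2_space\<^esub>"
      using mA by blast
    fix y assume "y \<in> ?c ` words p ?W \<and> y \<noteq> \<one>\<^bsub>exterior_power p F2_space\<^esub>"
    then obtain c where c: "c \<in> words p ?W" "y = ?c c" "y \<noteq> \<one>\<^bsub>exterior_power p F2_space\<^esub>" by blast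
    have cU: "c \<in> words p UNIV" using c(1) words_mono[of ?W UNIV p] by blast
    have "c \<notin> ?rel" using c(2,3) presentsD(7)[OF PE, of c] cU by simp
    then have "c + monom_word \<xi> A \<in> ?rel" using span[OF c(1)] by blast
    then show "y = ?c (monom_word \<xi> A)" unfolding c(2) using presents_eq[OF PE, of c "monom_word \<xi> A"] cU mA' by simp
  qed
qed

text \<open>
  Since \<open>\<omega>(\<sigma>)\<close> is the monomial \<open>\<xi>\<^sub>A\<close>, pairing with it is the coordinate \<open>A\<close>.
\<close>

lemma dual_omega_coord:
  fixes x \<xi> :: "'d \<Rightarrow> bit^'d"
  assumes dual: "dual_bases x \<xi>" and W: "mod2_space (tangent \<sigma>) = {\<Sum>i\<in>S. \<xi> i |S. S \<subseteq> A}" and A: "card A = p"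
    and us: "dual_omega p \<sigma> us"
  shows "coord p \<xi> A (word us) = 1" "length us = p"
proof -
  let ?rel = "exterior_relations p (F2_space :: (bit^'d) monoid)"
  let ?g = "gram_det p (map \<xi> (enum A)) us"
  have mF: "monoid (F2_space :: (bit^'d) monoid)" by (simp add: monoid_additive)
  have addrel: "addsub ?rel" unfolding exterior_relations_gen2[OF mF] by (rule addsub_gen2)
  define B where "B c d = (\<Sum>l \<in> Poly_Mapping.keys c. \<Sum>m \<in> Poly_Mapping.keys d.
            Poly_Mapping.lookup c l * Poly_Mapping.lookup d m * gram_det p l m)"
    for c d :: "(bit^'d) list \<Rightarrow>\<^sub>0 bit"
  have B: "B c d = linext (\<lambda>l. linext (gram_det p l) d) c" for c d
    unfolding B_def linext_def by (intro sum.cong refl) (simp add: lookup_keys_bit)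
  have val: "B c d = ?g"
    if c: "c \<in> omega p \<sigma>" and d: "d \<in> wedge p F2_space us" for c d
  proof -
    obtain r where r: "r \<in> ?rel" "c = r + monom_word \<xi> A"
      using c unfolding omega_eq[OF dual W A] free_space_words r_coset_additive by blast
    obtain s where s: "s \<in> ?rel" "d = s + word us"
      using d unfolding wedge_def free_space_words r_coset_additive by blast
    have "linext (gram_det p l) d = gram_det p us l" for l
      unfolding s(2) linext_add linext_gram_relations[OF s(1)] by (simp add: gram_det_commute)
    then have "B c d = linext (gram_det p us) c" unfolding B by simp
    also have "\<dots> = gram_det p us (map \<xi> (enum A))"
      unfolding r(2) linext_add linext_gram_relations[OF r(1)] by (simp add: monom_word_def)
    finally show ?thesis by (simp add: gram_det_commute)
  qed
  have "monom_word \<xi> A \<in> omega p \<sigma>"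
    unfolding omega_eq[OF dual W A] free_space_words r_coset_additive
    using addsub_0[OF addrel] by (intro image_eqI[of _ _ 0]) auto
  moreover have "word us \<in> wedge p F2_space us"
    unfolding wedge_def free_space_words r_coset_additive
    using addsub_0[OF addrel] by (intro image_eqI[of _ _ 0]) auto
  ultimately have "exterior_pairing p (omega p \<sigma>) (wedge p F2_space us) = ?g"
    unfolding exterior_pairing_def B_def[symmetric] using val by (intro the_equality) metis+
  then show "coord p \<xi> A (word us) = 1" "length us = p"
    using us by (auto simp: dual_omega_def coord_def)
qed

section \<open>The lifted boundary\<close>

text \<open>
  Exchanging the two entries of a pair of distinct elements is a fixed point free involution.
\<close>

lemma sum_symmetric_pairs:
  fixes g :: "'a \<Rightarrow> 'a \<Rightarrow> 'b::char2"
  assumes "finite V" "\<And>v w. g v w = g w v"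
  shows "(\<Sum>v\<in>V. \<Sum>w\<in>V - {v}. g v w) = 0"
proof -
  have "(\<Sum>v\<in>V. \<Sum>w\<in>V - {v}. g v w) = (\<Sum>(v, w)\<in>Sigma V (\<lambda>v. V - {v}). g v w)"
    using assms(1) by (intro sum.Sigma) auto
  also have "\<dots> = 0"
    by (rule sum_involution_char2[where t = "\<lambda>(v, w). (w, v)"]) (use assms in auto)
  finally show ?thesis .
qed

context smooth_triangulation
begin

definition facets :: "(real^'d) set \<Rightarrow> (real^'d) set set" where
  "facets \<sigma> = {\<rho> \<in> K. \<rho> \<noteq> {} \<and> \<rho> face_of \<sigma> \<and> aff_dim \<rho> = aff_dim \<sigma> - 1}"

definition covers :: "(real^'d) set \<Rightarrow> (real^'d) set set" where
  "covers Q = {Q'. Q' face_of P \<and> Q \<subseteq> Q' \<and> aff_dim Q' = aff_dim Q + 1}"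

text \<open>
  The boundary with constant coefficients. Its value at \<open>(\<sigma>, Q)\<close> collects the values on the cells
  having \<open>(\<sigma>, Q)\<close> as a face of codimension one; these are obtained by passing to a facet of \<open>\<sigma>\<close> or to
  a face of \<open>P\<close> of which \<open>Q\<close> is a facet.
\<close>

definition D :: "('d cell \<Rightarrow> 'v::char2) \<Rightarrow> ('d cell \<Rightarrow> 'v)" where
  "D b = (\<lambda>(\<sigma>, Q). (\<Sum>\<rho>\<in>facets \<sigma>. b (\<rho>, Q)) + (\<Sum>Q'\<in>covers Q. b (\<sigma>, Q')))"

lemma finite_facets: "finite (facets \<sigma>)"
  using finite_K by (simp add: facets_def)

lemma finite_covers: "finite (covers Q)"
  by (rule finite_subset[OF _ finite_polytope_faces[OF polytope_P]]) (auto simp: covers_def)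

lemma D_add: "D (b + c) = D b + D c"
  by (simp add: D_def fun_eq_iff sum.distrib algebra_simps split: prod.split)

text \<open>
  The condition on the number of vertices excludes the empty face of a vertex, to which no cell
  belongs.
\<close>

lemma sum_facets:
  assumes "\<sigma> \<in> K"
  shows "(\<Sum>\<rho>\<in>facets \<sigma>. g \<rho>) =
    (if 2 \<le> card (verts \<sigma>) then \<Sum>v\<in>verts \<sigma>. g (convex hull (verts \<sigma> - {v})) else 0)"
proof (cases "2 \<le> card (verts \<sigma>)")
  case True
  note S = simplexK[OF assms]
  have "facets \<sigma> = (\<lambda>v. convex hull (verts \<sigma> - {v})) ` verts \<sigma>"
  proof (intro equalityI subsetI)
    fix \<rho> assume r: "\<rho> \<in> facets \<sigma>"
    then obtain C where C: "C \<subseteq> verts \<sigma>" "\<rho> = convex hull C" using face_verts[OF assms] by (auto simp: facets_def)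
    have "int (card C) = aff_dim \<rho> + 1" using simplexK(4)[of \<rho>] verts_face[OF assms C(1)] C(2) r by (auto simp: facets_def)
    then have card: "card (verts \<sigma>) = card C + 1" using r S(4) by (simp add: facets_def)
    then have "card (verts \<sigma> - C) = 1" using C(1) S(3) by (simp add: card_Diff_subset finite_subset)
    then obtain v where "verts \<sigma> - C = {v}" by (meson card_1_singletonE)
    then have "v \<in> verts \<sigma>" "C = verts \<sigma> - {v}" using C(1) by auto
    then show "\<rho> \<in> (\<lambda>v. convex hull (verts \<sigma> - {v})) ` verts \<sigma>" using C(2) by blast
  next
    fix \<rho> assume "\<rho> \<in> (\<lambda>v. convex hull (verts \<sigma> - {v})) ` verts \<sigma>"
    then obtain v where v: "v \<in> verts \<sigma>" "\<rho> = convex hull (verts \<sigma> - {v})" by blast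
    have sub: "verts \<sigma> - {v} \<subseteq> verts \<sigma>" by blast
    have f: "\<rho> face_of \<sigma>" using face_verts[OF assms] v(2) sub by blast
    have rK: "\<rho> \<in> K" using simplicial_complexD(3)[OF complex assms f] .
    have cd: "card (verts \<sigma> - {v}) = card (verts \<sigma>) - 1" using v(1) S(3) by simp
    have "int (card (verts \<sigma> - {v})) = aff_dim \<rho> + 1"
      using simplexK(4)[OF rK] verts_face[OF assms sub] v(2) by simp
    then have "aff_dim \<rho> = aff_dim \<sigma> - 1" using cd S(4) True by linarith
    moreover have "\<rho> \<noteq> {}"
    proof
      assume "\<rho> = {}"
      then have "verts \<sigma> - {v} = {}" using v(2) by simp
      then have "card (verts \<sigma> - {v}) = 0" by (simp only: card.empty)
      then show False using cd True by linarith
    qed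
    ultimately show "\<rho> \<in> facets \<sigma>" using f rK by (simp add: facets_def)
  qed
  moreover have "inj_on (\<lambda>v. convex hull (verts \<sigma> - {v})) (verts \<sigma>)"
  proof (rule inj_onI)
    fix v w assume vw: "v \<in> verts \<sigma>" "w \<in> verts \<sigma>" "convex hull (verts \<sigma> - {v}) = convex hull (verts \<sigma> - {w})"
    have "verts (convex hull (verts \<sigma> - {u})) = verts \<sigma> - {u}" for u by (rule verts_face[OF assms]) blast
    from this[of v] this[of w] have "verts \<sigma> - {v} = verts \<sigma> - {w}" unfolding vw(3) by (rule trans[OF sym])
    then show "v = w" using vw(1,2) by blast
  qed
  ultimately show ?thesis using True by (simp add: sum.reindex)
next
  case False
  have "facets \<sigma> = {}"
  proof (rule ccontr)
    assume "facets \<sigma> \<noteq> {}"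
    then obtain \<rho> where "\<rho> \<in> facets \<sigma>" by blast
    then have "\<rho> \<noteq> {}" "aff_dim \<rho> = aff_dim \<sigma> - 1" by (auto simp: facets_def)
    moreover have "aff_dim \<sigma> \<le> 0" using simplexK(4)[OF assms] False by linarith
    ultimately have "aff_dim \<rho> < 0" by linarith
    then show False using \<open>\<rho> \<noteq> {}\<close> aff_dim_negative_iff by blast
  qed
  then show ?thesis using False by simp
qed

text \<open>
  In a chart, enlarging a face means omitting one of the facets that cut it out.
\<close>

lemma sum_covers:
  assumes c: "cell_chart \<sigma> T A x \<xi> Qf" and I: "I \<subseteq> T"
  shows "(\<Sum>Q\<in>covers (Qf I). g Q) = (\<Sum>i\<in>I. g (Qf (I - {i})))"
proof -
  note D = cell_chartD[OF c]
  have "covers (Qf I) = (\<lambda>i. Qf (I - {i})) ` I"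
  proof (intro equalityI subsetI)
    fix Q assume "Q \<in> covers (Qf I)"
    then have Q: "Q face_of P" "Qf I \<subseteq> Q" "aff_dim Q = aff_dim (Qf I) + 1" by (auto simp: covers_def)
    obtain I' where I': "I' \<subseteq> T" "Q = Qf I'" using D(12)[OF Q(1)] Q(2) D(14)[OF I] by blast
    have sub: "I' \<subseteq> I" using D(8)[OF I I'(1)] Q(2) I'(2) by simp
    have "card I = card I' + 1" using Q(3) D(5)[OF I] D(5)[OF I'(1)] I'(2) by simp
    then have "card (I - I') = 1" using sub by (simp add: card_Diff_subset)
    then obtain i where "I - I' = {i}" by (meson card_1_singletonE)
    then have "i \<in> I" "I' = I - {i}" using sub by auto
    then show "Q \<in> (\<lambda>i. Qf (I - {i})) ` I" using I'(2) by blast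
  next
    fix Q assume "Q \<in> (\<lambda>i. Qf (I - {i})) ` I"
    then obtain i where i: "i \<in> I" "Q = Qf (I - {i})" by blast
    have sub: "I - {i} \<subseteq> T" using I by blast
    have "card I = card (I - {i}) + 1" using i(1) by (simp add: card_gt_0_iff) (metis card_gt_0_iff Suc_pred empty_iff finite)
    then show "Q \<in> covers (Qf I)"
      unfolding covers_def i(2) using D(13)[OF sub] D(8)[OF I sub] D(5)[OF I] D(5)[OF sub] by auto
  qed
  moreover have "inj_on (\<lambda>i. Qf (I - {i})) I"
  proof (rule inj_onI)
    fix i j assume ij: "i \<in> I" "j \<in> I" "Qf (I - {i}) = Qf (I - {j})"
    have s: "I - {i} \<subseteq> T" "I - {j} \<subseteq> T" using I by auto
    have "I - {i} = I - {j}" using D(8)[OF s] D(8)[OF s(2,1)] ij(3) by blast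
    then show "i = j" using ij(1,2) by blast
  qed
  ultimately show ?thesis by (simp add: sum.reindex)
qed

text \<open>
  Removing two vertices of \<open>\<sigma>\<close>, or omitting two facets of \<open>P\<close> that cut out \<open>Q\<close>, can be done in two
  orders, and the terms cancel in pairs; the two mixed sums are equal.
\<close>

proposition D_D:
  assumes e: "(\<sigma>, Q) \<in> cells_Y P K"
  shows "D (D b) (\<sigma>, Q) = 0"
proof -
  note \<sigma> = cells_YD[OF e]
  have h: "(\<Sum>\<rho>\<in>facets \<sigma>. \<Sum>\<rho>'\<in>facets \<rho>. b (\<rho>', Q)) = 0"
  proof (cases "2 \<le> card (verts \<sigma>)")
    case True
    let ?V = "verts \<sigma>"
    note S = simplexK[OF \<sigma>(1)]
    have inner: "(\<Sum>\<rho>'\<in>facets (convex hull (?V - {v})). b (\<rho>', Q)) =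
      (if 3 \<le> card ?V then \<Sum>w\<in>?V - {v}. b (convex hull (?V - {v} - {w}), Q) else 0)" if v: "v \<in> ?V" for v
    proof -
      have sub: "?V - {v} \<subseteq> ?V" by blast
      have "convex hull (?V - {v}) face_of \<sigma>" using face_verts[OF \<sigma>(1)] sub by blast
      then have K': "convex hull (?V - {v}) \<in> K" using simplicial_complexD(3)[OF complex \<sigma>(1)] by blast
      have "card (?V - {v}) = card ?V - 1" using v S(3) by simp
      then show ?thesis
        using sum_facets[OF K', of "\<lambda>\<rho>'. b (\<rho>', Q)"] unfolding verts_face[OF \<sigma>(1) sub] by auto
    qed
    have "(\<Sum>\<rho>\<in>facets \<sigma>. \<Sum>\<rho>'\<in>facets \<rho>. b (\<rho>', Q)) =
      (\<Sum>v\<in>?V. if 3 \<le> card ?V then \<Sum>w\<in>?V - {v}. b (convex hull (?V - {v} - {w}), Q) else 0)"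
      unfolding sum_facets[OF \<sigma>(1)] using True inner by simp
    also have "\<dots> = 0"
    proof (cases "3 \<le> card ?V")
      case True
      have "?V - {v} - {w} = ?V - {w} - {v}" for v w by blast
      then have "(\<Sum>v\<in>?V. \<Sum>w\<in>?V - {v}. b (convex hull (?V - {v} - {w}), Q)) = 0"
        by (intro sum_symmetric_pairs[OF S(3)]) simp
      then show ?thesis using True by simp
    qed simp
    finally show ?thesis .
  qed (simp add: sum_facets[OF \<sigma>(1)])
  obtain T A x \<xi> Qf where c: "cell_chart \<sigma> T A x \<xi> Qf" by (rule cell_chartE[OF \<sigma>(1,2)])
  obtain I where I: "I \<subseteq> T" "Q = Qf I" using cell_chartD(12)[OF c \<sigma>(3,4)] by blast
  have v: "(\<Sum>Q'\<in>covers Q. \<Sum>Q''\<in>covers Q'. b (\<sigma>, Q'')) = 0"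
  proof -
    have "(\<Sum>Q'\<in>covers Q. \<Sum>Q''\<in>covers Q'. b (\<sigma>, Q'')) = (\<Sum>i\<in>I. \<Sum>j\<in>I - {i}. b (\<sigma>, Qf (I - {i} - {j})))"
      unfolding I(2) sum_covers[OF c I(1)]
    proof (rule sum.cong[OF refl])
      fix i assume "i \<in> I"
      have "I - {i} \<subseteq> T" using I(1) by blast
      then show "(\<Sum>Q''\<in>covers (Qf (I - {i})). b (\<sigma>, Q'')) = (\<Sum>j\<in>I - {i}. b (\<sigma>, Qf (I - {i} - {j})))"
        by (rule sum_covers[OF c])
    qed
    also have "\<dots> = 0"
    proof (rule sum_symmetric_pairs)
      have "I - {i} - {j} = I - {j} - {i}" for i j by blast
      then show "b (\<sigma>, Qf (I - {i} - {j})) = b (\<sigma>, Qf (I - {j} - {i}))" for i j by simp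
    qed simp
    finally show ?thesis .
  qed
  have "D (D b) (\<sigma>, Q) = ((\<Sum>\<rho>\<in>facets \<sigma>. \<Sum>\<rho>'\<in>facets \<rho>. b (\<rho>', Q)) + (\<Sum>\<rho>\<in>facets \<sigma>. \<Sum>Q'\<in>covers Q. b (\<rho>, Q')))
     + ((\<Sum>Q'\<in>covers Q. \<Sum>\<rho>\<in>facets \<sigma>. b (\<rho>, Q')) + (\<Sum>Q'\<in>covers Q. \<Sum>Q''\<in>covers Q'. b (\<sigma>, Q'')))"
    by (simp add: D_def sum.distrib)
  also have "(\<Sum>Q'\<in>covers Q. \<Sum>\<rho>\<in>facets \<sigma>. b (\<rho>, Q')) = (\<Sum>\<rho>\<in>facets \<sigma>. \<Sum>Q'\<in>covers Q. b (\<rho>, Q'))"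
    by (rule sum.swap)
  finally show ?thesis unfolding h v by simp
qed

lemma cell_face_cells:
  assumes "(\<sigma>, Q) \<in> cells_Y P K" "(\<sigma>', Q') \<in> cells_Y P K"
  shows "cell_face K (\<sigma>', Q') (\<sigma>, Q) \<longleftrightarrow> \<sigma> face_of \<sigma>' \<and> Q' \<subseteq> Q"
  by (rule cell_face_iff[OF complex union convex_P assms])

lemma facets_cells: "(\<sigma>, Q) \<in> cells_Y P K \<Longrightarrow> \<rho> \<in> facets \<sigma> \<Longrightarrow> (\<rho>, Q) \<in> cells_Y P K"
  using face_of_imp_subset by (fastforce simp: facets_def cells_Y_def)

lemma covers_cells: "(\<sigma>, Q) \<in> cells_Y P K \<Longrightarrow> Q' \<in> covers Q \<Longrightarrow> (\<sigma>, Q') \<in> cells_Y P K"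
  by (auto simp: covers_def cells_Y_def)

text \<open>
  A cell \<open>(\<rho>, Q')\<close> having \<open>(\<sigma>, Q)\<close> as a face satisfies \<open>dim \<rho> \<le> dim \<sigma>\<close> and \<open>dim Q \<le> dim Q'\<close>; in
  codimension one exactly one of the inequalities is strict.
\<close>

lemma cofaces:
  assumes e: "(\<sigma>, Q) \<in> cells_Y P K"
  shows "{e \<in> cells_Y P K. cell_dim e = cell_dim (\<sigma>, Q) + 1 \<and> cell_face K (\<sigma>, Q) e}
    = (\<lambda>\<rho>. (\<rho>, Q)) ` facets \<sigma> \<union> (\<lambda>Q'. (\<sigma>, Q')) ` covers Q"
proof (intro equalityI subsetI)
  note \<sigma> = cells_YD[OF e]
  fix e' assume "e' \<in> {e \<in> cells_Y P K. cell_dim e = cell_dim (\<sigma>, Q) + 1 \<and> cell_face K (\<sigma>, Q) e}"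
  then obtain \<rho> Q' where e': "e' = (\<rho>, Q')" "(\<rho>, Q') \<in> cells_Y P K"
    "aff_dim Q' - aff_dim \<rho> = aff_dim Q - aff_dim \<sigma> + 1" "\<rho> face_of \<sigma>" "Q \<subseteq> Q'"
    using cell_face_cells[OF _ e] by (cases e') (auto simp: cell_dim_def)
  note \<rho> = cells_YD[OF e'(2)]
  have le: "aff_dim \<rho> \<le> aff_dim \<sigma>" "aff_dim Q \<le> aff_dim Q'"
    using e'(4,5) face_of_imp_subset aff_dim_subset by blast+
  show "e' \<in> (\<lambda>\<rho>. (\<rho>, Q)) ` facets \<sigma> \<union> (\<lambda>Q'. (\<sigma>, Q')) ` covers Q"
  proof (cases "\<rho> = \<sigma>")
    case True
    then show ?thesis using e' \<rho>(3) by (auto simp: covers_def)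
  next
    case False
    have "aff_dim \<rho> < aff_dim \<sigma>" using face_of_aff_dim_lt[OF simplexK(5)[OF \<sigma>(1)] e'(4) False] .
    then have dims: "aff_dim \<rho> = aff_dim \<sigma> - 1" "aff_dim Q' = aff_dim Q" using e'(3) le by linarith+
    have "Q face_of Q'" using face_of_subset[OF \<sigma>(3) e'(5)] face_of_imp_subset[OF \<rho>(3)] .
    then have "Q = Q'" using face_of_aff_dim_lt[of Q' Q] face_of_imp_convex[OF \<rho>(3)] dims(2) by fastforce
    then show ?thesis using e' \<rho> dims(1) by (auto simp: facets_def)
  qed
next
  note \<sigma> = cells_YD[OF e]
  fix e' assume "e' \<in> (\<lambda>\<rho>. (\<rho>, Q)) ` facets \<sigma> \<union> (\<lambda>Q'. (\<sigma>, Q')) ` covers Q"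
  then show "e' \<in> {e \<in> cells_Y P K. cell_dim e = cell_dim (\<sigma>, Q) + 1 \<and> cell_face K (\<sigma>, Q) e}"
  proof
    assume "e' \<in> (\<lambda>\<rho>. (\<rho>, Q)) ` facets \<sigma>"
    then obtain \<rho> where \<rho>: "\<rho> \<in> facets \<sigma>" "e' = (\<rho>, Q)" by blast
    then show ?thesis
      using facets_cells[OF e \<rho>(1)] cell_face_cells[OF facets_cells[OF e \<rho>(1)] e]
      by (auto simp: cell_dim_def facets_def)
  next
    assume "e' \<in> (\<lambda>Q'. (\<sigma>, Q')) ` covers Q"
    then obtain Q' where Q': "Q' \<in> covers Q" "e' = (\<sigma>, Q')" by blast
    then show ?thesis
      using covers_cells[OF e Q'(1)] cell_face_cells[OF covers_cells[OF e Q'(1)] e]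
        face_of_refl[OF simplexK(5)[OF \<sigma>(1)]]
      by (auto simp: cell_dim_def covers_def)
  qed
qed

lemma D_cofaces:
  assumes e: "e' \<in> cells_Y P K"
  shows "D b e' = (\<Sum>e | e \<in> cells_Y P K \<and> cell_dim e = cell_dim e' + 1 \<and> cell_face K e' e. b e)"
proof -
  obtain \<sigma> Q where e': "e' = (\<sigma>, Q)" by (cases e')
  note c = cofaces[OF e[unfolded e']]
  have disj: "(\<lambda>\<rho>. (\<rho>, Q)) ` facets \<sigma> \<inter> (\<lambda>Q'. (\<sigma>, Q')) ` covers Q = {}"
    by (auto simp: facets_def)
  have "(\<Sum>e | e \<in> cells_Y P K \<and> cell_dim e = cell_dim (\<sigma>, Q) + 1 \<and> cell_face K (\<sigma>, Q) e. b e)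
    = (\<Sum>e\<in>(\<lambda>\<rho>. (\<rho>, Q)) ` facets \<sigma>. b e) + (\<Sum>e\<in>(\<lambda>Q'. (\<sigma>, Q')) ` covers Q. b e)"
    unfolding c using finite_facets finite_covers disj by (intro sum.union_disjoint) auto
  also have "\<dots> = D b (\<sigma>, Q)" by (simp add: D_def sum.reindex inj_on_def)
  finally show ?thesis by (simp add: e')
qed

end

section \<open>Cycles of the quotient complex\<close>

context smooth_triangulation
begin

lemma edgeR_chart:
  assumes c: "cell_chart \<sigma> T A x \<xi> Qf" and I: "I \<subseteq> T"
  shows "edgeR p \<sigma> (Qf I) =
    {c \<in> words p UNIV. \<forall>J. card J = p \<longrightarrow> A \<subseteq> J \<longrightarrow> J \<inter> I = {} \<longrightarrow> coord p \<xi> J c = 0}"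
proof -
  note D = cell_chartD[OF c]
  show ?thesis
    unfolding edgeR_def quotK_def
    by (rule monomial_description[OF D(1) D(9) D(10) D(6)[OF I] D(7)[OF I]])
qed

lemma quotK_mono:
  assumes "(\<sigma>, Q) \<in> cells_Y P K" "(\<sigma>', Q') \<in> cells_Y P K" "\<sigma> \<subseteq> \<sigma>'" "Q' \<subseteq> Q"
  shows "quotK p Q \<subseteq> quotK p Q'"
proof
  fix c assume c: "c \<in> quotK p Q"
  note S = cell_Sed(1)[OF assms(1)] cell_Sed(1)[OF assms(2)]
  note Q = presents_quot[OF S(1), of p] and Q' = presents_quot[OF S(2), of p]
  note tr = quot_transition[OF S cell_Sed_mono[OF assms]]
  have w: "c \<in> words p UNIV" "0 \<in> words p UNIV"
    using c addsub_0[OF addsub_words] by (auto simp: quotK_def quotient_kernel_def)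
  have "quot p Q c = quot p Q 0" using presents_eq[OF Q w] c by simp
  then have "quot p Q' c = quot p Q' 0" using tr[of p c] tr[of p 0] by simp
  then show "c \<in> quotK p Q'" using presents_eq[OF Q' w] by simp
qed

lemma edge_normals_mono: "\<sigma> face_of \<sigma>' \<Longrightarrow> edge_normals \<sigma> \<subseteq> edge_normals \<sigma>'"
  using extreme_point_of_face unfolding edge_normals_def by blast

lemma edgeR_mono:
  assumes "(\<sigma>, Q) \<in> cells_Y P K" "(\<sigma>', Q') \<in> cells_Y P K" "\<sigma> face_of \<sigma>'" "Q' \<subseteq> Q"
  shows "edgeR p \<sigma> Q \<subseteq> edgeR p \<sigma>' Q'"
proof -
  have "edge_words p (edge_normals \<sigma>) \<subseteq> edge_words p (edge_normals \<sigma>')"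
    using edge_normals_mono[OF assms(3)] unfolding edge_words_def by blast
  moreover have "quotK p Q \<subseteq> quotK p Q'"
    using quotK_mono[OF assms(1,2) face_of_imp_subset[OF assms(3)] assms(4)] .
  ultimately show ?thesis unfolding edgeR_def by (intro gen2_mono) blast
qed

text \<open>
  In the coordinate \<open>J\<close>, a family indexed by the faces \<open>Qf I\<close> is a cochain on the full simplex with
  vertex set \<open>T - J\<close>, the value on \<open>I\<close> being taken modulo \<open>edgeR\<close>, and the sum over \<open>i \<in> I\<close> is its
  coboundary. The cone construction with apex \<open>i0 J \<in> T - J\<close> contracts this complex: \<open>g I J\<close> is the
  coordinate of \<open>b\<close> at \<open>insert (i0 J) I\<close>. There is an apex, because \<open>I\<close> is a non-empty subset of \<open>T - J\<close>.
\<close>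

proposition vertical_exactness:
  assumes c: "cell_chart \<sigma> T A x \<xi> Qf" and b: "\<And>Q. b Q \<in> words p UNIV" and j: "0 < j"
    and cyc: "\<And>I. I \<subseteq> T \<Longrightarrow> card I = Suc j \<Longrightarrow> (\<Sum>i\<in>I. b (Qf (I - {i}))) \<in> edgeR p \<sigma> (Qf I)"
  shows "\<exists>a. (\<forall>Q. a Q \<in> words p UNIV) \<and>
    (\<forall>I\<subseteq>T. card I = j \<longrightarrow> b (Qf I) + (\<Sum>i\<in>I. a (Qf (I - {i}))) \<in> edgeR p \<sigma> (Qf I))"
proof -
  note D = cell_chartD[OF c]
  define i0 where "i0 J = (SOME i. i \<in> T - J)" for J
  have i0: "i0 J \<in> T - J" if "T - J \<noteq> {}" for J
    unfolding i0_def by (rule someI_ex) (use that in blast)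
  define g where "g I J = (if i0 J \<notin> I then coord p \<xi> J (b (Qf (insert (i0 J) I))) else 0)" for I J
  \<comment> \<open>the coordinates may be prescribed independently of each other\<close>
  define w where "w I = (SOME w. w \<in> words p UNIV \<and> (\<forall>J. card J = p \<longrightarrow> coord p \<xi> J w = g I J))" for I
  have "w I \<in> words p UNIV \<and> (\<forall>J. card J = p \<longrightarrow> coord p \<xi> J (w I) = g I J)" for I
    unfolding w_def by (rule someI_ex) (rule exists_coords[OF D(1), of p "g I", unfolded Bex_def])
  then have w: "\<And>I. w I \<in> words p UNIV" "\<And>I J. card J = p \<Longrightarrow> coord p \<xi> J (w I) = g I J"
    by simp_all
  \<comment> \<open>the contraction is indexed by subsets of \<open>T\<close>; distinct subsets give distinct faces\<close>
  define a where "a Q = w (THE I. I \<subseteq> T \<and> Q = Qf I)" for Q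
  have a: "a (Qf I) = w I" if I: "I \<subseteq> T" for I
  proof -
    have "(THE I'. I' \<subseteq> T \<and> Qf I = Qf I') = I"
    proof (rule the_equality)
      fix I' assume I': "I' \<subseteq> T \<and> Qf I = Qf I'"
      then show "I' = I" using D(8)[of I I'] D(8)[of I' I] I by blast
    qed (use I in simp)
    then show ?thesis by (simp add: a_def)
  qed
  have "b (Qf I) + (\<Sum>i\<in>I. a (Qf (I - {i}))) \<in> edgeR p \<sigma> (Qf I)" if I: "I \<subseteq> T" "card I = j" for I
    unfolding edgeR_chart[OF c I(1)]
  proof (intro CollectI conjI allI impI)
    show "b (Qf I) + (\<Sum>i\<in>I. a (Qf (I - {i}))) \<in> words p UNIV"
      using b w(1) by (intro addsub_add[OF addsub_words] addsub_sum[OF addsub_words]) (simp_all add: a_def)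
    fix J assume J: "card J = p" "A \<subseteq> J" "J \<inter> I = {}"
    have "I \<noteq> {}" using I(2) j by auto
    then have "T - J \<noteq> {}" using I(1) J(3) by blast
    note i = i0[OF this]
    have "coord p \<xi> J (\<Sum>i\<in>I. a (Qf (I - {i}))) = (\<Sum>i\<in>I. g (I - {i}) J)"
    proof -
      have "a (Qf (I - {i})) = w (I - {i})" for i using I(1) by (intro a) blast
      then show ?thesis using w(2)[OF J(1)] by (simp add: coord_sum)
    qed
    also have "\<dots> = coord p \<xi> J (b (Qf I))"
    proof (cases "i0 J \<in> I")
      case True
      \<comment> \<open>only the term that removes the apex survives, and the apex is put back by \<open>g\<close>\<close>
      have "(\<Sum>i\<in>I. g (I - {i}) J) = (\<Sum>i\<in>I. if i = i0 J then coord p \<xi> J (b (Qf I)) else 0)"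
        using True by (intro sum.cong[OF refl]) (auto simp: g_def insert_absorb)
      then show ?thesis using True by simp
    next
      case False
      \<comment> \<open>the cocycle condition on the cone over \<open>I\<close> expresses the value on \<open>I\<close> by the other values\<close>
      let ?I = "insert (i0 J) I"
      have sub: "?I \<subseteq> T" using i I(1) by blast
      have "J \<inter> ?I = {}" using i J(3) by blast
      moreover have "(\<Sum>i\<in>?I. b (Qf (?I - {i}))) \<in> edgeR p \<sigma> (Qf ?I)"
        using cyc[OF sub] False I(2) by simp
      ultimately have "coord p \<xi> J (\<Sum>i\<in>?I. b (Qf (?I - {i}))) = 0"
        unfolding edgeR_chart[OF c sub] using J by blast
      then have "coord p \<xi> J (b (Qf I)) + (\<Sum>i\<in>I. coord p \<xi> J (b (Qf (?I - {i})))) = 0"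
        using False by (simp add: coord_sum coord_add)
      moreover have "(\<Sum>i\<in>I. coord p \<xi> J (b (Qf (?I - {i})))) = (\<Sum>i\<in>I. g (I - {i}) J)"
      proof (rule sum.cong[OF refl])
        fix i assume "i \<in> I"
        then have "?I - {i} = insert (i0 J) (I - {i})" using False by blast
        then show "coord p \<xi> J (b (Qf (?I - {i}))) = g (I - {i}) J" using False by (simp add: g_def)
      qed
      ultimately show ?thesis by (simp add: add_eq_0_char2)
    qed
    finally show "coord p \<xi> J (b (Qf I) + (\<Sum>i\<in>I. a (Qf (I - {i})))) = 0"
      by (simp add: coord_add)
  qed
  moreover have "a Q \<in> words p UNIV" for Q using w(1) by (simp add: a_def)
  ultimately show ?thesis by blast
qed

lemma D_in:
  assumes S: "addsub S" and e: "\<And>\<rho>. \<rho> \<in> facets \<sigma> \<Longrightarrow> b (\<rho>, Q) \<in> S" and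
    e': "\<And>Q'. Q' \<in> covers Q \<Longrightarrow> b (\<sigma>, Q') \<in> S"
  shows "D b (\<sigma>, Q) \<in> S"
  unfolding D_def prod.case by (intro addsub_add[OF S] addsub_sum[OF S]) (use e e' in auto)

lemma D_words: "(\<And>e. b e \<in> words p UNIV) \<Longrightarrow> D b e \<in> words p UNIV"
  by (cases e) (auto intro: D_in)

text \<open>
  The chain \<open>b\<close>, of degree \<open>n + 1 - p = q + 1\<close>, vanishes in the quotient complex on all cells \<open>(\<sigma>, Q)\<close>
  with \<open>dim \<sigma> < k\<close>.
\<close>

definition small_cleared :: "nat \<Rightarrow> int \<Rightarrow> ('d cell \<Rightarrow> (bit^'d) list \<Rightarrow>\<^sub>0 bit) \<Rightarrow> bool" where
  "small_cleared p k b \<longleftrightarrow> (\<forall>\<sigma> Q. (\<sigma>, Q) \<in> cells_Y P K \<longrightarrow> cell_dim (\<sigma>, Q) = int CARD('d) - int p \<longrightarrow>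
     aff_dim \<sigma> < k \<longrightarrow> b (\<sigma>, Q) \<in> edgeR p \<sigma> Q)"

text \<open>
  The chain \<open>b\<close> of degree \<open>q + 1\<close> is a cycle of the quotient complex.
\<close>

definition cycle_mod :: "nat \<Rightarrow> ('d cell \<Rightarrow> (bit^'d) list \<Rightarrow>\<^sub>0 bit) \<Rightarrow> bool" where
  "cycle_mod p b \<longleftrightarrow> (\<forall>\<sigma> Q. (\<sigma>, Q) \<in> cells_Y P K \<longrightarrow> cell_dim (\<sigma>, Q) = int CARD('d) - int p - 1 \<longrightarrow>
     D b (\<sigma>, Q) \<in> edgeR p \<sigma> Q)"

text \<open>
  In the boundary at \<open>(\<sigma>, Q)\<close> the terms over facets of \<open>\<sigma>\<close> already vanish, so the cycle condition
  becomes a condition in the direction of \<open>Q\<close> alone.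
\<close>

lemma covers_part:
  assumes cyc: "cycle_mod p b" and small: "small_cleared p k b" and e: "(\<sigma>, Q) \<in> cells_Y P K"
    and dim: "cell_dim (\<sigma>, Q) = int CARD('d) - int p - 1" and k: "aff_dim \<sigma> \<le> k"
  shows "(\<Sum>Q'\<in>covers Q. b (\<sigma>, Q')) \<in> edgeR p \<sigma> Q"
proof -
  have "(\<Sum>\<rho>\<in>facets \<sigma>. b (\<rho>, Q)) \<in> edgeR p \<sigma> Q"
  proof (rule addsub_sum[OF addsub_edgeR])
    fix \<rho> assume \<rho>: "\<rho> \<in> facets \<sigma>"
    note e' = facets_cells[OF e \<rho>]
    have r: "aff_dim \<rho> = aff_dim \<sigma> - 1" "\<rho> face_of \<sigma>" using \<rho> by (auto simp: facets_def)
    have "b (\<rho>, Q) \<in> edgeR p \<rho> Q"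
      using small e' r(1) dim k unfolding small_cleared_def cell_dim_def by auto
    then show "b (\<rho>, Q) \<in> edgeR p \<sigma> Q" using edgeR_mono[OF e' e r(2), of p] by blast
  qed
  moreover have "(\<Sum>\<rho>\<in>facets \<sigma>. b (\<rho>, Q)) + (\<Sum>Q'\<in>covers Q. b (\<sigma>, Q')) \<in> edgeR p \<sigma> Q"
    using cyc e dim unfolding cycle_mod_def D_def by auto
  ultimately show ?thesis using addsub_cancel[OF addsub_edgeR] by blast
qed

lemma cycle_mod_add_D:
  assumes "cycle_mod p b"
  shows "cycle_mod p (b + D a)"
  using assms D_D[of _ _ a] unfolding cycle_mod_def D_add by simp

text \<open>
  On each \<open>k\<close>-simplex \<open>\<sigma>\<close> the values of \<open>b\<close> form a cocycle in the direction of \<open>Q\<close> and can be removed by a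
  coboundary. Adding the boundary of the resulting chain changes \<open>b\<close> only on simplices of dimension
  at least \<open>k\<close>, so what has been cleared remains clear.
\<close>

lemma clear_step:
  fixes b :: "'d cell \<Rightarrow> (bit^'d) list \<Rightarrow>\<^sub>0 bit"
  assumes b: "\<And>e. b e \<in> words p UNIV" and cyc: "cycle_mod p b" and small: "small_cleared p (int k) b" and k: "k < p"
  shows "\<exists>a. (\<forall>e. a e \<in> words p UNIV) \<and> small_cleared p (int (Suc k)) (b + D a)"
proof -
  define good where "good \<sigma> a \<longleftrightarrow> (\<forall>Q. a Q \<in> words p UNIV) \<and> (\<forall>Q. (\<sigma>, Q) \<in> cells_Y P K \<longrightarrow>
      cell_dim (\<sigma>, Q) = int CARD('d) - int p \<longrightarrow> b (\<sigma>, Q) + (\<Sum>Q'\<in>covers Q. a Q') \<in> edgeR p \<sigma> Q)" for \<sigma> a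
  have ex: "\<exists>a. good \<sigma> a"
    if \<sigma>: "\<sigma> \<in> K" "\<sigma> \<noteq> {}" "aff_dim \<sigma> = int k" for \<sigma>
  proof -
    obtain T A x \<xi> Qf where c: "cell_chart \<sigma> T A x \<xi> Qf" by (rule cell_chartE[OF \<sigma>(1,2)])
    note C = cell_chartD[OF c]
    have cell: "(\<sigma>, Qf I) \<in> cells_Y P K" if "I \<subseteq> T" for I
      using \<sigma> C(13)[OF that] C(14)[OF that] by (simp add: cells_Y_def)
    have "\<exists>a. (\<forall>Q. a Q \<in> words p UNIV) \<and> (\<forall>I\<subseteq>T. card I = p - k \<longrightarrow>
        b (\<sigma>, Qf I) + (\<Sum>i\<in>I. a (Qf (I - {i}))) \<in> edgeR p \<sigma> (Qf I))"
    proof (rule vertical_exactness[OF c])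
      show "b (\<sigma>, Q) \<in> words p UNIV" for Q by (rule b)
      show "0 < p - k" using k by simp
      fix I assume I: "I \<subseteq> T" "card I = Suc (p - k)"
      have "(\<Sum>Q'\<in>covers (Qf I). b (\<sigma>, Q')) \<in> edgeR p \<sigma> (Qf I)"
        by (rule covers_part[OF cyc small cell[OF I(1)]])
          (use C(5)[OF I(1)] I(2) k \<sigma>(3) in \<open>auto simp: cell_dim_def of_nat_diff\<close>)
      then show "(\<Sum>i\<in>I. b (\<sigma>, Qf (I - {i}))) \<in> edgeR p \<sigma> (Qf I)" unfolding sum_covers[OF c I(1)] .
    qed
    then obtain a where a: "\<forall>Q. a Q \<in> words p UNIV"
      "\<And>I. I \<subseteq> T \<Longrightarrow> card I = p - k \<Longrightarrow> b (\<sigma>, Qf I) + (\<Sum>i\<in>I. a (Qf (I - {i}))) \<in> edgeR p \<sigma> (Qf I)" by blast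
    show ?thesis
      unfolding good_def
    proof (intro exI[of _ a] conjI a(1) allI impI)
      fix Q assume Q: "(\<sigma>, Q) \<in> cells_Y P K" "cell_dim (\<sigma>, Q) = int CARD('d) - int p"
      obtain I where I: "I \<subseteq> T" "Q = Qf I" using C(12)[OF cells_YD(3,4)[OF Q(1)]] by blast
      have "card I = p - k" using Q(2) C(5)[OF I(1)] I(2) \<sigma>(3) k by (simp add: cell_dim_def)
      then show "b (\<sigma>, Q) + (\<Sum>Q'\<in>covers Q. a Q') \<in> edgeR p \<sigma> Q"
        unfolding I(2) sum_covers[OF c I(1)] by (rule a(2)[OF I(1)])
    qed
  qed
  define a where "a \<sigma> = (SOME a. good \<sigma> a)" for \<sigma>
  have good: "good \<sigma> (a \<sigma>)" if "\<sigma> \<in> K" "\<sigma> \<noteq> {}" "aff_dim \<sigma> = int k" for \<sigma>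
    unfolding a_def by (rule someI_ex[OF ex[OF that]])
  define a' where "a' = (\<lambda>(\<sigma>, Q). if \<sigma> \<in> K \<and> \<sigma> \<noteq> {} \<and> aff_dim \<sigma> = int k then a \<sigma> Q else 0)"
  have "a' e \<in> words p UNIV" for e
    using good addsub_0[OF addsub_words] by (cases e) (auto simp: a'_def good_def)
  moreover have "small_cleared p (int (Suc k)) (b + D a')"
    unfolding small_cleared_def
  proof (intro allI impI)
    fix \<sigma> Q assume e: "(\<sigma>, Q) \<in> cells_Y P K" "cell_dim (\<sigma>, Q) = int CARD('d) - int p" "aff_dim \<sigma> < int (Suc k)"
    note \<sigma> = cells_YD[OF e(1)]
    \<comment> \<open>facets of \<open>\<sigma>\<close> have dimension less than \<open>k\<close>\<close>
    have low: "(\<Sum>\<rho>\<in>facets \<sigma>. a' (\<rho>, Q)) = 0"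
      using e(3) by (intro sum.neutral) (auto simp: a'_def facets_def)
    show "(b + D a') (\<sigma>, Q) \<in> edgeR p \<sigma> Q"
    proof (cases "aff_dim \<sigma> = int k")
      case True
      then have "D a' (\<sigma>, Q) = (\<Sum>Q'\<in>covers Q. a \<sigma> Q')" using low \<sigma> by (simp add: D_def a'_def)
      then show ?thesis using good[OF \<sigma>(1,2) True] e by (simp add: good_def)
    next
      case False
      then have "D a' (\<sigma>, Q) = 0" using low \<sigma> by (simp add: D_def a'_def)
      moreover have "aff_dim \<sigma> < int k" using e(3) False by simp
      ultimately show ?thesis using small e unfolding small_cleared_def by simp
    qed
  qed
  ultimately show ?thesis by blast
qed

lemma clear_below:
  fixes b :: "'d cell \<Rightarrow> (bit^'d) list \<Rightarrow>\<^sub>0 bit"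
  assumes b: "\<And>e. b e \<in> words p UNIV" and cyc: "cycle_mod p b" and "k \<le> p"
  shows "\<exists>a. (\<forall>e. a e \<in> words p UNIV) \<and> small_cleared p (int k) (b + D a)"
  using assms(3)
proof (induction k)
  case 0
  have "small_cleared p 0 (b + D 0)"
    unfolding small_cleared_def
  proof (intro allI impI)
    fix \<sigma> Q assume "(\<sigma>, Q) \<in> cells_Y P K" "aff_dim \<sigma> < 0"
    then show "(b + D 0) (\<sigma>, Q) \<in> edgeR p \<sigma> Q" using aff_dim_negative_iff cells_YD(2) by blast
  qed
  then have "small_cleared p (int 0) (b + D 0)" by (simp only: of_nat_0)
  moreover have "(0 :: 'd cell \<Rightarrow> (bit^'d) list \<Rightarrow>\<^sub>0 bit) e \<in> words p UNIV" for e
    using addsub_0[OF addsub_words] by simp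
  ultimately show ?case by blast
next
  case (Suc k)
  have "k \<le> p" using Suc.prems by simp
  from Suc.IH[OF this] obtain a where a: "\<And>e. a e \<in> words p UNIV" "small_cleared p (int k) (b + D a)" by blast
  have "\<exists>a'. (\<forall>e. a' e \<in> words p UNIV) \<and> small_cleared p (int (Suc k)) ((b + D a) + D a')"
  proof (rule clear_step)
    show "(b + D a) e \<in> words p UNIV" for e
      using addsub_add[OF addsub_words b D_words[OF a(1)]] by simp
    show "cycle_mod p (b + D a)" by (rule cycle_mod_add_D[OF cyc])
  qed (use a Suc.prems in auto)
  then obtain a' where a': "\<And>e. a' e \<in> words p UNIV" "small_cleared p (int (Suc k)) ((b + D a) + D a')" by blast
  have "(b + D a) + D a' = b + D (a + a')" by (simp add: D_add add.assoc)
  moreover have "(a + a') e \<in> words p UNIV" for e using addsub_add[OF addsub_words a(1) a'(1)] by simp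
  ultimately show ?case using a'(2) by metis
qed

lemma frontier_iff:
  assumes "\<sigma> \<in> K" "\<sigma> \<noteq> {}"
  shows "\<sigma> \<subseteq> frontier P \<longleftrightarrow> (\<exists>Q. Q face_of P \<and> Q \<noteq> P \<and> \<sigma> \<subseteq> Q)"
proof -
  have "affine hull P = UNIV" using aff_dim_P aff_dim_eq_full[of P] by simp
  then have fr: "frontier P = rel_frontier P" by (simp add: rel_frontier_frontier)
  show ?thesis
  proof
    assume sub: "\<sigma> \<subseteq> frontier P"
    obtain z where z: "z \<in> rel_interior \<sigma>"
      using rel_interior_eq_empty[OF simplexK(5)[OF assms(1)]] assms(2) by blast
    then have "z \<in> rel_frontier P" using sub rel_interior_subset fr by blast
    then obtain Q where Q: "Q face_of P" "Q \<noteq> P" "z \<in> Q"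
      using rel_frontier_of_polyhedron_alt[OF polytope_imp_polyhedron[OF polytope_P]] by blast
    have "\<sigma> \<subseteq> Q" using z Q(3) by (intro subset_of_face_of[OF Q(1) simplexK(6)[OF assms(1)]]) blast
    then show "\<exists>Q. Q face_of P \<and> Q \<noteq> P \<and> \<sigma> \<subseteq> Q" using Q by blast
  next
    assume "\<exists>Q. Q face_of P \<and> Q \<noteq> P \<and> \<sigma> \<subseteq> Q"
    then show "\<sigma> \<subseteq> frontier P" using face_of_subset_rel_frontier[of _ P] fr by blast
  qed
qed

definition top_chain :: "'v \<Rightarrow> (real^'d) set \<Rightarrow> ('d cell \<Rightarrow> 'v::zero)" where
  "top_chain c \<sigma> = (\<lambda>e. if e = (\<sigma>, P) then c else 0)"

text \<open>
  After clearing, \<open>b\<close> lives on the cells \<open>(\<sigma>, P)\<close> with \<open>dim \<sigma> = p\<close>. As \<open>card A = p\<close> there, the quotient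
  stalk has the single coordinate \<open>J = A\<close>. If \<open>\<sigma>\<close> lies on a facet \<open>Qf {i}\<close> of \<open>P\<close>, the only face of \<open>P\<close>
  strictly containing that facet is \<open>P\<close>, so the cycle condition at \<open>(\<sigma>, Qf {i})\<close> says that this
  coordinate of \<open>b\<close> vanishes. Otherwise it is 0 or 1, and in the second case it is cancelled by
  \<open>\<omega>\<^sup>*(\<sigma>)\<close>.
\<close>

proposition cycles_generated_by_interior_simplices:
  fixes b :: "'d cell \<Rightarrow> (bit^'d) list \<Rightarrow>\<^sub>0 bit"
  assumes b: "\<And>e. b e \<in> words p UNIV" and cyc: "cycle_mod p b" and p: "p < CARD('d)"
    and us: "\<And>\<sigma>. \<sigma> \<in> interior_simplices P K p \<Longrightarrow> dual_omega p \<sigma> (us \<sigma>)"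
  obtains a S where "\<And>e. a e \<in> words p UNIV" "S \<subseteq> interior_simplices P K p"
    "\<And>\<sigma> Q. (\<sigma>, Q) \<in> cells_Y P K \<Longrightarrow> cell_dim (\<sigma>, Q) = int CARD('d) - int p \<Longrightarrow>
       (b + D a + (\<Sum>\<sigma>\<in>S. top_chain (word (us \<sigma>)) \<sigma>)) (\<sigma>, Q) \<in> edgeR p \<sigma> Q"
proof -
  obtain a where a: "\<And>e. a e \<in> words p UNIV" and small: "small_cleared p (int p) (b + D a)"
    using clear_below[OF b cyc, of p] by blast
  define b' where "b' = b + D a"
  have cyc': "cycle_mod p b'" unfolding b'_def by (rule cycle_mod_add_D[OF cyc])
  have b'w: "b' e \<in> words p UNIV" for e using addsub_add[OF addsub_words b D_words[OF a]] by (simp add: b'_def)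
  \<comment> \<open>the interior simplices at which the coefficient is non-zero\<close>
  define S where "S = {\<sigma> \<in> interior_simplices P K p. b' (\<sigma>, P) \<notin> edgeR p \<sigma> P}"
  have finS: "finite S" using finite_K by (simp add: S_def interior_simplices_def)
  have tops: "(\<Sum>\<rho>\<in>S. top_chain (word (us \<rho>)) \<rho>) (\<sigma>, Q) = (if \<sigma> \<in> S \<and> Q = P then word (us \<sigma>) else 0)" for \<sigma> Q
  proof -
    have "(\<Sum>\<rho>\<in>S. top_chain (word (us \<rho>)) \<rho>) (\<sigma>, Q) = (\<Sum>\<rho>\<in>S. if \<rho> = \<sigma> then (if Q = P then word (us \<sigma>) else 0) else 0)"
      unfolding sum_apply by (rule sum.cong) (auto simp: top_chain_def)
    then show ?thesis using finS by simp
  qed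
  show thesis
  proof (rule that[OF a])
    show "S \<subseteq> interior_simplices P K p" by (auto simp: S_def)
    fix \<sigma> Q assume e: "(\<sigma>, Q) \<in> cells_Y P K" "cell_dim (\<sigma>, Q) = int CARD('d) - int p"
    note \<sigma> = cells_YD[OF e(1)]
    have goal: "b' (\<sigma>, Q) + (if \<sigma> \<in> S \<and> Q = P then word (us \<sigma>) else 0) \<in> edgeR p \<sigma> Q"
    proof (cases "aff_dim \<sigma> < int p")
      case True
      then have "\<sigma> \<notin> S" by (auto simp: S_def interior_simplices_def aff_dim_simplex)
      then show ?thesis using small e True unfolding small_cleared_def b'_def by simp
    next
      case False
      have "aff_dim Q \<le> int CARD('d)" using aff_dim_subset[OF face_of_imp_subset[OF \<sigma>(3)]] aff_dim_P by simp
      then have dims: "aff_dim \<sigma> = int p" "aff_dim Q = int CARD('d)" using False e(2) by (auto simp: cell_dim_def)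
      have QP: "Q = P" using face_of_aff_dim_lt[OF convex_P \<sigma>(3)] dims(2) aff_dim_P by fastforce
      obtain T A x \<xi> Qf where c: "cell_chart \<sigma> T A x \<xi> Qf" by (rule cell_chartE[OF \<sigma>(1,2)])
      note C = cell_chartD[OF c]
      have A: "card A = p" using C(3) dims(1) by simp
      have only: "J = A" if "card J = p" "A \<subseteq> J" for J using that A card_subset_eq[of J A] by simp
      have R: "edgeR p \<sigma> (Qf I) = {c \<in> words p UNIV. coord p \<xi> A c = 0}" if I: "I \<subseteq> T" for I
        unfolding edgeR_chart[OF c I] using only A C(2) I by blast
      have RP: "edgeR p \<sigma> P = {c \<in> words p UNIV. coord p \<xi> A c = 0}" using R[of "{}"] C(4) by simp
      obtain n where n: "n simplex \<sigma>" using simplicial_complexD(1)[OF complex \<sigma>(1)] by blast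
      then have np: "int p simplex \<sigma>" using aff_dim_simplex[OF n] dims(1) by simp
      show ?thesis
      proof (cases "\<sigma> \<subseteq> frontier P")
        case True
        then obtain F where F: "F face_of P" "F \<noteq> P" "\<sigma> \<subseteq> F" using frontier_iff[OF \<sigma>(1,2)] by blast
        obtain I where I: "I \<subseteq> T" "F = Qf I" using C(12)[OF F(1,3)] by blast
        have "I \<noteq> {}" using F(2) I(2) C(4) by blast
        then obtain i where i: "i \<in> T" using I(1) by blast
        have iT: "{i} \<subseteq> T" using i by simp
        have cell: "(\<sigma>, Qf {i}) \<in> cells_Y P K" using \<sigma> C(13)[OF iT] C(14)[OF iT] by (simp add: cells_Y_def)
        have "(\<Sum>Q'\<in>covers (Qf {i}). b' (\<sigma>, Q')) \<in> edgeR p \<sigma> (Qf {i})"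
          by (rule covers_part[OF cyc' small[folded b'_def] cell]) (use C(5)[OF iT] dims in \<open>auto simp: cell_dim_def\<close>)
        then have "b' (\<sigma>, P) \<in> edgeR p \<sigma> (Qf {i})" unfolding sum_covers[OF c iT] using C(4) by simp
        then have "b' (\<sigma>, P) \<in> edgeR p \<sigma> P" unfolding R[OF iT] RP .
        moreover have "\<sigma> \<notin> S" using True by (simp add: S_def interior_simplices_def)
        ultimately show ?thesis using QP by simp
      next
        case False
        then have int: "\<sigma> \<in> interior_simplices P K p" using \<sigma>(1) np by (simp add: interior_simplices_def)
        note om = dual_omega_coord[OF C(1,11) A us[OF int]]
        show ?thesis
        proof (cases "b' (\<sigma>, P) \<in> edgeR p \<sigma> P")
          case True
          then show ?thesis using QP by (simp add: S_def)
        next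
          case False
          then have "\<sigma> \<in> S" using int by (simp add: S_def)
          moreover have "coord p \<xi> A (b' (\<sigma>, P)) = 1" using False b'w unfolding RP by auto
          then have "coord p \<xi> A (b' (\<sigma>, P) + word (us \<sigma>)) = 0" using om(1) by (simp add: coord_add)
          moreover have "b' (\<sigma>, P) + word (us \<sigma>) \<in> words p UNIV" using b'w om(2) by (intro addsub_add[OF addsub_words]) auto
          ultimately show ?thesis using QP RP by simp
        qed
      qed
    qed
    then show "(b + D a + (\<Sum>\<sigma>\<in>S. top_chain (word (us \<sigma>)) \<sigma>)) (\<sigma>, Q) \<in> edgeR p \<sigma> Q"
      unfolding b'_def plus_fun_apply tops by simp
  qed
qed

end

section \<open>The kernel of the inclusion in homology\<close>

context smooth_triangulation
begin

abbreviation CX where "CX p \<equiv> cosheaf_X P K p"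
abbreviation CY where "CY p \<equiv> cosheaf_Y P K p"

lemma cosheaf_simps [simp]:
  "cells (CY p) = cells_Y P K" "celldim (CY p) = cell_dim" "face (CY p) = cell_face K"
  "cells (CX p) = cells_X P K" "celldim (CX p) = cell_dim" "face (CX p) = cell_face K"
  "transition (CX p) = transition (CY p)"
  by (simp_all add: cosheaf_X_def cosheaf_Y_def)

lemma cells_X_Y: "e \<in> cells_X P K \<Longrightarrow> e \<in> cells_Y P K"
  by (auto simp: cells_X_def)

lemma finite_cells_Y: "finite (cells_Y P K)"
  by (rule finite_subset[of _ "K \<times> {Q. Q face_of P}"])
    (use finite_K finite_polytope_faces[OF polytope_P] in \<open>auto simp: cells_Y_def\<close>)

lemma face_facts:
  assumes "e \<in> cells_Y P K" "e' \<in> cells_Y P K" "cell_face K e' e"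
  shows "fst e face_of fst e'" "snd e' \<subseteq> snd e"
  using cell_face_cells[of "fst e" "snd e" "fst e'" "snd e'"] assms by auto

lemma presented_Y: "presented_cosheaf (CY p) (\<lambda>e. quot p (snd e)) (\<lambda>e. words p UNIV) (\<lambda>e. quotK p (snd e))"
proof
  show "finite (cells (CY p))" by (simp add: finite_cells_Y)
  show "presents (quot p (snd e)) (words p UNIV) (quotK p (snd e)) (stalk (CY p) e)" if "e \<in> cells (CY p)" for e
    using presents_stalk_Y[of "fst e" "snd e" p] that by simp
  fix e e' assume e: "e \<in> cells (CY p)" "e' \<in> cells (CY p)" "face (CY p) e' e"
  then have c: "(fst e, snd e) \<in> cells_Y P K" "(fst e', snd e') \<in> cells_Y P K" by auto
  have f: "fst e \<subseteq> fst e'" "snd e' \<subseteq> snd e" using face_facts[of e e'] e face_of_imp_subset by auto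
  show "words p UNIV \<subseteq> words p UNIV" by simp
  show "quotK p (snd e) \<subseteq> quotK p (snd e')" by (rule quotK_mono[OF c f])
  show "transition (CY p) e e' (quot p (snd e) w) = quot p (snd e') w" for w
    using quot_transition[OF cell_Sed(1)[OF c(1)] cell_Sed(1)[OF c(2)] cell_Sed_mono[OF c f], of p w]
    by (simp add: cosheaf_Y_def case_prod_beta)
qed

lemma presented_X: "presented_cosheaf (CX p) (\<lambda>e. quot p (snd e)) (\<lambda>e. edgeR p (fst e) (snd e)) (\<lambda>e. quotK p (snd e))"
proof
  interpret Y: presented_cosheaf "CY p" "\<lambda>e. quot p (snd e)" "\<lambda>e. words p UNIV" "\<lambda>e. quotK p (snd e)"
    by (rule presented_Y)
  show "finite (cells (CX p))" using finite_subset[OF subsetI[OF cells_X_Y] finite_cells_Y] by simp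
  show "presents (quot p (snd e)) (edgeR p (fst e) (snd e)) (quotK p (snd e)) (stalk (CX p) e)" if "e \<in> cells (CX p)" for e
    using presents_stalk_X[of "fst e" "snd e" p] that cells_X_Y by simp
  fix e e' assume "e \<in> cells (CX p)" "e' \<in> cells (CX p)" "face (CX p) e' e"
  then have e: "e \<in> cells_Y P K" "e' \<in> cells_Y P K" "cell_face K e' e" using cells_X_Y by auto
  then have c: "(fst e, snd e) \<in> cells_Y P K" "(fst e', snd e') \<in> cells_Y P K" by auto
  show "edgeR p (fst e) (snd e) \<subseteq> edgeR p (fst e') (snd e')" by (rule edgeR_mono[OF c face_facts[OF e]])
  show "quotK p (snd e) \<subseteq> quotK p (snd e')" using Y.restrict_N[of e e'] e by simp
  show "transition (CX p) e e' (quot p (snd e) w) = quot p (snd e') w" if "w \<in> edgeR p (fst e) (snd e)" for w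
    using Y.transitions[of e e' w] e that edgeR_subset by auto
qed

text \<open>
  The stalk of \<open>X\<close> is regarded as zero on the cells of \<open>Y\<close> outside \<open>X\<close>, those over vertices of \<open>K\<close>; a lift
  of a chain of \<open>X\<close> becomes a lift of its image in \<open>Y\<close> by truncation.
\<close>

definition trunc :: "('d cell \<Rightarrow> 'v::char2) \<Rightarrow> 'd cell \<Rightarrow> 'v" where
  "trunc c e = (if e \<in> cells_X P K then c e else 0)"

lemma trunc_add: "trunc (c + d) = trunc c + trunc d"
  by (simp add: trunc_def fun_eq_iff)

lemma D_cong:
  assumes "e' \<in> cells_Y P K" "\<And>e. e \<in> cells_Y P K \<Longrightarrow> cell_dim e = cell_dim e' + 1 \<Longrightarrow> b e = c e"
  shows "D b e' = D c e'"
  unfolding D_cofaces[OF assms(1)] using assms(2) by (intro sum.cong) auto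

lemma non_X_face:
  assumes "e \<in> cells_Y P K" "e' \<in> cells_Y P K" "cell_face K e' e" "e' \<notin> cells_X P K"
  shows "e \<notin> cells_X P K"
  using aff_dim_subset[OF face_of_imp_subset[OF face_facts(1)[OF assms(1-3)]]] assms
  by (cases e; cases e') (auto simp: cells_X_def)

text \<open>
  As \<open>X\<close> is a subcomplex, all cells having a face outside \<open>X\<close> lie outside \<open>X\<close>, where the truncation
  vanishes.
\<close>

lemma D_trunc_non_X:
  assumes "e' \<in> cells_Y P K" "e' \<notin> cells_X P K"
  shows "D (trunc c) e' = 0"
  unfolding D_cofaces[OF assms(1)] using non_X_face[OF _ assms(1) _ assms(2)]
  by (intro sum.neutral) (auto simp: trunc_def)

text \<open>
  Vertices have no edges. Thus \<open>edgeR\<close> describes the stalk zero at the cells outside \<open>X\<close>, and the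
  quotient stalks need no case distinction.
\<close>

lemma edgeR_vertex:
  assumes "(\<sigma>, Q) \<in> cells_Y P K" "(\<sigma>, Q) \<notin> cells_X P K"
  shows "edgeR p \<sigma> Q = quotK p Q"
proof -
  note \<sigma> = cells_YD[OF assms(1)]
  have "aff_dim \<sigma> \<le> 0" using assms by (simp add: cells_X_def)
  then have "card (verts \<sigma>) \<le> 1" using simplexK(4)[OF \<sigma>(1)] by linarith
  then have "edge_normals \<sigma> = {}"
    using simplexK(3)[OF \<sigma>(1)] by (auto simp: edge_normals_def card_le_Suc0_iff_eq)
  then have "edgeR p \<sigma> Q = gen2 (quotK p Q)" by (simp add: edgeR_def edge_words_def)
  then show ?thesis using gen2_addsub_id[OF addsub_quotK[OF assms(1)]] by simp
qed

text \<open>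
  No \<open>J\<close> with \<open>card J = p\<close> contains \<open>A\<close>, which has \<open>p + 1\<close> elements. This is why the coefficients of a
  face cycle lie in the stalks of \<open>X\<close>.
\<close>

lemma edgeR_large:
  assumes "(\<sigma>, P) \<in> cells_Y P K" "aff_dim \<sigma> = int p + 1"
  shows "edgeR p \<sigma> P = words p UNIV"
proof -
  note \<sigma> = cells_YD[OF assms(1)]
  obtain T A x \<xi> Qf where c: "cell_chart \<sigma> T A x \<xi> Qf" by (rule cell_chartE[OF \<sigma>(1,2)])
  note C = cell_chartD[OF c]
  have "card A = p + 1" using C(3) assms(2) by linarith
  then have "\<not> A \<subseteq> J" if "card J = p" for J using that card_mono[of J A] by auto
  then show ?thesis using edgeR_chart[OF c, of "{}" p] C(4) by auto
qed

definition face_lift :: "(bit^'d) list \<Rightarrow> (real^'d) set \<Rightarrow> ('d cell \<Rightarrow> (bit^'d) list \<Rightarrow>\<^sub>0 bit)" where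
  "face_lift us \<sigma> = D (top_chain (word us) \<sigma>)"

lemma interiorD:
  assumes "\<sigma> \<in> interior_simplices P K p"
  shows "\<sigma> \<in> K" "\<sigma> \<noteq> {}" "aff_dim \<sigma> = int p" "\<And>Q. Q face_of P \<Longrightarrow> \<sigma> \<subseteq> Q \<Longrightarrow> Q = P"
proof -
  show K: "\<sigma> \<in> K" and d: "aff_dim \<sigma> = int p"
    using assms by (auto simp: interior_simplices_def aff_dim_simplex)
  show ne: "\<sigma> \<noteq> {}" using d by auto
  show "Q = P" if "Q face_of P" "\<sigma> \<subseteq> Q" for Q
    using assms frontier_iff[OF K ne] that by (auto simp: interior_simplices_def)
qed

text \<open>
  The second half of the boundary is zero, because the only face of \<open>P\<close> containing an interior
  simplex is \<open>P\<close>.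
\<close>

lemma face_lift_eq:
  assumes "\<sigma> \<in> interior_simplices P K p" "(\<tau>, Q) \<in> cells_Y P K"
  shows "face_lift us \<sigma> (\<tau>, Q) = (if Q = P \<and> \<sigma> \<in> facets \<tau> then word us else 0)"
proof -
  note \<tau> = cells_YD[OF assms(2)]
  have "(\<Sum>\<rho>\<in>facets \<tau>. top_chain (word us) \<sigma> (\<rho>, Q)) = (\<Sum>\<rho>\<in>facets \<tau>. if \<rho> = \<sigma> then (if Q = P then word us else 0) else 0)"
    by (rule sum.cong) (auto simp: top_chain_def)
  also have "\<dots> = (if Q = P \<and> \<sigma> \<in> facets \<tau> then word us else 0)" using finite_facets by simp
  finally have 1: "(\<Sum>\<rho>\<in>facets \<tau>. top_chain (word us) \<sigma> (\<rho>, Q)) = \<dots>" .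
  have 2: "(\<Sum>Q'\<in>covers Q. top_chain (word us) \<sigma> (\<tau>, Q')) = 0"
  proof (rule sum.neutral, intro ballI)
    fix Q' assume Q': "Q' \<in> covers Q"
    show "top_chain (word us) \<sigma> (\<tau>, Q') = 0"
    proof (cases "\<tau> = \<sigma>")
      case True
      then have "Q = P" using interiorD(4)[OF assms(1) \<tau>(3)] \<tau>(4) by simp
      then have "aff_dim Q' \<noteq> aff_dim P" using Q' by (simp add: covers_def)
      then show ?thesis by (auto simp: top_chain_def)
    qed (simp add: top_chain_def)
  qed
  show ?thesis unfolding face_lift_def D_def prod.case 1 2 by simp
qed

lemma trunc_face_lift:
  assumes \<sigma>: "\<sigma> \<in> interior_simplices P K p" and e: "e \<in> cells_Y P K"
  shows "trunc (face_lift us \<sigma>) e = face_lift us \<sigma> e"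
proof (cases "e \<in> cells_X P K")
  case False
  obtain \<tau> Q where eq: "e = (\<tau>, Q)" by (cases e)
  have "\<sigma> \<notin> facets \<tau>"
    using False e interiorD(3)[OF \<sigma>] by (auto simp: eq cells_X_def facets_def)
  then show ?thesis using False face_lift_eq[OF \<sigma>, of \<tau> Q us] e by (simp add: eq trunc_def)
qed (simp add: trunc_def)

text \<open>
  Both homology groups are presented by lifted chains, and the inclusion becomes truncation. A
  face cycle bounds \<open>\<omega>\<^sup>*(\<sigma>) \<otimes> \<sigma>\<^sup>*\<close> in \<open>Y\<close>. Conversely, if a cycle \<open>c\<close> of \<open>X\<close> bounds \<open>b\<close> in \<open>Y\<close>, then \<open>b\<close> is a
  cycle of the quotient complex, so that \<open>t = b + D a + \<Sum>\<^sub>\<sigma> \<omega>\<^sup>*(\<sigma>) \<otimes> \<sigma>\<^sup>*\<close> has values in \<open>edgeR\<close>, that is,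
  \<open>t\<close> is a chain of \<open>X\<close>. Its boundary is \<open>c\<close> plus a sum of face cycles.
\<close>

theorem kernel_of_inclusion:
  fixes us :: "(real^'d) set \<Rightarrow> (bit^'d) list"
  assumes card: "CARD('d) = n + 1" and pq: "p + q = n"
    and us: "\<forall>\<sigma> \<in> interior_simplices P K p. dual_omega p \<sigma> (us \<sigma>)"
  shows "generate (homology_group (CX p) (int q))
           ((\<lambda>\<sigma>. homology_class (CX p) (int q) (face_cycle P K p q (us \<sigma>) \<sigma>)) ` interior_simplices P K p)
         = kernel (homology_group (CX p) (int q)) (homology_group (CY p) (int q))
             (homology_inclusion (CX p) (CY p) (int q))"
proof -
  interpret Y: presented_cosheaf "CY p" "\<lambda>e. quot p (snd e)" "\<lambda>e. words p UNIV" "\<lambda>e. quotK p (snd e)"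
    by (rule presented_Y)
  interpret X: presented_cosheaf "CX p" "\<lambda>e. quot p (snd e)" "\<lambda>e. edgeR p (fst e) (snd e)" "\<lambda>e. quotK p (snd e)"
    by (rule presented_X)
  define Q where "Q = int q"
  define fl where "fl \<sigma> = face_lift (us \<sigma>) \<sigma>" for \<sigma>
  let ?Int = "interior_simplices P K p"
  have cY: "e \<in> cells_of_dim (CY p) r \<longleftrightarrow> e \<in> cells_Y P K \<and> cell_dim e = r" for e r
    by (simp add: cells_of_dim_def)
  have cX: "e \<in> cells_of_dim (CX p) r \<longleftrightarrow> e \<in> cells_X P K \<and> cell_dim e = r" for e r
    by (simp add: cells_of_dim_def)
  have addK: "addsub (quotK p (snd e))" if "e \<in> cells_Y P K" for e
    using addsub_quotK[of "fst e" "snd e"] that by simp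
  have Ybd: "Y.bd r c e' = D c e'" if "e' \<in> cells_Y P K" "cell_dim e' = r - 1" for r c e'
    unfolding Y.bd_def D_cofaces[OF that(1)] cY using that(2) by (intro sum.cong) auto
  have Xbd: "X.bd r c e' = D (trunc c) e'" if "e' \<in> cells_X P K" "cell_dim e' = r - 1" for r c e'
    unfolding X.bd_def D_cofaces[OF cells_X_Y[OF that(1)]] cX using that(2) finite_cells_Y cells_X_Y
    by (intro sum.mono_neutral_cong_left) (auto simp: trunc_def)
  have len: "length (us \<sigma>) = p" if "\<sigma> \<in> ?Int" for \<sigma>
    using us that by (auto simp: dual_omega_def)
  \<comment> \<open>the boundary operators of \<open>Y\<close> and \<open>X\<close> are the restrictions of \<open>D\<close>, hence they square to zero\<close>
  have Ydd: "Y.bd r (Y.bd (r + 1) c) \<in> Y.null (r - 1)" for r c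
    unfolding Y.null_def
  proof (intro CollectI ballI)
    fix e' assume "e' \<in> cells_of_dim (CY p) (r - 1)"
    then have e': "e' \<in> cells_Y P K" "cell_dim e' = r - 1" by (auto simp: cY)
    have "Y.bd r (Y.bd (r + 1) c) e' = D (D c) e'"
      unfolding Ybd[OF e'] using e'(2) by (intro D_cong[OF e'(1)] Ybd) auto
    also have "\<dots> = 0" using D_D[of "fst e'" "snd e'" c] e'(1) by simp
    finally show "Y.bd r (Y.bd (r + 1) c) e' \<in> quotK p (snd e')" using addsub_0[OF addK[OF e'(1)]] by simp
  qed
  have Xdd: "X.bd r (X.bd (r + 1) c) \<in> X.null (r - 1)" for r c
    unfolding X.null_def
  proof (intro CollectI ballI)
    fix e' assume "e' \<in> cells_of_dim (CX p) (r - 1)"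
    then have e': "e' \<in> cells_X P K" "cell_dim e' = r - 1" by (auto simp: cX)
    note e'Y = cells_X_Y[OF e'(1)]
    have "X.bd r (X.bd (r + 1) c) e' = D (D (trunc c)) e'"
      unfolding Xbd[OF e']
    proof (rule D_cong[OF e'Y])
      fix e assume e: "e \<in> cells_Y P K" "cell_dim e = cell_dim e' + 1"
      show "trunc (X.bd (r + 1) c) e = D (trunc c) e"
        using e e'(2) D_trunc_non_X[OF e(1), of c] Xbd[of e "r + 1" c] by (cases "e \<in> cells_X P K") (auto simp: trunc_def)
    qed
    also have "\<dots> = 0" using D_D[of "fst e'" "snd e'" "trunc c"] e'Y by simp
    finally show "X.bd r (X.bd (r + 1) c) e' \<in> quotK p (snd e')" using addsub_0[OF addK[OF e'Y]] by simp
  qed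
  note HX = X.presents_homology[OF Xdd, of Q] and HY = Y.presents_homology[OF Ydd, of Q]
  have trunc_lifts: "trunc c \<in> Y.lifts r" if "c \<in> X.lifts r" for c r
    unfolding Y.lifts_def
  proof (intro CollectI ballI)
    fix e assume e: "e \<in> cells_of_dim (CY p) r"
    show "trunc c e \<in> words p UNIV"
    proof (cases "e \<in> cells_X P K")
      case True
      then have "c e \<in> edgeR p (fst e) (snd e)" using that e by (simp add: X.lifts_def cX cY)
      then show ?thesis using True edgeR_subset[of p "fst e" "snd e"] by (auto simp: trunc_def)
    qed (simp add: trunc_def addsub_0[OF addsub_words])
  qed
  have Y_bd_trunc: "Y.bd (r + 1) (trunc a) e = trunc (X.bd (r + 1) a) e"
    if "e \<in> cells_of_dim (CY p) r" for a e r
    using that Ybd[of e "r + 1" "trunc a"] Xbd[of e "r + 1" a] D_trunc_non_X[of e a] by (auto simp: cY trunc_def)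
  have trunc_null: "trunc c \<in> Y.null r" if "c \<in> X.null r" for c r
    unfolding Y.null_def
  proof (intro CollectI ballI)
    fix e assume e: "e \<in> cells_of_dim (CY p) r"
    then show "trunc c e \<in> quotK p (snd e)"
      using that addsub_0[OF addK[of e]] by (auto simp: X.null_def cX cY trunc_def)
  qed
  have Y_null_cong: "c \<in> Y.null r" if "d \<in> Y.null r" "\<And>e. e \<in> cells_of_dim (CY p) r \<Longrightarrow> c e = d e" for c d r
    using that unfolding Y.null_def by simp
  have trunc_boundary: "trunc c \<in> Y.boundary_lifts r" if c: "c \<in> X.boundary_lifts r" for c r
  proof -
    obtain a where a: "c \<in> X.lifts r" "a \<in> X.lifts (r + 1)" "c + X.bd (r + 1) a \<in> X.null r"
      using c by (auto simp: X.boundary_lifts_def)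
    have "trunc c + Y.bd (r + 1) (trunc a) \<in> Y.null r"
      by (rule Y_null_cong[OF trunc_null[OF a(3)]]) (simp add: trunc_add Y_bd_trunc)
    then show ?thesis using trunc_lifts a by (auto simp: Y.boundary_lifts_def)
  qed
  have trunc_cycle: "trunc c \<in> Y.cycle_lifts r" if c: "c \<in> X.cycle_lifts r" for c r
  proof -
    have "Y.bd r (trunc c) \<in> Y.null (r - 1)"
      by (rule Y_null_cong[OF trunc_null[of "X.bd r c"]])
        (use c Y_bd_trunc[of _ "r - 1" c] in \<open>auto simp: X.cycle_lifts_def\<close>)
    then show ?thesis using c trunc_lifts by (auto simp: Y.cycle_lifts_def X.cycle_lifts_def)
  qed
  \<comment> \<open>the inclusion of chains, and then of homology classes, is truncation of lifts\<close>
  have incl_chain: "chain_inclusion (CX p) (CY p) Q (X.chain Q c) = Y.chain Q (trunc c)" for c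
  proof -
    have "(if e \<in> cells (CX p) then X.chain Q c e else \<one>\<^bsub>stalk (CY p) e\<^esub>) = quot p (snd e) (trunc c e)"
      if e: "e \<in> cells_of_dim (CY p) Q" for e
      using e presents_0[OF Y.stalks[of e]] by (auto simp: X.chain_def cX cY trunc_def)
    then show ?thesis unfolding chain_inclusion_def Y.chain_def by (intro restrict_ext) simp
  qed
  have incl: "homology_inclusion (CX p) (CY p) Q (X.hclass Q c) = Y.hclass Q (trunc c)" if c: "c \<in> X.cycle_lifts Q" for c
  proof -
    interpret GY: group "chain_group (CY p) Q" using presentsD(3)[OF Y.presents_chain] .
    have cl: "c \<in> X.lifts Q" using c by (simp add: X.cycle_lifts_def)
    have bl: "b \<in> X.lifts Q" if "b \<in> X.boundary_lifts Q" for b using that by (simp add: X.boundary_lifts_def)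
    have "X.hclass Q c = (\<lambda>b. X.chain Q (b + c)) ` X.boundary_lifts Q"
      unfolding X.hclass_def homology_class_def X.boundaries_eq r_coset_def
      using presentsD(6)[OF X.presents_chain bl cl] by auto
    then have "chain_inclusion (CX p) (CY p) Q ` X.hclass Q c = (\<lambda>b. Y.chain Q (trunc b + trunc c)) ` X.boundary_lifts Q"
      by (simp add: image_image incl_chain trunc_add)
    then have "homology_inclusion (CX p) (CY p) Q (X.hclass Q c) = (Y.chain Q ` Y.boundary_lifts Q)
        <#>\<^bsub>chain_group (CY p) Q\<^esub> ((\<lambda>b. Y.chain Q (trunc b + trunc c)) ` X.boundary_lifts Q)"
      by (simp add: homology_inclusion_def coset_map_def Y.boundaries_eq)
    also have "\<dots> = Y.chain Q ` (\<lambda>b. b + trunc c) ` Y.boundary_lifts Q"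
    proof -
      have YB: "addsub (Y.boundary_lifts Q \<inter> Y.cycle_lifts Q)" using presents_addsub_kernel[OF HY] .
      have BZ: "b \<in> Y.boundary_lifts Q \<inter> Y.cycle_lifts Q" if b: "b \<in> Y.boundary_lifts Q" for b
      proof -
        have "Y.boundary_lifts Q \<subseteq> Y.cycle_lifts Q" by (rule Y.boundary_cycle_lifts[OF Ydd])
        then show ?thesis using b by blast
      qed
      have lY: "b \<in> Y.lifts Q" if "b \<in> Y.boundary_lifts Q" for b using that by (simp add: Y.boundary_lifts_def)
      have m: "Y.chain Q b' \<otimes>\<^bsub>chain_group (CY p) Q\<^esub> Y.chain Q (trunc b + trunc c) = Y.chain Q ((b' + trunc b) + trunc c)"
        if "b' \<in> Y.boundary_lifts Q" "b \<in> X.boundary_lifts Q" for b b'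
        using presentsD(6)[OF Y.presents_chain lY[OF that(1)], of "trunc b + trunc c"]
          addsub_add[OF Y.addsub_lifts trunc_lifts[OF bl[OF that(2)]] trunc_lifts[OF cl]] by (simp add: add.assoc)
      show ?thesis
      proof (intro equalityI subsetI)
        fix y assume "y \<in> (Y.chain Q ` Y.boundary_lifts Q)
          <#>\<^bsub>chain_group (CY p) Q\<^esub> ((\<lambda>b. Y.chain Q (trunc b + trunc c)) ` X.boundary_lifts Q)"
        then obtain b' b where b: "b' \<in> Y.boundary_lifts Q" "b \<in> X.boundary_lifts Q"
          "y = Y.chain Q b' \<otimes>\<^bsub>chain_group (CY p) Q\<^esub> Y.chain Q (trunc b + trunc c)"
          unfolding set_mult_def by blast
        have "b' + trunc b \<in> Y.boundary_lifts Q"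
          using addsub_add[OF YB BZ[OF b(1)] BZ[OF trunc_boundary[OF b(2)]]] by blast
        then show "y \<in> Y.chain Q ` (\<lambda>b. b + trunc c) ` Y.boundary_lifts Q"
          unfolding b(3) m[OF b(1,2)] by blast
      next
        fix y assume "y \<in> Y.chain Q ` (\<lambda>b. b + trunc c) ` Y.boundary_lifts Q"
        then obtain b' where b': "b' \<in> Y.boundary_lifts Q" "y = Y.chain Q (b' + trunc c)" by blast
        have 0: "0 \<in> X.boundary_lifts Q" using addsub_0[OF presents_addsub_kernel[OF HX]] by blast
        have "trunc 0 = (0 :: 'd cell \<Rightarrow> (bit^'d) list \<Rightarrow>\<^sub>0 bit)" by (simp add: trunc_def fun_eq_iff)
        then have "y = Y.chain Q b' \<otimes>\<^bsub>chain_group (CY p) Q\<^esub> Y.chain Q (trunc 0 + trunc c)"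
          using m[OF b'(1) 0] b'(2) by simp
        then show "y \<in> (Y.chain Q ` Y.boundary_lifts Q)
          <#>\<^bsub>chain_group (CY p) Q\<^esub> ((\<lambda>b. Y.chain Q (trunc b + trunc c)) ` X.boundary_lifts Q)"
          unfolding set_mult_def using b'(1) 0 by blast
      qed
    qed
    also have "\<dots> = Y.hclass Q (trunc c)"
    proof -
      have "b \<in> Y.lifts Q" if "b \<in> Y.boundary_lifts Q" for b using that by (simp add: Y.boundary_lifts_def)
      then show ?thesis
        unfolding Y.hclass_def homology_class_def Y.boundaries_eq r_coset_def
        using presentsD(6)[OF Y.presents_chain _ trunc_lifts[OF cl]] by (auto simp: image_image)
    qed
    finally show ?thesis .
  qed
  have fl_cell: "fl \<sigma> (\<tau>, R) = (if R = P \<and> \<sigma> \<in> facets \<tau> then word (us \<sigma>) else 0)"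
    if "\<sigma> \<in> ?Int" "(\<tau>, R) \<in> cells_Y P K" for \<sigma> \<tau> R
    unfolding fl_def by (rule face_lift_eq[OF that])
  have word_edgeR: "word (us \<sigma>) \<in> edgeR p \<tau> P" if "\<sigma> \<in> ?Int" "\<sigma> \<in> facets \<tau>" "(\<tau>, P) \<in> cells_Y P K" for \<sigma> \<tau>
  proof -
    have "aff_dim \<tau> = int p + 1" using that(2) interiorD(3)[OF that(1)] by (simp add: facets_def)
    then show ?thesis using edgeR_large[OF that(3)] len[OF that(1)] by simp
  qed
  have fl_lifts: "fl \<sigma> \<in> X.lifts Q" if \<sigma>: "\<sigma> \<in> ?Int" for \<sigma>
    unfolding X.lifts_def
  proof (intro CollectI ballI)
    fix e assume "e \<in> cells_of_dim (CX p) Q"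
    then have e: "(fst e, snd e) \<in> cells_Y P K" using cells_X_Y by (simp add: cX)
    show "fl \<sigma> e \<in> edgeR p (fst e) (snd e)"
      using fl_cell[OF \<sigma> e] word_edgeR[OF \<sigma>, of "fst e"] e addsub_0[OF addsub_edgeR] by auto
  qed
  have trunc_fl: "trunc (fl \<sigma>) e = fl \<sigma> e" if "\<sigma> \<in> ?Int" "e \<in> cells_Y P K" for \<sigma> e
    unfolding fl_def by (rule trunc_face_lift[OF that])
  have fl_cycle: "fl \<sigma> \<in> X.cycle_lifts Q" if \<sigma>: "\<sigma> \<in> ?Int" for \<sigma>
  proof -
    have "X.bd Q (fl \<sigma>) e = 0" if "e \<in> cells_of_dim (CX p) (Q - 1)" for e
    proof -
      have e: "e \<in> cells_X P K" "cell_dim e = Q - 1" using that by (auto simp: cX)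
      have "X.bd Q (fl \<sigma>) e = D (fl \<sigma>) e"
        unfolding Xbd[OF e] by (rule D_cong[OF cells_X_Y[OF e(1)]]) (rule trunc_fl[OF \<sigma>])
      then show ?thesis
        using D_D[of "fst e" "snd e"] cells_X_Y[OF e(1)] by (simp add: fl_def face_lift_def)
    qed
    then have "X.bd Q (fl \<sigma>) \<in> X.null (Q - 1)"
      unfolding X.null_def using addsub_0[OF addK] cells_X_Y by (simp add: cX)
    then show ?thesis using fl_lifts[OF \<sigma>] by (simp add: X.cycle_lifts_def)
  qed
  have top_lifts: "top_chain (word (us \<sigma>)) \<sigma> \<in> Y.lifts r" if "\<sigma> \<in> ?Int" for \<sigma> r
    using len[OF that] addsub_0[OF addsub_words[of p "UNIV :: (bit^'d) set"]]
    by (simp add: Y.lifts_def top_chain_def)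
  have fl_boundary: "trunc (fl \<sigma>) \<in> Y.boundary_lifts Q" if \<sigma>: "\<sigma> \<in> ?Int" for \<sigma>
  proof -
    have "(trunc (fl \<sigma>) + Y.bd (Q + 1) (top_chain (word (us \<sigma>)) \<sigma>)) e = 0" if "e \<in> cells_of_dim (CY p) Q" for e
    proof -
      have e: "e \<in> cells_Y P K" "cell_dim e = Q + 1 - 1" using that by (auto simp: cY)
      show ?thesis using trunc_fl[OF \<sigma> e(1)] Ybd[OF e] by (simp add: fl_def face_lift_def)
    qed
    then have "trunc (fl \<sigma>) + Y.bd (Q + 1) (top_chain (word (us \<sigma>)) \<sigma>) \<in> Y.null Q"
      unfolding Y.null_def using addsub_0[OF addK] by (simp add: cY)
    then show ?thesis
      using trunc_lifts[OF fl_lifts[OF \<sigma>]] top_lifts[OF \<sigma>] by (auto simp: Y.boundary_lifts_def)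
  qed
  \<comment> \<open>the face cycle is the chain with lift \<open>fl \<sigma>\<close>\<close>
  have cycle_class: "homology_class (CX p) Q (face_cycle P K p q (us \<sigma>) \<sigma>) = X.hclass Q (fl \<sigma>)" if \<sigma>: "\<sigma> \<in> ?Int" for \<sigma>
  proof -
    let ?T = "{\<tau> \<in> K. (int p + 1) simplex \<tau> \<and> \<sigma> face_of \<tau>}"
    let ?el = "\<lambda>\<tau>. \<lambda>e. if e = (\<tau>, P) then word (us \<sigma>) else 0"
    note I = interiorD[OF \<sigma>]
    have T: "\<tau> \<in> ?T \<longleftrightarrow> \<sigma> \<in> facets \<tau>" if \<tau>K: "\<tau> \<in> K" for \<tau>
    proof -
      obtain m where m: "m simplex \<tau>" using simplicial_complexD(1)[OF complex \<tau>K] by blast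
      have "(int p + 1) simplex \<tau> \<longleftrightarrow> aff_dim \<tau> = int p + 1" using m aff_dim_simplex by metis
      then show ?thesis using \<tau>K I by (auto simp: facets_def)
    qed
    have el: "elementary_chain (CX p) Q (wedge p (N_mod_Sed P) (map (\<lambda>u. Sed P #>\<^bsub>F2_space\<^esub> u) (us \<sigma>))) (\<tau>, P)
        = X.chain Q (?el \<tau>)" for \<tau>
    proof -
      have "wedge p (N_mod_Sed P) (map (\<lambda>u. Sed P #>\<^bsub>F2_space\<^esub> u) (us \<sigma>)) = quot p P (word (us \<sigma>))"
        by (simp add: wedge_def quot_def)
      then show ?thesis
        unfolding elementary_chain_def X.chain_def
        by (intro restrict_ext) (use presents_0[OF X.stalks] in \<open>auto simp: cX\<close>)
    qed
    have el_lifts: "?el \<tau> \<in> X.lifts Q" if "\<tau> \<in> ?T" for \<tau>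
      unfolding X.lifts_def
    proof (intro CollectI ballI)
      fix e assume "e \<in> cells_of_dim (CX p) Q"
      then have e: "e \<in> cells_Y P K" using cells_X_Y by (simp add: cX)
      show "(if e = (\<tau>, P) then word (us \<sigma>) else 0) \<in> edgeR p (fst e) (snd e)"
        using word_edgeR[OF \<sigma>, of \<tau>] T[of \<tau>] that e addsub_0[OF addsub_edgeR] by auto
    qed
    have "face_cycle P K p q (us \<sigma>) \<sigma> = finprod (chain_group (CX p) Q) (\<lambda>\<tau>. X.chain Q (?el \<tau>)) ?T"
      unfolding face_cycle_def el[unfolded Q_def] Q_def ..
    also have "\<dots> = X.chain Q (\<Sum>\<tau>\<in>?T. ?el \<tau>)"
      by (rule presents_finprod[OF X.presents_chain el_lifts])
    also have "\<dots> = X.chain Q (fl \<sigma>)"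
      unfolding X.chain_def
    proof (rule restrict_ext)
      fix e assume "e \<in> cells_of_dim (CX p) Q"
      then have e: "e \<in> cells_Y P K" using cells_X_Y by (simp add: cX)
      obtain \<tau> R where eq: "e = (\<tau>, R)" by (cases e)
      have \<tau>K: "\<tau> \<in> K" using e eq by (simp add: cells_Y_def)
      have finT: "finite ?T" using finite_K by simp
      have "(\<Sum>\<tau>\<in>?T. ?el \<tau>) e = (\<Sum>\<tau>'\<in>?T. if \<tau>' = \<tau> then (if R = P then word (us \<sigma>) else 0) else 0)"
        unfolding sum_apply eq by (rule sum.cong) auto
      also have "\<dots> = (if \<tau> \<in> ?T then (if R = P then word (us \<sigma>) else 0) else 0)" using finT by (rule sum.delta)
      also have "\<dots> = fl \<sigma> e" unfolding eq fl_cell[OF \<sigma> e[unfolded eq]] T[OF \<tau>K] by simp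
      finally show "quot p (snd e) ((\<Sum>\<tau>\<in>?T. ?el \<tau>) e) = quot p (snd e) (fl \<sigma> e)" by simp
    qed
    finally show ?thesis by (simp add: X.hclass_def)
  qed
  have sub: "fl ` ?Int \<subseteq> X.cycle_lifts Q" using fl_cycle by blast
  have gen_sub: "gen2 (fl ` ?Int) \<subseteq> X.cycle_lifts Q" by (rule gen2_minimal[OF presentsD(1)[OF HX] sub])
  have "generate (homology_group (CX p) Q)
      ((\<lambda>\<sigma>. homology_class (CX p) Q (face_cycle P K p q (us \<sigma>) \<sigma>)) ` ?Int)
    = generate (homology_group (CX p) Q) (X.hclass Q ` fl ` ?Int)"
    unfolding image_image using cycle_class by (simp cong: image_cong)
  also have "\<dots> = X.hclass Q ` gen2 (fl ` ?Int)" by (rule presents_generate[OF HX sub])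
  also have "\<dots> = kernel (homology_group (CX p) Q) (homology_group (CY p) Q) (homology_inclusion (CX p) (CY p) Q)"
  proof (intro equalityI subsetI)
    fix y assume "y \<in> X.hclass Q ` gen2 (fl ` ?Int)"
    then obtain c where c: "c \<in> gen2 (fl ` ?Int)" "y = X.hclass Q c" by blast
    have cZ: "c \<in> X.cycle_lifts Q" using c(1) gen_sub by blast
    have "trunc c \<in> Y.boundary_lifts Q \<inter> Y.cycle_lifts Q"
      by (rule additive_gen2[OF trunc_add presents_addsub_kernel[OF HY] _ c(1)])
        (use fl_boundary trunc_cycle[OF fl_cycle] in auto)
    then have "Y.hclass Q (trunc c) = \<one>\<^bsub>homology_group (CY p) Q\<^esub>" using presentsD(7)[OF HY, of "trunc c"] by simp
    then show "y \<in> kernel (homology_group (CX p) Q) (homology_group (CY p) Q) (homology_inclusion (CX p) (CY p) Q)"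
      unfolding kernel_def c(2) using presentsD(5)[OF HX cZ] incl[OF cZ] by simp
  next
    fix y assume "y \<in> kernel (homology_group (CX p) Q) (homology_group (CY p) Q) (homology_inclusion (CX p) (CY p) Q)"
    then have y: "y \<in> carrier (homology_group (CX p) Q)"
      "homology_inclusion (CX p) (CY p) Q y = \<one>\<^bsub>homology_group (CY p) Q\<^esub>" by (auto simp: kernel_def)
    obtain c where c: "c \<in> X.cycle_lifts Q" "y = X.hclass Q c" using y(1) unfolding presentsD(4)[OF HX, symmetric] by blast
    have "trunc c \<in> Y.boundary_lifts Q"
      using y(2) incl[OF c(1)] c(2) presentsD(7)[OF HY trunc_cycle[OF c(1)]] by simp
    then obtain b0 where b0: "b0 \<in> Y.lifts (Q + 1)" "trunc c + Y.bd (Q + 1) b0 \<in> Y.null Q"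
      by (auto simp: Y.boundary_lifts_def)
    \<comment> \<open>only the values of \<open>b0\<close> in degree \<open>Q + 1\<close> are constrained; the others are set to zero\<close>
    define b where "b e = (if e \<in> cells_of_dim (CY p) (Q + 1) then b0 e else 0)" for e
    have bw: "b e \<in> words p UNIV" for e
      using b0(1) addsub_0[OF addsub_words] by (auto simp: b_def Y.lifts_def)
    have clif: "c \<in> X.lifts Q" using c(1) by (simp add: X.cycle_lifts_def)
    have cDb: "trunc c e + D b e \<in> quotK p (snd e)" if e: "e \<in> cells_Y P K" "cell_dim e = Q" for e
    proof -
      have e': "cell_dim e = Q + 1 - 1" using e(2) by simp
      have "Y.bd (Q + 1) b0 e = D b e"
        unfolding Ybd[OF e(1) e'] by (rule D_cong[OF e(1)]) (use e(2) in \<open>auto simp: b_def cY\<close>)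
      moreover have "e \<in> cells_of_dim (CY p) Q" using e by (simp add: cY)
      then have "(trunc c + Y.bd (Q + 1) b0) e \<in> quotK p (snd e)" using b0(2) unfolding Y.null_def by blast
      ultimately show ?thesis by simp
    qed
    have dimQ: "int CARD('d) - int p - 1 = Q" "int CARD('d) - int p = Q + 1" using card pq by (auto simp: Q_def)
    have cyc: "cycle_mod p b"
      unfolding cycle_mod_def dimQ(1)
    proof (intro allI impI)
      fix \<sigma> R assume e: "(\<sigma>, R) \<in> cells_Y P K" "cell_dim (\<sigma>, R) = Q"
      have "trunc c (\<sigma>, R) \<in> edgeR p \<sigma> R"
      proof (cases "(\<sigma>, R) \<in> cells_X P K")
        case True
        then have "(\<sigma>, R) \<in> cells_of_dim (CX p) Q" using e(2) by (simp add: cX)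
        then have "c (\<sigma>, R) \<in> edgeR p (fst (\<sigma>, R)) (snd (\<sigma>, R))" using clif unfolding X.lifts_def by blast
        then show ?thesis using True by (simp add: trunc_def)
      qed (simp add: trunc_def addsub_0[OF addsub_edgeR])
      moreover have "trunc c (\<sigma>, R) + D b (\<sigma>, R) \<in> edgeR p \<sigma> R" using cDb[OF e] quotK_edgeR by auto
      ultimately show "D b (\<sigma>, R) \<in> edgeR p \<sigma> R" using addsub_cancel[OF addsub_edgeR] by blast
    qed
    obtain a S where "\<And>e. a e \<in> words p UNIV" and S: "S \<subseteq> ?Int" and x: "\<And>\<sigma> R. (\<sigma>, R) \<in> cells_Y P K \<Longrightarrow> cell_dim (\<sigma>, R) = int CARD('d) - int p \<Longrightarrow>
       (b + D a + (\<Sum>\<sigma>\<in>S. top_chain (word (us \<sigma>)) \<sigma>)) (\<sigma>, R) \<in> edgeR p \<sigma> R"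
      by (rule cycles_generated_by_interior_simplices[OF bw cyc, of us]) (use card pq us in auto)
    define t where "t = b + D a + (\<Sum>\<sigma>\<in>S. top_chain (word (us \<sigma>)) \<sigma>)"
    have t: "t e \<in> edgeR p (fst e) (snd e)" if "e \<in> cells_Y P K" "cell_dim e = Q + 1" for e
      using x[of "fst e" "snd e"] that unfolding t_def dimQ(2) by simp
    have tl: "t \<in> X.lifts (Q + 1)" using t cells_X_Y by (auto simp: X.lifts_def cX)
    have sumD: "D (\<Sum>\<sigma>\<in>S. f \<sigma>) = (\<Sum>\<sigma>\<in>S. D (f \<sigma>))" for f :: "(real^'d) set \<Rightarrow> 'd cell \<Rightarrow> (bit^'d) list \<Rightarrow>\<^sub>0 bit"
    proof (induction S rule: infinite_finite_induct)
      case (insert s S)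
      show ?case unfolding sum.insert[OF insert(1,2)] D_add insert(3) ..
    qed (simp_all add: D_def fun_eq_iff split: prod.split)
    define s where "s = (\<Sum>\<sigma>\<in>S. fl \<sigma>)"
    have "c + s + X.bd (Q + 1) t \<in> X.null Q"
      unfolding X.null_def
    proof (intro CollectI ballI)
      fix e assume "e \<in> cells_of_dim (CX p) Q"
      then have eX: "e \<in> cells_X P K" and dim: "cell_dim e = Q" by (auto simp: cX)
      note e = cells_X_Y[OF eX]
      \<comment> \<open>Outside \<open>X\<close> the values of \<open>t\<close> are in the kernel by \<open>edgeR_vertex\<close>, so truncating \<open>t\<close> does not
        change its boundary in the stalks.\<close>
      have "D t e + D (trunc t) e \<in> quotK p (snd e)"
      proof -
        have "D t e + D (trunc t) e = D (t + trunc t) e" by (simp add: D_add)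
        also have "\<dots> \<in> quotK p (snd e)"
          unfolding D_cofaces[OF e]
        proof (rule addsub_sum[OF addK[OF e]])
          fix e'' assume "e'' \<in> {e' \<in> cells_Y P K. cell_dim e' = cell_dim e + 1 \<and> cell_face K e e'}"
          then have e'': "e'' \<in> cells_Y P K" "cell_dim e'' = Q + 1" "cell_face K e e''" using dim by auto
          show "(t + trunc t) e'' \<in> quotK p (snd e)"
          proof (cases "e'' \<in> cells_X P K")
            case True
            then show ?thesis using addsub_0[OF addK[OF e]] by (simp add: trunc_def)
          next
            case False
            then have "t e'' \<in> quotK p (snd e'')"
              using t[OF e''(1,2)] edgeR_vertex[of "fst e''" "snd e''" p] e''(1) by simp
            then show ?thesis using Y.restrict_N[of e'' e] e'' e False by (auto simp: trunc_def)
          qed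
        qed
        finally show ?thesis .
      qed
      moreover have "D t e = D b e + s e"
        unfolding t_def D_add sumD using D_D[of "fst e" "snd e" a] e by (simp add: s_def fl_def face_lift_def)
      moreover have "trunc c e + D b e \<in> quotK p (snd e)" by (rule cDb[OF e dim])
      ultimately have "(trunc c e + D b e) + (D b e + s e + D (trunc t) e) \<in> quotK p (snd e)"
        using addsub_add[OF addK[OF e]] by simp
      moreover have "X.bd (Q + 1) t e = D (trunc t) e" using Xbd[OF eX, of "Q + 1"] dim by simp
      moreover have "trunc c e = c e" using eX by (simp add: trunc_def)
      ultimately show "(c + s + X.bd (Q + 1) t) e \<in> quotK p (snd e)" by (simp add: ac_simps)
    qed
    moreover have sg: "s \<in> gen2 (fl ` ?Int)"
      unfolding s_def using S by (intro addsub_sum[OF addsub_gen2] gen2_incl) auto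
    then have sZ: "s \<in> X.cycle_lifts Q" using gen_sub by blast
    moreover have "c + s \<in> X.lifts Q"
      using clif sZ by (intro addsub_add[OF X.addsub_lifts]) (auto simp: X.cycle_lifts_def)
    ultimately have "c + s \<in> X.boundary_lifts Q" using tl by (auto simp: X.boundary_lifts_def)
    then have "y = X.hclass Q s" using presents_eq[OF HX c(1) sZ] c(2) by simp
    then show "y \<in> X.hclass Q ` gen2 (fl ` ?Int)" using sg by blast
  qed
  finally show ?thesis unfolding Q_def .
qed

end

theorem proposition3p6:
  fixes P :: "(real^'d) set" and K :: "(real^'d) set set" and n p q :: nat
    and us :: "(real^'d) set \<Rightarrow> (bit^'d) list"
  assumes "CARD('d) = n + 1" and "1 \<le> n"
    and "smooth_polytope P" and "primitive_triangulation P K"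
    and "p + q = n"
    and "\<forall>\<sigma> \<in> interior_simplices P K p. dual_omega p \<sigma> (us \<sigma>)"
  shows "generate (homology_group (cosheaf_X P K p) (int q))
           ((\<lambda>\<sigma>. homology_class (cosheaf_X P K p) (int q) (face_cycle P K p q (us \<sigma>) \<sigma>))
              ` interior_simplices P K p)
         = kernel (homology_group (cosheaf_X P K p) (int q))
             (homology_group (cosheaf_Y P K p) (int q))
             (homology_inclusion (cosheaf_X P K p) (cosheaf_Y P K p) (int q))"
proof -
  interpret smooth_triangulation P K by standard (use assms in auto)
  show ?thesis by (rule kernel_of_inclusion[OF assms(1,5,6)])
qed

end
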